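(* Let $P$ be a submonoid of a group $G$ and let $G_0=\{g\in G: gP\cap S\neq\emptyset\text{ and }g^{-1}P\cap S\neq\emptyset\text{ for all nonempty constructible right ideals }S\text{ of }P\}$, a subgroup of $G$. The following statements are equivalent: (1) the partial action of $G$ on $\partial\Omega_P$ is topologically free; (2) the partial action of $G_0$ on $\partial\Omega_P$ is topologically free; (3) for every $g\in G_0$, $g\neq e$, and for every $p\in P$, there is $q\in pP$ with $qP\cap gqP=\emptyset$; (4) for all $p,t\in P$ with $p\neq t$, there is $s\in P$ such that $psP\cap tsP=\emptyset$; (5) every proper ideal of $\mathbb C\times_{\mathbb C^P}P$ is contained in the kernel of the canonical map $\Lambda_\partial\colon\mathbb C\times_{\mathbb C^P}P\to\partial\mathcal T_\lambda(P)$.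
   Context: $P$ is a submonoid of a group $G$ with identity $e$. Ideals of $\mathrm C^*$-algebras are closed and two-sided. A word is a finite sequence $\alpha=(p_1,p_2,\ldots,p_{2k-1},p_{2k})$ of even length $2k\ge 0$ with entries in $P$. Put $\dot\alpha:=p_1^{-1}p_2\cdots p_{2k-1}^{-1}p_{2k}\in G$ (equal to $e$ for the empty word); $\alpha$ is neutral if $\dot\alpha=e$. Put $\tilde\alpha:=(p_{2k},\ldots,p_1)$ and $K(\alpha):=P\cap p_{2k}^{-1}p_{2k-1}P\cap p_{2k}^{-1}p_{2k-1}p_{2k-2}^{-1}p_{2k-3}P\cap\cdots\cap p_{2k}^{-1}p_{2k-1}\cdots p_2^{-1}p_1P$ (equal to $P$ for the empty word). The constructible right ideals of $P$ are the members of $\mathfrak J:=\{K(\alpha):\alpha\text{ a word}\}$. For $w\colon P\to B$, $\dot w_\alpha:=w_{p_1}^*w_{p_2}\cdots w_{p_{2k-1}}^*w_{p_{2k}}$. $\hat{\mathfrak J}$ is the compact space (pointwise convergence) of nonzero functions $\chi\colon\mathfrak J\to\{0,1\}$ with $\chi(R\cap S)=\chi(R)\chi(S)$ and $\chi(\emptyset)=0$ if $\emptyset\in\mathfrak J$; $\Omega_P\subseteq\hat{\mathfrak J}$ is the closed subspace of those $\chi$ such that $S=\bigcup_{i=1}^nS_i$ in $\mathfrak J$ and $\chi(S)=1$ imply $\chi(S_i)=1$ for some $i$; it is the spectrum of $D_r:=\overline{\mathrm{span}}\{\mathbb 1_S:S\in\mathfrak J\}\subseteq\ell^\infty(P)$.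 $G$ acts partially on $\Omega_P$: $U_{g^{-1}}:=\{\chi\in\Omega_P:\chi(K(\alpha))=1\text{ for some }\alpha\text{ with }\dot\alpha=g\}$ and $\hat\gamma_g\colon U_{g^{-1}}\to U_g$ is the homeomorphism determined by $\hat\gamma_g(\chi)(K(\beta))=\chi(g^{-1}K(\beta))=\chi(K(\tilde\beta))$ for $\dot\beta=g^{-1}$. $\partial\Omega_P$ is the closure of the set of $\chi\in\hat{\mathfrak J}$ for which $\chi^{-1}(1)$ is maximal (among the sets $\chi'^{-1}(1)$, $\chi'\in\hat{\mathfrak J}$); it is a closed invariant subset of $\Omega_P$, on which $G$ and its subgroup $G_0$ act partially by restriction. A partial action is topologically free if for each group element $g\neq e$ the set of points in the domain of the partial homeomorphism of $g$ that it fixes has empty interior. The boundary quotient is $\partial\mathcal T_\lambda(P)\cong\mathrm C(\partial\Omega_P)\rtimes_rG$ (reduced partial crossed product). The covariance algebra $\mathbb C\times_{\mathbb C^P}P$ is the universal $\mathrm C^*$-algebra for strongly covariant isometric representations of $P$: with $L_p\delta_q=\delta_{pq}$ on $\ell^2(P)$ (so $\dot L_\alpha=\mathbb 1_{K(\alpha)}\in D_r$ for neutral $\alpha$), $\Delta_F:=\{p\in P:\forall g\in F,\ pP\cap gP=\emptyset\text{ or }pP\cap gP=pP\}$ for finite $F\subseteq G$, and $D_r^{\mathrm o}:=\{b\in D_r:\lim_F\|b|_{\ell^2(\Delta_F)}\|=0\}$ (limit over finite $F\subseteq G$ directed by inclusion), a representation $w$ of $P$ by isometries is strongly covariant if $\dot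 L_\alpha\mapsto\dot w_\alpha$ ($\alpha$ neutral) extends to a well-defined $*$-homomorphism on $D_r$ vanishing on $D_r^{\mathrm o}$. There is an isomorphism $\mathbb C\times_{\mathbb C^P}P\cong\mathrm C(\partial\Omega_P)\rtimes G$ (full partial crossed product) identifying the canonical generator $j_p$ with the image of $\mathbb 1_{pP}\delta_p$; $\Lambda_\partial$ is the composition of this isomorphism with the canonical map from the full to the reduced crossed product $\mathrm C(\partial\Omega_P)\rtimes_rG\cong\partial\mathcal T_\lambda(P)$. *)

theory Defs
  imports "HOL-Analysis.Analysis" "HOL-Algebra.RingHom"
begin

section \<open>Complex *-algebras and their completions\<close>

record 'a star_ring = "'a ring" +
  cscale :: "complex \<Rightarrow> 'a \<Rightarrow> 'a"
  adj :: "'a \<Rightarrow> 'a"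

record 'a normed_star_ring = "'a star_ring" +
  nrm :: "'a \<Rightarrow> real"

definition star_hom :: "('a, 'm) star_ring_scheme \<Rightarrow> ('b, 'n) star_ring_scheme \<Rightarrow> ('a \<Rightarrow> 'b) set" where
  "star_hom A B = {h \<in> ring_hom A B. \<forall>a\<in>carrier A.
     (\<forall>c. h (cscale A c a) = cscale B c (h a)) \<and> h (adj A a) = adj B (h a)}"

definition star_iso :: "('a, 'm) star_ring_scheme \<Rightarrow> ('b, 'n) star_ring_scheme \<Rightarrow> ('a \<Rightarrow> 'b) set" where
  "star_iso A B = {h \<in> star_hom A B. bij_betw h (carrier A) (carrier B)}"

definition closed_ideal :: "('a, 'm) normed_star_ring_scheme \<Rightarrow> 'a set \<Rightarrow> bool" where
  "closed_ideal A I \<longleftrightarrow> ideal I A \<and>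
     (\<forall>s. \<forall>a\<in>carrier A. (\<forall>n::nat. s n \<in> I) \<and> (\<lambda>n. nrm A (s n \<ominus>\<^bsub>A\<^esub> a)) \<longlonglongrightarrow> 0 \<longrightarrow> a \<in> I)"

definition cstar_seminorm :: "('a, 'm) star_ring_scheme \<Rightarrow> ('a \<Rightarrow> real) \<Rightarrow> bool" where
  "cstar_seminorm A q \<longleftrightarrow> (\<forall>a\<in>carrier A.
     0 \<le> q a \<and>
     (\<forall>c. q (cscale A c a) = cmod c * q a) \<and>
     (\<forall>b\<in>carrier A. q (a \<oplus>\<^bsub>A\<^esub> b) \<le> q a + q b \<and> q (a \<otimes>\<^bsub>A\<^esub> b) \<le> q a * q b) \<and>
     q (adj A a \<otimes>\<^bsub>A\<^esub> a) = (q a)\<^sup>2)"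

text \<open>The Hausdorff completion of a *-algebra with respect to a seminorm \<open>q\<close>: Cauchy sequences
  modulo sequences converging to zero.\<close>

definition cauchy_seqs :: "('a, 'm) star_ring_scheme \<Rightarrow> ('a \<Rightarrow> real) \<Rightarrow> (nat \<Rightarrow> 'a) set" where
  "cauchy_seqs A q = {s. (\<forall>n. s n \<in> carrier A) \<and>
     (\<forall>e>0. \<exists>N. \<forall>m\<ge>N. \<forall>n\<ge>N. q (s m \<ominus>\<^bsub>A\<^esub> s n) < e)}"

definition null_rel :: "('a, 'm) star_ring_scheme \<Rightarrow> ('a \<Rightarrow> real) \<Rightarrow> ((nat \<Rightarrow> 'a) \<times> (nat \<Rightarrow> 'a)) set" where
  "null_rel A q = {(s, t). s \<in> cauchy_seqs A q \<and> t \<in> cauchy_seqs A q \<and>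
     (\<lambda>n. q (s n \<ominus>\<^bsub>A\<^esub> t n)) \<longlonglongrightarrow> 0}"

definition completion_incl :: "('a, 'm) star_ring_scheme \<Rightarrow> ('a \<Rightarrow> real) \<Rightarrow> 'a \<Rightarrow> (nat \<Rightarrow> 'a) set" where
  "completion_incl A q a = null_rel A q `` {\<lambda>_. a}"

definition completion ::
  "('a, 'm) star_ring_scheme \<Rightarrow> ('a \<Rightarrow> real) \<Rightarrow> (nat \<Rightarrow> 'a) set normed_star_ring" where
  "completion A q =
    \<lparr> carrier = cauchy_seqs A q // null_rel A q,
      mult = (\<lambda>X Y. \<Union>s\<in>X. \<Union>t\<in>Y. null_rel A q `` {\<lambda>n. s n \<otimes>\<^bsub>A\<^esub> t n}),
      one = completion_incl A q \<one>\<^bsub>A\<^esub>,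
      zero = completion_incl A q \<zero>\<^bsub>A\<^esub>,
      add = (\<lambda>X Y. \<Union>s\<in>X. \<Union>t\<in>Y. null_rel A q `` {\<lambda>n. s n \<oplus>\<^bsub>A\<^esub> t n}),
      cscale = (\<lambda>c X. \<Union>s\<in>X. null_rel A q `` {\<lambda>n. cscale A c (s n)}),
      adj = (\<lambda>X. \<Union>s\<in>X. null_rel A q `` {\<lambda>n. adj A (s n)}),
      nrm = (\<lambda>X. THE r. \<forall>s\<in>X. (\<lambda>n. q (s n)) \<longlonglongrightarrow> r) \<rparr>"

text \<open>For a seminorm \<open>q'\<close> dominated by \<open>q\<close>, the continuous extension of the identity of \<open>A\<close> to a map
  from the completion for \<open>q\<close> to the completion for \<open>q'\<close>.\<close>

definition completion_map :: "('a, 'm) star_ring_scheme \<Rightarrow> ('a \<Rightarrow> real) \<Rightarrow> (nat \<Rightarrow> 'a) set \<Rightarrow> (nat \<Rightarrow> 'a) set" where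
  "completion_map A q' X = null_rel A q' `` X"


section \<open>Constructible right ideals\<close>

definition pwords :: "'g set \<Rightarrow> 'g list set" where
  "pwords P = {\<alpha> \<in> lists P. even (length \<alpha>)}"

text \<open>Only lists of even length are relevant in the next function and in \<open>word_op\<close> below;
  the word \<open>\<alpha>\<close> with a tilde is \<open>rev \<alpha>\<close>.\<close>

fun word_val :: "('g, 'm) monoid_scheme \<Rightarrow> 'g list \<Rightarrow> 'g" where
  "word_val G (p # q # \<alpha>) = inv\<^bsub>G\<^esub> p \<otimes>\<^bsub>G\<^esub> q \<otimes>\<^bsub>G\<^esub> word_val G \<alpha>"
| "word_val G _ = \<one>\<^bsub>G\<^esub>"

definition neutral :: "('g, 'm) monoid_scheme \<Rightarrow> 'g list \<Rightarrow> bool" where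
  "neutral G \<alpha> \<longleftrightarrow> word_val G \<alpha> = \<one>\<^bsub>G\<^esub>"

text \<open>The translates intersected are those by the products
  \<open>p\<^bsub>2k\<^esub>\<^sup>-\<^sup>1 p\<^bsub>2k-1\<^esub> \<dots> p\<^bsub>2i+2\<^esub>\<^sup>-\<^sup>1 p\<^bsub>2i+1\<^esub>\<close>, for \<open>0 \<le> i < k\<close>.\<close>

definition cideal :: "('g, 'm) monoid_scheme \<Rightarrow> 'g set \<Rightarrow> 'g list \<Rightarrow> 'g set" where
  "cideal G P \<alpha> = P \<inter> (\<Inter>i<length \<alpha> div 2. word_val G (rev (drop (2 * i) \<alpha>)) <#\<^bsub>G\<^esub> P)"

definition cideals :: "('g, 'm) monoid_scheme \<Rightarrow> 'g set \<Rightarrow> 'g set set" where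
  "cideals G P = cideal G P ` pwords P"

definition G0 :: "('g, 'm) monoid_scheme \<Rightarrow> 'g set \<Rightarrow> 'g set" where
  "G0 G P = {g \<in> carrier G. \<forall>S\<in>cideals G P. S \<noteq> {} \<longrightarrow>
     (g <#\<^bsub>G\<^esub> P) \<inter> S \<noteq> {} \<and> (inv\<^bsub>G\<^esub> g <#\<^bsub>G\<^esub> P) \<inter> S \<noteq> {}}"


section \<open>The spectrum, its boundary and the partial action\<close>

definition J_hat :: "('g, 'm) monoid_scheme \<Rightarrow> 'g set \<Rightarrow> ('g set \<Rightarrow> nat) set" where
  "J_hat G P = {\<omega> \<in> cideals G P \<rightarrow>\<^sub>E {0, 1}.
     (\<exists>S\<in>cideals G P. \<omega> S \<noteq> 0) \<and>
     (\<forall>R\<in>cideals G P. \<forall>S\<in>cideals G P. \<omega> (R \<inter> S) = \<omega> R * \<omega> S) \<and>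
     ({} \<in> cideals G P \<longrightarrow> \<omega> {} = 0)}"

definition J_hat_top :: "('g, 'm) monoid_scheme \<Rightarrow> 'g set \<Rightarrow> ('g set \<Rightarrow> nat) topology" where
  "J_hat_top G P =
     subtopology (product_topology (\<lambda>_. discrete_topology {0, 1}) (cideals G P)) (J_hat G P)"

definition Omega :: "('g, 'm) monoid_scheme \<Rightarrow> 'g set \<Rightarrow> ('g set \<Rightarrow> nat) set" where
  "Omega G P = {\<omega> \<in> J_hat G P. \<forall>S\<in>cideals G P. \<forall>\<S>\<subseteq>cideals G P.
     finite \<S> \<and> S = \<Union>\<S> \<and> \<omega> S = 1 \<longrightarrow> (\<exists>R\<in>\<S>. \<omega> R = 1)}"

definition char_support :: "('g, 'm) monoid_scheme \<Rightarrow> 'g set \<Rightarrow> ('g set \<Rightarrow> nat) \<Rightarrow> 'g set set" where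
  "char_support G P \<omega> = {S \<in> cideals G P. \<omega> S = 1}"

definition maximal_chars :: "('g, 'm) monoid_scheme \<Rightarrow> 'g set \<Rightarrow> ('g set \<Rightarrow> nat) set" where
  "maximal_chars G P = {\<omega> \<in> J_hat G P. \<forall>\<omega>'\<in>J_hat G P.
     char_support G P \<omega> \<subseteq> char_support G P \<omega>' \<longrightarrow> char_support G P \<omega>' = char_support G P \<omega>}"

definition bd_Omega :: "('g, 'm) monoid_scheme \<Rightarrow> 'g set \<Rightarrow> ('g set \<Rightarrow> nat) set" where
  "bd_Omega G P = J_hat_top G P closure_of maximal_chars G P"

definition bd_top :: "('g, 'm) monoid_scheme \<Rightarrow> 'g set \<Rightarrow> ('g set \<Rightarrow> nat) topology" where
  "bd_top G P = subtopology (J_hat_top G P) (bd_Omega G P)"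

text \<open>The partial homeomorphism \<open>pact_hom G P g\<close> has domain \<open>pact_dom G P (inv\<^bsub>G\<^esub> g)\<close> and range
  \<open>pact_dom G P g\<close>.  An element of \<open>pact_dom G P g\<close> takes the value 1 on some \<open>cideal G P \<beta>\<close> with
  \<open>word_val G \<beta> = inv\<^bsub>G\<^esub> g\<close>; since the ideals of this form are closed under intersection with arbitrary
  constructible ideals, it is determined by its values on them.\<close>

definition pact_dom :: "('g, 'm) monoid_scheme \<Rightarrow> 'g set \<Rightarrow> 'g \<Rightarrow> ('g set \<Rightarrow> nat) set" where
  "pact_dom G P g = {\<omega> \<in> Omega G P. \<exists>\<alpha>\<in>pwords P. word_val G \<alpha> = inv\<^bsub>G\<^esub> g \<and> \<omega> (cideal G P \<alpha>) = 1}"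

definition pact_hom :: "('g, 'm) monoid_scheme \<Rightarrow> 'g set \<Rightarrow> 'g \<Rightarrow> ('g set \<Rightarrow> nat) \<Rightarrow> 'g set \<Rightarrow> nat" where
  "pact_hom G P g \<omega> = (THE \<eta>. \<eta> \<in> pact_dom G P g \<and>
     (\<forall>\<beta>\<in>pwords P. word_val G \<beta> = inv\<^bsub>G\<^esub> g \<longrightarrow> \<eta> (cideal G P \<beta>) = \<omega> (cideal G P (rev \<beta>))))"

definition bd_dom :: "('g, 'm) monoid_scheme \<Rightarrow> 'g set \<Rightarrow> 'g \<Rightarrow> ('g set \<Rightarrow> nat) set" where
  "bd_dom G P g = pact_dom G P g \<inter> bd_Omega G P"

text \<open>Throughout, a partial action is given by a topology \<open>X\<close>, a family \<open>U\<close> of sets and a family of maps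
  \<open>\<theta>\<close>, where \<open>\<theta> g\<close> maps \<open>U (inv\<^bsub>G\<^esub> g)\<close> onto \<open>U g\<close>.\<close>

definition topologically_free ::
  "('g, 'm) monoid_scheme \<Rightarrow> 'g set \<Rightarrow> 'x topology \<Rightarrow> ('g \<Rightarrow> 'x set) \<Rightarrow> ('g \<Rightarrow> 'x \<Rightarrow> 'x) \<Rightarrow> bool" where
  "topologically_free G H X U \<theta> \<longleftrightarrow>
     (\<forall>g\<in>H. g \<noteq> \<one>\<^bsub>G\<^esub> \<longrightarrow> X interior_of {x \<in> U (inv\<^bsub>G\<^esub> g). \<theta> g x = x} = {})"


section \<open>Partial crossed products\<close>

text \<open>Functions on \<open>topspace X\<close> are represented by functions on the whole type vanishing elsewhere.
  When \<open>X\<close> is compact Hausdorff and \<open>V\<close> is open, \<open>C0_on X V\<close> is \<open>C\<^sub>0(V)\<close> as an ideal of \<open>C(X)\<close>.\<close>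

definition C0_on :: "'x topology \<Rightarrow> 'x set \<Rightarrow> ('x \<Rightarrow> complex) set" where
  "C0_on X V = {f. continuous_map X euclidean f \<and> (\<forall>x. x \<notin> topspace X \<inter> V \<longrightarrow> f x = 0)}"

definition dual_pact ::
  "('g, 'm) monoid_scheme \<Rightarrow> ('g \<Rightarrow> 'x set) \<Rightarrow> ('g \<Rightarrow> 'x \<Rightarrow> 'x) \<Rightarrow> 'g \<Rightarrow> ('x \<Rightarrow> complex) \<Rightarrow> 'x \<Rightarrow> complex" where
  "dual_pact G U \<theta> g f x = (if x \<in> U g then f (\<theta> (inv\<^bsub>G\<^esub> g) x) else 0)"

text \<open>The algebraic partial crossed product: \<open>f\<close> stands for the finite formal sum of the
  \<open>f g \<delta>\<^sub>g\<close>, with the operations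
  \<open>(a \<delta>\<^sub>g) (b \<delta>\<^sub>h) = \<gamma>\<^sub>g (\<gamma>\<^sub>g\<^sup>-\<^sup>1(a) b) \<delta>\<^sub>g\<^sub>h\<close> and \<open>(a \<delta>\<^sub>g)\<^sup>* = \<gamma>\<^sub>g\<^sup>-\<^sup>1(a\<^sup>*) \<delta>\<^sub>g\<^sup>-\<^sup>1\<close>,
  where \<open>\<gamma>\<^sub>g\<close> is \<open>dual_pact G U \<theta> g\<close>.\<close>

definition alg_crossed ::
  "('g, 'm) monoid_scheme \<Rightarrow> 'x topology \<Rightarrow> ('g \<Rightarrow> 'x set) \<Rightarrow> ('g \<Rightarrow> 'x \<Rightarrow> 'x) \<Rightarrow> ('g \<Rightarrow> 'x \<Rightarrow> complex) star_ring" where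
  "alg_crossed G X U \<theta> =
    \<lparr> carrier = {f. finite {g. f g \<noteq> (\<lambda>_. 0)} \<and> {g. f g \<noteq> (\<lambda>_. 0)} \<subseteq> carrier G \<and>
                    (\<forall>g\<in>carrier G. f g \<in> C0_on X (U g))},
      mult = (\<lambda>f h k x. if k \<in> carrier G
                then \<Sum>g | f g \<noteq> (\<lambda>_. 0).
                  dual_pact G U \<theta> g
                    (\<lambda>y. dual_pact G U \<theta> (inv\<^bsub>G\<^esub> g) (f g) y * h (inv\<^bsub>G\<^esub> g \<otimes>\<^bsub>G\<^esub> k) y) x
                else 0),
      one = (\<lambda>g x. if g = \<one>\<^bsub>G\<^esub> then indicator (topspace X) x else 0),
      zero = (\<lambda>_ _. 0),
      add = (\<lambda>f h g x. f g x + h g x),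
      cscale = (\<lambda>c f g x. c * f g x),
      adj = (\<lambda>f g x. if g \<in> carrier G
               then dual_pact G U \<theta> g (\<lambda>y. cnj (f (inv\<^bsub>G\<^esub> g) y)) x else 0) \<rparr>"

definition sup_norm :: "'x topology \<Rightarrow> ('x \<Rightarrow> complex) \<Rightarrow> real" where
  "sup_norm X f = (SUP x\<in>topspace X. cmod (f x))"

definition full_norm ::
  "('g, 'm) monoid_scheme \<Rightarrow> 'x topology \<Rightarrow> ('g \<Rightarrow> 'x set) \<Rightarrow> ('g \<Rightarrow> 'x \<Rightarrow> 'x) \<Rightarrow> ('g \<Rightarrow> 'x \<Rightarrow> complex) \<Rightarrow> real" where
  "full_norm G X U \<theta> f = (SUP q\<in>{q. cstar_seminorm (alg_crossed G X U \<theta>) q}. q f)"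

text \<open>The reduced norm is the operator norm of the left regular representation on the Hilbert
  \<open>C(X)\<close>-module obtained from the algebraic crossed product and the inner product
  \<open>\<langle>\<xi>, \<eta>\<rangle> = (\<xi>\<^sup>* \<eta>)\<^sub>e\<close>, evaluated on the dense submodule of finite sums.\<close>

definition hilbmod_norm ::
  "('g, 'm) monoid_scheme \<Rightarrow> 'x topology \<Rightarrow> ('g \<Rightarrow> 'x set) \<Rightarrow> ('g \<Rightarrow> 'x \<Rightarrow> 'x) \<Rightarrow> ('g \<Rightarrow> 'x \<Rightarrow> complex) \<Rightarrow> real" where
  "hilbmod_norm G X U \<theta> \<xi> =
     sqrt (sup_norm X ((adj (alg_crossed G X U \<theta>) \<xi> \<otimes>\<^bsub>alg_crossed G X U \<theta>\<^esub> \<xi>) \<one>\<^bsub>G\<^esub>))"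

definition reduced_norm ::
  "('g, 'm) monoid_scheme \<Rightarrow> 'x topology \<Rightarrow> ('g \<Rightarrow> 'x set) \<Rightarrow> ('g \<Rightarrow> 'x \<Rightarrow> 'x) \<Rightarrow> ('g \<Rightarrow> 'x \<Rightarrow> complex) \<Rightarrow> real" where
  "reduced_norm G X U \<theta> f =
     (SUP \<xi>\<in>{\<xi> \<in> carrier (alg_crossed G X U \<theta>). hilbmod_norm G X U \<theta> \<xi> \<le> 1}.
        hilbmod_norm G X U \<theta> (f \<otimes>\<^bsub>alg_crossed G X U \<theta>\<^esub> \<xi>))"

definition full_crossed ::
  "('g, 'm) monoid_scheme \<Rightarrow> 'x topology \<Rightarrow> ('g \<Rightarrow> 'x set) \<Rightarrow> ('g \<Rightarrow> 'x \<Rightarrow> 'x)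
     \<Rightarrow> (nat \<Rightarrow> 'g \<Rightarrow> 'x \<Rightarrow> complex) set normed_star_ring" where
  "full_crossed G X U \<theta> = completion (alg_crossed G X U \<theta>) (full_norm G X U \<theta>)"

definition reduced_crossed ::
  "('g, 'm) monoid_scheme \<Rightarrow> 'x topology \<Rightarrow> ('g \<Rightarrow> 'x set) \<Rightarrow> ('g \<Rightarrow> 'x \<Rightarrow> 'x)
     \<Rightarrow> (nat \<Rightarrow> 'g \<Rightarrow> 'x \<Rightarrow> complex) set normed_star_ring" where
  "reduced_crossed G X U \<theta> = completion (alg_crossed G X U \<theta>) (reduced_norm G X U \<theta>)"

definition full_to_reduced ::
  "('g, 'm) monoid_scheme \<Rightarrow> 'x topology \<Rightarrow> ('g \<Rightarrow> 'x set) \<Rightarrow> ('g \<Rightarrow> 'x \<Rightarrow> 'x)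
     \<Rightarrow> (nat \<Rightarrow> 'g \<Rightarrow> 'x \<Rightarrow> complex) set \<Rightarrow> (nat \<Rightarrow> 'g \<Rightarrow> 'x \<Rightarrow> complex) set" where
  "full_to_reduced G X U \<theta> = completion_map (alg_crossed G X U \<theta>) (reduced_norm G X U \<theta>)"

definition boundary_quotient ::
  "('g, 'm) monoid_scheme \<Rightarrow> 'g set \<Rightarrow> (nat \<Rightarrow> 'g \<Rightarrow> ('g set \<Rightarrow> nat) \<Rightarrow> complex) set normed_star_ring" where
  "boundary_quotient G P = reduced_crossed G (bd_top G P) (bd_dom G P) (pact_hom G P)"


section \<open>Strongly covariant representations and the covariance algebra\<close>

text \<open>Elements of \<open>\<ell>\<^sup>\<infinity>(P)\<close> are functions vanishing off \<open>P\<close>.  As all constructible ideals are contained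
  in \<open>P\<close>, the carrier below is the closed linear span of their indicator functions.\<close>

definition D_r :: "('g, 'm) monoid_scheme \<Rightarrow> 'g set \<Rightarrow> ('g \<Rightarrow> complex) star_ring" where
  "D_r G P =
    \<lparr> carrier = {f. \<forall>e>0. \<exists>\<S> c. finite \<S> \<and> \<S> \<subseteq> cideals G P \<and>
                      (\<forall>x. cmod (f x - (\<Sum>S\<in>\<S>. c S * indicator S x)) < e)},
      mult = (\<lambda>f h x. f x * h x),
      one = indicator P,
      zero = (\<lambda>_. 0),
      add = (\<lambda>f h x. f x + h x),
      cscale = (\<lambda>c f x. c * f x),
      adj = (\<lambda>f x. cnj (f x)) \<rparr>"

definition Delta :: "('g, 'm) monoid_scheme \<Rightarrow> 'g set \<Rightarrow> 'g set \<Rightarrow> 'g set" where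
  "Delta G P F = {p \<in> P. \<forall>g\<in>F. (p <#\<^bsub>G\<^esub> P) \<inter> (g <#\<^bsub>G\<^esub> P) = {} \<or>
                                (p <#\<^bsub>G\<^esub> P) \<inter> (g <#\<^bsub>G\<^esub> P) = p <#\<^bsub>G\<^esub> P}"

text \<open>The operator norm on \<open>\<ell>\<^sup>2(A)\<close> of multiplication by \<open>b\<close>.\<close>

definition mult_opnorm :: "'g set \<Rightarrow> ('g \<Rightarrow> complex) \<Rightarrow> real" where
  "mult_opnorm A b =
     (SUP \<xi>\<in>{\<xi> :: 'g \<Rightarrow> complex. (\<lambda>p. (cmod (\<xi> p))\<^sup>2) summable_on A \<and> (\<Sum>\<^sub>\<infinity>p\<in>A. (cmod (\<xi> p))\<^sup>2) \<le> 1}.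
        sqrt (\<Sum>\<^sub>\<infinity>p\<in>A. (cmod (b p * \<xi> p))\<^sup>2))"

definition D_r_o :: "('g, 'm) monoid_scheme \<Rightarrow> 'g set \<Rightarrow> ('g \<Rightarrow> complex) set" where
  "D_r_o G P = {b \<in> carrier (D_r G P).
     ((\<lambda>F. mult_opnorm (Delta G P F) b) \<longlongrightarrow> 0) (finite_subsets_at_top (carrier G))}"

fun word_op :: "('b, 'n) star_ring_scheme \<Rightarrow> ('g \<Rightarrow> 'b) \<Rightarrow> 'g list \<Rightarrow> 'b" where
  "word_op B w (p # q # \<alpha>) = adj B (w p) \<otimes>\<^bsub>B\<^esub> w q \<otimes>\<^bsub>B\<^esub> word_op B w \<alpha>"
| "word_op B w _ = \<one>\<^bsub>B\<^esub>"

definition isometric_rep ::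
  "('g, 'm) monoid_scheme \<Rightarrow> 'g set \<Rightarrow> ('b, 'n) star_ring_scheme \<Rightarrow> ('g \<Rightarrow> 'b) \<Rightarrow> bool" where
  "isometric_rep G P B w \<longleftrightarrow>
     (\<forall>p\<in>P. w p \<in> carrier B \<and> adj B (w p) \<otimes>\<^bsub>B\<^esub> w p = \<one>\<^bsub>B\<^esub>) \<and>
     w \<one>\<^bsub>G\<^esub> = \<one>\<^bsub>B\<^esub> \<and>
     (\<forall>p\<in>P. \<forall>q\<in>P. w (p \<otimes>\<^bsub>G\<^esub> q) = w p \<otimes>\<^bsub>B\<^esub> w q)"

text \<open>For neutral \<open>\<alpha>\<close>, the product of \<open>\<alpha>\<close> in the left regular representation is multiplication by
  \<open>indicator (cideal G P \<alpha>)\<close> on \<open>\<ell>\<^sup>2(P)\<close>.\<close>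

definition strongly_covariant ::
  "('g, 'm) monoid_scheme \<Rightarrow> 'g set \<Rightarrow> ('b, 'n) star_ring_scheme \<Rightarrow> ('g \<Rightarrow> 'b) \<Rightarrow> bool" where
  "strongly_covariant G P B w \<longleftrightarrow> isometric_rep G P B w \<and>
     (\<exists>\<phi>\<in>star_hom (D_r G P) B.
        (\<forall>\<alpha>\<in>pwords P. neutral G \<alpha> \<longrightarrow> \<phi> (indicator (cideal G P \<alpha>)) = word_op B w \<alpha>) \<and>
        (\<forall>b\<in>D_r_o G P. \<phi> b = \<zero>\<^bsub>B\<^esub>))"

text \<open>The free unital complex *-algebra on \<open>P\<close>: finitely supported functions on lists of letters, where
  \<open>(p, False)\<close> is the generator of \<open>p\<close> and \<open>(p, True)\<close> its adjoint.\<close>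

definition free_star_alg :: "'g set \<Rightarrow> (('g \<times> bool) list \<Rightarrow> complex) star_ring" where
  "free_star_alg P =
    \<lparr> carrier = {f. finite {u. f u \<noteq> 0} \<and> {u. f u \<noteq> 0} \<subseteq> lists (P \<times> UNIV)},
      mult = (\<lambda>f h u. \<Sum>i\<le>length u. f (take i u) * h (drop i u)),
      one = indicator {[]},
      zero = (\<lambda>_. 0),
      add = (\<lambda>f h u. f u + h u),
      cscale = (\<lambda>c f u. c * f u),
      adj = (\<lambda>f u. cnj (f (rev (map (\<lambda>(p, b). (p, \<not> b)) u)))) \<rparr>"

definition free_gen :: "'g \<Rightarrow> ('g \<times> bool) list \<Rightarrow> complex" where
  "free_gen p = indicator {[(p, False)]}"

text \<open>The universal \<open>C\<^sup>*\<close>-algebra for strongly covariant representations is the completion of the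
  free *-algebra with respect to the supremum of the seminorms induced by such representations.
  A representation enters only through the \<open>C\<^sup>*\<close>-seminorm \<open>q\<close> that it induces: the \<open>C\<^sup>*\<close>-algebra that
  it generates is the completion for \<open>q\<close>.\<close>

definition covariance_norm ::
  "('g, 'm) monoid_scheme \<Rightarrow> 'g set \<Rightarrow> (('g \<times> bool) list \<Rightarrow> complex) \<Rightarrow> real" where
  "covariance_norm G P f =
     (SUP q\<in>{q. cstar_seminorm (free_star_alg P) q \<and>
              strongly_covariant G P (completion (free_star_alg P) q)
                (\<lambda>p. completion_incl (free_star_alg P) q (free_gen p))}. q f)"

definition covariance_algebra ::
  "('g, 'm) monoid_scheme \<Rightarrow> 'g set \<Rightarrow> (nat \<Rightarrow> ('g \<times> bool) list \<Rightarrow> complex) set normed_star_ring" where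
  "covariance_algebra G P = completion (free_star_alg P) (covariance_norm G P)"

definition covariance_gen ::
  "('g, 'm) monoid_scheme \<Rightarrow> 'g set \<Rightarrow> 'g \<Rightarrow> (nat \<Rightarrow> ('g \<times> bool) list \<Rightarrow> complex) set" where
  "covariance_gen G P p = completion_incl (free_star_alg P) (covariance_norm G P) (free_gen p)"

text \<open>The element \<open>1\<^sub>p\<^sub>P \<delta>\<^sub>p\<close>; as a function on the spectrum, \<open>1\<^sub>p\<^sub>P\<close> is evaluation at \<open>p P\<close>.\<close>

definition crossed_gen ::
  "('g, 'm) monoid_scheme \<Rightarrow> 'g set \<Rightarrow> 'g \<Rightarrow> 'g \<Rightarrow> ('g set \<Rightarrow> nat) \<Rightarrow> complex" where
  "crossed_gen G P p g \<omega> =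
     (if g = p \<and> \<omega> \<in> bd_Omega G P then of_nat (\<omega> (p <#\<^bsub>G\<^esub> P)) else 0)"

abbreviation bd_full_crossed ::
  "('g, 'm) monoid_scheme \<Rightarrow> 'g set \<Rightarrow> (nat \<Rightarrow> 'g \<Rightarrow> ('g set \<Rightarrow> nat) \<Rightarrow> complex) set normed_star_ring" where
  "bd_full_crossed G P \<equiv> full_crossed G (bd_top G P) (bd_dom G P) (pact_hom G P)"

text \<open>The isomorphism is unique on the carrier, since the generators generate the covariance algebra.\<close>

definition covariance_iso ::
  "('g, 'm) monoid_scheme \<Rightarrow> 'g set \<Rightarrow> (nat \<Rightarrow> ('g \<times> bool) list \<Rightarrow> complex) set
     \<Rightarrow> (nat \<Rightarrow> 'g \<Rightarrow> ('g set \<Rightarrow> nat) \<Rightarrow> complex) set" where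
  "covariance_iso G P = (SOME \<Phi>. \<Phi> \<in> star_iso (covariance_algebra G P) (bd_full_crossed G P) \<and>
     (\<forall>p\<in>P. \<Phi> (covariance_gen G P p) =
        completion_incl (alg_crossed G (bd_top G P) (bd_dom G P) (pact_hom G P))
          (full_norm G (bd_top G P) (bd_dom G P) (pact_hom G P)) (crossed_gen G P p)))"

definition Lambda_bd ::
  "('g, 'm) monoid_scheme \<Rightarrow> 'g set \<Rightarrow> (nat \<Rightarrow> ('g \<times> bool) list \<Rightarrow> complex) set
     \<Rightarrow> (nat \<Rightarrow> 'g \<Rightarrow> ('g set \<Rightarrow> nat) \<Rightarrow> complex) set" where
  "Lambda_bd G P =
     full_to_reduced G (bd_top G P) (bd_dom G P) (pact_hom G P) \<circ> covariance_iso G P"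

end

theory Submission
 imports Defs
begin


text \<open>Write \<open>W\<^sub>p\<close> for the set of boundary characters taking the value 1 at \<open>p P\<close>; these sets form a \<open>\<pi>\<close>-base.
 On them, (1)-(4) become statements about principal right ideals, because a maximal character that is not fixed
 by \<open>g\<close> is separated from its image by disjoint constructible ideals.

 For (5), the covariance algebra is identified with the full crossed product through \<open>C\<^sup>*\<close>-seminorms. The
 homomorphism \<open>psi\<close> from the free *-algebra to the algebraic crossed product has \<open>l\<^sup>1\<close>-dense range. Each
 \<open>C\<^sup>*\<close>-seminorm of the crossed product pulls back to a strongly covariant one, since functions in \<open>D\<^sub>r\<close> have
 limits at boundary points and those in \<open>D\<^sub>r\<^sup>o\<close> have limit 0. Conversely, a function in the span of the
 \<open>1\<^sub>S\<close> is determined modulo \<open>D\<^sub>r\<^sup>o\<close> by its boundary values, so that a strongly covariant seminorm is bounded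
 by the \<open>l\<^sup>1\<close>-norm along the grading by \<open>G\<close> and hence factors through \<open>psi\<close>.

 If the action is topologically free, then \<open>W\<^sub>r\<close> can be chosen disjoint from its translates by given \<open>g \<noteq> e\<close>;
 cutting down by \<open>1\<^sub>r\<^sub>P\<close> leaves only the diagonal coefficient, and as \<open>1\<^sub>r\<^sub>P\<close> is the range projection of an
 isometry, a proper ideal cannot contain an element whose expectation is nonzero on \<open>W\<^sub>r\<close>. If instead
 \<open>g \<noteq> e\<close> fixes \<open>W\<^sub>p\<close> pointwise, the representation on \<open>l\<^sup>2\<close> of the boundary annihilates
 \<open>1\<^sub>p\<^sub>P \<delta>\<^sub>g - 1\<^sub>p\<^sub>P \<delta>\<^sub>e\<close>, which is nonzero in the reduced crossed product.\<close>

section \<open>Star algebras and C*-seminorms\<close>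

text \<open>C*-algebras occur only as Hausdorff completions, without spectra or Hilbert spaces.
  Contractivity of seminorms therefore rests on one device: a C*-seminorm is at most 1 on
  isometries, and in a complete algebra every self-adjoint element of norm less than 1 is the real
  part of a unitary. Representations are replaced by families of positive functionals: point
  evaluations of the coefficient at the identity give the reduced norm, diagonal matrix coefficients
  give the representation on orbits. The obstacle in (5) is that \<open>covariance_norm\<close> is a
  supremum over seminorms of a free algebra, constrained by a homomorphism from
  \<open>D_r G P\<close> into a completion, while \<open>full_norm\<close> is a supremum over all
  C*-seminorms of another algebra; both sides become comparable because the l1-norm bounds them. As
  \<open>covariance_iso\<close> is a choice, its defining property must first be shown satisfiable;
  afterwards only its being a *-isomorphism matters, and ideals are studied in the crossed product.
  Elements outside \<open>G0 G P\<close> cause no trouble in (4): an ideal missed by a translate of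
  \<open>P\<close> directly supplies disjoint ideals.\<close>

locale star_alg = ring A for A :: "('a, 'm) star_ring_scheme" (structure) +
 assumes cscale_closed [simp, intro]: "a \<in> carrier A ==> cscale A c a \<in> carrier A"
  and cscale_add_right: "[|a \<in> carrier A; b \<in> carrier A|] ==> cscale A c (a \<oplus> b) = cscale A c a \<oplus> cscale A c b"
  and cscale_add_left: "a \<in> carrier A ==> cscale A (c + d) a = cscale A c a \<oplus> cscale A d a"
  and cscale_cscale [simp]: "a \<in> carrier A ==> cscale A c (cscale A d a) = cscale A (c * d) a"
  and cscale_1 [simp]: "a \<in> carrier A ==> cscale A 1 a = a"
  and mult_cscale_left: "[|a \<in> carrier A; b \<in> carrier A|] ==> cscale A c a \<otimes> b = cscale A c (a \<otimes> b)"
  and mult_cscale_right: "[|a \<in> carrier A; b \<in> carrier A|] ==> a \<otimes> cscale A c b = cscale A c (a \<otimes> b)"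
  and adj_closed [simp, intro]: "a \<in> carrier A ==> adj A a \<in> carrier A"
  and adj_adj [simp]: "a \<in> carrier A ==> adj A (adj A a) = a"
  and adj_add: "[|a \<in> carrier A; b \<in> carrier A|] ==> adj A (a \<oplus> b) = adj A a \<oplus> adj A b"
  and adj_mult: "[|a \<in> carrier A; b \<in> carrier A|] ==> adj A (a \<otimes> b) = adj A b \<otimes> adj A a"
  and adj_cscale: "a \<in> carrier A ==> adj A (cscale A c a) = cscale A (cnj c) (adj A a)"
begin

lemma add_eq_self_iff: "[|a \<in> carrier A; b \<in> carrier A|] ==> a \<oplus> b = a \<longleftrightarrow> b = \<zero>"
 by simp

lemma cscale_0 [simp]: "a \<in> carrier A ==> cscale A 0 a = \<zero>"
 using cscale_add_left[of a 0 0] add_eq_self_iff[of "cscale A 0 a" "cscale A 0 a"] by auto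

lemma cscale_zero [simp]: "cscale A c \<zero> = \<zero>"
 using cscale_add_right[of \<zero> \<zero> c] add_eq_self_iff[of "cscale A c \<zero>" "cscale A c \<zero>"] by auto

lemma cscale_m1: "a \<in> carrier A ==> cscale A (-1) a = \<ominus> a"
 using cscale_add_left[of a "-1" 1] by (metis add.inv_equality add.left_inverse cscale_0 cscale_1 cscale_closed)

lemma cscale_minus_right: "a \<in> carrier A ==> cscale A c (\<ominus> a) = \<ominus> cscale A c a"
 by (simp flip: cscale_m1)

lemma cscale_diff_right: "[|a \<in> carrier A; b \<in> carrier A|] ==> cscale A c (a \<ominus> b) = cscale A c a \<ominus> cscale A c b"
 by (simp add: a_minus_def cscale_add_right cscale_minus_right)

lemma adj_zero [simp]: "adj A \<zero> = \<zero>"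
 using adj_cscale[of \<zero> 0] by simp

lemma adj_one [simp]: "adj A \<one> = \<one>"
 by (metis adj_adj adj_closed adj_mult l_one one_closed r_one)

lemma adj_minus: "a \<in> carrier A ==> adj A (\<ominus> a) = \<ominus> adj A a"
 by (simp add: adj_cscale flip: cscale_m1)

lemma adj_diff: "[|a \<in> carrier A; b \<in> carrier A|] ==> adj A (a \<ominus> b) = adj A a \<ominus> adj A b"
 by (simp add: a_minus_def adj_add adj_minus)

lemma diff_self [simp]: "a \<in> carrier A ==> a \<ominus> a = \<zero>"
 by (simp add: a_minus_def r_neg)

lemma diff_zero [simp]: "a \<in> carrier A ==> a \<ominus> \<zero> = a"
 by (simp add: a_minus_def)

lemma diff_eq_zero: "[|a \<in> carrier A; b \<in> carrier A|] ==> a \<ominus> b = \<zero> \<longleftrightarrow> a = b"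
 by (metis a_minus_def a_inv_closed add.m_assoc l_neg l_zero r_neg r_zero)

lemma diff_swap: "[|a \<in> carrier A; b \<in> carrier A|] ==> \<ominus> (a \<ominus> b) = b \<ominus> a"
 by (simp add: a_minus_def minus_add a_comm)

lemma diff_telescope: "[|a \<in> carrier A; b \<in> carrier A; c \<in> carrier A|] ==> (a \<ominus> b) \<oplus> (b \<ominus> c) = a \<ominus> c"
 by algebra

lemma add_diff_add:
 "[|a \<in> carrier A; b \<in> carrier A; c \<in> carrier A; d \<in> carrier A|] ==> (a \<oplus> b) \<ominus> (c \<oplus> d) = (a \<ominus> c) \<oplus> (b \<ominus> d)"
 by algebra

lemma mult_diff_mult:
 "[|a \<in> carrier A; b \<in> carrier A; c \<in> carrier A; d \<in> carrier A|] ==>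
   (a \<otimes> b) \<ominus> (c \<otimes> d) = (a \<ominus> c) \<otimes> b \<oplus> c \<otimes> (b \<ominus> d)"
 by algebra

lemma diff_mult_left: "[|a \<in> carrier A; b \<in> carrier A; c \<in> carrier A|] ==> c \<otimes> (a \<ominus> b) = c \<otimes> a \<ominus> c \<otimes> b"
 by algebra

lemma diff_mult_right: "[|a \<in> carrier A; b \<in> carrier A; c \<in> carrier A|] ==> (a \<ominus> b) \<otimes> c = a \<otimes> c \<ominus> b \<otimes> c"
 by algebra

end

lemma star_algI:
 assumes "ring A"
  "!!a c. a \<in> carrier A ==> cscale A c a \<in> carrier A"
  "!!a b c. [|a \<in> carrier A; b \<in> carrier A|] ==> cscale A c (a \<oplus>\<^bsub>A\<^esub> b) = cscale A c a \<oplus>\<^bsub>A\<^esub> cscale A c b"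
  "!!a c d. a \<in> carrier A ==> cscale A (c + d) a = cscale A c a \<oplus>\<^bsub>A\<^esub> cscale A d a"
  "!!a c d. a \<in> carrier A ==> cscale A c (cscale A d a) = cscale A (c * d) a"
  "!!a. a \<in> carrier A ==> cscale A 1 a = a"
  "!!a b c. [|a \<in> carrier A; b \<in> carrier A|] ==> cscale A c a \<otimes>\<^bsub>A\<^esub> b = cscale A c (a \<otimes>\<^bsub>A\<^esub> b)"
  "!!a b c. [|a \<in> carrier A; b \<in> carrier A|] ==> a \<otimes>\<^bsub>A\<^esub> cscale A c b = cscale A c (a \<otimes>\<^bsub>A\<^esub> b)"
  "!!a. a \<in> carrier A ==> adj A a \<in> carrier A"
  "!!a. a \<in> carrier A ==> adj A (adj A a) = a"
  "!!a b. [|a \<in> carrier A; b \<in> carrier A|] ==> adj A (a \<oplus>\<^bsub>A\<^esub> b) = adj A a \<oplus>\<^bsub>A\<^esub> adj A b"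
  "!!a b. [|a \<in> carrier A; b \<in> carrier A|] ==> adj A (a \<otimes>\<^bsub>A\<^esub> b) = adj A b \<otimes>\<^bsub>A\<^esub> adj A a"
  "!!a c. a \<in> carrier A ==> adj A (cscale A c a) = cscale A (cnj c) (adj A a)"
 shows "star_alg A"
 by (intro star_alg.intro star_alg_axioms.intro assms)

lemma ring_axiomsI:
 assumes "!!x y. [|x \<in> carrier A; y \<in> carrier A|] ==> x \<oplus>\<^bsub>A\<^esub> y \<in> carrier A"
  "\<zero>\<^bsub>A\<^esub> \<in> carrier A"
  "!!x y z. [|x \<in> carrier A; y \<in> carrier A; z \<in> carrier A|] ==> (x \<oplus>\<^bsub>A\<^esub> y) \<oplus>\<^bsub>A\<^esub> z = x \<oplus>\<^bsub>A\<^esub> (y \<oplus>\<^bsub>A\<^esub> z)"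
  "!!x y. [|x \<in> carrier A; y \<in> carrier A|] ==> x \<oplus>\<^bsub>A\<^esub> y = y \<oplus>\<^bsub>A\<^esub> x"
  "!!x. x \<in> carrier A ==> \<zero>\<^bsub>A\<^esub> \<oplus>\<^bsub>A\<^esub> x = x"
  "!!x. x \<in> carrier A ==> \<exists>y\<in>carrier A. y \<oplus>\<^bsub>A\<^esub> x = \<zero>\<^bsub>A\<^esub>"
  "!!x y. [|x \<in> carrier A; y \<in> carrier A|] ==> x \<otimes>\<^bsub>A\<^esub> y \<in> carrier A"
  "\<one>\<^bsub>A\<^esub> \<in> carrier A"
  "!!x y z. [|x \<in> carrier A; y \<in> carrier A; z \<in> carrier A|] ==> (x \<otimes>\<^bsub>A\<^esub> y) \<otimes>\<^bsub>A\<^esub> z = x \<otimes>\<^bsub>A\<^esub> (y \<otimes>\<^bsub>A\<^esub> z)"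
  "!!x. x \<in> carrier A ==> \<one>\<^bsub>A\<^esub> \<otimes>\<^bsub>A\<^esub> x = x"
  "!!x. x \<in> carrier A ==> x \<otimes>\<^bsub>A\<^esub> \<one>\<^bsub>A\<^esub> = x"
  "!!x y z. [|x \<in> carrier A; y \<in> carrier A; z \<in> carrier A|] ==> (x \<oplus>\<^bsub>A\<^esub> y) \<otimes>\<^bsub>A\<^esub> z = x \<otimes>\<^bsub>A\<^esub> z \<oplus>\<^bsub>A\<^esub> y \<otimes>\<^bsub>A\<^esub> z"
  "!!x y z. [|x \<in> carrier A; y \<in> carrier A; z \<in> carrier A|] ==> z \<otimes>\<^bsub>A\<^esub> (x \<oplus>\<^bsub>A\<^esub> y) = z \<otimes>\<^bsub>A\<^esub> x \<oplus>\<^bsub>A\<^esub> z \<otimes>\<^bsub>A\<^esub> y"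
 shows "ring A"
 by (intro ringI abelian_groupI monoidI assms)

lemma star_homD:
 assumes "h \<in> star_hom A B"
 shows star_hom_closed: "a \<in> carrier A ==> h a \<in> carrier B"
  and star_hom_add: "[|a \<in> carrier A; b \<in> carrier A|] ==> h (a \<oplus>\<^bsub>A\<^esub> b) = h a \<oplus>\<^bsub>B\<^esub> h b"
  and star_hom_mult: "[|a \<in> carrier A; b \<in> carrier A|] ==> h (a \<otimes>\<^bsub>A\<^esub> b) = h a \<otimes>\<^bsub>B\<^esub> h b"
  and star_hom_one: "h \<one>\<^bsub>A\<^esub> = \<one>\<^bsub>B\<^esub>"
  and star_hom_cscale: "a \<in> carrier A ==> h (cscale A c a) = cscale B c (h a)"
  and star_hom_adj: "a \<in> carrier A ==> h (adj A a) = adj B (h a)"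
 using assms by (auto simp: star_hom_def ring_hom_def)

lemma star_homI:
 assumes "!!a. a \<in> carrier A ==> h a \<in> carrier B"
  "!!a b. [|a \<in> carrier A; b \<in> carrier A|] ==> h (a \<oplus>\<^bsub>A\<^esub> b) = h a \<oplus>\<^bsub>B\<^esub> h b"
  "!!a b. [|a \<in> carrier A; b \<in> carrier A|] ==> h (a \<otimes>\<^bsub>A\<^esub> b) = h a \<otimes>\<^bsub>B\<^esub> h b"
  "h \<one>\<^bsub>A\<^esub> = \<one>\<^bsub>B\<^esub>"
  "!!a c. a \<in> carrier A ==> h (cscale A c a) = cscale B c (h a)"
  "!!a. a \<in> carrier A ==> h (adj A a) = adj B (h a)"
 shows "h \<in> star_hom A B"
 using assms by (auto simp: star_hom_def ring_hom_def)

lemma star_hom_zero: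
 assumes "h \<in> star_hom A B" "star_alg A" "star_alg B"
 shows "h \<zero>\<^bsub>A\<^esub> = \<zero>\<^bsub>B\<^esub>"
 by (metis assms ring.ring_simprules(2) star_alg.axioms(1) star_alg.cscale_0 star_hom_cscale star_hom_closed)

lemma star_hom_diff:
 assumes "h \<in> star_hom A B" "star_alg A" "star_alg B" "a \<in> carrier A" "b \<in> carrier A"
 shows "h (a \<ominus>\<^bsub>A\<^esub> b) = h a \<ominus>\<^bsub>B\<^esub> h b"
proof -
 interpret A: star_alg A by fact
 interpret B: star_alg B by fact
 have "h (\<ominus>\<^bsub>A\<^esub> b) = \<ominus>\<^bsub>B\<^esub> h b"
  by (metis A.cscale_m1 B.cscale_m1 assms(1) assms(5) star_hom_closed star_hom_cscale)
 then show ?thesis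
  using assms by (simp add: a_minus_def star_hom_add[OF assms(1)])
qed

lemma star_hom_comp:
 "[|h \<in> star_hom A B; k \<in> star_hom B C|] ==> k \<circ> h \<in> star_hom A C"
 by (auto simp: star_hom_def ring_hom_def Pi_iff)

lemma star_iso_inv:
 assumes "h \<in> star_iso A B" "star_alg A"
 shows "inv_into (carrier A) h \<in> star_iso B A"
proof -
 interpret A: star_alg A by fact
 let ?k = "inv_into (carrier A) h"
 have h: "h \<in> star_hom A B" and bij: "bij_betw h (carrier A) (carrier B)"
  using assms by (auto simp: star_iso_def)
 have k: "?k b \<in> carrier A" "h (?k b) = b" if "b \<in> carrier B" for b
  using bij that by (auto simp: bij_betw_def inv_into_into f_inv_into_f)
 have kI: "?k b = a" if "a \<in> carrier A" "h a = b" for a b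
  using bij that by (auto simp: bij_betw_def inv_into_f_f)
 have "?k \<in> star_hom B A"
  by (rule star_homI; (rule kI)?)
    (auto simp: k star_hom_add[OF h] star_hom_mult[OF h] star_hom_one[OF h] star_hom_cscale[OF h] star_hom_adj[OF h])
 then show ?thesis
  using bij by (simp add: star_iso_def bij_betw_inv_into)
qed

locale cstar_seminormed = star_alg +
 fixes q :: "'a => real"
 assumes seminorm: "cstar_seminorm A q"
begin

lemma q_nonneg [simp]: "a \<in> carrier A ==> 0 \<le> q a"
 and q_cscale: "a \<in> carrier A ==> q (cscale A c a) = cmod c * q a"
 and q_add: "[|a \<in> carrier A; b \<in> carrier A|] ==> q (a \<oplus> b) \<le> q a + q b"
 and q_mult: "[|a \<in> carrier A; b \<in> carrier A|] ==> q (a \<otimes> b) \<le> q a * q b"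
 and q_cstar: "a \<in> carrier A ==> q (adj A a \<otimes> a) = (q a)\<^sup>2"
 using seminorm by (auto simp: cstar_seminorm_def)

lemma q_zero [simp]: "q \<zero> = 0"
 using q_cscale[of \<zero> 0] by simp

lemma q_minus: "a \<in> carrier A ==> q (\<ominus> a) = q a"
 by (simp add: q_cscale flip: cscale_m1)

lemma q_diff_swap: "[|a \<in> carrier A; b \<in> carrier A|] ==> q (a \<ominus> b) = q (b \<ominus> a)"
 by (metis diff_swap minus_closed q_minus)

lemma q_triangle:
 "[|a \<in> carrier A; b \<in> carrier A; c \<in> carrier A|] ==> q (a \<ominus> c) \<le> q (a \<ominus> b) + q (b \<ominus> c)"
 by (metis diff_telescope minus_closed q_add)

lemma q_le_diff: "[|a \<in> carrier A; b \<in> carrier A|] ==> q a \<le> q (a \<ominus> b) + q b"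
 using q_triangle[of a b \<zero>] by simp

lemma q_abs_diff: "[|a \<in> carrier A; b \<in> carrier A|] ==> \<bar>q a - q b\<bar> \<le> q (a \<ominus> b)"
 using q_le_diff[of a b] q_le_diff[of b a] q_diff_swap[of a b] by auto

text \<open>By the C*-identity the square of \<open>q b\<close> is at most
  \<open>q (adj A b) * q b\<close>. Cancelling \<open>q b\<close> gives one inequality, and the same
  argument for the adjoint gives the other.\<close>

lemma q_adj [simp]:
 assumes a: "a \<in> carrier A"
 shows "q (adj A a) = q a"
proof -
 have *: "q b \<le> q (adj A b)" if b: "b \<in> carrier A" for b
 proof (cases "q b = 0")
  case False
  then have "q b * q b \<le> q (adj A b) * q b"
   using q_mult[of "adj A b" b] q_cstar[OF b] b by (simp add: power2_eq_square)
  then show ?thesis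
   using False q_nonneg[OF b] mult_le_cancel_right_pos[of "q b"] by simp
 qed (use b in simp)
 show ?thesis
  using *[OF a] *[of "adj A a"] a by simp
qed

text \<open>The zero seminorm counts as a C*-seminorm, so the unit may have seminorm 0.\<close>

lemma q_one_cases: "q \<one> = 0 \<or> q \<one> = 1"
 using q_cstar[of \<one>] by (simp add: power2_eq_square)

lemma q_one_le: "q \<one> \<le> 1"
 using q_one_cases by auto

text \<open>This bound holds without completeness; automatic contractivity is derived from
  it.\<close>

lemma q_isometry_le: "[|u \<in> carrier A; adj A u \<otimes> u = \<one>|] ==> q u \<le> 1"
 using q_cstar[of u] q_one_le by (simp add: power_le_one_iff)

text \<open>Purely algebraic. Closedness comes from contractivity, in
  \<open>kernel_closed_ideal\<close>.\<close>

lemma kernel_ideal: "ideal {a \<in> carrier A. q a = 0} A"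
proof -
 have le: "q (a \<otimes> b) = 0" if "a \<in> carrier A" "b \<in> carrier A" "q a = 0 \<or> q b = 0" for a b
  using q_mult[of a b] q_nonneg[of "a \<otimes> b"] that by fastforce
 have "subgroup {a \<in> carrier A. q a = 0} (add_monoid A)"
 proof (rule add.subgroupI)
  show "a \<oplus> b \<in> {a \<in> carrier A. q a = 0}"
   if "a \<in> {a \<in> carrier A. q a = 0}" "b \<in> {a \<in> carrier A. q a = 0}" for a b
   using that q_add[of a b] q_nonneg[of "a \<oplus> b"] by (auto intro: antisym)
  show "\<ominus> a \<in> {a \<in> carrier A. q a = 0}" if "a \<in> {a \<in> carrier A. q a = 0}" for a
   using that q_minus[of a] by auto
  show "{a \<in> carrier A. q a = 0} \<noteq> {}"
   using q_zero by blast
 qed auto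
 then show ?thesis
  by (intro idealI local.ring_axioms) (auto simp: le)
qed

end

lemma cstar_seminormI:
 assumes "!!a. a \<in> carrier A ==> 0 \<le> q a"
  "!!a c. a \<in> carrier A ==> q (cscale A c a) = cmod c * q a"
  "!!a b. [|a \<in> carrier A; b \<in> carrier A|] ==> q (a \<oplus>\<^bsub>A\<^esub> b) \<le> q a + q b"
  "!!a b. [|a \<in> carrier A; b \<in> carrier A|] ==> q (a \<otimes>\<^bsub>A\<^esub> b) \<le> q a * q b"
  "!!a. a \<in> carrier A ==> q (adj A a \<otimes>\<^bsub>A\<^esub> a) = (q a)\<^sup>2"
 shows "cstar_seminorm A q"
 using assms by (simp add: cstar_seminorm_def)

lemma cstar_seminorm_pullback:
 assumes "star_alg A" and h: "h \<in> star_hom A B" and p: "cstar_seminorm B p"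
 shows "cstar_seminorm A (\<lambda>a. p (h a))"
 unfolding cstar_seminorm_def
proof (intro ballI conjI allI)
 fix a assume a: "a \<in> carrier A"
 note ha = star_hom_closed[OF h a]
 show "0 \<le> p (h a)"
  using p ha by (simp add: cstar_seminorm_def)
 show "p (h (cscale A c a)) = cmod c * p (h a)" for c
  using p ha by (simp add: cstar_seminorm_def star_hom_cscale[OF h a])
 show "p (h (a \<oplus>\<^bsub>A\<^esub> b)) \<le> p (h a) + p (h b)" "p (h (a \<otimes>\<^bsub>A\<^esub> b)) \<le> p (h a) * p (h b)" if "b \<in> carrier A" for b
  using p ha star_hom_closed[OF h that]
  by (simp_all add: cstar_seminorm_def star_hom_add[OF h a that] star_hom_mult[OF h a that])
 have "h (adj A a \<otimes>\<^bsub>A\<^esub> a) = adj B (h a) \<otimes>\<^bsub>B\<^esub> h a"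
  using star_alg.adj_closed[OF assms(1) a] by (simp add: star_hom_mult[OF h _ a] star_hom_adj[OF h a])
 then show "p (h (adj A a \<otimes>\<^bsub>A\<^esub> a)) = (p (h a))\<^sup>2"
  using p ha by (simp add: cstar_seminorm_def)
qed



section \<open>Completions\<close>

definition cauchy_class :: "('a, 'm) star_ring_scheme => ('a => real) => (nat => 'a) => (nat => 'a) set" where
 "cauchy_class A q s = null_rel A q `` {s}"

text \<open>The operations of \<open>completion\<close> are unions over all representatives;
  well-definedness means that every set in such a union is the same.\<close>

lemma UN_eq_const: "[|x \<in> S; !!y. y \<in> S ==> g y = C|] ==> (\<Union>y\<in>S. g y) = C"
 by auto

context cstar_seminormed
begin

abbreviation "CS \<equiv> cauchy_seqs A q"
abbreviation "R \<equiv> null_rel A q"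
abbreviation "cls \<equiv> cauchy_class A q"
abbreviation "Co \<equiv> completion A q"

lemma CS_carrier: "s \<in> CS ==> s n \<in> carrier A"
 by (auto simp: cauchy_seqs_def)

lemma CS_I:
 assumes "!!n. s n \<in> carrier A" "!!e. e > 0 ==> \<exists>N. \<forall>m\<ge>N. \<forall>n\<ge>N. q (s m \<ominus> s n) < e"
 shows "s \<in> CS"
 using assms by (auto simp: cauchy_seqs_def)

lemma CS_cauchy_D: "[|s \<in> CS; e > 0|] ==> \<exists>N. \<forall>m\<ge>N. \<forall>n\<ge>N. q (s m \<ominus> s n) < e"
 by (auto simp: cauchy_seqs_def)

lemma CS_const [simp]: "a \<in> carrier A ==> (\<lambda>_. a) \<in> CS"
 by (auto simp: cauchy_seqs_def)

lemma CS_dominated: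
 assumes s: "s \<in> CS" and t: "!!n. t n \<in> carrier A"
  and le: "!!m n. q (t m \<ominus> t n) \<le> K * q (s m \<ominus> s n)"
 shows "t \<in> CS"
proof (rule CS_I)
 fix e :: real assume "e > 0"
 \<comment> \<open>Adding 1 keeps the divisor positive even when \<open>K\<close> is 0.\<close>
 then have "e / (\<bar>K\<bar> + 1) > 0" by simp
 from CS_cauchy_D[OF s this] obtain N where N: "\<forall>m\<ge>N. \<forall>n\<ge>N. q (s m \<ominus> s n) < e / (\<bar>K\<bar> + 1)"
  by blast
 have "q (t m \<ominus> t n) < e" if "m \<ge> N" "n \<ge> N" for m n
 proof -
  have "K * q (s m \<ominus> s n) \<le> (\<bar>K\<bar> + 1) * q (s m \<ominus> s n)"
   using CS_carrier[OF s] by (intro mult_right_mono) auto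
  also have "\<dots> < e"
   using N that by (simp add: field_simps)
  finally show ?thesis using le[of m n] by simp
 qed
 then show "\<exists>N. \<forall>m\<ge>N. \<forall>n\<ge>N. q (t m \<ominus> t n) < e" by blast
qed (fact t)

lemma CS_add:
 assumes s: "s \<in> CS" and t: "t \<in> CS" shows "(\<lambda>n. s n \<oplus> t n) \<in> CS"
proof (rule CS_I)
 fix e :: real assume "e > 0"
 then have e: "e / 2 > 0" by simp
 obtain N where N: "\<forall>m\<ge>N. \<forall>n\<ge>N. q (s m \<ominus> s n) < e / 2" using CS_cauchy_D[OF s e] by blast
 obtain M where M: "\<forall>m\<ge>M. \<forall>n\<ge>M. q (t m \<ominus> t n) < e / 2" using CS_cauchy_D[OF t e] by blast
 have "q ((s m \<oplus> t m) \<ominus> (s n \<oplus> t n)) < e" if "m \<ge> max N M" "n \<ge> max N M" for m n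
 proof -
  have "q (s m \<ominus> s n) < e / 2" "q (t m \<ominus> t n) < e / 2" using N M that by auto
  moreover have "q ((s m \<ominus> s n) \<oplus> (t m \<ominus> t n)) \<le> q (s m \<ominus> s n) + q (t m \<ominus> t n)"
   using CS_carrier[OF s] CS_carrier[OF t] by (intro q_add) auto
  ultimately show ?thesis
   using CS_carrier[OF s] CS_carrier[OF t] by (simp add: add_diff_add)
 qed
 then show "\<exists>N. \<forall>m\<ge>N. \<forall>n\<ge>N. q ((s m \<oplus> t m) \<ominus> (s n \<oplus> t n)) < e" by blast
qed (use CS_carrier[OF s] CS_carrier[OF t] in auto)

lemma CS_cscale:
 assumes s: "s \<in> CS" shows "(\<lambda>n. cscale A c (s n)) \<in> CS"
 by (rule CS_dominated[OF s, of _ "cmod c"])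
   (use CS_carrier[OF s] in \<open>auto simp: q_cscale simp flip: cscale_diff_right\<close>)

lemma CS_minus: "s \<in> CS ==> (\<lambda>n. \<ominus> s n) \<in> CS"
 using CS_cscale[of s "-1"] by (simp add: CS_carrier cscale_m1)

lemma CS_adj:
 assumes s: "s \<in> CS" shows "(\<lambda>n. adj A (s n)) \<in> CS"
 by (rule CS_dominated[OF s, of _ 1])
   (use CS_carrier[OF s] in \<open>auto simp flip: adj_diff\<close>)

lemma CS_q_convergent:
 assumes s: "s \<in> CS" shows "convergent (\<lambda>n. q (s n))"
proof -
 have "Cauchy (\<lambda>n. q (s n))"
 proof (rule metric_CauchyI)
  fix e :: real assume "e > 0"
  then obtain N where "\<forall>m\<ge>N. \<forall>n\<ge>N. q (s m \<ominus> s n) < e" using CS_cauchy_D[OF s] by blast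
  then show "\<exists>N. \<forall>m\<ge>N. \<forall>n\<ge>N. dist (q (s m)) (q (s n)) < e"
   using q_abs_diff CS_carrier[OF s] unfolding dist_real_def by (meson le_less_trans)
 qed
 then show ?thesis by (simp add: Cauchy_convergent_iff)
qed

lemma CS_bounded:
 assumes s: "s \<in> CS" obtains K where "K > 0" "!!n. q (s n) \<le> K"
proof -
 have "Bseq (\<lambda>n. q (s n))" using CS_q_convergent[OF s] by (rule convergent_imp_Bseq)
 then obtain K where "K > 0" "!!n. norm (q (s n)) \<le> K" by (auto simp: Bseq_def)
 then show thesis using that[of K] by (metis abs_le_D1 real_norm_def)
qed

lemma CS_mult:
 assumes s: "s \<in> CS" and t: "t \<in> CS" shows "(\<lambda>n. s n \<otimes> t n) \<in> CS"
proof (rule CS_I)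
 obtain K where K: "K > 0" "!!n. q (s n) \<le> K" using CS_bounded[OF s] by blast 
 obtain L where L: "L > 0" "!!n. q (t n) \<le> L" using CS_bounded[OF t] by blast 
 note c = CS_carrier[OF s] CS_carrier[OF t]
 fix e :: real assume e: "e > 0"
 obtain N where N: "\<forall>m\<ge>N. \<forall>n\<ge>N. q (s m \<ominus> s n) < e / (2 * L)" using CS_cauchy_D[OF s, of "e / (2 * L)"] e L by auto
 obtain M where M: "\<forall>m\<ge>M. \<forall>n\<ge>M. q (t m \<ominus> t n) < e / (2 * K)" using CS_cauchy_D[OF t, of "e / (2 * K)"] e K by auto
 have "q ((s m \<otimes> t m) \<ominus> (s n \<otimes> t n)) < e" if "m \<ge> max N M" "n \<ge> max N M" for m n
 proof -
  have "q ((s m \<otimes> t m) \<ominus> (s n \<otimes> t n)) \<le> q ((s m \<ominus> s n) \<otimes> t m) + q (s n \<otimes> (t m \<ominus> t n))"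
   using c by (subst mult_diff_mult) (auto intro!: q_add)
  also have "\<dots> \<le> q (s m \<ominus> s n) * q (t m) + q (s n) * q (t m \<ominus> t n)"
   using c by (intro add_mono q_mult) auto
  also have "\<dots> \<le> q (s m \<ominus> s n) * L + K * q (t m \<ominus> t n)"
   using c K L by (intro add_mono mult_left_mono mult_right_mono) auto
  also have "\<dots> < e / (2 * L) * L + K * (e / (2 * K))"
   using K(1) L(1) N M that by (intro add_strict_mono mult_strict_left_mono mult_strict_right_mono) auto
  also have "\<dots> = e" using K(1) L(1) by simp
  finally show ?thesis .
 qed
 then show "\<exists>N. \<forall>m\<ge>N. \<forall>n\<ge>N. q ((s m \<otimes> t m) \<ominus> (s n \<otimes> t n)) < e" by blast
qed (use CS_carrier[OF s] CS_carrier[OF t] in auto)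

lemma R_iff: "(s, t) \<in> R \<longleftrightarrow> s \<in> CS \<and> t \<in> CS \<and> (\<lambda>n. q (s n \<ominus> t n)) \<longlonglongrightarrow> 0"
 by (simp add: null_rel_def)

lemma q_tendsto_0_le:
 assumes "!!n. t n \<in> carrier A" "!!n. q (t n) \<le> f n" "f \<longlonglongrightarrow> 0"
 shows "(\<lambda>n. q (t n)) \<longlonglongrightarrow> 0"
 by (rule tendsto_sandwich[OF _ _ tendsto_const assms(3)]) (use assms(1,2) in auto)

lemma equiv_R: "equiv CS R"
proof (rule equivI)
 show "R \<subseteq> CS \<times> CS" by (auto simp: R_iff)
 show "refl_on CS R" by (rule refl_onI) (auto simp: R_iff CS_carrier)
 show "sym R" by (rule symI) (auto simp: R_iff CS_carrier q_diff_swap)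
 show "trans R"
 proof (rule transI)
  fix s t u assume a: "(s, t) \<in> R" "(t, u) \<in> R"
  then have c: "s \<in> CS" "t \<in> CS" "u \<in> CS" by (auto simp: R_iff)
  have "(\<lambda>n. q (s n \<ominus> t n) + q (t n \<ominus> u n)) \<longlonglongrightarrow> 0 + 0"
   using a by (intro tendsto_add) (auto simp: R_iff)
  then have "(\<lambda>n. q (s n \<ominus> u n)) \<longlonglongrightarrow> 0"
   by (intro q_tendsto_0_le[where f = "\<lambda>n. q (s n \<ominus> t n) + q (t n \<ominus> u n)"] q_triangle) (use c in \<open>auto simp: CS_carrier\<close>)
  then show "(s, u) \<in> R" using c by (simp add: R_iff)
 qed
qed

lemma cls_eq_iff: "[|s \<in> CS; t \<in> CS|] ==> cls s = cls t \<longleftrightarrow> (\<lambda>n. q (s n \<ominus> t n)) \<longlonglongrightarrow> 0"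
 using eq_equiv_class_iff[OF equiv_R] by (simp add: R_iff cauchy_class_def)

lemma mem_cls: "s' \<in> cls s \<longleftrightarrow> (s, s') \<in> R"
 by (simp add: cauchy_class_def)

lemma self_cls: "s \<in> CS ==> s \<in> cls s"
 by (simp add: mem_cls R_iff CS_carrier)

lemma carrier_Co: "carrier Co = CS // R"
 by (simp add: completion_def)

lemma cls_carrier [simp]: "s \<in> CS ==> cls s \<in> carrier Co"
 by (simp add: carrier_Co cauchy_class_def quotientI)

lemma carrier_CoE: assumes "X \<in> carrier Co" obtains s where "s \<in> CS" "X = cls s"
 using assms unfolding carrier_Co cauchy_class_def by (auto elim: quotientE)

lemma UN_cls1:
 assumes "s \<in> CS" "!!s'. (s, s') \<in> R ==> (f s, f s') \<in> R"
 shows "(\<Union>s'\<in>cls s. cls (f s')) = cls (f s)"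
proof -
 have "cls (f s') = cls (f s)" if "s' \<in> cls s" for s'
  using assms(2)[of s'] that equiv_class_eq_iff[OF equiv_R] by (simp add: mem_cls cauchy_class_def)
 then show ?thesis by (rule UN_eq_const[OF self_cls[OF assms(1)]])
qed

lemma UN_cls2:
 assumes "s \<in> CS" "t \<in> CS" "!!s' t'. [|(s, s') \<in> R; (t, t') \<in> R|] ==> (f s t, f s' t') \<in> R"
 shows "(\<Union>s'\<in>cls s. \<Union>t'\<in>cls t. cls (f s' t')) = cls (f s t)"
proof -
 have "cls (f s' t') = cls (f s t)" if "s' \<in> cls s" "t' \<in> cls t" for s' t'
  using assms(3)[of s' t'] that equiv_class_eq_iff[OF equiv_R] by (simp add: mem_cls cauchy_class_def)
 then show ?thesis
  by (intro UN_eq_const[OF self_cls[OF assms(1)]] UN_eq_const[OF self_cls[OF assms(2)]])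
qed

lemma R_add: "[|(s, s') \<in> R; (t, t') \<in> R|] ==> ((\<lambda>n. s n \<oplus> t n), (\<lambda>n. s' n \<oplus> t' n)) \<in> R"
proof -
 assume a: "(s, s') \<in> R" "(t, t') \<in> R"
 then have c: "s \<in> CS" "t \<in> CS" "s' \<in> CS" "t' \<in> CS" by (auto simp: R_iff)
 have "(\<lambda>n. q (s n \<ominus> s' n) + q (t n \<ominus> t' n)) \<longlonglongrightarrow> 0 + 0"
  using a by (intro tendsto_add) (auto simp: R_iff)
 then have "(\<lambda>n. q ((s n \<oplus> t n) \<ominus> (s' n \<oplus> t' n))) \<longlonglongrightarrow> 0"
  by (intro q_tendsto_0_le[where f = "\<lambda>n. q (s n \<ominus> s' n) + q (t n \<ominus> t' n)"])
    (use c in \<open>auto simp: CS_carrier add_diff_add q_add\<close>)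
 then show ?thesis using c by (simp add: R_iff CS_add)
qed

lemma R_mult: "[|(s, s') \<in> R; (t, t') \<in> R|] ==> ((\<lambda>n. s n \<otimes> t n), (\<lambda>n. s' n \<otimes> t' n)) \<in> R"
proof -
 assume a: "(s, s') \<in> R" "(t, t') \<in> R"
 then have c: "s \<in> CS" "t \<in> CS" "s' \<in> CS" "t' \<in> CS" by (auto simp: R_iff)
 note cc = c[THEN CS_carrier]
 obtain K where K: "K > 0" "!!n. q (s' n) \<le> K" using CS_bounded[OF c(3)] by blast 
 obtain L where L: "L > 0" "!!n. q (t n) \<le> L" using CS_bounded[OF c(2)] by blast 
 have "(\<lambda>n. q (s n \<ominus> s' n) * L + K * q (t n \<ominus> t' n)) \<longlonglongrightarrow> 0 * L + K * 0"
  using a by (intro tendsto_add tendsto_mult tendsto_const) (auto simp: R_iff)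
 moreover have "q ((s n \<otimes> t n) \<ominus> (s' n \<otimes> t' n)) \<le> q (s n \<ominus> s' n) * L + K * q (t n \<ominus> t' n)" for n
 proof -
  have "q ((s n \<otimes> t n) \<ominus> (s' n \<otimes> t' n)) \<le> q ((s n \<ominus> s' n) \<otimes> t n) + q (s' n \<otimes> (t n \<ominus> t' n))"
   using cc by (subst mult_diff_mult) (auto intro!: q_add)
  also have "\<dots> \<le> q (s n \<ominus> s' n) * q (t n) + q (s' n) * q (t n \<ominus> t' n)"
   using cc by (intro add_mono q_mult) auto
  also have "\<dots> \<le> q (s n \<ominus> s' n) * L + K * q (t n \<ominus> t' n)"
   using cc K L by (intro add_mono mult_left_mono mult_right_mono) auto
  finally show ?thesis .
 qed
 ultimately have "(\<lambda>n. q ((s n \<otimes> t n) \<ominus> (s' n \<otimes> t' n))) \<longlonglongrightarrow> 0"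
  by (intro q_tendsto_0_le[where f = "\<lambda>n. q (s n \<ominus> s' n) * L + K * q (t n \<ominus> t' n)"])
    (use cc in auto)
 then show ?thesis using c by (simp add: R_iff CS_mult)
qed

lemma R_cscale: "(s, s') \<in> R ==> ((\<lambda>n. cscale A c (s n)), (\<lambda>n. cscale A c (s' n))) \<in> R"
proof -
 assume a: "(s, s') \<in> R"
 then have c: "s \<in> CS" "s' \<in> CS" by (auto simp: R_iff)
 have "(\<lambda>n. cmod c * q (s n \<ominus> s' n)) \<longlonglongrightarrow> cmod c * 0"
  using a by (intro tendsto_mult tendsto_const) (auto simp: R_iff)
 then show ?thesis
  using c by (simp add: R_iff CS_cscale CS_carrier q_cscale flip: cscale_diff_right)
qed

lemma R_adj: "(s, s') \<in> R ==> ((\<lambda>n. adj A (s n)), (\<lambda>n. adj A (s' n))) \<in> R"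
 by (simp add: R_iff CS_adj CS_carrier flip: adj_diff)

lemma Co_simps:
 shows Co_mult: "[|s \<in> CS; t \<in> CS|] ==> cls s \<otimes>\<^bsub>Co\<^esub> cls t = cls (\<lambda>n. s n \<otimes> t n)"
  and Co_add: "[|s \<in> CS; t \<in> CS|] ==> cls s \<oplus>\<^bsub>Co\<^esub> cls t = cls (\<lambda>n. s n \<oplus> t n)"
  and Co_cscale: "s \<in> CS ==> cscale Co c (cls s) = cls (\<lambda>n. cscale A c (s n))"
  and Co_adj: "s \<in> CS ==> adj Co (cls s) = cls (\<lambda>n. adj A (s n))"
  and Co_one: "\<one>\<^bsub>Co\<^esub> = cls (\<lambda>_. \<one>)"
  and Co_zero: "\<zero>\<^bsub>Co\<^esub> = cls (\<lambda>_. \<zero>)"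
 unfolding completion_def completion_incl_def cauchy_class_def[symmetric]
 by (simp_all add: UN_cls2[where f = "\<lambda>s t n. s n \<otimes> t n"] R_mult UN_cls2[where f = "\<lambda>s t n. s n \<oplus> t n"] R_add
   UN_cls1[where f = "\<lambda>s n. cscale A c (s n)"] R_cscale UN_cls1[where f = "\<lambda>s n. adj A (s n)"] R_adj)

text \<open>The \<open>THE\<close> in \<open>nrm\<close> denotes something because Cauchy sequences
  have convergent seminorms and equivalent sequences have the same limit.\<close>

lemma nrm_cls:
 assumes s: "s \<in> CS" shows "(\<lambda>n. q (s n)) \<longlonglongrightarrow> nrm Co (cls s)"
proof -
 obtain r where r: "(\<lambda>n. q (s n)) \<longlonglongrightarrow> r" using CS_q_convergent[OF s] by (auto simp: convergent_def)
 have *: "(\<lambda>n. q (t n)) \<longlonglongrightarrow> r" if "t \<in> cls s" for t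
 proof -
  have t: "t \<in> CS" "(\<lambda>n. q (s n \<ominus> t n)) \<longlonglongrightarrow> 0" using that by (auto simp: R_iff mem_cls)
  have "(\<lambda>n. q (t n) - q (s n)) \<longlonglongrightarrow> 0"
   by (rule tendsto_0_le[OF t(2), of _ 1])
     (use q_abs_diff s t CS_carrier in \<open>auto simp: abs_minus_commute\<close>)
  from tendsto_add[OF this r] show ?thesis by simp
 qed
 have "nrm Co (cls s) = r"
  unfolding completion_def using * self_cls[OF s] LIMSEQ_unique
  by (simp, intro the_equality) blast+
 then show ?thesis using r by simp
qed

lemma Co_star_alg: "star_alg Co"
proof (rule star_algI)
 show "ring Co"
 proof (rule ring_axiomsI)
  fix X assume "X \<in> carrier Co"
  then obtain s where "s \<in> CS" "X = cls s" by (rule carrier_CoE)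
  then show "\<exists>Y\<in>carrier Co. Y \<oplus>\<^bsub>Co\<^esub> X = \<zero>\<^bsub>Co\<^esub>"
   by (intro bexI[of _ "cls (\<lambda>n. \<ominus> s n)"])
     (simp_all add: Co_simps CS_minus CS_carrier l_neg)
 next
  show "X \<oplus>\<^bsub>Co\<^esub> Y = Y \<oplus>\<^bsub>Co\<^esub> X" if "X \<in> carrier Co" "Y \<in> carrier Co" for X Y
   using that by (auto elim!: carrier_CoE simp: Co_simps CS_carrier a_comm)
 qed (auto elim!: carrier_CoE simp: Co_simps CS_add CS_mult CS_carrier a_assoc m_assoc l_distr r_distr)
qed (auto elim!: carrier_CoE
   simp: Co_simps CS_add CS_mult CS_cscale CS_adj CS_carrier cscale_add_right cscale_add_left
    mult_cscale_left mult_cscale_right adj_add adj_mult adj_cscale)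

text \<open>The additive inverse is not a field of the record; it is reached through scaling by -1,
  which is computed on representatives.\<close>

lemma Co_diff:
 assumes "s \<in> CS" "t \<in> CS" shows "cls s \<ominus>\<^bsub>Co\<^esub> cls t = cls (\<lambda>n. s n \<ominus> t n)"
proof -
 interpret Co: star_alg Co by (rule Co_star_alg)
 show ?thesis
  using assms by (simp add: a_minus_def Co_simps CS_carrier CS_cscale flip: Co.cscale_m1 cscale_m1)
qed

lemma CS_diff: "[|s \<in> CS; t \<in> CS|] ==> (\<lambda>n. s n \<ominus> t n) \<in> CS"
 using CS_add[OF _ CS_cscale[of t "-1"], of s] by (simp add: a_minus_def CS_carrier cscale_m1)

lemma nrm_nonneg: "s \<in> CS ==> 0 \<le> nrm Co (cls s)"
 by (rule LIMSEQ_le_const[OF nrm_cls]) (auto simp: CS_carrier)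

lemma Co_cstar_seminorm: "cstar_seminorm Co (nrm Co)"
proof (rule cstar_seminormI)
 fix X assume "X \<in> carrier Co"
 then obtain s where X [simp]: "X = cls s" and s: "s \<in> CS" by (auto elim: carrier_CoE)
 note c = CS_carrier[OF s]
 show "0 \<le> nrm Co X"
  using nrm_nonneg[OF s] by simp
 show "nrm Co (cscale Co k X) = cmod k * nrm Co X" for k
  using LIMSEQ_unique[OF nrm_cls[OF CS_cscale[OF s]], of k "cmod k * nrm Co X"]
   tendsto_mult_left[OF nrm_cls[OF s], of "cmod k"] s c
  by (simp add: Co_simps q_cscale)
 show "nrm Co (adj Co X \<otimes>\<^bsub>Co\<^esub> X) = (nrm Co X)\<^sup>2"
  using LIMSEQ_unique[OF nrm_cls[OF CS_mult[OF CS_adj[OF s] s]], of "(nrm Co X)\<^sup>2"]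
   tendsto_power[OF nrm_cls[OF s], of 2] s c
  by (simp add: Co_simps q_cstar CS_adj)
next
 fix X Y assume "X \<in> carrier Co" "Y \<in> carrier Co"
 then obtain s t where XY [simp]: "X = cls s" "Y = cls t" and s: "s \<in> CS" and t: "t \<in> CS"
  by (metis carrier_CoE)
 note c = CS_carrier[OF s] and d = CS_carrier[OF t]
 show "nrm Co (X \<oplus>\<^bsub>Co\<^esub> Y) \<le> nrm Co X + nrm Co Y"
  using LIMSEQ_le[OF nrm_cls[OF CS_add[OF s t]] tendsto_add[OF nrm_cls[OF s] nrm_cls[OF t]]] q_add[OF c d] s t
  by (simp add: Co_simps)
 show "nrm Co (X \<otimes>\<^bsub>Co\<^esub> Y) \<le> nrm Co X * nrm Co Y"
  using LIMSEQ_le[OF nrm_cls[OF CS_mult[OF s t]] tendsto_mult[OF nrm_cls[OF s] nrm_cls[OF t]]] q_mult[OF c d] s t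
  by (simp add: Co_simps)
qed

lemma incl_eq: "completion_incl A q a = cls (\<lambda>_. a)"
 by (simp add: completion_incl_def cauchy_class_def)

lemma incl_carrier [simp]: "a \<in> carrier A ==> completion_incl A q a \<in> carrier Co"
 by (simp add: incl_eq)

lemma incl_star_hom: "completion_incl A q \<in> star_hom A Co"
 by (rule star_homI) (simp_all add: incl_eq Co_simps)

lemma nrm_incl [simp]:
 assumes "a \<in> carrier A" shows "nrm Co (completion_incl A q a) = q a"
 using LIMSEQ_unique[OF nrm_cls[OF CS_const[OF assms]] tendsto_const] by (simp add: incl_eq)

lemma nrm_incl_diff: "[|a \<in> carrier A; b \<in> carrier A|] ==>
  nrm Co (completion_incl A q a \<ominus>\<^bsub>Co\<^esub> completion_incl A q b) = q (a \<ominus> b)"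
 using nrm_incl[of "a \<ominus> b"] by (simp add: incl_eq Co_diff)

lemma nrm_diff_zero_iff:
 assumes "X \<in> carrier Co" "Y \<in> carrier Co"
 shows "nrm Co (X \<ominus>\<^bsub>Co\<^esub> Y) = 0 \<longleftrightarrow> X = Y"
proof -
 obtain s t where st: "s \<in> CS" "X = cls s" "t \<in> CS" "Y = cls t"
  by (meson assms carrier_CoE)
 then have "X = Y \<longleftrightarrow> (\<lambda>n. q (s n \<ominus> t n)) \<longlonglongrightarrow> 0"
  by (simp add: cls_eq_iff)
 moreover have "(\<lambda>n. q (s n \<ominus> t n)) \<longlonglongrightarrow> nrm Co (X \<ominus>\<^bsub>Co\<^esub> Y)"
  using st nrm_cls[OF CS_diff[OF st(1,3)]] by (simp add: Co_diff)
 ultimately show ?thesis by (auto dest: LIMSEQ_unique)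
qed

lemma nrm_diff_incl_le:
 assumes s: "s \<in> CS" and a: "a \<in> carrier A" and le: "!!m. m \<ge> N ==> q (s m \<ominus> a) \<le> e"
 shows "nrm Co (cls s \<ominus>\<^bsub>Co\<^esub> completion_incl A q a) \<le> e"
proof -
 have "(\<lambda>m. q (s m \<ominus> a)) \<longlonglongrightarrow> nrm Co (cls s \<ominus>\<^bsub>Co\<^esub> completion_incl A q a)"
  using nrm_cls[OF CS_diff[OF s CS_const[OF a]]] s a by (simp add: incl_eq Co_diff)
 then show ?thesis by (rule LIMSEQ_le_const2) (use le in auto)
qed

lemma incl_tendsto_cls:
 assumes s: "s \<in> CS"
 shows "(\<lambda>n. nrm Co (cls s \<ominus>\<^bsub>Co\<^esub> completion_incl A q (s n))) \<longlonglongrightarrow> 0"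
proof (rule LIMSEQ_I)
 interpret Co: cstar_seminormed Co "nrm Co"
  by (simp add: cstar_seminormed.intro cstar_seminormed_axioms.intro Co_star_alg Co_cstar_seminorm)
 fix r :: real assume "r > 0"
 then obtain N where N: "\<forall>m\<ge>N. \<forall>n\<ge>N. q (s m \<ominus> s n) < r / 2" using CS_cauchy_D[OF s, of "r / 2"] by auto
 have "nrm Co (cls s \<ominus>\<^bsub>Co\<^esub> completion_incl A q (s n)) \<le> r / 2" if "n \<ge> N" for n
  by (rule nrm_diff_incl_le[OF s CS_carrier[OF s], of N]) (use N that in \<open>auto intro: less_imp_le\<close>)
 then have "norm (nrm Co (cls s \<ominus>\<^bsub>Co\<^esub> completion_incl A q (s n)) - 0) < r" if "n \<ge> N" for n
  using that \<open>r > 0\<close> Co.q_nonneg[of "cls s \<ominus>\<^bsub>Co\<^esub> completion_incl A q (s n)"] CS_carrier[OF s] s by fastforce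
 then show "\<exists>N. \<forall>n\<ge>N. norm (nrm Co (cls s \<ominus>\<^bsub>Co\<^esub> completion_incl A q (s n)) - 0) < r" by blast
qed

lemma incl_dense:
 assumes "X \<in> carrier Co" "e > 0"
 obtains a where "a \<in> carrier A" "nrm Co (X \<ominus>\<^bsub>Co\<^esub> completion_incl A q a) < e"
proof -
 obtain s where s: "s \<in> CS" "X = cls s" using assms(1) by (rule carrier_CoE)
 have "eventually (\<lambda>n. nrm Co (cls s \<ominus>\<^bsub>Co\<^esub> completion_incl A q (s n)) < e) sequentially"
  using incl_tendsto_cls[OF s(1)] assms(2) by (rule order_tendstoD)
 then obtain n where "nrm Co (cls s \<ominus>\<^bsub>Co\<^esub> completion_incl A q (s n)) < e"
  by (auto simp: eventually_sequentially)
 then show thesis using that[of "s n"] s CS_carrier by auto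
qed

end

locale cstar_algebra = cstar_seminormed A "nrm A" for A :: "('a, 'm) normed_star_ring_scheme" (structure) +
 assumes nrm_eq_0: "[|a \<in> carrier A; nrm A a = 0|] ==> a = \<zero>"
  and complete: "s \<in> cauchy_seqs A (nrm A) ==> \<exists>a\<in>carrier A. (\<lambda>n. nrm A (s n \<ominus> a)) \<longlonglongrightarrow> 0"

text \<open>Completeness by diagonal choice: replace the n-th term by an element \<open>a n\<close>
  of the original algebra at distance less than 1/(n+1). Then \<open>a\<close> is Cauchy and its
  class is the limit.\<close>

lemma (in cstar_seminormed) Co_cstar_algebra: "cstar_algebra Co"
proof -
 interpret Co: cstar_seminormed Co "nrm Co"
  by (simp add: cstar_seminormed.intro cstar_seminormed_axioms.intro Co_star_alg Co_cstar_seminorm)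
 show ?thesis
 proof
  fix X assume "X \<in> carrier Co" "nrm Co X = 0"
  then show "X = \<zero>\<^bsub>Co\<^esub>" using nrm_diff_zero_iff[of X "\<zero>\<^bsub>Co\<^esub>"] by simp
 next
  fix s assume s: "s \<in> cauchy_seqs Co (nrm Co)"
  have "\<exists>a. a \<in> carrier A \<and> nrm Co (s n \<ominus>\<^bsub>Co\<^esub> completion_incl A q a) < inverse (real (Suc n))" for n
   using incl_dense[OF Co.CS_carrier[OF s, of n], of "inverse (real (Suc n))"] by auto
  then obtain a where a: "!!n. a n \<in> carrier A"
   and near: "!!n. nrm Co (s n \<ominus>\<^bsub>Co\<^esub> completion_incl A q (a n)) < inverse (real (Suc n))"
   by metis
  note sc = Co.CS_carrier[OF s]
  have aCS: "a \<in> CS"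
  proof (rule CS_I[OF a])
   fix e :: real assume "e > 0"
   then have e: "e / 3 > 0" by simp
   obtain N where N: "\<forall>m\<ge>N. \<forall>n\<ge>N. nrm Co (s m \<ominus>\<^bsub>Co\<^esub> s n) < e / 3" using Co.CS_cauchy_D[OF s e] by blast
   obtain M where M: "inverse (real (Suc M)) < e / 3" using reals_Archimedean[OF e] by blast
   have "q (a m \<ominus> a n) < e" if "m \<ge> max N M" "n \<ge> max N M" for m n
   proof -
    have le: "inverse (real (Suc k)) \<le> inverse (real (Suc M))" if "k \<ge> M" for k
     using that by (simp add: field_simps)
    let ?i = "completion_incl A q"
    have mn: "m \<ge> M" "n \<ge> M" and Nmn: "nrm Co (s m \<ominus>\<^bsub>Co\<^esub> s n) < e / 3" using that N by auto
    have "q (a m \<ominus> a n) = nrm Co (?i (a m) \<ominus>\<^bsub>Co\<^esub> ?i (a n))" by (simp add: nrm_incl_diff a)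
    also have "\<dots> \<le> nrm Co (?i (a m) \<ominus>\<^bsub>Co\<^esub> s m) + nrm Co (s m \<ominus>\<^bsub>Co\<^esub> ?i (a n))"
     by (rule Co.q_triangle) (auto simp: a sc)
    also have "nrm Co (s m \<ominus>\<^bsub>Co\<^esub> ?i (a n)) \<le> nrm Co (s m \<ominus>\<^bsub>Co\<^esub> s n) + nrm Co (s n \<ominus>\<^bsub>Co\<^esub> ?i (a n))"
     by (rule Co.q_triangle) (auto simp: a sc)
    also have "nrm Co (?i (a m) \<ominus>\<^bsub>Co\<^esub> s m) = nrm Co (s m \<ominus>\<^bsub>Co\<^esub> ?i (a m))"
     by (rule Co.q_diff_swap) (auto simp: a sc)
    finally show ?thesis
     using near[of m] near[of n] le[of m] le[of n] M Nmn mn by linarith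
   qed
   then show "\<exists>N. \<forall>m\<ge>N. \<forall>n\<ge>N. q (a m \<ominus> a n) < e" by blast
  qed
  have "(\<lambda>n. inverse (real (Suc n)) + nrm Co (cls a \<ominus>\<^bsub>Co\<^esub> completion_incl A q (a n))) \<longlonglongrightarrow> 0 + 0"
   by (intro tendsto_add LIMSEQ_inverse_real_of_nat incl_tendsto_cls[OF aCS])
  moreover have "nrm Co (s n \<ominus>\<^bsub>Co\<^esub> cls a) \<le> inverse (real (Suc n)) + nrm Co (cls a \<ominus>\<^bsub>Co\<^esub> completion_incl A q (a n))" for n
   using Co.q_triangle[of "s n" "completion_incl A q (a n)" "cls a"] near[of n]
    Co.q_diff_swap[of "cls a" "completion_incl A q (a n)"] a aCS sc by simp
  ultimately have "(\<lambda>n. nrm Co (s n \<ominus>\<^bsub>Co\<^esub> cls a)) \<longlonglongrightarrow> 0"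
   by (intro Co.q_tendsto_0_le[where f = "\<lambda>n. inverse (real (Suc n)) + nrm Co (cls a \<ominus>\<^bsub>Co\<^esub> completion_incl A q (a n))"])
     (auto simp: sc aCS)
  then show "\<exists>X\<in>carrier Co. (\<lambda>n. nrm Co (s n \<ominus>\<^bsub>Co\<^esub> X)) \<longlonglongrightarrow> 0"
   using aCS by (intro bexI[of _ "cls a"]) auto
 qed
qed

definition induced_map ::
 "('b, 'n) star_ring_scheme => ('b => real) => ('a => 'b) => (nat => 'a) set => (nat => 'b) set" where
 "induced_map B p h X = (\<Union>s\<in>X. cauchy_class B p (h \<circ> s))"

text \<open>Makes \<open>full_to_reduced\<close> an instance of the extension of contractive
  homomorphisms, with the identity as homomorphism.\<close>

lemma completion_map_eq: "completion_map A p = induced_map A p id"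
 by (auto simp: fun_eq_iff completion_map_def induced_map_def cauchy_class_def)

locale seminormed_hom = A: cstar_seminormed A q + B: cstar_seminormed B p
 for A :: "('a, 'm) star_ring_scheme" and q and B :: "('b, 'n) star_ring_scheme" and p +
 fixes h
 assumes hom: "h \<in> star_hom A B" and le: "a \<in> carrier A ==> p (h a) \<le> q a"
begin

lemma h_closed [simp]: "a \<in> carrier A ==> h a \<in> carrier B"
 using hom by (rule star_hom_closed)

lemma h_diff: "[|a \<in> carrier A; b \<in> carrier A|] ==> h (a \<ominus>\<^bsub>A\<^esub> b) = h a \<ominus>\<^bsub>B\<^esub> h b"
 by (rule star_hom_diff[OF hom A.star_alg_axioms B.star_alg_axioms])

lemma le_diff: "[|a \<in> carrier A; b \<in> carrier A|] ==> p (h a \<ominus>\<^bsub>B\<^esub> h b) \<le> q (a \<ominus>\<^bsub>A\<^esub> b)"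
 using le[of "a \<ominus>\<^bsub>A\<^esub> b"] by (simp add: h_diff)

lemma map_CS:
 assumes s: "s \<in> A.CS" shows "h \<circ> s \<in> B.CS"
proof (rule B.CS_I)
 fix e :: real assume "e > 0"
 then obtain N where N: "\<forall>m\<ge>N. \<forall>n\<ge>N. q (s m \<ominus>\<^bsub>A\<^esub> s n) < e" using A.CS_cauchy_D[OF s] by blast
 have "p ((h \<circ> s) m \<ominus>\<^bsub>B\<^esub> (h \<circ> s) n) < e" if "m \<ge> N" "n \<ge> N" for m n
  using le_diff[OF A.CS_carrier[OF s] A.CS_carrier[OF s], of m n] N that by (simp add: le_less_trans)
 then show "\<exists>N. \<forall>m\<ge>N. \<forall>n\<ge>N. p ((h \<circ> s) m \<ominus>\<^bsub>B\<^esub> (h \<circ> s) n) < e"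
  by blast
qed (simp add: A.CS_carrier[OF s])

lemma induced_cls:
 assumes s: "s \<in> A.CS"
 shows "induced_map B p h (A.cls s) = B.cls (h \<circ> s)"
 unfolding induced_map_def
proof (rule UN_eq_const[OF A.self_cls[OF s]])
 fix t assume "t \<in> A.cls s"
 then have t: "t \<in> A.CS" "(\<lambda>n. q (s n \<ominus>\<^bsub>A\<^esub> t n)) \<longlonglongrightarrow> 0" by (auto simp: A.mem_cls A.R_iff)
 have "(\<lambda>n. p (h (s n) \<ominus>\<^bsub>B\<^esub> h (t n))) \<longlonglongrightarrow> 0"
  by (rule B.q_tendsto_0_le[OF _ _ t(2)]) (use le_diff s t A.CS_carrier in auto)
 then show "B.cls (h \<circ> t) = B.cls (h \<circ> s)"
  using B.cls_eq_iff[OF map_CS[OF s] map_CS[OF t(1)]] by simp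
qed

lemma induced_incl: "a \<in> carrier A ==> induced_map B p h (completion_incl A q a) = completion_incl B p (h a)"
 by (simp add: A.incl_eq B.incl_eq induced_cls comp_def)

lemma induced_star_hom: "induced_map B p h \<in> star_hom A.Co B.Co"
proof (rule star_homI)
 have [simp]: "(\<lambda>n. h (s n)) \<in> B.CS" if "s \<in> A.CS" for s
  using map_CS[OF that] by (simp add: comp_def)
 show "induced_map B p h \<one>\<^bsub>A.Co\<^esub> = \<one>\<^bsub>B.Co\<^esub>"
  by (simp add: A.Co_one B.Co_one induced_cls comp_def star_hom_one[OF hom])
 fix X assume "X \<in> carrier A.Co"
 then obtain s where X: "X = A.cls s" and s: "s \<in> A.CS" by (auto elim: A.carrier_CoE)
 show "induced_map B p h X \<in> carrier B.Co"
  using X s by (simp add: induced_cls comp_def)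
 show "induced_map B p h (cscale A.Co c X) = cscale B.Co c (induced_map B p h X)" for c
  using X s by (simp add: A.Co_cscale B.Co_cscale induced_cls A.CS_cscale comp_def star_hom_cscale[OF hom] A.CS_carrier)
 show "induced_map B p h (adj A.Co X) = adj B.Co (induced_map B p h X)"
  using X s by (simp add: A.Co_adj B.Co_adj induced_cls A.CS_adj comp_def star_hom_adj[OF hom] A.CS_carrier)
 fix Y assume "Y \<in> carrier A.Co"
 then obtain t where Y: "Y = A.cls t" and t: "t \<in> A.CS" by (auto elim: A.carrier_CoE)
 show "induced_map B p h (X \<oplus>\<^bsub>A.Co\<^esub> Y) = induced_map B p h X \<oplus>\<^bsub>B.Co\<^esub> induced_map B p h Y"
  using X s Y t by (simp add: A.Co_add B.Co_add induced_cls A.CS_add comp_def star_hom_add[OF hom] A.CS_carrier)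
 show "induced_map B p h (X \<otimes>\<^bsub>A.Co\<^esub> Y) = induced_map B p h X \<otimes>\<^bsub>B.Co\<^esub> induced_map B p h Y"
  using X s Y t by (simp add: A.Co_mult B.Co_mult induced_cls A.CS_mult comp_def star_hom_mult[OF hom] A.CS_carrier)
qed

text \<open>Surjectivity: a Cauchy sequence \<open>t\<close> in \<open>B\<close> is replaced by
  images \<open>h (s n)\<close> at distance less than 1/(n+1), and isometry makes \<open>s\<close>
  Cauchy.\<close>

lemma induced_star_iso:
 assumes isometric: "!!a. a \<in> carrier A ==> p (h a) = q a"
  and dense: "!!b e. [|b \<in> carrier B; e > 0|] ==> \<exists>a\<in>carrier A. p (b \<ominus>\<^bsub>B\<^esub> h a) < e"
 shows "induced_map B p h \<in> star_iso A.Co B.Co"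
proof -
 have iso: "p (h a \<ominus>\<^bsub>B\<^esub> h b) = q (a \<ominus>\<^bsub>A\<^esub> b)" if "a \<in> carrier A" "b \<in> carrier A" for a b
  using isometric[of "a \<ominus>\<^bsub>A\<^esub> b"] that by (simp add: h_diff)
 have "inj_on (induced_map B p h) (carrier A.Co)"
 proof (rule inj_onI)
  fix X Y assume "X \<in> carrier A.Co" "Y \<in> carrier A.Co" and eq: "induced_map B p h X = induced_map B p h Y"
  then obtain s t where st: "s \<in> A.CS" "X = A.cls s" "t \<in> A.CS" "Y = A.cls t" by (metis A.carrier_CoE)
  then have "(\<lambda>n. p (h (s n) \<ominus>\<^bsub>B\<^esub> h (t n))) \<longlonglongrightarrow> 0"
   using eq by (simp add: induced_cls map_CS B.cls_eq_iff)
  then show "X = Y" using st by (simp add: A.cls_eq_iff iso A.CS_carrier)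
 qed
 moreover have "induced_map B p h ` carrier A.Co = carrier B.Co"
 proof (intro equalityI subsetI)
  fix Y assume "Y \<in> carrier B.Co"
  then obtain t where t: "t \<in> B.CS" and Y: "Y = B.cls t" by (rule B.carrier_CoE)
  have "\<exists>a\<in>carrier A. p (t n \<ominus>\<^bsub>B\<^esub> h a) < inverse (real (Suc n))" for n
   using dense[OF B.CS_carrier[OF t]] by simp
  then obtain s where s: "!!n. s n \<in> carrier A"
   and near: "!!n. p (t n \<ominus>\<^bsub>B\<^esub> h (s n)) < inverse (real (Suc n))" by metis
  note tc = B.CS_carrier[OF t]
  have lim: "(\<lambda>n. p (t n \<ominus>\<^bsub>B\<^esub> h (s n))) \<longlonglongrightarrow> 0"
   by (rule B.q_tendsto_0_le[OF _ _ LIMSEQ_inverse_real_of_nat]) (use near s tc in \<open>auto intro: less_imp_le\<close>)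
  have "s \<in> A.CS"
  proof (rule A.CS_I[OF s])
   fix e :: real assume "e > 0"
   then have e: "e / 3 > 0" by simp
   obtain N where N: "\<forall>m\<ge>N. \<forall>n\<ge>N. p (t m \<ominus>\<^bsub>B\<^esub> t n) < e / 3" using B.CS_cauchy_D[OF t e] by blast
   obtain M where M: "\<forall>m\<ge>M. p (t m \<ominus>\<^bsub>B\<^esub> h (s m)) < e / 3"
    using order_tendstoD(2)[OF lim e] by (auto simp: eventually_sequentially)
   have "q (s m \<ominus>\<^bsub>A\<^esub> s n) < e" if "m \<ge> max N M" "n \<ge> max N M" for m n
   proof -
    have "q (s m \<ominus>\<^bsub>A\<^esub> s n) = p (h (s m) \<ominus>\<^bsub>B\<^esub> h (s n))" by (simp add: iso s)
    also have "\<dots> \<le> p (h (s m) \<ominus>\<^bsub>B\<^esub> t m) + p (t m \<ominus>\<^bsub>B\<^esub> h (s n))"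
     by (rule B.q_triangle) (auto simp: s tc)
    also have "p (t m \<ominus>\<^bsub>B\<^esub> h (s n)) \<le> p (t m \<ominus>\<^bsub>B\<^esub> t n) + p (t n \<ominus>\<^bsub>B\<^esub> h (s n))"
     by (rule B.q_triangle) (auto simp: s tc)
    also have "p (h (s m) \<ominus>\<^bsub>B\<^esub> t m) = p (t m \<ominus>\<^bsub>B\<^esub> h (s m))"
     by (rule B.q_diff_swap) (auto simp: s tc)
    finally show ?thesis
     using M[rule_format, of m] M[rule_format, of n] N[rule_format, of m n] that by simp
   qed
   then show "\<exists>N. \<forall>m\<ge>N. \<forall>n\<ge>N. q (s m \<ominus>\<^bsub>A\<^esub> s n) < e" by blast
  qed
  then show "Y \<in> induced_map B p h ` carrier A.Co"
   using lim t Y by (intro image_eqI[of _ _ "A.cls s"]) (auto simp: induced_cls B.cls_eq_iff map_CS)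
 qed (use star_hom_closed[OF induced_star_hom] in auto)
 ultimately show ?thesis
  by (simp add: star_iso_def induced_star_hom bij_betw_def)
qed

end



section \<open>Complete C*-algebras\<close>

context cstar_algebra
begin

definition conv :: "(nat => 'a) => 'a => bool" where
 "conv s a \<longleftrightarrow> (\<forall>n. s n \<in> carrier A) \<and> a \<in> carrier A \<and> (\<lambda>n. nrm A (s n \<ominus> a)) \<longlonglongrightarrow> 0"

lemma convD: "conv s a ==> s n \<in> carrier A" "conv s a ==> a \<in> carrier A"
  "conv s a ==> (\<lambda>n. nrm A (s n \<ominus> a)) \<longlonglongrightarrow> 0"
 by (auto simp: conv_def)

lemma conv_const: "a \<in> carrier A ==> conv (\<lambda>_. a) a"
 by (simp add: conv_def)

lemma conv_Suc: "conv s a ==> conv (\<lambda>n. s (Suc n)) a"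
 using LIMSEQ_Suc[of "\<lambda>n. nrm A (s n \<ominus> a)"] by (auto simp: conv_def)

lemma conv_unique:
 assumes "conv s a" "conv s b" shows "a = b"
proof -
 note c = convD[OF assms(1)] convD[OF assms(2)]
 have "(\<lambda>n. nrm A (s n \<ominus> a) + nrm A (s n \<ominus> b)) \<longlonglongrightarrow> 0 + 0"
  using c by (intro tendsto_add) auto
 moreover have "nrm A (a \<ominus> b) \<le> nrm A (s n \<ominus> a) + nrm A (s n \<ominus> b)" for n
  using q_triangle[of a "s n" b] q_diff_swap[of a "s n"] c by simp
 ultimately have "nrm A (a \<ominus> b) \<le> 0"
  by (intro LIMSEQ_le_const) auto
 then show ?thesis
  using nrm_eq_0[of "a \<ominus> b"] q_nonneg[of "a \<ominus> b"] c diff_eq_zero[of a b] by (simp add: antisym)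
qed

lemma conv_add:
 assumes "conv s a" "conv t b" shows "conv (\<lambda>n. s n \<oplus> t n) (a \<oplus> b)"
proof -
 note c = convD[OF assms(1)] convD[OF assms(2)]
 have "(\<lambda>n. nrm A (s n \<ominus> a) + nrm A (t n \<ominus> b)) \<longlonglongrightarrow> 0 + 0"
  using c by (intro tendsto_add) auto
 then have "(\<lambda>n. nrm A ((s n \<oplus> t n) \<ominus> (a \<oplus> b))) \<longlonglongrightarrow> 0"
  by (intro q_tendsto_0_le[where f = "\<lambda>n. nrm A (s n \<ominus> a) + nrm A (t n \<ominus> b)"])
    (use c in \<open>auto simp: add_diff_add q_add\<close>)
 then show ?thesis using c by (simp add: conv_def)
qed

lemma conv_nrm:
 assumes "conv s a" shows "(\<lambda>n. nrm A (s n)) \<longlonglongrightarrow> nrm A a"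
proof -
 note c = convD[OF assms]
 have "(\<lambda>n. nrm A (s n) - nrm A a) \<longlonglongrightarrow> 0"
  by (rule tendsto_0_le[OF c(3), of _ 1]) (use q_abs_diff c in auto)
 then show ?thesis by (simp add: LIM_zero_iff)
qed

lemma conv_mult:
 assumes "conv s a" "conv t b" shows "conv (\<lambda>n. s n \<otimes> t n) (a \<otimes> b)"
proof -
 note c = convD[OF assms(1)] convD[OF assms(2)]
 have "(\<lambda>n. nrm A (s n \<ominus> a) * nrm A (t n) + nrm A a * nrm A (t n \<ominus> b)) \<longlonglongrightarrow> 0 * nrm A b + nrm A a * 0"
  using c conv_nrm[OF assms(2)] by (intro tendsto_add tendsto_mult tendsto_const) auto
 moreover have "nrm A (s n \<otimes> t n \<ominus> a \<otimes> b) \<le> nrm A (s n \<ominus> a) * nrm A (t n) + nrm A a * nrm A (t n \<ominus> b)" for n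
 proof -
  have "nrm A (s n \<otimes> t n \<ominus> a \<otimes> b) \<le> nrm A ((s n \<ominus> a) \<otimes> t n) + nrm A (a \<otimes> (t n \<ominus> b))"
   using c by (subst mult_diff_mult) (auto intro!: q_add)
  also have "\<dots> \<le> nrm A (s n \<ominus> a) * nrm A (t n) + nrm A a * nrm A (t n \<ominus> b)"
   using c by (intro add_mono q_mult) auto
  finally show ?thesis .
 qed
 ultimately have "(\<lambda>n. nrm A (s n \<otimes> t n \<ominus> a \<otimes> b)) \<longlonglongrightarrow> 0"
  by (intro q_tendsto_0_le[where f = "\<lambda>n. nrm A (s n \<ominus> a) * nrm A (t n) + nrm A a * nrm A (t n \<ominus> b)"])
    (use c in auto)
 then show ?thesis using c by (simp add: conv_def)
qed

lemma conv_adj: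
 assumes "conv s a" shows "conv (\<lambda>n. adj A (s n)) (adj A a)"
 using convD[OF assms] by (simp add: conv_def flip: adj_diff)

lemma contraction_convergent:
 assumes x: "!!n. x n \<in> carrier A" and r: "0 \<le> r" "r < 1"
  and step: "!!n. nrm A (x (Suc (Suc n)) \<ominus> x (Suc n)) \<le> r * nrm A (x (Suc n) \<ominus> x n)"
 obtains a where "conv x a"
proof -
 define C where "C = nrm A (x 1 \<ominus> x 0)"
 have C: "0 \<le> C" by (simp add: C_def x)
 have d: "nrm A (x (Suc n) \<ominus> x n) \<le> C * r ^ n" for n
 proof (induction n)
  case (Suc n)
  have "nrm A (x (Suc (Suc n)) \<ominus> x (Suc n)) \<le> r * (C * r ^ n)"
   using step[of n] mult_left_mono[OF Suc.IH r(1)] by simp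
  then show ?case by (simp add: mult_ac)
 qed (simp add: C_def)
 \<comment> \<open>The right-hand side is the partial geometric sum
   \<open>C r^n + ... + C r^(n+k-1)\<close> in closed form, which is what makes the induction on
   \<open>k\<close> go through.\<close>
 have tail: "nrm A (x (n + k) \<ominus> x n) \<le> C * r ^ n * (1 - r ^ k) / (1 - r)" for n k
 proof (induction k)
  case (Suc k)
  have "nrm A (x (n + Suc k) \<ominus> x n) \<le> nrm A (x (Suc (n + k)) \<ominus> x (n + k)) + nrm A (x (n + k) \<ominus> x n)"
   using q_triangle[of "x (Suc (n + k))" "x (n + k)" "x n"] x by simp
  also have "\<dots> \<le> C * r ^ (n + k) + C * r ^ n * (1 - r ^ k) / (1 - r)"
   using d[of "n + k"] Suc.IH by simp
  also have "\<dots> = C * r ^ n * (1 - r ^ Suc k) / (1 - r)"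
   using r by (simp add: field_simps power_add)
  finally show ?case .
 qed (simp add: x)
 have le: "nrm A (x (n + k) \<ominus> x n) \<le> C / (1 - r) * r ^ n" for n k
 proof -
  have "C * r ^ n * (1 - r ^ k) / (1 - r) \<le> C * r ^ n * 1 / (1 - r)"
   using C r by (intro divide_right_mono mult_left_mono) (auto simp: power_le_one)
  then show ?thesis using tail[of n k] by simp
 qed
 have "x \<in> CS"
 proof (rule CS_I[OF x])
  fix e :: real assume "e > 0"
  have "(\<lambda>n. C / (1 - r) * r ^ n) \<longlonglongrightarrow> C / (1 - r) * 0"
   using r by (intro tendsto_mult tendsto_const LIMSEQ_realpow_zero) auto
  then obtain N where N: "!!n. n \<ge> N ==> C / (1 - r) * r ^ n < e"
   using order_tendstoD(2)[of _ "0::real" sequentially e] \<open>e > 0\<close> by (force simp: eventually_sequentially)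
  have "nrm A (x m \<ominus> x n) < e" if "m \<ge> N" "n \<ge> N" for m n
  proof (cases "m \<ge> n")
   case True
   then show ?thesis using le[of n "m - n"] N[of n] that by simp
  next
   case False
   then show ?thesis using le[of m "n - m"] N[of m] that q_diff_swap[OF x x, of m n] by simp
  qed
  then show "\<exists>N. \<forall>m\<ge>N. \<forall>n\<ge>N. nrm A (x m \<ominus> x n) < e" by blast
 qed
 from complete[OF this] x show thesis by (auto intro: that simp: conv_def)
qed

text \<open>The limit of \<open>y \<mapsto> (h\<^sup>2 + y\<^sup>2) / 2\<close> is \<open>y = 1 - c\<close> with \<open>c\<close> the positive square root of
 \<open>1 - h\<^sup>2\<close>, so that \<open>h + \<i> c\<close> is unitary.\<close>

lemma selfadjoint_real_part_unitary:
 assumes h: "h \<in> carrier A" "adj A h = h" "nrm A h < 1"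
 obtains u where "u \<in> carrier A" "adj A u \<otimes> u = \<one>" "h = cscale A (1/2) (u \<oplus> adj A u)"
proof -
 define b where "b = h \<otimes> h"
 define r where "r = nrm A b"
 have b: "b \<in> carrier A" "adj A b = b" "h \<otimes> b = b \<otimes> h"
  using h by (simp_all add: b_def adj_mult m_assoc)
 have r: "0 \<le> r" "r < 1"
  using q_cstar[OF h(1)] h power_less_one_iff[of "nrm A h" 2] by (auto simp: r_def b_def)
 define y where "y = rec_nat \<zero> (\<lambda>_ z. cscale A (1/2) (b \<oplus> z \<otimes> z))"
 have y0: "y 0 = \<zero>" and yS: "!!n. y (Suc n) = cscale A (1/2) (b \<oplus> y n \<otimes> y n)"
  by (simp_all add: y_def)
 have y: "y n \<in> carrier A" for n by (induction n) (auto simp: y0 yS b)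
 have y_adj: "adj A (y n) = y n" for n
  by (induction n) (auto simp: y0 yS b y adj_cscale adj_add adj_mult)
 \<comment> \<open>Commutation with \<open>h\<close> passes to the limit, and without it the mixed
   terms of \<open>adj A u \<otimes> u\<close> would not cancel.\<close>
 have y_comm: "h \<otimes> y n = y n \<otimes> h" for n
 proof (induction n)
  case (Suc n)
  have "h \<otimes> (y n \<otimes> y n) = y n \<otimes> y n \<otimes> h"
   using Suc.IH y[of n] h(1) by (metis m_assoc)
  then show ?case
   by (simp add: yS mult_cscale_left mult_cscale_right h b y l_distr r_distr)
 qed (simp add: y0 h)
 \<comment> \<open>The iterates stay in the ball of radius \<open>r < 1\<close>, on which the
   iterated map contracts by the factor \<open>r\<close>.\<close>
 have y_le: "nrm A (y n) \<le> r" for n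
 proof (induction n)
  case (Suc n)
  have "nrm A (b \<oplus> y n \<otimes> y n) \<le> nrm A b + nrm A (y n \<otimes> y n)"
   using y b by (intro q_add) auto
  also have "nrm A (y n \<otimes> y n) \<le> nrm A (y n) * nrm A (y n)"
   using y by (intro q_mult) auto
  also have "\<dots> \<le> r * 1"
   using Suc.IH r y by (intro mult_mono) auto
  finally show ?case using y b by (simp add: yS q_cscale r_def norm_divide)
 qed (use r in \<open>simp add: y0\<close>)
 have "nrm A (y (Suc (Suc n)) \<ominus> y (Suc n)) \<le> r * nrm A (y (Suc n) \<ominus> y n)" for n
 proof -
  have "y (Suc (Suc n)) \<ominus> y (Suc n)
    = cscale A (1/2) ((b \<oplus> y (Suc n) \<otimes> y (Suc n)) \<ominus> (b \<oplus> y n \<otimes> y n))"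
   unfolding yS[of "Suc n"] yS[of n] using y b by (simp add: cscale_diff_right yS[symmetric])
  also have "\<dots> = cscale A (1/2) ((y (Suc n) \<ominus> y n) \<otimes> y (Suc n) \<oplus> y n \<otimes> (y (Suc n) \<ominus> y n))"
   using y b by (simp add: add_diff_add flip: mult_diff_mult)
  finally have "nrm A (y (Suc (Suc n)) \<ominus> y (Suc n))
    = 1/2 * nrm A ((y (Suc n) \<ominus> y n) \<otimes> y (Suc n) \<oplus> y n \<otimes> (y (Suc n) \<ominus> y n))"
   using y by (simp add: q_cscale norm_divide)
  also have "nrm A ((y (Suc n) \<ominus> y n) \<otimes> y (Suc n) \<oplus> y n \<otimes> (y (Suc n) \<ominus> y n))
    \<le> nrm A ((y (Suc n) \<ominus> y n) \<otimes> y (Suc n)) + nrm A (y n \<otimes> (y (Suc n) \<ominus> y n))"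
   using y by (intro q_add) auto
  also have "\<dots> \<le> nrm A (y (Suc n) \<ominus> y n) * nrm A (y (Suc n)) + nrm A (y n) * nrm A (y (Suc n) \<ominus> y n)"
   using y by (intro add_mono q_mult) auto
  also have "\<dots> \<le> nrm A (y (Suc n) \<ominus> y n) * r + r * nrm A (y (Suc n) \<ominus> y n)"
   using y y_le by (intro add_mono mult_left_mono mult_right_mono) auto
  finally show ?thesis by simp
 qed
 then obtain l where l: "conv y l" using contraction_convergent[of y r] y r by blast
 note lc = convD(2)[OF l]
 have "adj A l = l"
  using conv_unique[OF conv_adj[OF l]] l by (simp add: y_adj)
 have l_comm: "h \<otimes> l = l \<otimes> h"
  by (rule conv_unique[OF conv_mult[OF conv_const[OF h(1)] l]])
    (use conv_mult[OF l conv_const[OF h(1)]] in \<open>simp add: y_comm\<close>)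
 \<comment> \<open>The fixed point equation; completing the square turns it into
   \<open>(1 - l)^2 = 1 - b\<close>.\<close>
 have "l \<oplus> l = b \<oplus> l \<otimes> l"
 proof (rule conv_unique[OF conv_add[OF conv_Suc[OF l] conv_Suc[OF l]]])
  have "y (Suc n) \<oplus> y (Suc n) = b \<oplus> y n \<otimes> y n" for n
   using cscale_add_left[of "b \<oplus> y n \<otimes> y n" "1/2" "1/2"] y b by (simp add: yS)
  then show "conv (\<lambda>n. y (Suc n) \<oplus> y (Suc n)) (b \<oplus> l \<otimes> l)"
   using conv_add[OF conv_const[OF b(1)] conv_mult[OF l l]] by simp
 qed
 define c where "c = \<one> \<ominus> l"
 have c: "c \<in> carrier A" "adj A c = c" "h \<otimes> c = c \<otimes> h"
  using lc h \<open>adj A l = l\<close> l_comm by (simp_all add: c_def adj_diff diff_mult_left diff_mult_right)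
 have "c \<otimes> c = \<one> \<ominus> l \<ominus> (l \<ominus> l \<otimes> l)"
  unfolding c_def using lc by (simp add: diff_mult_right[of \<one> l] diff_mult_left[of \<one> l])
 also have "\<dots> = \<one> \<ominus> (l \<oplus> l) \<oplus> l \<otimes> l"
  using lc by algebra
 also have "\<dots> = \<one> \<ominus> (b \<oplus> l \<otimes> l) \<oplus> l \<otimes> l" using \<open>l \<oplus> l = _\<close> by simp
 also have "\<dots> = \<one> \<ominus> b" using lc b(1) by algebra
 finally have cc: "c \<otimes> c = \<one> \<ominus> b" .
 define u where "u = h \<oplus> cscale A \<i> c"
 have u_adj: "adj A u = h \<oplus> cscale A (- \<i>) c"
  using c h by (simp add: u_def adj_add adj_cscale)
 have "adj A u \<otimes> u = (h \<otimes> h \<oplus> cscale A \<i> (c \<otimes> h)) \<oplus> (cscale A (- \<i>) (c \<otimes> h) \<oplus> c \<otimes> c)"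
  unfolding u_adj unfolding u_def using c h
  by (simp add: l_distr r_distr mult_cscale_left mult_cscale_right cscale_add_right a_ac)
 also have "\<dots> = h \<otimes> h \<oplus> (cscale A \<i> (c \<otimes> h) \<oplus> cscale A (- \<i>) (c \<otimes> h)) \<oplus> c \<otimes> c"
  using c h by (simp add: a_assoc)
 also have "cscale A \<i> (c \<otimes> h) \<oplus> cscale A (- \<i>) (c \<otimes> h) = \<zero>"
  using c h cscale_add_left[of "c \<otimes> h" \<i> "-\<i>"] by simp
 also have "h \<otimes> h \<oplus> \<zero> \<oplus> c \<otimes> c = \<one>"
  unfolding cc b_def[symmetric] using b(1) by algebra
 finally have uni: "adj A u \<otimes> u = \<one>" .
 have "u \<oplus> adj A u = h \<oplus> h \<oplus> (cscale A \<i> c \<oplus> cscale A (- \<i>) c)"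
  unfolding u_adj unfolding u_def using c h by (simp add: a_ac)
 then have uu: "u \<oplus> adj A u = h \<oplus> h"
  using c h cscale_add_left[of c \<i> "-\<i>"] by simp
 have "cscale A (1/2) (h \<oplus> h) = cscale A (1/2 + 1/2) h"
  by (simp only: cscale_add_left[OF h(1)] cscale_add_right[OF h(1) h(1)])
 then have hu: "h = cscale A (1/2) (u \<oplus> adj A u)"
  unfolding uu using h(1) by simp
 show thesis by (rule that[OF _ uni hu]) (simp add: u_def c h)
qed

text \<open>A self-adjoint element of norm less than 1 is the average of a unitary and its adjoint,
  and \<open>p\<close> is at most 1 on both. Scaling removes the restriction on the norm, and the
  C*-identity for \<open>adj A a \<otimes> a\<close> removes self-adjointness. Completeness enters
  through the construction of the unitary.\<close>

lemma cstar_seminorm_le_nrm: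
 assumes p: "cstar_seminorm A p" and a: "a \<in> carrier A"
 shows "p a \<le> nrm A a"
proof -
 interpret p: cstar_seminormed A p by unfold_locales (fact p)
 have 1: "p h \<le> 1" if h: "h \<in> carrier A" "adj A h = h" "nrm A h < 1" for h
 proof -
  obtain u where u: "u \<in> carrier A" "adj A u \<otimes> u = \<one>" "h = cscale A (1/2) (u \<oplus> adj A u)"
   using h by (rule selfadjoint_real_part_unitary)
  have "p h = 1/2 * p (u \<oplus> adj A u)" unfolding u(3) using u(1) by (simp add: p.q_cscale norm_divide)
  also have "\<dots> \<le> 1/2 * (p u + p (adj A u))" using u(1) by (intro mult_left_mono p.q_add) auto
  finally show ?thesis using p.q_isometry_le[OF u(1,2)] u(1) by simp
 qed
 have 2: "p h \<le> nrm A h" if h: "h \<in> carrier A" "adj A h = h" for h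
 proof (rule field_le_epsilon)
  fix e :: real assume "e > 0"
  \<comment> \<open>The summand \<open>e\<close> makes the scaled element have norm strictly below
    1, and it keeps \<open>t\<close> positive when \<open>h\<close> has norm 0.\<close>
  define t where "t = nrm A h + e"
  have t: "t > 0" "nrm A h < t" using \<open>e > 0\<close> q_nonneg[OF h(1)] by (simp_all add: t_def)
  have "p (cscale A (1 / of_real t) h) \<le> 1"
   using h t by (intro 1) (simp_all add: adj_cscale q_cscale norm_divide)
  then have "p h \<le> t"
   using h t by (simp add: p.q_cscale norm_divide field_simps)
  then show "p h \<le> nrm A h + e" by (simp add: t_def)
 qed
 have "(p a)\<^sup>2 \<le> (nrm A a)\<^sup>2"
  using 2[of "adj A a \<otimes> a"] a p.q_cstar[OF a] q_cstar[OF a] by (simp add: adj_mult)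
 then show ?thesis using a by (simp add: power2_le_iff_abs_le)
qed

text \<open>The iteration \<open>z -> 1 + z b\<close> yields a left inverse, and a one-sided inverse
  is enough to show that an ideal contains the unit.\<close>

lemma neumann_inverse:
 assumes b: "b \<in> carrier A" "nrm A b < 1"
 obtains z where "z \<in> carrier A" "z \<otimes> (\<one> \<ominus> b) = \<one>"
proof -
 define y where "y = rec_nat \<zero> (\<lambda>_ z. \<one> \<oplus> z \<otimes> b)"
 have y0: "y 0 = \<zero>" and yS: "!!n. y (Suc n) = \<one> \<oplus> y n \<otimes> b"
  by (simp_all add: y_def)
 have y: "y n \<in> carrier A" for n by (induction n) (auto simp: y0 yS b)
 have "nrm A (y (Suc (Suc n)) \<ominus> y (Suc n)) \<le> nrm A b * nrm A (y (Suc n) \<ominus> y n)" for n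
 proof -
  have "y (Suc (Suc n)) \<ominus> y (Suc n) = (y (Suc n) \<ominus> y n) \<otimes> b"
   unfolding yS[of "Suc n"] using y b by (subst (2) yS) (simp add: add_diff_add diff_mult_right)
  then show ?thesis using q_mult[of "y (Suc n) \<ominus> y n" b] y b by (simp add: mult.commute)
 qed
 then obtain z where z: "conv y z"
  using contraction_convergent[of y "nrm A b"] y b by auto
 note zc = convD(2)[OF z]
 have eq: "z = \<one> \<oplus> z \<otimes> b"
  by (rule conv_unique[OF conv_Suc[OF z]])
    (use conv_add[OF conv_const conv_mult[OF z conv_const]] b in \<open>simp add: yS\<close>)
 have "z \<ominus> z \<otimes> b = (\<one> \<oplus> z \<otimes> b) \<ominus> z \<otimes> b" using eq by simp
 also have "\<dots> = \<one>" using zc b(1) by (simp add: a_minus_def a_assoc r_neg)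
 finally show thesis using that[OF zc] zc b(1) by (simp add: diff_mult_left)
qed

text \<open>A limit of kernel elements \<open>s n\<close> satisfies
  \<open>p a \<le> p (a - s n) \<le> nrm A (a - s n)\<close> by automatic contractivity.\<close>

lemma kernel_closed_ideal:
 assumes p: "cstar_seminorm A p"
 shows "closed_ideal A {a \<in> carrier A. p a = 0}"
proof -
 interpret p: cstar_seminormed A p by unfold_locales (fact p)
 have "p a = 0" if s: "!!n::nat. s n \<in> carrier A \<and> p (s n) = 0" and lim: "(\<lambda>n. nrm A (s n \<ominus> a)) \<longlonglongrightarrow> 0"
  and a: "a \<in> carrier A" for s a
 proof -
  have "p a \<le> nrm A (s n \<ominus> a)" for n
   using p.q_le_diff[of a "s n"] cstar_seminorm_le_nrm[OF p, of "a \<ominus> s n"] q_diff_swap[of a "s n"] s a by fastforce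
  then have "p a \<le> 0" using LIMSEQ_le_const[OF lim] by blast
  then show ?thesis using p.q_nonneg[OF a] by simp
 qed
 then show ?thesis unfolding closed_ideal_def using p.kernel_ideal by auto
qed

end


section \<open>Partial crossed products\<close>

lemma continuous_map_complexI:
 fixes f :: "'x => complex"
 assumes "!!x e. [|x \<in> topspace X; e > 0|] ==> \<exists>V. openin X V \<and> x \<in> V \<and> (\<forall>y\<in>V. cmod (f y - f x) < e)"
 shows "continuous_map X euclidean f"
 using assms Met_TC.continuous_map_to_metric[of X f]
 by (simp add: dist_norm norm_minus_commute)

lemma continuous_map_complexD:
 fixes f :: "'x => complex"
 assumes "continuous_map X euclidean f" "x \<in> topspace X" "e > 0"
 shows "\<exists>V. openin X V \<and> x \<in> V \<and> (\<forall>y\<in>V. cmod (f y - f x) < e)"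
proof -
 have "\<exists>V. openin X V \<and> x \<in> V \<and> (\<forall>y\<in>V. f y \<in> ball (f x) e)"
  using assms Met_TC.continuous_map_to_metric[of X f] by simp
 then show ?thesis by (simp add: dist_norm norm_minus_commute)
qed

lemma continuous_map_complex_mult:
 fixes f h :: "'x => complex"
 shows "[|continuous_map X euclidean f; continuous_map X euclidean h|] ==> continuous_map X euclidean (\<lambda>x. f x * h x)"
 by (simp add: continuous_map_atin tendsto_mult)

lemma C0_onD:
 assumes "f \<in> C0_on X V"
 shows "continuous_map X euclidean f" "x \<notin> V ==> f x = 0" "x \<notin> topspace X ==> f x = 0"
 using assms by (auto simp: C0_on_def)

lemma C0_onI:
 "[|continuous_map X euclidean f; !!x. x \<notin> V ==> f x = 0; !!x. x \<notin> topspace X ==> f x = 0|] ==> f \<in> C0_on X V"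
 by (auto simp: C0_on_def)

lemma C0_on_zero: "(\<lambda>_. 0) \<in> C0_on X V"
 by (auto simp: C0_on_def)

lemma C0_on_add: "[|f \<in> C0_on X V; h \<in> C0_on X V|] ==> (\<lambda>x. f x + h x) \<in> C0_on X V"
 by (auto simp: C0_on_def intro: continuous_map_add)

lemma C0_on_cmult: "f \<in> C0_on X V ==> (\<lambda>x. c * f x) \<in> C0_on X V"
 by (rule C0_onI) (auto dest: C0_onD intro!: continuous_map_complex_mult continuous_map_const)

definition single :: "'g => ('x => complex) => 'g => 'x => complex" where
 "single g a = (\<lambda>h x. if h = g then a x else 0)"

lemma single_same [simp]: "single g a g = a"
 by (simp add: single_def)

abbreviation supp :: "('g => 'x => complex) => 'g set" where
 "supp f \<equiv> {g. f g \<noteq> (\<lambda>_. 0)}"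

locale partial_system = group G for G :: "('g, 'm) monoid_scheme" (structure) +
 fixes X :: "'x topology" and U :: "'g => 'x set" and \<theta> :: "'g => 'x => 'x"
 assumes compact: "compact_space X" and Hausdorff: "Hausdorff_space X" and nonempty: "topspace X \<noteq> {}"
  and U_open: "g \<in> carrier G ==> openin X (U g)"
  and U_one: "U \<one> = topspace X"
  and act_one: "x \<in> topspace X ==> \<theta> \<one> x = x"
  and act_range: "[|g \<in> carrier G; x \<in> U (inv g)|] ==> \<theta> g x \<in> U g"
  and act_comp: "[|g \<in> carrier G; h \<in> carrier G; x \<in> U (inv h); \<theta> h x \<in> U (inv g)|]
    ==> x \<in> U (inv (g \<otimes> h)) \<and> \<theta> (g \<otimes> h) x = \<theta> g (\<theta> h x)"
  and act_cont: "g \<in> carrier G ==> continuous_map (subtopology X (U (inv g))) X (\<theta> g)"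
begin

abbreviation "B \<equiv> alg_crossed G X U \<theta>"

abbreviation mult_B (infixl "\<star>" 70) where "f \<star> h \<equiv> f \<otimes>\<^bsub>B\<^esub> h"
abbreviation add_B (infixl "\<uplus>" 65) where "f \<uplus> h \<equiv> f \<oplus>\<^bsub>B\<^esub> h"
abbreviation diff_B (infixl "\<minus>" 65) where "f \<minus> h \<equiv> f \<ominus>\<^bsub>B\<^esub> h"

text \<open>The inverse of \<open>\<theta> g\<close>, with domain \<open>U g\<close>. Dual partial
  automorphisms are compositions with it, so the formulas of the crossed product are written in
  terms of \<open>tau\<close>.\<close>

definition tau :: "'g => 'x => 'x" where
 "tau g x = \<theta> (inv g) x"

lemma U_topspace: "g \<in> carrier G ==> U g \<subseteq> topspace X"
 using U_open openin_subset by blast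

lemma tau_range: "[|g \<in> carrier G; x \<in> U g|] ==> tau g x \<in> U (inv g)"
 using act_range[of "inv g" x] by (simp add: tau_def)

lemma tau_comp:
 assumes "g \<in> carrier G" "h \<in> carrier G" "x \<in> U g" "tau g x \<in> U h"
 shows "x \<in> U (g \<otimes> h)" "tau (g \<otimes> h) x = tau h (tau g x)"
 using act_comp[of "inv h" "inv g" x] assms by (simp_all add: tau_def inv_mult_group)

lemma tau_one: "x \<in> topspace X ==> tau \<one> x = x"
 by (simp add: tau_def act_one)

lemma act_tau: "[|g \<in> carrier G; x \<in> U g|] ==> \<theta> g (tau g x) = x"
 using act_comp[of g "inv g" x] tau_range[of g x] U_topspace[of g] by (auto simp: tau_def act_one)

lemma tau_act: "[|g \<in> carrier G; x \<in> U (inv g)|] ==> tau g (\<theta> g x) = x"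
 using act_tau[of "inv g" x] by (simp add: tau_def)

text \<open>For the converse apply \<open>tau_comp\<close> at the point \<open>tau g x\<close>, to
  \<open>inv g\<close> and then \<open>g \<otimes> h\<close>: the first map returns to
  \<open>x\<close>.\<close>

lemma tau_mem_iff:
 assumes "g \<in> carrier G" "h \<in> carrier G" "x \<in> U g"
 shows "tau g x \<in> U h \<longleftrightarrow> x \<in> U (g \<otimes> h)"
proof
 assume "x \<in> U (g \<otimes> h)"
 moreover have "tau (inv g) (tau g x) = x" using act_tau[OF assms(1,3)] assms(1) by (simp add: tau_def)
 ultimately have "tau g x \<in> U (inv g \<otimes> (g \<otimes> h))"
  using tau_comp(1)[of "inv g" "g \<otimes> h" "tau g x"] tau_range[OF assms(1,3)] assms by simp
 then show "tau g x \<in> U h" using assms by (simp flip: m_assoc)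
qed (use tau_comp assms in blast)

lemma tau_cont: "g \<in> carrier G ==> continuous_map (subtopology X (U g)) X (tau g)"
 using act_cont[of "inv g"] by (simp add: tau_def[abs_def])

lemma tau_topspace: "[|g \<in> carrier G; x \<in> U g|] ==> tau g x \<in> topspace X"
 using tau_range U_topspace by (meson inv_closed subsetD)

lemma continuous_tau_near:
 fixes f :: "'x => complex"
 assumes g: "g \<in> carrier G" and x: "x \<in> U g" and f: "continuous_map X euclidean f" and e: "e > 0"
 shows "\<exists>V. openin X V \<and> x \<in> V \<and> V \<subseteq> U g \<and> (\<forall>y\<in>V. cmod (f (tau g y) - f (tau g x)) < e)"
proof -
 obtain W where W: "openin X W" "tau g x \<in> W" "\<forall>y\<in>W. cmod (f y - f (tau g x)) < e"
  using continuous_map_complexD[OF f tau_topspace[OF g x] e] by blast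
 have "openin (subtopology X (U g)) {y \<in> topspace (subtopology X (U g)). tau g y \<in> W}"
  by (rule openin_continuous_map_preimage[OF tau_cont[OF g] W(1)])
 then have "openin X {y \<in> topspace (subtopology X (U g)). tau g y \<in> W}"
  using openin_trans_full U_open[OF g] by blast
 then show ?thesis
  using W x U_topspace[OF g] by (intro exI[of _ "{y \<in> topspace (subtopology X (U g)). tau g y \<in> W}"]) auto
qed

lemma C0_bounded:
 assumes "continuous_map X euclidean (f :: 'x => complex)"
 obtains M where "M > 0" "!!x. x \<in> topspace X ==> cmod (f x) \<le> M"
proof -
 have "compactin euclidean (f ` topspace X)"
  using image_compactin[of X "topspace X" euclidean f] compact assms by (simp add: compact_space_def)
 then have "bounded (f ` topspace X)" by (simp add: compact_imp_bounded)
 then show thesis using that by (auto simp: bounded_pos)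
qed

text \<open>The map \<open>tau g\<close> has no limit in general at the edge of \<open>U g\<close>.
  Continuity survives there because \<open>f\<close> is bounded, by compactness, while
  \<open>a\<close> tends to 0.\<close>

lemma C0_mult_tau:
 assumes g: "g \<in> carrier G" and a: "a \<in> C0_on X (U g)" and f: "continuous_map X euclidean f"
 shows "continuous_map X euclidean (\<lambda>x. a x * f (tau g x))"
proof (rule continuous_map_complexI)
 fix x and e :: real assume x: "x \<in> topspace X" and e: "e > 0"
 obtain M where M: "M > 0" "!!y. y \<in> topspace X ==> cmod (f y) \<le> M" using C0_bounded[OF f] by blast
 obtain L where L: "L > 0" "!!y. y \<in> topspace X ==> cmod (a y) \<le> L" using C0_bounded[OF C0_onD(1)[OF a]] by blast
 obtain V where V: "openin X V" "x \<in> V" "\<forall>y\<in>V. cmod (a y - a x) < e / (2 * M)"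
  using continuous_map_complexD[OF C0_onD(1)[OF a] x, of "e / (2 * M)"] e M(1) by auto
 show "\<exists>V. openin X V \<and> x \<in> V \<and> (\<forall>y\<in>V. cmod (a y * f (tau g y) - a x * f (tau g x)) < e)"
 proof (cases "x \<in> U g")
  case True
  obtain W where W: "openin X W" "x \<in> W" "W \<subseteq> U g" "\<forall>y\<in>W. cmod (f (tau g y) - f (tau g x)) < e / (2 * L)"
   using continuous_tau_near[OF g True f, of "e / (2 * L)"] e L(1) by auto
  have "cmod (a y * f (tau g y) - a x * f (tau g x)) < e" if y: "y \<in> V \<inter> W" for y
  proof -
   have "a y * f (tau g y) - a x * f (tau g x) = (a y - a x) * f (tau g y) + a x * (f (tau g y) - f (tau g x))"
    by (simp add: algebra_simps)
   then have "cmod (a y * f (tau g y) - a x * f (tau g x)) \<le> cmod (a y - a x) * cmod (f (tau g y)) + cmod (a x) * cmod (f (tau g y) - f (tau g x))"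
    by (metis norm_mult norm_triangle_ineq)
   also have "\<dots> \<le> cmod (a y - a x) * M + L * cmod (f (tau g y) - f (tau g x))"
    using M(2)[OF tau_topspace[OF g]] L(2)[OF x] W(3) y by (intro add_mono mult_left_mono mult_right_mono) auto
   also have "\<dots> < e / (2 * M) * M + L * (e / (2 * L))"
    using V(3) W(4) y M(1) L(1) by (intro add_strict_mono mult_strict_left_mono mult_strict_right_mono) auto
   finally show ?thesis using M(1) L(1) by simp
  qed
  then show ?thesis using V W by (intro exI[of _ "V \<inter> W"]) auto
 next
  case False
  then have ax: "a x = 0" using C0_onD(2)[OF a] by simp
  have "cmod (a y * f (tau g y)) < e" if y: "y \<in> V" for y
  proof (cases "y \<in> U g")
   case True
   have "cmod (a y * f (tau g y)) \<le> cmod (a y) * M"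
    using M(2)[OF tau_topspace[OF g True]] by (simp add: norm_mult mult_left_mono)
   also have "\<dots> < e / (2 * M) * M" using V(3) y M(1) ax by (intro mult_strict_right_mono) auto
   finally show ?thesis using M(1) e by simp
  qed (use C0_onD(2)[OF a] e in simp)
  then show ?thesis using V ax by auto
 qed
qed

text \<open>The delicate points lie outside \<open>U g\<close>. The set \<open>K\<close> where the
  modulus of \<open>b\<close> is at least \<open>e\<close> is compact inside
  \<open>U (inv g)\<close>, so its image under \<open>\<theta> g\<close> is compact, hence closed in
  a Hausdorff space. The complement of that image is a neighbourhood on which the pulled back
  function stays below \<open>e\<close>.\<close>

lemma C0_pullback:
 assumes g: "g \<in> carrier G" and b: "b \<in> C0_on X (U (inv g))"
 shows "(\<lambda>x. if x \<in> U g then b (tau g x) else 0) \<in> C0_on X (U g)"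
proof (rule C0_onI)
 note bc = C0_onD(1)[OF b]
 show "continuous_map X euclidean (\<lambda>x. if x \<in> U g then b (tau g x) else 0)"
 proof (rule continuous_map_complexI)
  fix x and e :: real assume x: "x \<in> topspace X" and e: "e > 0"
  show "\<exists>V. openin X V \<and> x \<in> V \<and> (\<forall>y\<in>V. cmod ((if y \<in> U g then b (tau g y) else 0) - (if x \<in> U g then b (tau g x) else 0)) < e)"
  proof (cases "x \<in> U g")
   case True
   obtain V where V: "openin X V" "x \<in> V" "V \<subseteq> U g" "\<forall>y\<in>V. cmod (b (tau g y) - b (tau g x)) < e"
    using continuous_tau_near[OF g True bc e] by blast
   then have "\<forall>y\<in>V. cmod ((if y \<in> U g then b (tau g y) else 0) - (if x \<in> U g then b (tau g x) else 0)) < e"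
    using True by auto
   then show ?thesis using V(1,2) by blast
  next
   case False
   define K where "K = {y \<in> topspace X. b y \<in> {z. cmod z \<ge> e}}"
   have "closed {z. cmod z \<ge> e}" by (simp add: closed_Collect_le continuous_on_norm_id)
   then have "closedin X K" unfolding K_def by (intro closedin_continuous_map_preimage[OF bc]) auto
   then have Kc: "compactin X K" using compact by (simp add: closedin_compact_space)
   have KU: "K \<subseteq> U (inv g)" using C0_onD(2)[OF b] e by (force simp: K_def)
   then have "compactin (subtopology X (U (inv g))) K" using Kc by (simp add: compactin_subtopology)
   then have "compactin X (\<theta> g ` K)" using image_compactin act_cont[OF g] by blast
   then have "closedin X (\<theta> g ` K)" using Hausdorff compactin_imp_closedin by blast
   then have "openin X (topspace X - \<theta> g ` K)" by blast
   moreover have "x \<notin> \<theta> g ` K" using False KU act_range[OF g] by blast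
   moreover have "cmod (b (tau g y)) < e" if "y \<in> topspace X - \<theta> g ` K" "y \<in> U g" for y
   proof (rule ccontr)
    assume "\<not> cmod (b (tau g y)) < e"
    then have "tau g y \<in> K" using tau_topspace[OF g that(2)] by (simp add: K_def)
    then show False using act_tau[OF g that(2)] that(1) by (metis DiffD2 imageI)
   qed
   ultimately show ?thesis using False x e by (intro exI[of _ "topspace X - \<theta> g ` K"]) auto
  qed
 qed
qed (use U_topspace[OF g] in auto)

lemma carrier_BD:
 assumes "f \<in> carrier B"
 shows "finite (supp f)" "supp f \<subseteq> carrier G" "g \<in> carrier G ==> f g \<in> C0_on X (U g)"
  "g \<notin> carrier G ==> f g = (\<lambda>_. 0)" "x \<notin> topspace X ==> f g x = 0" "x \<notin> U g ==> f g x = 0"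
proof -
 show *: "finite (supp f)" "supp f \<subseteq> carrier G" "g \<in> carrier G ==> f g \<in> C0_on X (U g)" for g
  using assms by (auto simp: alg_crossed_def)
 show 0: "g \<notin> carrier G ==> f g = (\<lambda>_. 0)" using *(2) by blast
 show "f g x = 0" if "x \<notin> topspace X"
  using 0 C0_onD(3)[OF *(3) that] by (cases "g \<in> carrier G") auto
 show "f g x = 0" if "x \<notin> U g"
  using 0 C0_onD(2)[OF *(3) that] by (cases "g \<in> carrier G") auto
qed

lemma carrier_BI:
 "[|finite F; F \<subseteq> carrier G; !!g x. g \<notin> F ==> f g x = 0; !!g. g \<in> F ==> f g \<in> C0_on X (U g)|] ==> f \<in> carrier B"
proof -
 assume a: "finite F" "F \<subseteq> carrier G" "!!g x. g \<notin> F ==> f g x = 0" "!!g. g \<in> F ==> f g \<in> C0_on X (U g)"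
 have s: "supp f \<subseteq> F" using a(3) by auto
 have "f g \<in> C0_on X (U g)" for g
 proof (cases "g \<in> F")
  case False
  then have "f g = (\<lambda>_. 0)" using a(3) by auto
  then show ?thesis by (simp add: C0_on_zero)
 qed (use a(4) in simp)
 then show "f \<in> carrier B" using s a(1,2) finite_subset[OF s a(1)] by (simp add: alg_crossed_def subset_trans[OF s])
qed

lemma single_carrier: "[|g \<in> carrier G; a \<in> C0_on X (U g)|] ==> single g a \<in> carrier B"
 by (rule carrier_BI[of "{g}"]) (auto simp: single_def)

lemma B_simps: "\<zero>\<^bsub>B\<^esub> = (\<lambda>_ _. 0)" "f \<uplus> h = (\<lambda>g x. f g x + h g x)" "cscale B c f = (\<lambda>g x. c * f g x)"
 by (simp_all add: alg_crossed_def)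

lemma B_one: "\<one>\<^bsub>B\<^esub> = single \<one> (indicator (topspace X))"
 by (auto simp: alg_crossed_def single_def fun_eq_iff)

lemma B_adj: "g \<in> carrier G ==> adj B f g x = (if x \<in> U g then cnj (f (inv g) (tau g x)) else 0)"
 by (simp add: alg_crossed_def dual_pact_def tau_def)

lemma B_adj_out: "g \<notin> carrier G ==> adj B f g x = 0"
 by (simp add: alg_crossed_def)

lemma B_mult_out: "k \<notin> carrier G ==> (f \<star> h) k x = 0"
 by (simp add: alg_crossed_def)

text \<open>The nested dual actions of the definition collapse because \<open>tau g\<close> and
  \<open>\<theta> g\<close> are mutually inverse. The index set \<open>F\<close> is any finite
  superset of the support, so that several elements can share one sum.\<close>

lemma B_mult:
 assumes f: "f \<in> carrier B" and k: "k \<in> carrier G" and F: "finite F" "supp f \<subseteq> F" "F \<subseteq> carrier G"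
 shows "(f \<star> h) k x = (\<Sum>g\<in>F. f g x * h (inv g \<otimes> k) (tau g x))"
proof -
 have "(f \<star> h) k x = (\<Sum>g\<in>supp f. dual_pact G U \<theta> g (\<lambda>y. dual_pact G U \<theta> (inv g) (f g) y * h (inv g \<otimes> k) y) x)"
  using k by (simp add: alg_crossed_def)
 also have "\<dots> = (\<Sum>g\<in>supp f. f g x * h (inv g \<otimes> k) (tau g x))"
 proof (rule sum.cong[OF refl])
  fix g assume "g \<in> supp f"
  then have g: "g \<in> carrier G" using F by blast
  show "dual_pact G U \<theta> g (\<lambda>y. dual_pact G U \<theta> (inv g) (f g) y * h (inv g \<otimes> k) y) x = f g x * h (inv g \<otimes> k) (tau g x)"
  proof (cases "x \<in> U g")
   case True
   then show ?thesis using g tau_range[OF g True] act_tau[OF g True] by (simp add: dual_pact_def tau_def)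
  next
   case False
   then show ?thesis using carrier_BD(6)[OF f False] by (simp add: dual_pact_def)
  qed
 qed
 also have "\<dots> = (\<Sum>g\<in>F. f g x * h (inv g \<otimes> k) (tau g x))"
  by (rule sum.mono_neutral_left[OF F(1,2)]) auto
 finally show ?thesis .
qed

lemmas B_mult_supp = B_mult[OF _ _ carrier_BD(1) subset_refl carrier_BD(2)]

lemma continuous_map_sum_complex:
 "finite F ==> (!!i. i \<in> F ==> continuous_map X euclidean (\<lambda>x. f i x :: complex)) ==> continuous_map X euclidean (\<lambda>x. \<Sum>i\<in>F. f i x)"
 by (rule continuous_map_sum)

lemma supp_mult_subset:
 assumes f: "f \<in> carrier B" and h: "h \<in> carrier B" and nz: "(f \<star> h) k x \<noteq> 0"
 shows "k \<in> (\<lambda>(g, m). g \<otimes> m) ` (supp f \<times> supp h)"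
proof -
 have k: "k \<in> carrier G" using nz B_mult_out by blast
 then obtain g where g: "g \<in> supp f" "f g x * h (inv g \<otimes> k) (tau g x) \<noteq> 0"
  using nz B_mult_supp[OF f k f f, of h x] by (metis (mono_tags, lifting) sum.neutral)
 then have "g \<in> carrier G" "inv g \<otimes> k \<in> supp h" using carrier_BD(2)[OF f] by auto
 moreover have "k = g \<otimes> (inv g \<otimes> k)" using \<open>g \<in> carrier G\<close> k by (simp flip: m_assoc)
 ultimately show ?thesis using g(1) by (intro image_eqI[of _ _ "(g, inv g \<otimes> k)"]) auto
qed

lemma B_mult_closed:
 assumes f: "f \<in> carrier B" and h: "h \<in> carrier B" shows "f \<star> h \<in> carrier B"
proof (rule carrier_BI)
 let ?F = "(\<lambda>(g, m). g \<otimes> m) ` (supp f \<times> supp h)"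
 show "finite ?F" using carrier_BD(1)[OF f] carrier_BD(1)[OF h] by auto
 show sub: "?F \<subseteq> carrier G" using carrier_BD(2)[OF f] carrier_BD(2)[OF h] by force
 show "(f \<star> h) k x = 0" if "k \<notin> ?F" for k x
  using supp_mult_subset[OF f h] that by blast
 fix k assume "k \<in> ?F"
 then have k: "k \<in> carrier G" using sub by blast
 have eq: "(f \<star> h) k = (\<lambda>x. \<Sum>g\<in>supp f. f g x * h (inv g \<otimes> k) (tau g x))"
  using B_mult_supp[OF f k f f] by blast
 show "(f \<star> h) k \<in> C0_on X (U k)"
  unfolding eq
 proof (rule C0_onI)
  show "continuous_map X euclidean (\<lambda>x. \<Sum>g\<in>supp f. f g x * h (inv g \<otimes> k) (tau g x))"
  proof (rule continuous_map_sum_complex[OF carrier_BD(1)[OF f]])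
   fix g assume "g \<in> supp f"
   then have g: "g \<in> carrier G" using carrier_BD(2)[OF f] by blast
   show "continuous_map X euclidean (\<lambda>x. f g x * h (inv g \<otimes> k) (tau g x))"
    using C0_mult_tau[OF g carrier_BD(3)[OF f g] C0_onD(1)[OF carrier_BD(3)[OF h]]] g k by simp
  qed
  show "(\<Sum>g\<in>supp f. f g x * h (inv g \<otimes> k) (tau g x)) = 0" if x: "x \<notin> U k" for x
  proof (rule sum.neutral, rule ballI)
   fix g assume "g \<in> supp f"
   then have g: "g \<in> carrier G" using carrier_BD(2)[OF f] by blast
   show "f g x * h (inv g \<otimes> k) (tau g x) = 0"
   proof (cases "x \<in> U g \<and> tau g x \<in> U (inv g \<otimes> k)")
    case True
    then have "x \<in> U (g \<otimes> (inv g \<otimes> k))" using tau_comp(1) g k by simp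
    then show ?thesis using x g k by (simp flip: m_assoc)
   qed (use carrier_BD(6)[OF f] carrier_BD(6)[OF h] in auto)
  qed
  then show "(\<Sum>g\<in>supp f. f g x * h (inv g \<otimes> k) (tau g x)) = 0" if "x \<notin> topspace X" for x
   using that U_topspace[OF k] by blast
 qed
qed

lemma B_mult_assoc:
 assumes f: "f \<in> carrier B" and h: "h \<in> carrier B" and l: "l \<in> carrier B"
 shows "(f \<star> h) \<star> l = f \<star> (h \<star> l)"
proof (intro ext)
 fix k x
 let ?F = "(\<lambda>(g, m). g \<otimes> m) ` (supp f \<times> supp h)"
 have F: "finite ?F" "?F \<subseteq> carrier G"
  using carrier_BD(1,2)[OF f] carrier_BD(1,2)[OF h] by force+
 show "((f \<star> h) \<star> l) k x = (f \<star> (h \<star> l)) k x"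
 proof (cases "k \<in> carrier G")
  case k: True
  have "supp (f \<star> h) \<subseteq> ?F" using supp_mult_subset[OF f h] by blast
  then have "((f \<star> h) \<star> l) k x = (\<Sum>m\<in>?F. (f \<star> h) m x * l (inv m \<otimes> k) (tau m x))"
   by (rule B_mult[OF B_mult_closed[OF f h] k F(1) _ F(2)])
  also have "\<dots> = (\<Sum>m\<in>?F. \<Sum>g\<in>supp f. f g x * (h (inv g \<otimes> m) (tau g x) * l (inv m \<otimes> k) (tau m x)))"
   using F(2) by (intro sum.cong refl) (auto simp: B_mult_supp[OF f _ f f] sum_distrib_right mult.assoc)
  also have "\<dots> = (\<Sum>g\<in>supp f. f g x * (\<Sum>m\<in>?F. h (inv g \<otimes> m) (tau g x) * l (inv m \<otimes> k) (tau m x)))"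
   by (subst sum.swap) (simp add: sum_distrib_left)
  also have "\<dots> = (\<Sum>g\<in>supp f. f g x * (h \<star> l) (inv g \<otimes> k) (tau g x))"
  proof (rule sum.cong[OF refl])
   fix g assume gF: "g \<in> supp f"
   then have g: "g \<in> carrier G" using carrier_BD(2)[OF f] by blast
   show "f g x * (\<Sum>m\<in>?F. h (inv g \<otimes> m) (tau g x) * l (inv m \<otimes> k) (tau m x)) = f g x * (h \<star> l) (inv g \<otimes> k) (tau g x)"
   proof (cases "x \<in> U g")
    case x: True
    \<comment> \<open>Substitute \<open>m = g \<otimes> n\<close> with \<open>n\<close> in the
      support of \<open>h\<close>; all other \<open>m\<close> contribute 0. Points outside
      \<open>U g\<close> need no comparison because \<open>f g\<close> vanishes there.\<close>
    have sub: "(\<otimes>) g ` supp h \<subseteq> ?F" using gF by force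
    have "(\<Sum>m\<in>?F. h (inv g \<otimes> m) (tau g x) * l (inv m \<otimes> k) (tau m x))
      = (\<Sum>m\<in>(\<otimes>) g ` supp h. h (inv g \<otimes> m) (tau g x) * l (inv m \<otimes> k) (tau m x))"
    proof (rule sum.mono_neutral_right[OF F(1) sub], rule ballI)
     fix m assume m: "m \<in> ?F - (\<otimes>) g ` supp h"
     have "m \<in> carrier G" using m F(2) by blast
     then have "m = g \<otimes> (inv g \<otimes> m)" using g by (simp flip: m_assoc)
     then have "inv g \<otimes> m \<notin> supp h" using m by blast
     then show "h (inv g \<otimes> m) (tau g x) * l (inv m \<otimes> k) (tau m x) = 0" by simp
    qed
    also have "\<dots> = (\<Sum>n\<in>supp h. h (inv g \<otimes> (g \<otimes> n)) (tau g x) * l (inv (g \<otimes> n) \<otimes> k) (tau (g \<otimes> n) x))"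
     using carrier_BD(2)[OF h] g by (intro sum.reindex[unfolded comp_def]) (auto simp: inj_on_def subset_iff)
    also have "\<dots> = (\<Sum>n\<in>supp h. h n (tau g x) * l (inv n \<otimes> (inv g \<otimes> k)) (tau n (tau g x)))"
    proof (rule sum.cong[OF refl])
     fix n assume "n \<in> supp h"
     then have n: "n \<in> carrier G" using carrier_BD(2)[OF h] by blast
     have gn: "inv g \<otimes> (g \<otimes> n) = n" using g n by (simp flip: m_assoc)
     show "h (inv g \<otimes> (g \<otimes> n)) (tau g x) * l (inv (g \<otimes> n) \<otimes> k) (tau (g \<otimes> n) x)
       = h n (tau g x) * l (inv n \<otimes> (inv g \<otimes> k)) (tau n (tau g x))"
     proof (cases "tau g x \<in> U n")
      case True
      then show ?thesis using tau_comp(2)[OF g n x True] g n k by (simp add: gn inv_mult_group m_assoc)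
     next
      case False
      then show ?thesis using carrier_BD(6)[OF h False] by (simp add: gn)
     qed
    qed
    also have "\<dots> = (h \<star> l) (inv g \<otimes> k) (tau g x)"
     using g k by (simp add: B_mult_supp[OF h _ h h])
    finally show ?thesis by simp
   qed (use carrier_BD(6)[OF f] in simp)
  qed
  also have "\<dots> = (f \<star> (h \<star> l)) k x" by (simp add: B_mult_supp[OF f k f f])
  finally show ?thesis .
 qed (simp add: B_mult_out)
qed

lemma supp_add: "f \<uplus> h = (\<lambda>g x. f g x + h g x)" "supp (\<lambda>g x. f g x + h g x) \<subseteq> supp f \<union> supp h"
 by (auto simp: B_simps fun_eq_iff)

lemma B_add_closed:
 assumes f: "f \<in> carrier B" and h: "h \<in> carrier B" shows "(\<lambda>g x. f g x + h g x) \<in> carrier B"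
proof (rule carrier_BI[of "supp f \<union> supp h"])
 show "(\<lambda>x. f g x + h g x) \<in> C0_on X (U g)" if "g \<in> supp f \<union> supp h" for g
  using that carrier_BD(2)[OF f] carrier_BD(2)[OF h] C0_on_add[OF carrier_BD(3)[OF f, of g] carrier_BD(3)[OF h, of g]] by blast
qed (use carrier_BD(1,2)[OF f] carrier_BD(1,2)[OF h] in auto)

lemma B_cmult_closed:
 assumes f: "f \<in> carrier B" shows "(\<lambda>g x. c * f g x) \<in> carrier B"
proof (rule carrier_BI[of "supp f"])
 show "(\<lambda>x. c * f g x) \<in> C0_on X (U g)" if "g \<in> supp f" for g
  using that carrier_BD(2)[OF f] C0_on_cmult[OF carrier_BD(3)[OF f, of g]] by blast
qed (use carrier_BD(1,2)[OF f] in auto)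

lemma B_adj_supp: assumes "f \<in> carrier B" shows "supp (adj B f) \<subseteq> (\<lambda>g. inv g) ` supp f"
proof
 fix g assume "g \<in> supp (adj B f)"
 then obtain x where x: "adj B f g x \<noteq> 0" by blast
 then have g: "g \<in> carrier G" using B_adj_out by blast
 then have "inv g \<in> supp f" using x by (auto simp: B_adj split: if_splits)
 then show "g \<in> (\<lambda>g. inv g) ` supp f" using g by force
qed

lemma B_adj_closed:
 assumes f: "f \<in> carrier B" shows "adj B f \<in> carrier B"
proof (rule carrier_BI)
 let ?F = "(\<lambda>g. inv g) ` supp f"
 show "finite ?F" "?F \<subseteq> carrier G" using carrier_BD(1,2)[OF f] by auto
 show "adj B f g x = 0" if "g \<notin> ?F" for g x
 proof -
  have "g \<notin> supp (adj B f)" using B_adj_supp[OF f] that by blast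
  then show ?thesis by simp
 qed
 fix g assume "g \<in> ?F"
 then have g: "g \<in> carrier G" using carrier_BD(2)[OF f] by auto
 have "(\<lambda>x. cnj (f (inv g) x)) \<in> C0_on X (U (inv g))"
  using carrier_BD(3)[OF f, of "inv g"] g
  by (intro C0_onI) (auto dest: C0_onD simp: continuous_map_atin tendsto_cnj)
 moreover have "adj B f g = (\<lambda>x. if x \<in> U g then cnj (f (inv g) (tau g x)) else 0)"
  using g by (auto simp: B_adj)
 ultimately show "adj B f g \<in> C0_on X (U g)"
  using C0_pullback[OF g] by simp
qed

lemma B_mult_add_left:
 assumes f: "f \<in> carrier B" and h: "h \<in> carrier B"
 shows "(\<lambda>g x. f g x + h g x) \<star> l = (\<lambda>g x. (f \<star> l) g x + (h \<star> l) g x)"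
proof (intro ext)
 fix k x
 let ?F = "supp f \<union> supp h"
 have F: "finite ?F" "?F \<subseteq> carrier G" using carrier_BD(1,2)[OF f] carrier_BD(1,2)[OF h] by auto
 show "((\<lambda>g x. f g x + h g x) \<star> l) k x = (f \<star> l) k x + (h \<star> l) k x"
 proof (cases "k \<in> carrier G")
  case k: True
  show ?thesis
   using B_mult[OF B_add_closed[OF f h] k F(1) supp_add(2) F(2)] B_mult[OF f k F(1) _ F(2)] B_mult[OF h k F(1) _ F(2)]
   by (simp add: sum.distrib distrib_right)
 qed (simp add: B_mult_out)
qed

lemma B_mult_add_right:
 assumes l: "l \<in> carrier B"
 shows "l \<star> (\<lambda>g x. f g x + h g x) = (\<lambda>g x. (l \<star> f) g x + (l \<star> h) g x)"
proof (intro ext)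
 fix k x
 show "(l \<star> (\<lambda>g x. f g x + h g x)) k x = (l \<star> f) k x + (l \<star> h) k x"
  by (cases "k \<in> carrier G") (simp_all add: B_mult_supp[OF l _ l l] B_mult_out sum.distrib distrib_left)
qed

lemma B_mult_cmult_left:
 assumes f: "f \<in> carrier B"
 shows "(\<lambda>g x. c * f g x) \<star> l = (\<lambda>g x. c * (f \<star> l) g x)"
proof (intro ext)
 fix k x
 have s: "supp (\<lambda>g x. c * f g x) \<subseteq> supp f" by (auto simp: fun_eq_iff)
 show "((\<lambda>g x. c * f g x) \<star> l) k x = c * (f \<star> l) k x"
  by (cases "k \<in> carrier G")
    (simp_all add: B_mult[OF B_cmult_closed[OF f] _ carrier_BD(1)[OF f] s carrier_BD(2)[OF f]] B_mult_supp[OF f _ f f]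
     B_mult_out sum_distrib_left mult.assoc)
qed

lemma B_mult_cmult_right:
 assumes l: "l \<in> carrier B"
 shows "l \<star> (\<lambda>g x. c * f g x) = (\<lambda>g x. c * (l \<star> f) g x)"
proof (intro ext)
 fix k x
 show "(l \<star> (\<lambda>g x. c * f g x)) k x = c * (l \<star> f) k x"
  by (cases "k \<in> carrier G") (simp_all add: B_mult_supp[OF l _ l l] B_mult_out sum_distrib_left mult_ac)
qed

lemma indicator_C0: "(indicator (topspace X) :: 'x => complex) \<in> C0_on X (U \<one>)"
proof (rule C0_onI)
 have "continuous_map X euclidean (\<lambda>_. 1 :: complex)" by (simp add: continuous_map_const)
 then show "continuous_map X euclidean (indicator (topspace X) :: 'x => complex)"
  by (rule continuous_map_eq) simp
qed (auto simp: U_one)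

lemma single_mult_left:
 assumes g: "g \<in> carrier G" and a: "a \<in> C0_on X (U g)" and k: "k \<in> carrier G"
 shows "(single g a \<star> h) k x = a x * h (inv g \<otimes> k) (tau g x)"
proof -
 have "supp (single g a) \<subseteq> {g}" by (auto simp: single_def)
 then show ?thesis using B_mult[OF single_carrier[OF g a] k, of "{g}" h x] g by simp
qed

lemma single_mult_right:
 assumes f: "f \<in> carrier B" and g: "g \<in> carrier G" and k: "k \<in> carrier G"
 shows "(f \<star> single g a) k x = f (k \<otimes> inv g) x * a (tau (k \<otimes> inv g) x)"
proof -
 let ?F = "insert (k \<otimes> inv g) (supp f)"
 have F: "finite ?F" "?F \<subseteq> carrier G" using carrier_BD(1,2)[OF f] g k by auto
 have "(f \<star> single g a) k x = (\<Sum>m\<in>?F. f m x * single g a (inv m \<otimes> k) (tau m x))"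
  by (rule B_mult[OF f k F(1) _ F(2)]) auto
 also have "\<dots> = (\<Sum>m\<in>{k \<otimes> inv g}. f m x * single g a (inv m \<otimes> k) (tau m x))"
 proof (rule sum.mono_neutral_right[OF F(1)])
  show "\<forall>m\<in>?F - {k \<otimes> inv g}. f m x * single g a (inv m \<otimes> k) (tau m x) = 0"
  proof
   fix m assume m: "m \<in> ?F - {k \<otimes> inv g}"
   then have mc: "m \<in> carrier G" using F(2) by blast
   have "inv m \<otimes> k \<noteq> g"
   proof
    assume "inv m \<otimes> k = g"
    then have "m \<otimes> g = k" using mc k by (auto simp flip: m_assoc)
    then have "m = k \<otimes> inv g" using mc g by (metis inv_solve_right m_closed)
    then show False using m by simp
   qed
   then show "f m x * single g a (inv m \<otimes> k) (tau m x) = 0" by (simp add: single_def)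
  qed
 qed auto
 also have "\<dots> = f (k \<otimes> inv g) x * a (tau (k \<otimes> inv g) x)"
  using g k by (simp add: inv_mult_group m_assoc)
 finally show ?thesis .
qed

lemma B_one_left: assumes f: "f \<in> carrier B" shows "\<one>\<^bsub>B\<^esub> \<star> f = f"
proof (intro ext)
 fix k x show "(\<one>\<^bsub>B\<^esub> \<star> f) k x = f k x"
  using carrier_BD(4)[OF f, of k] carrier_BD(5)[OF f, of x k]
  by (cases "k \<in> carrier G"; cases "x \<in> topspace X")
    (simp_all add: B_one single_mult_left[OF _ indicator_C0] B_mult_out tau_one)
qed

lemma B_one_right: assumes f: "f \<in> carrier B" shows "f \<star> \<one>\<^bsub>B\<^esub> = f"
proof (intro ext)
 fix k x show "(f \<star> \<one>\<^bsub>B\<^esub>) k x = f k x"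
 proof (cases "k \<in> carrier G")
  case k: True
  then show ?thesis
   using carrier_BD(6)[OF f, of x k] tau_topspace[OF k, of x]
   by (cases "x \<in> U k") (simp_all add: B_one single_mult_right[OF f])
 qed (use carrier_BD(4)[OF f] in \<open>simp add: B_mult_out\<close>)
qed

lemma B_adj_adj: assumes f: "f \<in> carrier B" shows "adj B (adj B f) = f"
proof (intro ext)
 fix k x show "adj B (adj B f) k x = f k x"
 proof (cases "k \<in> carrier G")
  case k: True
  have "tau (inv k) (tau k x) = x" if "x \<in> U k"
   using act_tau[OF k that] k by (simp add: tau_def)
  then show ?thesis
   using carrier_BD(6)[OF f, of x k] tau_range[OF k, of x] k by (simp add: B_adj)
 qed (use carrier_BD(4)[OF f] in \<open>simp add: B_adj_out\<close>)
qed

lemma B_adj_mult: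
 assumes f: "f \<in> carrier B" and h: "h \<in> carrier B"
 shows "adj B (f \<star> h) = adj B h \<star> adj B f"
proof (intro ext)
 fix k x
 show "adj B (f \<star> h) k x = (adj B h \<star> adj B f) k x"
 proof (cases "k \<in> carrier G")
  case k: True
  let ?H = "(\<lambda>g. inv g) ` supp h" and ?K = "(\<otimes>) k ` supp f"
  have fin: "finite (?H \<union> ?K)" "?H \<union> ?K \<subseteq> carrier G"
   using carrier_BD(1,2)[OF f] carrier_BD(1,2)[OF h] k by auto
  have "(adj B h \<star> adj B f) k x = (\<Sum>m\<in>?H \<union> ?K. adj B h m x * adj B f (inv m \<otimes> k) (tau m x))"
   by (rule B_mult[OF B_adj_closed[OF h] k fin(1) _ fin(2)]) (use B_adj_supp[OF h] in blast)
  also have "\<dots> = (\<Sum>m\<in>?K. adj B h m x * adj B f (inv m \<otimes> k) (tau m x))"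
  proof (rule sum.mono_neutral_right[OF fin(1) Un_upper2], rule ballI)
   fix m assume m: "m \<in> (?H \<union> ?K) - ?K"
   then have mc: "m \<in> carrier G" using fin(2) by blast
   have "k \<otimes> (inv k \<otimes> m) = m" using mc k by (simp flip: m_assoc)
   then have "inv k \<otimes> m \<notin> supp f" using m imageI[of "inv k \<otimes> m" "supp f" "(\<otimes>) k"] by auto
   then show "adj B h m x * adj B f (inv m \<otimes> k) (tau m x) = 0"
    using mc k by (simp add: B_adj inv_mult_group)
  qed
  \<comment> \<open>The substitution \<open>m = k \<otimes> g\<close> pairs the terms with those of
    \<open>f \<star> h\<close> at \<open>inv k\<close>, evaluated at \<open>tau k x\<close>.\<close>
  also have "\<dots> = (\<Sum>g\<in>supp f. adj B h (k \<otimes> g) x * adj B f (inv (k \<otimes> g) \<otimes> k) (tau (k \<otimes> g) x))"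
   using carrier_BD(2)[OF f] k by (intro sum.reindex[unfolded comp_def]) (auto simp: inj_on_def subset_iff)
  also have "\<dots> = (\<Sum>g\<in>supp f. if x \<in> U k then cnj (f g (tau k x) * h (inv g \<otimes> inv k) (tau g (tau k x))) else 0)"
  proof (rule sum.cong[OF refl])
   fix g assume "g \<in> supp f"
   then have g: "g \<in> carrier G" using carrier_BD(2)[OF f] by blast
   have i1: "inv (k \<otimes> g) = inv g \<otimes> inv k" using g k by (simp add: inv_mult_group)
   have i2: "inv g \<otimes> inv k \<otimes> k = inv g" using g k by (simp add: m_assoc)
   have i3: "k \<otimes> g \<otimes> inv g = k" using g k by (simp add: m_assoc)
   show "adj B h (k \<otimes> g) x * adj B f (inv (k \<otimes> g) \<otimes> k) (tau (k \<otimes> g) x)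
     = (if x \<in> U k then cnj (f g (tau k x) * h (inv g \<otimes> inv k) (tau g (tau k x))) else 0)"
   proof (cases "x \<in> U (k \<otimes> g)")
    case xkg: True
    have iff: "tau (k \<otimes> g) x \<in> U (inv g) \<longleftrightarrow> x \<in> U k"
     using tau_mem_iff[of "k \<otimes> g" "inv g" x] xkg g k i3 by simp
    show ?thesis
    proof (cases "x \<in> U k")
     case xk: True
     then have tg: "tau k x \<in> U g" using tau_mem_iff[OF k g xk] xkg by simp
     have t1: "tau (k \<otimes> g) x = tau g (tau k x)" using tau_comp(2)[OF k g xk tg] .
     have "tau (inv g) (tau (k \<otimes> g) x) = tau k x"
      using tau_comp(2)[of "k \<otimes> g" "inv g" x] xkg iff xk g k i3 by simp
     then show ?thesis using xkg xk iff g k t1 by (simp add: B_adj i1 i2)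
    qed (use xkg iff g k in \<open>simp add: B_adj i1 i2\<close>)
   next
    case False
    then have "f g (tau k x) = 0" if "x \<in> U k" using tau_mem_iff[OF k g that] carrier_BD(6)[OF f] by simp
    then show ?thesis using False g k by (simp add: B_adj)
   qed
  qed
  also have "\<dots> = adj B (f \<star> h) k x"
   using k by (simp add: B_adj B_mult_supp[OF f _ f f])
  finally show ?thesis by simp
 qed (simp add: B_adj_out B_mult_out)
qed

lemma B_adj_add: "adj B (\<lambda>g x. f g x + h g x) = (\<lambda>g x. adj B f g x + adj B h g x)"
proof (intro ext)
 fix k x show "adj B (\<lambda>g x. f g x + h g x) k x = adj B f k x + adj B h k x"
  by (cases "k \<in> carrier G") (simp_all add: B_adj B_adj_out)
qed

lemma B_adj_cmult: "adj B (\<lambda>g x. c * f g x) = (\<lambda>g x. cnj c * adj B f g x)"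
proof (intro ext)
 fix k x show "adj B (\<lambda>g x. c * f g x) k x = cnj c * adj B f k x"
  by (cases "k \<in> carrier G") (simp_all add: B_adj B_adj_out)
qed

lemma B_star_alg: "star_alg B"
proof (rule star_algI)
 show "ring B"
 proof (rule ring_axiomsI)
  show "\<exists>y\<in>carrier B. y \<uplus> x = \<zero>\<^bsub>B\<^esub>" if "x \<in> carrier B" for x
   using B_cmult_closed[OF that, of "-1"] by (intro bexI[of _ "\<lambda>g y. -1 * x g y"]) (auto simp: B_simps)
  show "\<zero>\<^bsub>B\<^esub> \<in> carrier B" by (rule carrier_BI[of "{}"]) (auto simp: B_simps)
  show "\<one>\<^bsub>B\<^esub> \<in> carrier B" unfolding B_one by (rule single_carrier[OF one_closed indicator_C0])
 qed (simp_all add: B_simps B_add_closed B_mult_closed B_mult_assoc B_one_left B_one_right B_mult_add_left B_mult_add_right add_ac)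
qed (simp_all add: B_simps B_cmult_closed B_mult_cmult_left B_mult_cmult_right B_adj_closed B_adj_adj B_adj_mult B_adj_add B_adj_cmult
  algebra_simps)

end


section \<open>Seminorms from positive functionals\<close>

text \<open>The C*-identity passes to suprema since squaring is monotone on nonnegative numbers.
  Boundedness is needed for the real \<open>SUP\<close> to be a supremum at all.\<close>

lemma (in star_alg) sup_cstar_seminorm:
 assumes ne: "S \<noteq> {}" and S: "!!q. q \<in> S ==> cstar_seminorm A q"
  and bdd: "!!a. a \<in> carrier A ==> bdd_above ((\<lambda>q. q a) ` S)"
 shows "cstar_seminorm A (\<lambda>a. SUP q\<in>S. q a)"
proof -
 let ?p = "\<lambda>a. SUP q\<in>S. q a"
 have le: "q a \<le> ?p a" if "q \<in> S" "a \<in> carrier A" for q a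
  using that bdd by (intro cSUP_upper) auto
 have least: "?p a \<le> c" if "!!q. q \<in> S ==> q a \<le> c" for a c
  using that ne by (intro cSUP_least) auto
 have q: "cstar_seminormed A q" if "q \<in> S" for q
  using S[OF that] by unfold_locales
 obtain q0 where q0: "q0 \<in> S" using ne by blast
 have nonneg: "0 \<le> ?p a" if "a \<in> carrier A" for a
  using le[OF q0 that] cstar_seminormed.q_nonneg[OF q[OF q0] that] by linarith
 show ?thesis
 proof (rule cstar_seminormI)
  fix a assume a: "a \<in> carrier A"
  show "0 \<le> ?p a" using nonneg[OF a] .
  have cs: "?p (cscale A c b) \<le> cmod c * ?p b" if "b \<in> carrier A" for c b
  proof (rule least)
   fix r assume r: "r \<in> S"
   show "r (cscale A c b) \<le> cmod c * ?p b"
    using cstar_seminormed.q_cscale[OF q[OF r] that] le[OF r that] by (simp add: mult_left_mono)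
  qed
  show "?p (cscale A c a) = cmod c * ?p a" for c
  proof (cases "c = 0")
   case True
   then show ?thesis using cs[OF a, of 0] nonneg[of \<zero>] a by simp
  next
   case False
   have "?p a \<le> cmod (1 / c) * ?p (cscale A c a)"
    using cs[of "cscale A c a" "1 / c"] a False by simp
   then have "cmod c * ?p a \<le> ?p (cscale A c a)" using False by (simp add: norm_divide field_simps)
   then show ?thesis using cs[OF a, of c] by simp
  qed
  show "?p (adj A a \<otimes> a) = (?p a)\<^sup>2"
  proof (rule antisym)
   show "?p (adj A a \<otimes> a) \<le> (?p a)\<^sup>2"
   proof (rule least)
    fix r assume r: "r \<in> S"
    show "r (adj A a \<otimes> a) \<le> (?p a)\<^sup>2"
     using cstar_seminormed.q_cstar[OF q[OF r] a] cstar_seminormed.q_nonneg[OF q[OF r] a] le[OF r a]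
     by (simp add: power_mono)
   qed
   have "?p a \<le> sqrt (?p (adj A a \<otimes> a))"
   proof (rule least)
    fix q assume qS: "q \<in> S"
    have "(q a)\<^sup>2 \<le> ?p (adj A a \<otimes> a)"
     using le[OF qS, of "adj A a \<otimes> a"] cstar_seminormed.q_cstar[OF q[OF qS] a] a by simp
    then show "q a \<le> sqrt (?p (adj A a \<otimes> a))" by (rule real_le_rsqrt)
   qed
   then have "(?p a)\<^sup>2 \<le> (sqrt (?p (adj A a \<otimes> a)))\<^sup>2" using nonneg[OF a] by (intro power_mono) auto
   then show "(?p a)\<^sup>2 \<le> ?p (adj A a \<otimes> a)" using nonneg[of "adj A a \<otimes> a"] a by simp
  qed
  fix b assume b: "b \<in> carrier A"
  show "?p (a \<oplus> b) \<le> ?p a + ?p b"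
  proof (rule least)
   fix r assume r: "r \<in> S"
   show "r (a \<oplus> b) \<le> ?p a + ?p b"
    using cstar_seminormed.q_add[OF q[OF r] a b] le[OF r a] le[OF r b] by simp
  qed
  show "?p (a \<otimes> b) \<le> ?p a * ?p b"
  proof (rule least)
   fix r assume r: "r \<in> S"
   have "r (a \<otimes> b) \<le> r a * r b" using cstar_seminormed.q_mult[OF q[OF r] a b] .
   also have "\<dots> \<le> ?p a * ?p b"
    using cstar_seminormed.q_nonneg[OF q[OF r]] le[OF r] a b nonneg by (intro mult_mono) auto
   finally show "r (a \<otimes> b) \<le> ?p a * ?p b" .
  qed
 qed
qed

locale positive_functional = star_alg +
 fixes \<phi> :: "'a => complex"
 assumes phi_add: "[|a \<in> carrier A; b \<in> carrier A|] ==> \<phi> (a \<oplus> b) = \<phi> a + \<phi> b"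
  and phi_cscale: "a \<in> carrier A ==> \<phi> (cscale A c a) = c * \<phi> a"
  and phi_Im: "a \<in> carrier A ==> Im (\<phi> (adj A a \<otimes> a)) = 0"
  and phi_Re: "a \<in> carrier A ==> 0 \<le> Re (\<phi> (adj A a \<otimes> a))"
begin

text \<open>The GNS seminorm of the functional; no Hilbert space is formed from it.\<close>

definition nn :: "'a => real" where "nn a = sqrt (Re (\<phi> (adj A a \<otimes> a)))"

lemma nn_nonneg [simp]: "a \<in> carrier A ==> 0 \<le> nn a"
 by (simp add: nn_def phi_Re)

lemma nn_sq: "a \<in> carrier A ==> \<phi> (adj A a \<otimes> a) = of_real ((nn a)\<^sup>2)"
 by (simp add: nn_def phi_Re phi_Im complex_eq_iff)

lemma phi_expand:
 assumes "a \<in> carrier A" "b \<in> carrier A"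
 shows "\<phi> (adj A (a \<oplus> cscale A c b) \<otimes> (a \<oplus> cscale A c b))
   = \<phi> (adj A a \<otimes> a) + c * \<phi> (adj A a \<otimes> b) + cnj c * \<phi> (adj A b \<otimes> a) + cnj c * c * \<phi> (adj A b \<otimes> b)"
proof -
 have "adj A (a \<oplus> cscale A c b) \<otimes> (a \<oplus> cscale A c b)
   = (adj A a \<otimes> a \<oplus> cscale A c (adj A a \<otimes> b)) \<oplus> (cscale A (cnj c) (adj A b \<otimes> a) \<oplus> cscale A (cnj c * c) (adj A b \<otimes> b))"
  using assms by (simp add: adj_add adj_cscale l_distr r_distr mult_cscale_left mult_cscale_right cscale_add_right a_ac mult.commute)
 then show ?thesis using assms by (simp add: phi_add phi_cscale)
qed

text \<open>Polarisation: positivity makes the expanded form real at \<open>c = 1\<close> and at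
  \<open>c = \<i>\<close>, which determines imaginary and real part of the coefficient.\<close>

lemma phi_hermitian:
 assumes "a \<in> carrier A" "b \<in> carrier A" shows "\<phi> (adj A b \<otimes> a) = cnj (\<phi> (adj A a \<otimes> b))"
proof -
 have "Im (\<phi> (adj A (a \<oplus> cscale A c b) \<otimes> (a \<oplus> cscale A c b))) = 0" for c
  using assms by (intro phi_Im) auto
 from this[of 1] this[of \<i>] show ?thesis
  unfolding phi_expand[OF assms] using assms by (simp add: complex_eq_iff phi_Im)
qed

lemma cauchy_schwarz:
 assumes a: "a \<in> carrier A" and b: "b \<in> carrier A"
 shows "cmod (\<phi> (adj A a \<otimes> b)) \<le> nn a * nn b"
proof -
 define z where "z = \<phi> (adj A a \<otimes> b)"
 have pos: "0 \<le> (nn a)\<^sup>2 - 2 * s * (cmod z)\<^sup>2 + s\<^sup>2 * (cmod z)\<^sup>2 * (nn b)\<^sup>2" for s :: real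
 proof -
  \<comment> \<open>The factor \<open>cnj z\<close> absorbs the phase of \<open>z\<close> and leaves
    a real polynomial in \<open>s\<close>, quadratic unless \<open>nn b\<close> or \<open>z\<close>
    vanishes.\<close>
  define c where "c = - complex_of_real s * cnj z"
  have zz: "c * z = - of_real (s * (cmod z)\<^sup>2)" "cnj c * cnj z = - of_real (s * (cmod z)\<^sup>2)" "cnj c * c = of_real (s\<^sup>2 * (cmod z)\<^sup>2)"
   using complex_norm_square[of z] by (simp_all add: c_def mult_ac power2_eq_square)
  have "\<phi> (adj A (a \<oplus> cscale A c b) \<otimes> (a \<oplus> cscale A c b))
    = of_real ((nn a)\<^sup>2) + c * z + cnj c * cnj z + (cnj c * c) * of_real ((nn b)\<^sup>2)"
   unfolding phi_expand[OF a b] z_def phi_hermitian[OF a b] using a b by (simp add: nn_sq)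
  then have "\<phi> (adj A (a \<oplus> cscale A c b) \<otimes> (a \<oplus> cscale A c b))
    = of_real ((nn a)\<^sup>2 - 2 * s * (cmod z)\<^sup>2 + s\<^sup>2 * (cmod z)\<^sup>2 * (nn b)\<^sup>2)"
   unfolding zz by simp
  then show ?thesis using phi_Re[of "a \<oplus> cscale A c b"] a b by simp
 qed
 have "(cmod z)\<^sup>2 \<le> (nn a)\<^sup>2 * (nn b)\<^sup>2"
 proof (cases "nn b = 0")
  case True
  show ?thesis
  proof (rule ccontr)
   assume "\<not> ?thesis"
   then have z: "(cmod z)\<^sup>2 > 0" using True by simp
   \<comment> \<open>When \<open>nn b = 0\<close> the polynomial is affine in \<open>s\<close>, and
     this value of \<open>s\<close> takes it to \<open>- (nn a)^2 - 2\<close>, which is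
     negative.\<close>
   have "0 \<le> (nn a)\<^sup>2 - 2 * (((nn a)\<^sup>2 + 1) / (cmod z)\<^sup>2) * (cmod z)\<^sup>2"
    using pos[of "((nn a)\<^sup>2 + 1) / (cmod z)\<^sup>2"] True by simp
   then have "(nn a)\<^sup>2 + 2 \<le> 0" using z by simp
   then show False using zero_le_power2[of "nn a"] by linarith
  qed
 next
  case False
  then have nb: "(nn b)\<^sup>2 > 0" by simp
  have "0 \<le> (nn a)\<^sup>2 - (cmod z)\<^sup>2 / (nn b)\<^sup>2"
   using pos[of "1 / (nn b)\<^sup>2"] nb False by (simp add: power2_eq_square)
  then show ?thesis using nb by (simp add: field_simps)
 qed
 then have "(cmod z)\<^sup>2 \<le> (nn a * nn b)\<^sup>2" by (simp add: power_mult_distrib)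
 then show ?thesis unfolding z_def using a b by (auto intro: power2_le_imp_le)
qed

lemma nn_add:
 assumes a: "a \<in> carrier A" and b: "b \<in> carrier A" shows "nn (a \<oplus> b) \<le> nn a + nn b"
proof -
 have "of_real ((nn (a \<oplus> b))\<^sup>2) = of_real ((nn a)\<^sup>2) + \<phi> (adj A a \<otimes> b) + cnj (\<phi> (adj A a \<otimes> b)) + of_real ((nn b)\<^sup>2)"
  using phi_expand[OF a b, of 1] a b phi_hermitian[OF a b] by (simp add: nn_sq)
 then have "(nn (a \<oplus> b))\<^sup>2 = (nn a)\<^sup>2 + 2 * Re (\<phi> (adj A a \<otimes> b)) + (nn b)\<^sup>2"
  by (simp add: complex_eq_iff)
 also have "\<dots> \<le> (nn a)\<^sup>2 + 2 * (nn a * nn b) + (nn b)\<^sup>2"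
  using cauchy_schwarz[OF a b] complex_Re_le_cmod[of "\<phi> (adj A a \<otimes> b)"] by simp
 also have "\<dots> = (nn a + nn b)\<^sup>2" by (simp add: power2_sum)
 finally show ?thesis using a b by (auto intro: power2_le_imp_le)
qed

lemma nn_cscale: "a \<in> carrier A ==> nn (cscale A c a) = cmod c * nn a"
proof -
 assume a: "a \<in> carrier A"
 have "adj A (cscale A c a) \<otimes> cscale A c a = cscale A (of_real ((cmod c)\<^sup>2)) (adj A a \<otimes> a)"
  using a complex_norm_square[of c] by (simp add: adj_cscale mult_cscale_left mult_cscale_right mult_ac)
 then have "of_real ((nn (cscale A c a))\<^sup>2) = (of_real ((cmod c * nn a)\<^sup>2) :: complex)"
  using a nn_sq[of "cscale A c a"] by (simp add: phi_cscale nn_sq power_mult_distrib)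
 then have "(nn (cscale A c a))\<^sup>2 = (cmod c * nn a)\<^sup>2" by (simp only: of_real_eq_iff)
 then show ?thesis using a by (auto intro: power2_eq_imp_eq)
qed

lemma cmod_phi_adj_mult: "a \<in> carrier A ==> cmod (\<phi> (adj A a \<otimes> a)) = (nn a)\<^sup>2"
 by (simp add: nn_sq norm_power)

end

text \<open>Together with \<open>gns_seminorm\<close> this copies the shape of
  \<open>hilbmod_norm\<close> and \<open>reduced_norm\<close>, so that one abstract argument serves
  both the reduced norm and the representation on orbits.\<close>

definition gns_norm :: "('a, 'm) star_ring_scheme => ('i => 'a => complex) => 'i set => 'a => real" where
 "gns_norm A \<phi> I z = sqrt (SUP i\<in>I. cmod (\<phi> i (adj A z \<otimes>\<^bsub>A\<^esub> z)))"

definition gns_seminorm :: "('a, 'm) star_ring_scheme => ('i => 'a => complex) => 'i set => 'a => real" where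
 "gns_seminorm A \<phi> I a = (SUP z\<in>{z \<in> carrier A. gns_norm A \<phi> I z \<le> 1}. gns_norm A \<phi> I (a \<otimes>\<^bsub>A\<^esub> z))"

text \<open>The function \<open>K\<close> bounds left multiplication uniformly in \<open>i\<close>;
  it keeps the suprema in \<open>gns_norm\<close> and \<open>gns_seminorm\<close> bounded.\<close>

locale positive_family = star_alg +
 fixes \<phi> :: "'i => 'a => complex" and I :: "'i set" and K :: "'a => real"
 assumes nonempty_I: "I \<noteq> {}" and phi: "i \<in> I ==> positive_functional A (\<phi> i)"
  and phi_one: "i \<in> I ==> \<phi> i \<one> = 1"
  and K_bound: "[|i \<in> I; a \<in> carrier A; z \<in> carrier A|] ==>
    positive_functional.nn A (\<phi> i) (a \<otimes> z) \<le> K a * positive_functional.nn A (\<phi> i) z"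
begin

abbreviation "ni i \<equiv> positive_functional.nn A (\<phi> i)"
abbreviation "NN \<equiv> gns_norm A \<phi> I"
abbreviation "PP \<equiv> gns_seminorm A \<phi> I"

lemma ni_one: "i \<in> I ==> ni i \<one> = 1"
 by (simp add: positive_functional.nn_def[OF phi] phi_one)

lemma ni_le_K: "[|i \<in> I; a \<in> carrier A|] ==> ni i a \<le> K a"
 using K_bound[of i a \<one>] by (simp add: ni_one)

lemma ni_nonneg: "[|i \<in> I; a \<in> carrier A|] ==> 0 \<le> ni i a"
 by (rule positive_functional.nn_nonneg[OF phi])

lemma K_nonneg: "a \<in> carrier A ==> 0 \<le> K a"
 using ni_le_K ni_nonneg nonempty_I by (metis ex_in_conv order_trans)

lemma NN_alt: "z \<in> carrier A ==> NN z = sqrt (SUP i\<in>I. (ni i z)\<^sup>2)"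
 unfolding gns_norm_def by (simp add: positive_functional.cmod_phi_adj_mult[OF phi] cong: SUP_cong_simp)

lemma ni_le_NN: assumes "i \<in> I" "z \<in> carrier A" shows "ni i z \<le> NN z"
proof -
 have "(ni j z)\<^sup>2 \<le> (K z)\<^sup>2" if "j \<in> I" for j
  using ni_le_K[OF that assms(2)] ni_nonneg[OF that assms(2)] by (rule power_mono)
 then have "(ni i z)\<^sup>2 \<le> (SUP i\<in>I. (ni i z)\<^sup>2)"
  using assms(1) by (intro cSUP_upper) (auto intro: bdd_aboveI2[of _ _ "(K z)\<^sup>2"])
 then show ?thesis using assms by (simp add: NN_alt real_le_rsqrt)
qed

lemma NN_le: assumes "z \<in> carrier A" "0 \<le> c" "!!i. i \<in> I ==> ni i z \<le> c" shows "NN z \<le> c"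
proof -
 have "(SUP i\<in>I. (ni i z)\<^sup>2) \<le> c\<^sup>2"
  using assms ni_nonneg nonempty_I by (intro cSUP_least) (auto intro: power_mono)
 then show ?thesis using assms by (simp add: NN_alt real_le_lsqrt)
qed

lemma NN_nonneg: "z \<in> carrier A ==> 0 \<le> NN z"
 using ni_le_NN ni_nonneg nonempty_I by (metis ex_in_conv order_trans)

lemma NN_add: "[|z \<in> carrier A; v \<in> carrier A|] ==> NN (z \<oplus> v) \<le> NN z + NN v"
 by (rule NN_le) (auto simp: NN_nonneg intro: order_trans[OF positive_functional.nn_add[OF phi]] add_mono ni_le_NN)

lemma NN_cscale_le: "z \<in> carrier A ==> NN (cscale A c z) \<le> cmod c * NN z"
 by (rule NN_le) (auto simp: NN_nonneg positive_functional.nn_cscale[OF phi] ni_le_NN mult_left_mono)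

lemma NN_mult_K: "[|a \<in> carrier A; z \<in> carrier A|] ==> NN (a \<otimes> z) \<le> K a * NN z"
proof (rule NN_le)
 fix i assume a: "a \<in> carrier A" and x: "z \<in> carrier A" and i: "i \<in> I"
 have "ni i (a \<otimes> z) \<le> K a * ni i z" using K_bound[OF i a x] .
 also have "\<dots> \<le> K a * NN z" using ni_le_NN[OF i x] K_nonneg[OF a] by (rule mult_left_mono)
 finally show "ni i (a \<otimes> z) \<le> K a * NN z" .
qed (auto simp: NN_nonneg K_nonneg)

lemma NN_one: "NN \<one> \<le> 1"
 by (rule NN_le) (auto simp: ni_one)

lemma PP_bdd: "a \<in> carrier A ==> bdd_above ((\<lambda>z. NN (a \<otimes> z)) ` {z \<in> carrier A. NN z \<le> 1})"
 by (rule bdd_aboveI2[of _ _ "K a"])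
   (auto intro!: order_trans[OF NN_mult_K] mult_left_le simp: K_nonneg)

lemma NN_le_PP: assumes a: "a \<in> carrier A" and x: "z \<in> carrier A" shows "NN (a \<otimes> z) \<le> PP a * NN z"
proof (cases "NN z = 0")
 case True
 then show ?thesis using NN_mult_K[OF a x] by simp
next
 case False
 then have pos: "NN z > 0" using NN_nonneg[OF x] by simp
 let ?c = "complex_of_real (1 / NN z)"
 have "NN (cscale A ?c z) \<le> 1" using NN_cscale_le[OF x, of ?c] pos by (simp add: norm_divide)
 then have "NN (a \<otimes> cscale A ?c z) \<le> PP a"
  unfolding gns_seminorm_def using x by (intro cSUP_upper PP_bdd[OF a]) auto
 moreover have "NN (a \<otimes> z) \<le> cmod (of_real (NN z)) * NN (a \<otimes> cscale A ?c z)"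
  using NN_cscale_le[of "a \<otimes> cscale A ?c z" "of_real (NN z)"] a x False by (simp add: mult_cscale_right)
 ultimately show ?thesis using pos by (smt (verit) mult.commute mult_left_mono norm_of_real)
qed

lemma PP_le: assumes "a \<in> carrier A" "0 \<le> c" "!!z. z \<in> carrier A ==> NN z \<le> 1 ==> NN (a \<otimes> z) \<le> c" shows "PP a \<le> c"
 unfolding gns_seminorm_def
proof (rule cSUP_least)
 show "{z \<in> carrier A. NN z \<le> 1} \<noteq> {}" using NN_one by blast
qed (use assms in auto)

lemma NN_le_PP_self: "a \<in> carrier A ==> NN a \<le> PP a"
 unfolding gns_seminorm_def using NN_one PP_bdd[of a] cSUP_upper[of \<one> "{z \<in> carrier A. NN z \<le> 1}" "\<lambda>z. NN (a \<otimes> z)"] by simp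

lemma PP_nonneg: "a \<in> carrier A ==> 0 \<le> PP a"
 using NN_le_PP_self NN_nonneg order_trans by blast

lemma PP_cscale_le: "a \<in> carrier A ==> PP (cscale A c a) \<le> cmod c * PP a"
proof (rule PP_le)
 fix z assume a: "a \<in> carrier A" and x: "z \<in> carrier A" "NN z \<le> 1"
 have "NN (cscale A c a \<otimes> z) \<le> cmod c * NN (a \<otimes> z)" using NN_cscale_le[of "a \<otimes> z" c] a x by (simp add: mult_cscale_left)
 also have "NN (a \<otimes> z) \<le> PP a * 1" using NN_le_PP[OF a x(1)] mult_left_mono[OF x(2) PP_nonneg[OF a]] by simp
 finally show "NN (cscale A c a \<otimes> z) \<le> cmod c * PP a" by (simp add: mult_left_mono)
qed (auto simp: PP_nonneg)

lemma PP_mult: assumes a: "a \<in> carrier A" and b: "b \<in> carrier A" shows "PP (a \<otimes> b) \<le> PP a * PP b"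
proof (rule PP_le)
 fix z assume x: "z \<in> carrier A" "NN z \<le> 1"
 have "NN (a \<otimes> b \<otimes> z) \<le> PP a * NN (b \<otimes> z)" using NN_le_PP[OF a, of "b \<otimes> z"] a b x by (simp add: m_assoc)
 also have "\<dots> \<le> PP a * (PP b * NN z)" using NN_le_PP[OF b x(1)] PP_nonneg[OF a] by (rule mult_left_mono)
 also have "\<dots> \<le> PP a * (PP b * 1)" using x PP_nonneg[OF a] PP_nonneg[OF b] by (intro mult_left_mono) auto
 finally show "NN (a \<otimes> b \<otimes> z) \<le> PP a * PP b" by simp
qed (use a b PP_nonneg in auto)

text \<open>For each functional, the square of the seminorm of \<open>a z\<close> is the pairing of
  \<open>z\<close> with \<open>a* a z\<close>; Cauchy-Schwarz bounds it by the seminorms of these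
  two. This is the nontrivial half of the C*-identity, the other being submultiplicativity.\<close>

lemma PP_sq_le: assumes a: "a \<in> carrier A" shows "(PP a)\<^sup>2 \<le> PP (adj A a \<otimes> a)"
proof -
 let ?b = "adj A a \<otimes> a"
 have b: "?b \<in> carrier A" using a by simp
 have "PP a \<le> sqrt (PP ?b)"
 proof (rule PP_le[OF a])
  fix z assume x: "z \<in> carrier A" "NN z \<le> 1"
  show "NN (a \<otimes> z) \<le> sqrt (PP ?b)"
  proof (rule NN_le)
   fix i assume i: "i \<in> I"
   interpret i: positive_functional A "\<phi> i" by (rule phi[OF i])
   have "(ni i (a \<otimes> z))\<^sup>2 = cmod (\<phi> i (adj A z \<otimes> (?b \<otimes> z)))"
    using i.cmod_phi_adj_mult[of "a \<otimes> z"] a x by (simp add: adj_mult m_assoc)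
   also have "\<dots> \<le> ni i z * ni i (?b \<otimes> z)" using a x by (intro i.cauchy_schwarz) auto
   also have "\<dots> \<le> 1 * (PP ?b * 1)"
   proof (rule mult_mono)
    show "ni i z \<le> 1" using ni_le_NN[OF i x(1)] x(2) by simp
    have "ni i (?b \<otimes> z) \<le> PP ?b * NN z" using ni_le_NN[OF i, of "?b \<otimes> z"] NN_le_PP[OF b x(1)] b x by simp
    also have "\<dots> \<le> PP ?b * 1" using x PP_nonneg[OF b] by (intro mult_left_mono) auto
    finally show "ni i (?b \<otimes> z) \<le> PP ?b * 1" .
   qed (use ni_nonneg[OF i] b x in auto)
   finally show "ni i (a \<otimes> z) \<le> sqrt (PP ?b)" by (simp add: real_le_rsqrt)
  qed (use a x PP_nonneg[OF b] in auto)
 qed (simp add: PP_nonneg[OF b])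
 then have "(PP a)\<^sup>2 \<le> (sqrt (PP ?b))\<^sup>2" using PP_nonneg[OF a] by (rule power_mono)
 then show ?thesis using PP_nonneg[OF b] by simp
qed

lemma PP_adj_le: assumes a: "a \<in> carrier A" shows "PP a \<le> PP (adj A a)"
proof (cases "PP a = 0")
 case False
 then have pos: "PP a > 0" using PP_nonneg[OF a] by simp
 have "PP a * PP a \<le> PP (adj A a) * PP a"
  using PP_sq_le[OF a] PP_mult[of "adj A a" a] a by (simp add: power2_eq_square)
 then show ?thesis using pos by simp
qed (use PP_nonneg a in simp)

lemma PP_cstar_seminorm: "cstar_seminorm A PP"
proof (rule cstar_seminormI)
 fix a assume a: "a \<in> carrier A"
 show "0 \<le> PP a" using PP_nonneg[OF a] .
 show "PP (cscale A c a) = cmod c * PP a" for c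
 proof (cases "c = 0")
  case True
  then show ?thesis using PP_cscale_le[OF a, of 0] PP_nonneg[of \<zero>] a by simp
 next
  case False
  have "PP a \<le> cmod (1 / c) * PP (cscale A c a)"
   using PP_cscale_le[of "cscale A c a" "1 / c"] a False by simp
  then have "cmod c * PP a \<le> PP (cscale A c a)" using False by (simp add: norm_divide field_simps)
  then show ?thesis using PP_cscale_le[OF a, of c] by simp
 qed
 have "PP (adj A a) = PP a" using PP_adj_le[OF a] PP_adj_le[of "adj A a"] a by simp
 then show "PP (adj A a \<otimes> a) = (PP a)\<^sup>2"
  using PP_sq_le[OF a] PP_mult[of "adj A a" a] a by (simp add: power2_eq_square)
 fix b assume b: "b \<in> carrier A"
 show "PP (a \<otimes> b) \<le> PP a * PP b" by (rule PP_mult[OF a b])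
 show "PP (a \<oplus> b) \<le> PP a + PP b"
 proof (rule PP_le)
  fix z assume x: "z \<in> carrier A" "NN z \<le> 1"
  have "NN ((a \<oplus> b) \<otimes> z) \<le> NN (a \<otimes> z) + NN (b \<otimes> z)" using a b x NN_add by (simp add: l_distr)
  also have "\<dots> \<le> PP a * NN z + PP b * NN z" using a b x by (intro add_mono NN_le_PP) auto
  also have "\<dots> \<le> PP a * 1 + PP b * 1" using a b x PP_nonneg by (intro add_mono mult_left_mono) auto
  finally show "NN ((a \<oplus> b) \<otimes> z) \<le> PP a + PP b" by simp
 qed (use a b PP_nonneg in auto)
qed

end

text \<open>A real function \<open>h\<close> with \<open>\<bar>h\<bar> \<le> 1\<close> is the real part of the unitary \<open>h + \<i> sqrt (1 - h\<^sup>2)\<close>.\<close>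

lemma function_cstar_seminorm_le:
 fixes N :: "('y => complex) => real"
 assumes sq: "!!f. f \<in> S ==> N (\<lambda>y. cnj (f y) * f y) = (N f)\<^sup>2"
  and nonneg: "!!f. f \<in> S ==> 0 \<le> N f"
  and half: "!!f g. [|f \<in> S; g \<in> S|] ==> N (\<lambda>y. (f y + g y) / 2) \<le> (N f + N g) / 2"
  and funct: "!!f k. [|f \<in> S; continuous_on UNIV k|] ==> (\<lambda>y. if y \<in> Y then k (f y) else 0) \<in> S"
  and one: "N (indicator Y) \<le> 1"
  and f: "f \<in> S" "!!y. y \<notin> Y ==> f y = 0" "!!y. cmod (f y) \<le> 1"
 shows "N f \<le> 1"
proof -
 \<comment> \<open>The unitary trick with \<open>h = |z|^2\<close>: on the unit disc
   \<open>u z\<close> has modulus 1 and real part \<open>|z|^2\<close>. It is applied to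
   \<open>cnj f * f\<close>, and the C*-identity leads back to \<open>f\<close>, which need not be
   real.\<close>
 define u where "u z = complex_of_real ((cmod z)\<^sup>2) + \<i> * of_real (sqrt (max 0 (1 - ((cmod z)\<^sup>2)\<^sup>2)))" for z
 have u: "continuous_on UNIV u" "continuous_on UNIV (\<lambda>z. cnj (u z))"
  unfolding u_def by (intro continuous_intros)+
 define v where "v y = (if y \<in> Y then u (f y) else 0)" for y
 define v' where "v' y = (if y \<in> Y then cnj (u (f y)) else 0)" for y
 have vS: "v \<in> S" "v' \<in> S"
  using funct[OF f(1) u(1)] funct[OF f(1) u(2)] by (simp_all add: v_def[abs_def] v'_def[abs_def])
 have uu: "cnj (u z) * u z = 1" "u z * cnj (u z) = 1" "u z + cnj (u z) = 2 * of_real ((cmod z)\<^sup>2)" if "cmod z \<le> 1" for z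
 proof -
  have "((cmod z)\<^sup>2)\<^sup>2 \<le> 1" using that by (simp add: power_le_one)
  then have "(Re (u z))\<^sup>2 + (Im (u z))\<^sup>2 = 1" by (simp add: u_def)
  then show "cnj (u z) * u z = 1" "u z * cnj (u z) = 1"
   by (simp_all add: complex_eq_iff power2_eq_square)
  show "u z + cnj (u z) = 2 * of_real ((cmod z)\<^sup>2)" by (simp add: u_def complex_eq_iff)
 qed
 have "(\<lambda>y. cnj (v y) * v y) = indicator Y" "(\<lambda>y. cnj (v' y) * v' y) = indicator Y"
  using uu f(3) by (auto simp: v_def v'_def fun_eq_iff)
 then have "(N v)\<^sup>2 \<le> 1" "(N v')\<^sup>2 \<le> 1" using sq[OF vS(1)] sq[OF vS(2)] one by simp_all
 then have "N v \<le> 1" "N v' \<le> 1" using nonneg vS by (simp_all add: power_le_one_iff)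
 have "(\<lambda>y. cnj (f y) * f y) = (\<lambda>y. (v y + v' y) / 2)"
 proof
  fix y show "cnj (f y) * f y = (v y + v' y) / 2"
   using uu(3)[OF f(3)[of y]] f(2)[of y] complex_norm_square[of "f y"]
   by (cases "y \<in> Y") (simp_all add: v_def v'_def mult.commute)
 qed
 then have "(N f)\<^sup>2 \<le> (N v + N v') / 2" using sq[OF f(1)] half[OF vS] by simp
 also have "\<dots> \<le> 1" using \<open>N v \<le> 1\<close> \<open>N v' \<le> 1\<close> by simp
 finally show ?thesis using nonneg[OF f(1)] by (simp add: power_le_one_iff)
qed



section \<open>Full and reduced norms of a partial crossed product\<close>

context partial_system
begin

sublocale B: star_alg B by (rule B_star_alg)

lemma sup_norm_upper:
 assumes "continuous_map X euclidean f" "x \<in> topspace X" shows "cmod (f x) \<le> sup_norm X f"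
proof -
 obtain M where "!!x. x \<in> topspace X ==> cmod (f x) \<le> M" using C0_bounded[OF assms(1)] by blast
 then have "bdd_above ((\<lambda>x. cmod (f x)) ` topspace X)" by (rule bdd_aboveI2)
 then show ?thesis unfolding sup_norm_def by (rule cSUP_upper[OF assms(2)])
qed

lemma sup_norm_least: "(!!x. x \<in> topspace X ==> cmod (f x) \<le> c) ==> sup_norm X f \<le> c"
 unfolding sup_norm_def using nonempty by (intro cSUP_least) auto

lemma sup_norm_nonneg: "continuous_map X euclidean f ==> 0 \<le> sup_norm X f"
proof -
 assume f: "continuous_map X euclidean f"
 obtain x where "x \<in> topspace X" using nonempty by blast
 from order_trans[OF norm_ge_zero sup_norm_upper[OF f this]] show ?thesis .
qed

lemma sup_norm_zero [simp]: "sup_norm X (\<lambda>_. 0) = 0"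
 using nonempty by (simp add: sup_norm_def)

lemma C0_upper: "a \<in> C0_on X V ==> cmod (a x) \<le> sup_norm X a"
 using sup_norm_upper[OF C0_onD(1), of a V x] sup_norm_nonneg[OF C0_onD(1), of a V] C0_onD(3)[of a X V x]
 by (cases "x \<in> topspace X") auto

lemma carrier_upper: "f \<in> carrier B ==> cmod (f g x) \<le> sup_norm X (f g)"
 using C0_upper[OF carrier_BD(3)] carrier_BD(4) by (cases "g \<in> carrier G") auto

lemma carrier_sup_nonneg: "f \<in> carrier B ==> 0 \<le> sup_norm X (f g)"
 using carrier_upper[of f g undefined] norm_ge_zero order_trans by blast

text \<open>The norm of the l1-sum of the spaces \<open>C0 (U g)\<close>. It dominates every
  C*-seminorm of \<open>B\<close>, which makes the supremum in \<open>full_norm\<close> finite, and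
  density arguments are carried out in it.\<close>

definition l1 :: "('g => 'x => complex) => real" where
 "l1 f = (\<Sum>g\<in>supp f. sup_norm X (f g))"

lemma l1_eq:
 assumes "finite F" "supp f \<subseteq> F" shows "l1 f = (\<Sum>g\<in>F. sup_norm X (f g))"
 unfolding l1_def by (rule sum.mono_neutral_left[OF assms]) auto

lemma l1_nonneg: "f \<in> carrier B ==> 0 \<le> l1 f"
 unfolding l1_def by (intro sum_nonneg carrier_sup_nonneg)

lemma supp_single: "supp (single g a) \<subseteq> {g}"
 by (auto simp: single_def)

lemma l1_add:
 assumes f: "f \<in> carrier B" and h: "h \<in> carrier B" shows "l1 (f \<uplus> h) \<le> l1 f + l1 h"
proof -
 let ?F = "supp f \<union> supp h"
 have F: "finite ?F" using carrier_BD(1)[OF f] carrier_BD(1)[OF h] by simp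
 have "l1 (f \<uplus> h) = (\<Sum>g\<in>?F. sup_norm X (\<lambda>x. f g x + h g x))"
  unfolding supp_add(1) by (rule l1_eq[OF F supp_add(2)])
 also have "\<dots> \<le> (\<Sum>g\<in>?F. sup_norm X (f g) + sup_norm X (h g))"
  by (intro sum_mono sup_norm_least) (meson carrier_upper[OF f] carrier_upper[OF h] add_mono norm_triangle_ineq order_trans)
 also have "\<dots> = l1 f + l1 h" by (simp add: sum.distrib l1_eq[OF F])
 finally show ?thesis .
qed

lemma l1_cscale: assumes f: "f \<in> carrier B" shows "l1 (cscale B c f) \<le> cmod c * l1 f"
proof -
 have s: "supp (cscale B c f) \<subseteq> supp f" by (auto simp: B_simps fun_eq_iff)
 have "l1 (cscale B c f) = (\<Sum>g\<in>supp f. sup_norm X (\<lambda>x. c * f g x))"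
  using l1_eq[OF carrier_BD(1)[OF f] s] by (simp add: B_simps)
 also have "\<dots> \<le> (\<Sum>g\<in>supp f. cmod c * sup_norm X (f g))"
  by (intro sum_mono sup_norm_least) (simp add: norm_mult mult_left_mono carrier_upper[OF f])
 finally show ?thesis by (simp add: l1_def sum_distrib_left)
qed

lemma l1_adj: assumes f: "f \<in> carrier B" shows "l1 (adj B f) \<le> l1 f"
proof -
 have fin: "finite ((\<lambda>g. inv g) ` supp f)" using carrier_BD(1)[OF f] by simp
 have c: "supp f \<subseteq> carrier G" by (rule carrier_BD(2)[OF f])
 have "l1 (adj B f) = (\<Sum>g\<in>(\<lambda>g. inv g) ` supp f. sup_norm X (adj B f g))"
  by (rule l1_eq[OF fin B_adj_supp[OF f]])
 also have "\<dots> = (\<Sum>g\<in>supp f. sup_norm X (adj B f (inv g)))"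
  using c by (intro sum.reindex[unfolded comp_def]) (auto simp: inj_on_def subset_iff)
 also have "\<dots> \<le> (\<Sum>g\<in>supp f. sup_norm X (f g))"
 proof (intro sum_mono sup_norm_least)
  fix g x assume "g \<in> supp f"
  then have "g \<in> carrier G" using c by blast
  then show "cmod (adj B f (inv g) x) \<le> sup_norm X (f g)"
   using carrier_upper[OF f] carrier_sup_nonneg[OF f] by (simp add: B_adj)
 qed
 finally show ?thesis by (simp add: l1_def)
qed

lemma subadditive_le_sum:
 assumes f: "f \<in> carrier B"
  and zero: "q \<zero>\<^bsub>B\<^esub> \<le> (0::real)"
  and add: "!!f h. [|f \<in> carrier B; h \<in> carrier B|] ==> q (f \<uplus> h) \<le> q f + q h"
  and single: "!!g. g \<in> carrier G ==> q (single g (f g)) \<le> c g"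
 shows "q f \<le> (\<Sum>g\<in>supp f. c g)"
proof -
 have "(\<lambda>g x. if g \<in> F then f g x else 0) \<in> carrier B \<and> q (\<lambda>g x. if g \<in> F then f g x else 0) \<le> (\<Sum>g\<in>F. c g)"
  if "finite F" "F \<subseteq> supp f" for F
  using that
 proof (induction F rule: finite_induct)
  case empty
  then show ?case using zero B.zero_closed by (simp add: B_simps)
 next
  case (insert g F)
  let ?r = "\<lambda>g x. if g \<in> F then f g x else 0"
  have g: "g \<in> carrier G" using insert carrier_BD(2)[OF f] by blast
  have s: "single g (f g) \<in> carrier B" using single_carrier[OF g carrier_BD(3)[OF f g]] .
  have eq: "(\<lambda>h x. if h \<in> Set.insert g F then f h x else 0) = single g (f g) \<uplus> ?r"
   using insert(2) by (auto simp: B_simps single_def fun_eq_iff)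
  have r: "?r \<in> carrier B" "q ?r \<le> (\<Sum>g\<in>F. c g)" using insert by auto
  show ?case unfolding eq using add[OF s r(1)] single[OF g] r(2) insert(1,2) B.a_closed[OF s r(1)] by simp
 qed
 from this[OF carrier_BD(1)[OF f] subset_refl]
 have "q (\<lambda>g x. if g \<in> supp f then f g x else 0) \<le> (\<Sum>g\<in>supp f. c g)" by (rule conjunct2)
 moreover have "(\<lambda>g x. if g \<in> supp f then f g x else 0) = f"
 proof (intro ext)
  fix g x show "(if g \<in> supp f then f g x else 0) = f g x" by (cases "g \<in> supp f") auto
 qed
 ultimately show ?thesis by simp
qed

lemma image_mult_singleton: "[|k \<in> (\<lambda>(g, m). g \<otimes> m) ` (S \<times> T); S \<subseteq> {g}|] ==> k \<in> (\<otimes>) g ` T"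
 by auto

lemma l1_single_mult:
 assumes g: "g \<in> carrier G" and a: "a \<in> C0_on X (U g)" and h: "h \<in> carrier B"
 shows "l1 (single g a \<star> h) \<le> sup_norm X a * l1 h"
proof -
 have c: "supp h \<subseteq> carrier G" by (rule carrier_BD(2)[OF h])
 have fin: "finite ((\<otimes>) g ` supp h)" using carrier_BD(1)[OF h] by simp
 have s: "supp (single g a \<star> h) \<subseteq> (\<otimes>) g ` supp h"
 proof
  fix k assume "k \<in> supp (single g a \<star> h)"
  then obtain x where "(single g a \<star> h) k x \<noteq> 0" by blast
  from supp_mult_subset[OF single_carrier[OF g a] h this]
  show "k \<in> (\<otimes>) g ` supp h" by (rule image_mult_singleton[OF _ supp_single])
 qed
 have "l1 (single g a \<star> h) = (\<Sum>k\<in>(\<otimes>) g ` supp h. sup_norm X ((single g a \<star> h) k))"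
  by (rule l1_eq[OF fin s])
 also have "\<dots> = (\<Sum>n\<in>supp h. sup_norm X ((single g a \<star> h) (g \<otimes> n)))"
  using c g by (intro sum.reindex[unfolded comp_def]) (auto simp: inj_on_def subset_iff)
 also have "\<dots> \<le> (\<Sum>n\<in>supp h. sup_norm X a * sup_norm X (h n))"
 proof (intro sum_mono sup_norm_least)
  fix n x assume "n \<in> supp h"
  then have n: "n \<in> carrier G" using c by blast
  have "(single g a \<star> h) (g \<otimes> n) x = a x * h n (tau g x)"
   using g n by (simp add: single_mult_left[OF g a] flip: m_assoc)
  then show "cmod ((single g a \<star> h) (g \<otimes> n) x) \<le> sup_norm X a * sup_norm X (h n)"
   using C0_upper[OF a] carrier_upper[OF h] sup_norm_nonneg[OF C0_onD(1)[OF a]] by (auto simp: norm_mult intro: mult_mono)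
 qed
 finally show ?thesis by (simp add: l1_def sum_distrib_left)
qed

lemma l1_zero [simp]: "l1 \<zero>\<^bsub>B\<^esub> = 0"
 by (simp add: l1_def B_simps)

lemma l1_mult: assumes f: "f \<in> carrier B" and h: "h \<in> carrier B" shows "l1 (f \<star> h) \<le> l1 f * l1 h"
proof -
 have "l1 (f \<star> h) \<le> (\<Sum>g\<in>supp f. sup_norm X (f g) * l1 h)"
 proof (rule subadditive_le_sum[OF f])
  show "l1 ((f \<uplus> f') \<star> h) \<le> l1 (f \<star> h) + l1 (f' \<star> h)"
   if "f \<in> carrier B" "f' \<in> carrier B" for f f'
   using that h l1_add by (simp add: B.l_distr)
 qed (use h l1_single_mult carrier_BD(3)[OF f] in auto)
 then show ?thesis by (simp add: l1_def sum_distrib_right)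
qed

lemma single_one_add: "single \<one> a \<uplus> single \<one> b = single \<one> (\<lambda>x. a x + b x)"
 by (auto simp: B_simps single_def fun_eq_iff)

lemma single_cscale: "cscale B c (single g a) = single g (\<lambda>x. c * a x)"
 by (auto simp: B_simps single_def fun_eq_iff)

lemma single_one_mult:
 assumes "a \<in> C0_on X (U \<one>)" shows "single \<one> a \<star> single \<one> b = single \<one> (\<lambda>x. a x * b x)"
proof (intro ext)
 fix k x
 show "(single \<one> a \<star> single \<one> b) k x = single \<one> (\<lambda>x. a x * b x) k x"
  using C0_onD(3)[OF assms, of x] single_mult_left[OF one_closed assms, of k "single \<one> b" x] tau_one[of x]
  by (cases "k \<in> carrier G"; cases "x \<in> topspace X") (auto simp: single_def B_mult_out)
qed

lemma adj_single:
 assumes g: "g \<in> carrier G"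
 shows "adj B (single g a) = single (inv g) (\<lambda>x. if x \<in> U (inv g) then cnj (a (\<theta> g x)) else 0)"
proof (intro ext)
 fix k x
 show "adj B (single g a) k x = single (inv g) (\<lambda>x. if x \<in> U (inv g) then cnj (a (\<theta> g x)) else 0) k x"
  using g by (cases "k \<in> carrier G") (auto simp: B_adj B_adj_out single_def tau_def)
qed

lemma adj_single_one:
 assumes "a \<in> C0_on X (U \<one>)" shows "adj B (single \<one> a) = single \<one> (\<lambda>x. cnj (a x))"
proof -
 have "(\<lambda>x. if x \<in> U \<one> then cnj (a (\<theta> \<one> x)) else 0) = (\<lambda>x. cnj (a x))"
  using C0_onD(3)[OF assms] by (auto simp: U_one act_one)
 then show ?thesis by (simp add: adj_single)
qed

text \<open>The squared modulus of \<open>a\<close> transported from \<open>U g\<close> to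
  \<open>U (inv g)\<close>; it is the product of the adjoint of \<open>single g a\<close> with
  \<open>single g a\<close>, see \<open>adj_single_mult_single\<close>.\<close>

definition sqf :: "'g => ('x => complex) => 'x => complex" where
 "sqf g a x = (if x \<in> U (inv g) then of_real ((cmod (a (\<theta> g x)))\<^sup>2) else 0)"

lemma adj_single_mult_single:
 assumes g: "g \<in> carrier G" and a: "a \<in> C0_on X (U g)"
 shows "adj B (single g a) \<star> single g a = single \<one> (sqf g a)"
proof (intro ext)
 fix k x
 have s: "single g a \<in> carrier B" by (rule single_carrier[OF g a])
 show "(adj B (single g a) \<star> single g a) k x = single \<one> (sqf g a) k x"
 proof (cases "k \<in> carrier G")
  case k: True
  have "(adj B (single g a) \<star> single g a) k x = adj B (single g a) (k \<otimes> inv g) x * a (tau (k \<otimes> inv g) x)"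
   by (rule single_mult_right[OF B_adj_closed[OF s] g k])
  moreover have "k \<otimes> inv g = inv g \<longleftrightarrow> k = \<one>" using k g by simp
  ultimately show ?thesis
   using g k complex_norm_square[of "a (\<theta> g x)"] unfolding adj_single[OF g] by (auto simp: single_def sqf_def tau_def mult.commute)
 qed (auto simp: single_def B_mult_out)
qed

lemma sqf_C0: assumes g: "g \<in> carrier G" and a: "a \<in> C0_on X (U g)" shows "sqf g a \<in> C0_on X (U \<one>)"
proof -
 have "adj B (single g a) \<star> single g a \<in> carrier B" using single_carrier[OF g a] by simp
 from carrier_BD(3)[OF this one_closed] show ?thesis by (simp add: adj_single_mult_single[OF g a])
qed

lemma sqf_le: assumes g: "g \<in> carrier G" and a: "a \<in> C0_on X (U g)" shows "cmod (sqf g a x) \<le> (sup_norm X a)\<^sup>2"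
 using C0_upper[OF a] by (auto simp: sqf_def norm_power intro!: power_mono)

lemma C0_funct:
 assumes f: "f \<in> C0_on X (U \<one>)" and k: "continuous_on UNIV (k :: complex => complex)"
 shows "(\<lambda>y. if y \<in> topspace X then k (f y) else 0) \<in> C0_on X (U \<one>)"
proof (rule C0_onI)
 have "continuous_map euclidean euclidean k" using k by simp
 from continuous_map_compose[OF C0_onD(1)[OF f] this]
 have "continuous_map X euclidean (\<lambda>y. k (f y))" by (simp add: comp_def)
 then show "continuous_map X euclidean (\<lambda>y. if y \<in> topspace X then k (f y) else 0)"
  by (rule continuous_map_eq) simp
qed (auto simp: U_one)

context
 fixes q assumes q: "cstar_seminorm B q"
begin

interpretation q: cstar_seminormed B q
 by unfold_locales (rule q)

text \<open>In the diagonal algebra continuous functional calculus is composition of functions, by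
  \<open>C0_funct\<close>, so the bound holds for every C*-seminorm on the uncompleted
  algebra.\<close>

lemma cstar_seminorm_function_le:
 assumes a: "a \<in> C0_on X (U \<one>)" shows "q (single \<one> a) \<le> sup_norm X a"
proof (rule field_le_epsilon)
 fix e :: real assume e: "e > 0"
 \<comment> \<open>The summand \<open>e\<close> keeps the divisor positive when \<open>a\<close> is
   0.\<close>
 define c where "c = sup_norm X a + e"
 have c: "c > 0" using sup_norm_nonneg[OF C0_onD(1)[OF a]] e by (simp add: c_def)
 let ?f = "\<lambda>x. a x / of_real c"
 have fC: "?f \<in> C0_on X (U \<one>)" using C0_on_cmult[OF a, of "1 / of_real c"] by simp
 note sc = single_carrier[OF one_closed]
 have "q (single \<one> ?f) \<le> 1"
 proof (rule function_cstar_seminorm_le[where S = "C0_on X (U \<one>)" and Y = "topspace X" and N = "\<lambda>f. q (single \<one> f)"])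
  fix f :: "'x => complex" assume f: "f \<in> C0_on X (U \<one>)"
  have "(\<lambda>x. cnj (f x)) \<in> C0_on X (U \<one>)"
   using carrier_BD(3)[OF B_adj_closed[OF sc[OF f]] one_closed] by (simp add: adj_single_one[OF f])
  then have "adj B (single \<one> f) \<star> single \<one> f = single \<one> (\<lambda>y. cnj (f y) * f y)"
   by (simp add: adj_single_one[OF f] single_one_mult)
  then show "q (single \<one> (\<lambda>y. cnj (f y) * f y)) = (q (single \<one> f))\<^sup>2" using q.q_cstar[OF sc[OF f]] by simp
  show "0 \<le> q (single \<one> f)" using sc[OF f] by simp
  show "(\<lambda>y. if y \<in> topspace X then k (f y) else 0) \<in> C0_on X (U \<one>)" if "continuous_on UNIV k" for k
   using C0_funct[OF f that] .
  fix g :: "'x => complex" assume g: "g \<in> C0_on X (U \<one>)"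
  have "single \<one> (\<lambda>y. (f y + g y) / 2) = cscale B (1/2) (single \<one> f \<uplus> single \<one> g)"
   by (auto simp: single_one_add single_cscale)
  then have "q (single \<one> (\<lambda>y. (f y + g y) / 2)) = 1/2 * q (single \<one> f \<uplus> single \<one> g)"
   using sc[OF f] sc[OF g] by (simp add: q.q_cscale norm_divide)
  then show "q (single \<one> (\<lambda>y. (f y + g y) / 2)) \<le> (q (single \<one> f) + q (single \<one> g)) / 2"
   using q.q_add[OF sc[OF f] sc[OF g]] by simp
 next
  show "q (single \<one> (indicator (topspace X))) \<le> 1" using q.q_one_le by (simp add: B_one)
  show "?f y = 0" if "y \<notin> topspace X" for y using C0_onD(3)[OF fC that] .
  show "cmod (?f y) \<le> 1" for y
  proof -
   have "cmod (a y) \<le> c" using C0_upper[OF a, of y] e by (simp add: c_def)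
   then show ?thesis using c by (simp add: norm_divide)
  qed
 qed (rule fC)
 moreover have "single \<one> ?f = cscale B (1 / of_real c) (single \<one> a)" by (simp add: single_cscale)
 ultimately have "q (single \<one> a) \<le> c"
  using c sc[OF a] by (simp add: q.q_cscale norm_divide field_simps)
 then show "q (single \<one> a) \<le> sup_norm X a + e" by (simp add: c_def)
qed

text \<open>The C*-identity moves an element of degree \<open>g\<close> to the function
  \<open>sqf g a\<close> in degree \<open>\<one>\<close>.\<close>

lemma cstar_seminorm_single_le:
 assumes g: "g \<in> carrier G" and a: "a \<in> C0_on X (U g)" shows "q (single g a) \<le> sup_norm X a"
proof -
 have "(q (single g a))\<^sup>2 = q (single \<one> (sqf g a))"
  using q.q_cstar[OF single_carrier[OF g a]] by (simp add: adj_single_mult_single[OF g a])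
 also have "\<dots> \<le> sup_norm X (sqf g a)" by (rule cstar_seminorm_function_le[OF sqf_C0[OF g a]])
 also have "\<dots> \<le> (sup_norm X a)\<^sup>2" by (rule sup_norm_least) (rule sqf_le[OF g a])
 finally show ?thesis using sup_norm_nonneg[OF C0_onD(1)[OF a]] by (auto intro: power2_le_imp_le)
qed

lemma cstar_seminorm_le_l1: assumes f: "f \<in> carrier B" shows "q f \<le> l1 f"
 unfolding l1_def
 by (rule subadditive_le_sum[OF f]) (use q.q_add cstar_seminorm_single_le carrier_BD(3)[OF f] in auto)

end

lemma cstar_seminorm_zero: "cstar_seminorm B (\<lambda>_. 0)"
 by (simp add: cstar_seminorm_def)

lemma full_norm_bdd: "f \<in> carrier B ==> bdd_above ((\<lambda>q. q f) ` {q. cstar_seminorm B q})"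
 by (rule bdd_aboveI2[of _ _ "l1 f"]) (simp add: cstar_seminorm_le_l1)

lemma full_norm_upper: "[|cstar_seminorm B q; f \<in> carrier B|] ==> q f \<le> full_norm G X U \<theta> f"
 unfolding full_norm_def by (rule cSUP_upper2[OF full_norm_bdd]) auto

lemma full_norm_le_l1: "f \<in> carrier B ==> full_norm G X U \<theta> f \<le> l1 f"
 unfolding full_norm_def
 by (rule cSUP_least) (use cstar_seminorm_zero cstar_seminorm_le_l1 in auto)

lemma full_norm_cstar_seminorm: "cstar_seminorm B (full_norm G X U \<theta>)"
proof -
 have "cstar_seminorm B (\<lambda>f. SUP q\<in>{q. cstar_seminorm B q}. q f)"
  by (rule B.sup_cstar_seminorm) (use cstar_seminorm_zero full_norm_bdd in auto)
 then show ?thesis by (simp add: full_norm_def[abs_def])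
qed

text \<open>The function \<open>k\<close>, the square root of the squared sup norm minus
  \<open>sqf g a\<close>, completes \<open>single g a\<close> to a multiple of the unit: the two
  elements \<open>s* s\<close> and \<open>k* k\<close> add up to the squared sup norm. The squared
  seminorms of \<open>s \<xi>\<close> and \<open>k \<xi>\<close> then add up to that of
  \<open>\<xi>\<close> times this constant, so the first is bounded.\<close>

lemma positive_functional_bound:
 assumes "positive_functional B \<phi>" and f: "f \<in> carrier B" and x: "\<xi> \<in> carrier B"
 shows "positive_functional.nn B \<phi> (f \<star> \<xi>) \<le> l1 f * positive_functional.nn B \<phi> \<xi>"
proof -
 interpret p: positive_functional B \<phi> by fact
 have single: "p.nn (single g a \<star> \<xi>) \<le> sup_norm X a * p.nn \<xi>" if g: "g \<in> carrier G" and a: "a \<in> C0_on X (U g)" for g a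
 proof -
  let ?c = "sup_norm X a" and ?s = "single g a"
  have c: "0 \<le> ?c" by (rule sup_norm_nonneg[OF C0_onD(1)[OF a]])
  have s: "?s \<in> carrier B" by (rule single_carrier[OF g a])
  define k where "k x = (if x \<in> topspace X then of_real (sqrt (max 0 (?c\<^sup>2 - Re (sqf g a x)))) else 0 :: complex)" for x
  have kC: "k \<in> C0_on X (U \<one>)"
   using C0_funct[OF sqf_C0[OF g a], of "\<lambda>z. of_real (sqrt (max 0 (?c\<^sup>2 - Re z)))"]
   by (simp add: k_def[abs_def] continuous_intros)
  then have kc: "single \<one> k \<in> carrier B" by (rule single_carrier[OF one_closed])
  have "adj B (single \<one> k) \<star> single \<one> k = single \<one> (\<lambda>x. k x * k x)"
  proof -
   have "(\<lambda>x. cnj (k x)) = k" by (auto simp: k_def)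
   then show ?thesis using kC by (simp add: adj_single_one single_one_mult)
  qed
  moreover have "sqf g a x + k x * k x = of_real (?c\<^sup>2) * indicator (topspace X) x" for x
  proof (cases "x \<in> topspace X")
   case True
   have r: "sqf g a x = of_real (Re (sqf g a x))" "0 \<le> Re (sqf g a x)" by (auto simp: sqf_def)
   have "Re (sqf g a x) \<le> ?c\<^sup>2" using sqf_le[OF g a, of x] complex_Re_le_cmod[of "sqf g a x"] by linarith
   then have "k x * k x = of_real (?c\<^sup>2 - Re (sqf g a x))"
    using True by (simp add: k_def flip: of_real_mult)
   then show ?thesis using True r by (metis add_diff_cancel_left' diff_add_cancel indicator_simps(1) mult.right_neutral of_real_diff)
  qed (use C0_onD(3)[OF sqf_C0[OF g a]] in \<open>simp add: k_def\<close>)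
  ultimately have sum: "adj B ?s \<star> ?s \<uplus> adj B (single \<one> k) \<star> single \<one> k = cscale B (of_real (?c\<^sup>2)) \<one>\<^bsub>B\<^esub>"
   by (simp add: adj_single_mult_single[OF g a] single_one_add B_one single_cscale)
  have "of_real ((p.nn (?s \<star> \<xi>))\<^sup>2) + of_real ((p.nn (single \<one> k \<star> \<xi>))\<^sup>2)
    = \<phi> (adj B \<xi> \<star> (adj B ?s \<star> ?s) \<star> \<xi>) + \<phi> (adj B \<xi> \<star> (adj B (single \<one> k) \<star> single \<one> k) \<star> \<xi>)"
   using p.nn_sq[of "?s \<star> \<xi>"] p.nn_sq[of "single \<one> k \<star> \<xi>"] s kc x by (simp add: B.adj_mult B.m_assoc)
  also have "\<dots> = \<phi> (adj B \<xi> \<star> (adj B ?s \<star> ?s \<uplus> adj B (single \<one> k) \<star> single \<one> k) \<star> \<xi>)"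
   using s kc x by (simp add: B.l_distr B.r_distr p.phi_add)
  also have "\<dots> = of_real (?c\<^sup>2) * \<phi> (adj B \<xi> \<star> \<xi>)"
   unfolding sum using x by (simp add: B.mult_cscale_left B.mult_cscale_right p.phi_cscale)
  also have "\<dots> = of_real ((?c * p.nn \<xi>)\<^sup>2)" using x by (simp add: p.nn_sq power_mult_distrib)
  finally have "(p.nn (?s \<star> \<xi>))\<^sup>2 + (p.nn (single \<one> k \<star> \<xi>))\<^sup>2 = (?c * p.nn \<xi>)\<^sup>2"
   by (simp only: of_real_add[symmetric] of_real_eq_iff)
  then have "(p.nn (?s \<star> \<xi>))\<^sup>2 \<le> (?c * p.nn \<xi>)\<^sup>2"
   using zero_le_power2[of "p.nn (single \<one> k \<star> \<xi>)"] by linarith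
  then show ?thesis using c x by (auto intro: power2_le_imp_le)
 qed
 have "p.nn (f \<star> \<xi>) \<le> (\<Sum>g\<in>supp f. sup_norm X (f g) * p.nn \<xi>)"
 proof (rule subadditive_le_sum[OF f])
  have "p.nn \<zero>\<^bsub>B\<^esub> = 0" using p.nn_cscale[of "\<zero>\<^bsub>B\<^esub>" 0] by simp
  then show "p.nn (\<zero>\<^bsub>B\<^esub> \<star> \<xi>) \<le> 0" using x by simp
  show "p.nn ((f \<uplus> f') \<star> \<xi>) \<le> p.nn (f \<star> \<xi>) + p.nn (f' \<star> \<xi>)"
   if "f \<in> carrier B" "f' \<in> carrier B" for f f'
   using that x p.nn_add by (simp add: B.l_distr)
 qed (use single carrier_BD(3)[OF f] in auto)
 then show ?thesis by (simp add: l1_def sum_distrib_right)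
qed

lemma positive_familyI:
 assumes "I \<noteq> {}" "!!i. i \<in> I ==> positive_functional B (\<phi> i)" "!!i. i \<in> I ==> \<phi> i \<one>\<^bsub>B\<^esub> = 1"
 shows "positive_family B \<phi> I l1"
proof (intro positive_family.intro positive_family_axioms.intro B_star_alg)
 show "positive_functional.nn B (\<phi> i) (a \<star> z) \<le> l1 a * positive_functional.nn B (\<phi> i) z"
  if "i \<in> I" "a \<in> carrier B" "z \<in> carrier B" for i a z
  by (rule positive_functional_bound[OF assms(2)[OF that(1)] that(2,3)])
qed (fact assms)+

lemma expectation_adj_mult:
 assumes f: "f \<in> carrier B" and x: "x \<in> topspace X"
 shows "(adj B f \<star> h) \<one> x = (\<Sum>g\<in>supp (adj B f). if x \<in> U g then cnj (f (inv g) (tau g x)) * h (inv g) (tau g x) else 0)"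
proof -
 have "(adj B f \<star> h) \<one> x = (\<Sum>g\<in>supp (adj B f). adj B f g x * h (inv g \<otimes> \<one>) (tau g x))"
  by (rule B_mult_supp) (use B_adj_closed[OF f] in auto)
 also have "\<dots> = (\<Sum>g\<in>supp (adj B f). if x \<in> U g then cnj (f (inv g) (tau g x)) * h (inv g) (tau g x) else 0)"
 proof (rule sum.cong[OF refl])
  fix g assume "g \<in> supp (adj B f)"
  then have "g \<in> carrier G" using carrier_BD(2)[OF B_adj_closed[OF f]] by blast
  then show "adj B f g x * h (inv g \<otimes> \<one>) (tau g x) = (if x \<in> U g then cnj (f (inv g) (tau g x)) * h (inv g) (tau g x) else 0)"
   by (simp add: B_adj)
 qed
 finally show ?thesis .
qed

text \<open>The coefficient of \<open>f* f\<close> at the identity is a sum of squared moduli, one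
  for each group element defined at \<open>x\<close>.\<close>

lemma expectation_positive_functional:
 assumes x: "x \<in> topspace X" shows "positive_functional B (\<lambda>b. b \<one> x)"
proof unfold_locales
 fix f assume f: "f \<in> carrier B"
 have eq: "(adj B f \<star> f) \<one> x = of_real (\<Sum>g\<in>supp (adj B f). if x \<in> U g then (cmod (f (inv g) (tau g x)))\<^sup>2 else 0)"
  unfolding expectation_adj_mult[OF f x] of_real_sum
  by (rule sum.cong) (auto simp: complex_norm_square mult.commute simp del: of_real_power)
 show "Im ((adj B f \<star> f) \<one> x) = 0" unfolding eq by simp
 show "0 \<le> Re ((adj B f \<star> f) \<one> x)" unfolding eq by (auto intro: sum_nonneg)
qed (simp_all add: B_simps)

sublocale red: positive_family B "\<lambda>x b. b \<one> x" "topspace X" l1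
proof (rule positive_familyI[OF nonempty expectation_positive_functional])
 show "\<one>\<^bsub>B\<^esub> \<one> x = 1" if "x \<in> topspace X" for x using that by (simp add: B_one)
qed

text \<open>A sup norm over points is a supremum over the evaluation functionals, so the Hilbert
  module norm falls under the abstract scheme.\<close>

lemma hilbmod_norm_eq: "hilbmod_norm G X U \<theta> = red.NN"
 by (rule ext) (simp add: hilbmod_norm_def gns_norm_def sup_norm_def)

lemma reduced_norm_eq: "reduced_norm G X U \<theta> = red.PP"
 by (rule ext) (simp add: reduced_norm_def gns_seminorm_def hilbmod_norm_eq)

lemma reduced_norm_cstar_seminorm: "cstar_seminorm B (reduced_norm G X U \<theta>)"
 unfolding reduced_norm_eq by (rule red.PP_cstar_seminorm)

lemma hilbmod_le_reduced: "f \<in> carrier B ==> hilbmod_norm G X U \<theta> f \<le> reduced_norm G X U \<theta> f"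
 unfolding reduced_norm_eq hilbmod_norm_eq by (rule red.NN_le_PP_self)

text \<open>For \<open>s = single g a\<close> the coefficient of \<open>s* b s\<close> at the
  identity is that of \<open>b\<close> transported along \<open>\<theta> g\<close> and multiplied by
  \<open>sqf g a\<close>. Hence right multiplications are bounded too, which is what faithfulness of
  the expectation rests on.\<close>

lemma hilbmod_mult_right:
 assumes f: "f \<in> carrier B" and z: "z \<in> carrier B"
 shows "hilbmod_norm G X U \<theta> (f \<star> z) \<le> l1 z * hilbmod_norm G X U \<theta> f"
proof -
 have single: "red.NN (f \<star> single g a) \<le> sup_norm X a * red.NN f" if g: "g \<in> carrier G" and a: "a \<in> C0_on X (U g)" for g a
 proof (rule red.NN_le)
  let ?s = "single g a" and ?b = "adj B f \<star> f"
  have s: "?s \<in> carrier B" by (rule single_carrier[OF g a])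
  have b: "?b \<in> carrier B" using f by simp
  have nn: "0 \<le> sup_norm X a" by (rule sup_norm_nonneg[OF C0_onD(1)[OF a]])
  then show "0 \<le> sup_norm X a * red.NN f" using red.NN_nonneg[OF f] by simp
  show "f \<star> ?s \<in> carrier B" using f s by simp
  fix x assume x: "x \<in> topspace X"
  interpret p: positive_functional B "\<lambda>b. b \<one> x" by (rule expectation_positive_functional[OF x])
  let ?a' = "\<lambda>x. if x \<in> U (inv g) then cnj (a (\<theta> g x)) else 0"
  have a': "?a' \<in> C0_on X (U (inv g))"
   using carrier_BD(3)[OF B_adj_closed[OF s], of "inv g"] g by (simp add: adj_single[OF g])
  have "(adj B ?s \<star> (?b \<star> ?s)) \<one> x = ?a' x * (?b \<star> ?s) g (\<theta> g x)"
   using single_mult_left[OF _ a' one_closed] g by (simp add: adj_single[OF g] tau_def)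
  also have "\<dots> = (if x \<in> U (inv g) then sqf g a x * ?b \<one> (\<theta> g x) else 0)"
  proof (cases "x \<in> U (inv g)")
   case True
   then have "\<theta> g x \<in> topspace X" using act_range[OF g True] U_topspace[OF g] by blast
   then show ?thesis
    using True g complex_norm_square[of "a (\<theta> g x)"] by (simp add: single_mult_right[OF b g g] sqf_def tau_one mult_ac)
  qed simp
  finally have eq: "(adj B (f \<star> ?s) \<star> (f \<star> ?s)) \<one> x = (if x \<in> U (inv g) then sqf g a x * ?b \<one> (\<theta> g x) else 0)"
   using f s by (simp add: B.adj_mult B.m_assoc)
  have "(red.ni x (f \<star> ?s))\<^sup>2 = cmod (if x \<in> U (inv g) then sqf g a x * ?b \<one> (\<theta> g x) else 0)"
   using p.cmod_phi_adj_mult[of "f \<star> ?s"] f s eq by simp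
  also have "\<dots> \<le> (sup_norm X a * red.NN f)\<^sup>2"
  proof (cases "x \<in> U (inv g)")
   case True
   then have y: "\<theta> g x \<in> topspace X" using act_range[OF g True] U_topspace[OF g] by blast
   interpret p': positive_functional B "\<lambda>b. b \<one> (\<theta> g x)" by (rule expectation_positive_functional[OF y])
   have "cmod (sqf g a x * ?b \<one> (\<theta> g x)) = cmod (sqf g a x) * (red.ni (\<theta> g x) f)\<^sup>2"
    using p'.cmod_phi_adj_mult[OF f] by (simp add: norm_mult)
   also have "\<dots> \<le> (sup_norm X a)\<^sup>2 * (red.NN f)\<^sup>2"
    using sqf_le[OF g a, of x] red.ni_le_NN[OF y f] red.ni_nonneg[OF y f] by (intro mult_mono power_mono) auto
   finally show ?thesis using True by (simp add: power_mult_distrib)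
  qed simp
  finally show "red.ni x (f \<star> ?s) \<le> sup_norm X a * red.NN f"
   using nn red.NN_nonneg[OF f] by (auto intro: power2_le_imp_le)
 qed
 have "red.NN (f \<star> z) \<le> (\<Sum>g\<in>supp z. sup_norm X (z g) * red.NN f)"
 proof (rule subadditive_le_sum[OF z])
  have "red.NN \<zero>\<^bsub>B\<^esub> \<le> 0" using red.NN_cscale_le[of "\<zero>\<^bsub>B\<^esub>" 0] by simp
  then show "red.NN (f \<star> \<zero>\<^bsub>B\<^esub>) \<le> 0" using f by simp
  show "red.NN (f \<star> (z \<uplus> v)) \<le> red.NN (f \<star> z) + red.NN (f \<star> v)"
   if "z \<in> carrier B" "v \<in> carrier B" for z v
   using that f red.NN_add by (simp add: B.r_distr)
 qed (use single carrier_BD(3)[OF z] in auto)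
 then show ?thesis by (simp add: hilbmod_norm_eq l1_def sum_distrib_right)
qed

text \<open>This is the faithfulness of the conditional expectation on the reduced crossed product.\<close>

lemma reduced_norm_tendsto_0:
 assumes s: "s \<in> cauchy_seqs B (reduced_norm G X U \<theta>)" and lim: "(\<lambda>n. hilbmod_norm G X U \<theta> (s n)) \<longlonglongrightarrow> 0"
 shows "(\<lambda>n. reduced_norm G X U \<theta> (s n)) \<longlonglongrightarrow> 0"
proof (rule LIMSEQ_I)
 interpret r: cstar_seminormed B "reduced_norm G X U \<theta>"
  by unfold_locales (rule reduced_norm_cstar_seminorm)
 note sc = r.CS_carrier[OF s]
 fix e :: real assume "e > 0"
 then obtain N where N: "\<forall>m\<ge>N. \<forall>n\<ge>N. reduced_norm G X U \<theta> (s m \<minus> s n) < e / 2" using r.CS_cauchy_D[OF s, of "e / 2"] by auto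
 have "red.PP (s n) \<le> e / 2" if n: "n \<ge> N" for n
 proof (rule red.PP_le[OF sc])
  fix z assume z: "z \<in> carrier B" "red.NN z \<le> 1"
  \<comment> \<open>With \<open>n\<close> and \<open>z\<close> fixed, \<open>m\<close> tends to
    infinity: the Cauchy property controls \<open>s n - s m\<close>, and the bound on right
    multiplication by \<open>z\<close> makes \<open>s m \<star> z\<close> vanish in the
    limit.\<close>
  have "red.NN (s n \<star> z) \<le> e / 2 + l1 z * red.NN (s m)" if m: "m \<ge> N" for m
  proof -
   have "s n \<star> z = (s n \<minus> s m) \<star> z \<uplus> s m \<star> z"
    using sc z by (simp add: B.diff_mult_right) (simp add: a_minus_def B.a_assoc B.l_neg)
   then have "red.NN (s n \<star> z) \<le> red.NN ((s n \<minus> s m) \<star> z) + red.NN (s m \<star> z)"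
    using red.NN_add[of "(s n \<minus> s m) \<star> z" "s m \<star> z"] sc z by simp
   also have "red.NN ((s n \<minus> s m) \<star> z) \<le> red.PP (s n \<minus> s m) * red.NN z"
    using sc z by (intro red.NN_le_PP) auto
   also have "\<dots> \<le> red.PP (s n \<minus> s m) * 1"
    using sc z red.PP_nonneg by (intro mult_left_mono) auto
   also have "\<dots> \<le> e / 2" using N n m by (simp add: reduced_norm_eq less_imp_le)
   also have "red.NN (s m \<star> z) \<le> l1 z * red.NN (s m)" using hilbmod_mult_right[OF sc z(1)] by (simp add: hilbmod_norm_eq)
   finally show ?thesis by simp
  qed
  moreover have "(\<lambda>m. e / 2 + l1 z * red.NN (s m)) \<longlonglongrightarrow> e / 2 + l1 z * 0"
   using lim by (intro tendsto_intros) (simp add: hilbmod_norm_eq)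
  ultimately show "red.NN (s n \<star> z) \<le> e / 2"
   by (intro LIMSEQ_le_const[of "\<lambda>m. e / 2 + l1 z * red.NN (s m)"]) auto
 qed (use \<open>e > 0\<close> in simp)
 then have "norm (reduced_norm G X U \<theta> (s n) - 0) < e" if "n \<ge> N" for n
  using that \<open>e > 0\<close> red.PP_nonneg[OF sc, of n] by (fastforce simp: reduced_norm_eq)
 then show "\<exists>N. \<forall>n\<ge>N. norm (reduced_norm G X U \<theta> (s n) - 0) < e" by blast
qed

end


section \<open>The representation on the orbits of points\<close>

context partial_system
begin

lemma additive_eq_sum:
 assumes f: "f \<in> carrier B"
  and zero: "q \<zero>\<^bsub>B\<^esub> = (0::complex)"
  and add: "!!f h. [|f \<in> carrier B; h \<in> carrier B|] ==> q (f \<uplus> h) = q f + q h"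
 shows "q f = (\<Sum>g\<in>supp f. q (single g (f g)))"
proof -
 have "cmod (q f - (\<Sum>g\<in>supp f. q (single g (f g)))) \<le> 0"
 proof -
  define c where "c g = q (single g (f g))" for g
  have "(\<lambda>g x. if g \<in> F then f g x else 0) \<in> carrier B \<and> q (\<lambda>g x. if g \<in> F then f g x else 0) = (\<Sum>g\<in>F. c g)"
   if "finite F" "F \<subseteq> supp f" for F
   using that
  proof (induction F rule: finite_induct)
   case empty
   then show ?case using zero B.zero_closed by (simp add: B_simps)
  next
   case (insert g F)
   let ?r = "\<lambda>g x. if g \<in> F then f g x else 0"
   have g: "g \<in> carrier G" using insert carrier_BD(2)[OF f] by blast
   have s: "single g (f g) \<in> carrier B" using single_carrier[OF g carrier_BD(3)[OF f g]] .
   have eq: "(\<lambda>h x. if h \<in> Set.insert g F then f h x else 0) = single g (f g) \<uplus> ?r"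
    using insert(2) by (auto simp: B_simps single_def fun_eq_iff)
   have r: "?r \<in> carrier B" "q ?r = (\<Sum>g\<in>F. c g)" using insert by auto
   show ?case unfolding eq using add[OF s r(1)] r(2) insert(1,2) B.a_closed[OF s r(1)] by (simp add: c_def)
  qed
  from this[OF carrier_BD(1)[OF f] subset_refl]
  have "q (\<lambda>g x. if g \<in> supp f then f g x else 0) = (\<Sum>g\<in>supp f. c g)" by (rule conjunct2)
  moreover have "(\<lambda>g x. if g \<in> supp f then f g x else 0) = f"
  proof (intro ext)
   fix g x show "(if g \<in> supp f then f g x else 0) = f g x" by (cases "g \<in> supp f") auto
  qed
  ultimately show ?thesis by (simp add: c_def)
 qed
 then show ?thesis by simp
qed

text \<open>The matrix coefficients \<open>\<langle>f \<delta>\<^sub>x, \<delta>\<^sub>y\<rangle>\<close> of the representation on \<open>\<ell>\<^sup>2(X)\<close> given by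
 \<open>(a \<delta>\<^sub>g) \<delta>\<^sub>x = a(g x) \<delta>\<^sub>g\<^sub>x\<close>.\<close>

definition orb :: "'x => ('g => 'x => complex) => 'x => complex" where
 "orb x f y = (\<Sum>g\<in>supp f. if y \<in> U g \<and> tau g y = x then f g y else 0)"

lemma orb_eq:
 assumes "finite F" "supp f \<subseteq> F" shows "orb x f y = (\<Sum>g\<in>F. if y \<in> U g \<and> tau g y = x then f g y else 0)"
 unfolding orb_def by (rule sum.mono_neutral_left[OF assms]) auto

lemma orb_add:
 assumes f: "f \<in> carrier B" and h: "h \<in> carrier B"
 shows "orb x (f \<uplus> h) y = orb x f y + orb x h y"
proof -
 let ?F = "supp f \<union> supp h"
 have F: "finite ?F" using carrier_BD(1)[OF f] carrier_BD(1)[OF h] by simp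
 show ?thesis
  unfolding supp_add(1) orb_eq[OF F supp_add(2)] orb_eq[OF F Un_upper1] orb_eq[OF F Un_upper2]
  by (simp add: if_distrib flip: sum.distrib cong: if_cong)
qed

lemma orb_zero [simp]: "orb x \<zero>\<^bsub>B\<^esub> y = 0"
 by (simp add: orb_def B_simps)

lemma orb_cscale: assumes f: "f \<in> carrier B" shows "orb x (cscale B c f) y = c * orb x f y"
proof -
 have s: "supp (\<lambda>g x. c * f g x) \<subseteq> supp f" by (auto simp: fun_eq_iff)
 show ?thesis
  unfolding B_simps orb_eq[OF carrier_BD(1)[OF f] s] orb_def sum_distrib_left by (rule sum.cong) auto
qed

lemma orb_single_mult:
 assumes g: "g \<in> carrier G" and a: "a \<in> C0_on X (U g)" and h: "h \<in> carrier B"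
 shows "orb x (single g a \<star> h) y = (if y \<in> U g then a y * orb x h (tau g y) else 0)"
proof (cases "y \<in> U g")
 case y: True
 have c: "supp h \<subseteq> carrier G" by (rule carrier_BD(2)[OF h])
 have fin: "finite ((\<otimes>) g ` supp h)" using carrier_BD(1)[OF h] by simp
 have s: "supp (single g a \<star> h) \<subseteq> (\<otimes>) g ` supp h"
 proof
  fix k assume "k \<in> supp (single g a \<star> h)"
  then obtain x where "(single g a \<star> h) k x \<noteq> 0" by blast
  from supp_mult_subset[OF single_carrier[OF g a] h this]
  show "k \<in> (\<otimes>) g ` supp h" by (rule image_mult_singleton[OF _ supp_single])
 qed
 have "orb x (single g a \<star> h) y = (\<Sum>n\<in>supp h. if y \<in> U (g \<otimes> n) \<and> tau (g \<otimes> n) y = x then (single g a \<star> h) (g \<otimes> n) y else 0)"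
  unfolding orb_eq[OF fin s]
  using c g by (intro sum.reindex[unfolded comp_def]) (auto simp: inj_on_def subset_iff)
 also have "\<dots> = (\<Sum>n\<in>supp h. a y * (if tau g y \<in> U n \<and> tau n (tau g y) = x then h n (tau g y) else 0))"
 proof (rule sum.cong[OF refl])
  fix n assume "n \<in> supp h"
  then have n: "n \<in> carrier G" using c by blast
  have "(single g a \<star> h) (g \<otimes> n) y = a y * h n (tau g y)"
   using g n by (simp add: single_mult_left[OF g a] flip: m_assoc)
  then show "(if y \<in> U (g \<otimes> n) \<and> tau (g \<otimes> n) y = x then (single g a \<star> h) (g \<otimes> n) y else 0)
    = a y * (if tau g y \<in> U n \<and> tau n (tau g y) = x then h n (tau g y) else 0)"
   using tau_mem_iff[OF g n y] tau_comp(2)[OF g n y] by auto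
 qed
 finally show ?thesis using y by (simp add: orb_def sum_distrib_left)
next
 case False
 then have a0: "a y = 0" using C0_onD(2)[OF a] by blast
 have "(single g a \<star> h) k y = 0" for k
  using a0 by (cases "k \<in> carrier G") (simp_all add: single_mult_left[OF g a] B_mult_out)
 then have "orb x (single g a \<star> h) y = 0" unfolding orb_def by (intro sum.neutral) auto
 then show ?thesis using False by simp
qed

text \<open>Different group elements can carry \<open>x\<close> to the same point. Grouping the sum
  by the target point turns the coefficients with a common target into one matrix coefficient;
  isotropy thus becomes visible, in contrast to the expectation.\<close>

lemma orb_adj_mult:
 assumes f: "f \<in> carrier B" and h: "h \<in> carrier B" and x: "x \<in> topspace X"
 shows "orb x (adj B f \<star> h) x = (\<Sum>y\<in>(\<lambda>g. \<theta> g x) ` {g \<in> supp f. x \<in> U (inv g)}. cnj (orb x f y) * orb x h y)"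
proof -
 let ?F = "{g \<in> supp f. x \<in> U (inv g)}"
 have fin: "finite ?F" using carrier_BD(1)[OF f] by simp
 have c: "supp f \<subseteq> carrier G" by (rule carrier_BD(2)[OF f])
 have "orb x (adj B f \<star> h) x = (\<Sum>g\<in>supp f. orb x (adj B (single g (f g)) \<star> h) x)"
  by (rule additive_eq_sum[OF f]) (use h in \<open>auto simp: B.adj_add B.l_distr orb_add\<close>)
 also have "\<dots> = (\<Sum>g\<in>supp f. if x \<in> U (inv g) then cnj (f g (\<theta> g x)) * orb x h (\<theta> g x) else 0)"
 proof (rule sum.cong[OF refl])
  fix g assume "g \<in> supp f"
  then have g: "g \<in> carrier G" using c by blast
  let ?a = "\<lambda>x. if x \<in> U (inv g) then cnj (f g (\<theta> g x)) else 0"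
  have "?a \<in> C0_on X (U (inv g))"
   using carrier_BD(3)[OF B_adj_closed[OF single_carrier[OF g carrier_BD(3)[OF f g]]], of "inv g"] g
   by (simp add: adj_single[OF g])
  then show "orb x (adj B (single g (f g)) \<star> h) x = (if x \<in> U (inv g) then cnj (f g (\<theta> g x)) * orb x h (\<theta> g x) else 0)"
   using g orb_single_mult[of "inv g" ?a h x x] h by (simp add: adj_single[OF g] tau_def)
 qed
 also have "\<dots> = (\<Sum>g\<in>?F. cnj (f g (\<theta> g x)) * orb x h (\<theta> g x))"
  by (rule sum.inter_filter[OF carrier_BD(1)[OF f], symmetric])
 also have "\<dots> = (\<Sum>y\<in>(\<lambda>g. \<theta> g x) ` ?F. \<Sum>g\<in>{g \<in> ?F. \<theta> g x = y}. cnj (f g (\<theta> g x)) * orb x h (\<theta> g x))"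
  by (rule sum.group[symmetric]) (use fin in auto)
 also have "\<dots> = (\<Sum>y\<in>(\<lambda>g. \<theta> g x) ` ?F. cnj (orb x f y) * orb x h y)"
 proof (rule sum.cong[OF refl])
  fix y
  have set_eq: "{g \<in> ?F. \<theta> g x = y} = {g \<in> supp f. y \<in> U g \<and> tau g y = x}"
  proof (intro Set.set_eqI iffI)
   fix g assume g: "g \<in> {g \<in> ?F. \<theta> g x = y}"
   then have "g \<in> carrier G" using c by blast
   then show "g \<in> {g \<in> supp f. y \<in> U g \<and> tau g y = x}" using g act_range[of g x] tau_act[of g x] by auto
  next
   fix g assume g: "g \<in> {g \<in> supp f. y \<in> U g \<and> tau g y = x}"
   then have "g \<in> carrier G" using c by blast
   then show "g \<in> {g \<in> ?F. \<theta> g x = y}" using g tau_range[of g y] act_tau[of g y] by auto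
  qed
  have "(\<Sum>g\<in>{g \<in> ?F. \<theta> g x = y}. cnj (f g (\<theta> g x)) * orb x h (\<theta> g x))
    = (\<Sum>g\<in>{g \<in> ?F. \<theta> g x = y}. cnj (f g y) * orb x h y)"
   by (rule sum.cong) auto
  then have "(\<Sum>g\<in>{g \<in> ?F. \<theta> g x = y}. cnj (f g (\<theta> g x)) * orb x h (\<theta> g x))
    = (\<Sum>g\<in>{g \<in> supp f. y \<in> U g \<and> tau g y = x}. cnj (f g y)) * orb x h y"
   unfolding set_eq sum_distrib_right .
  also have "(\<Sum>g\<in>{g \<in> supp f. y \<in> U g \<and> tau g y = x}. cnj (f g y)) = cnj (orb x f y)"
   unfolding orb_def cnj_sum using sum.inter_filter[OF carrier_BD(1)[OF f], of "\<lambda>g. cnj (f g y)"]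
   by (simp add: if_distrib[of cnj] cong: if_cong)
  finally show "(\<Sum>g\<in>{g \<in> ?F. \<theta> g x = y}. cnj (f g (\<theta> g x)) * orb x h (\<theta> g x)) = cnj (orb x f y) * orb x h y" .
 qed
 finally show ?thesis .
qed

lemma orbit_positive_functional:
 assumes x: "x \<in> topspace X" shows "positive_functional B (\<lambda>b. orb x b x)"
proof unfold_locales
 fix f assume f: "f \<in> carrier B"
 have eq: "orb x (adj B f \<star> f) x = of_real (\<Sum>y\<in>(\<lambda>g. \<theta> g x) ` {g \<in> supp f. x \<in> U (inv g)}. (cmod (orb x f y))\<^sup>2)"
  unfolding orb_adj_mult[OF f f x] of_real_sum
  by (rule sum.cong) (auto simp: complex_norm_square mult.commute simp del: of_real_power)
 show "Im (orb x (adj B f \<star> f) x) = 0" unfolding eq by simp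
 show "0 \<le> Re (orb x (adj B f \<star> f) x)" unfolding eq by (auto intro: sum_nonneg)
qed (simp_all add: orb_add orb_cscale)

sublocale orbit: positive_family B "\<lambda>x b. orb x b x" "topspace X" l1
proof (rule positive_familyI[OF nonempty orbit_positive_functional])
 show "orb x \<one>\<^bsub>B\<^esub> x = 1" if "x \<in> topspace X" for x
  using that orb_eq[of "{\<one>}" "\<one>\<^bsub>B\<^esub>" x x] by (simp add: B_one supp_single U_one tau_one)
qed

definition orbit_seminorm :: "('g => 'x => complex) => real" where
 "orbit_seminorm = orbit.PP"

lemma orbit_cstar_seminorm: "cstar_seminorm B orbit_seminorm"
 unfolding orbit_seminorm_def by (rule orbit.PP_cstar_seminorm)

text \<open>Ensures that the kernel of the orbit representation is a proper ideal.\<close>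

lemma orbit_seminorm_one: "orbit_seminorm \<one>\<^bsub>B\<^esub> \<noteq> 0"
proof -
 obtain x where x: "x \<in> topspace X" using nonempty by blast
 have "1 \<le> orbit.NN \<one>\<^bsub>B\<^esub>" using orbit.ni_le_NN[OF x B.one_closed] orbit.ni_one[OF x] by simp
 also have "\<dots> \<le> orbit_seminorm \<one>\<^bsub>B\<^esub>" unfolding orbit_seminorm_def by (rule orbit.NN_le_PP_self) simp
 finally show ?thesis by simp
qed

lemma orbit_seminorm_eq_0:
 assumes f: "f \<in> carrier B" and act: "!!x y z. z \<in> carrier B ==> orb x (f \<star> z) y = 0"
 shows "orbit_seminorm f = 0"
proof -
 have "orbit.NN (f \<star> z) = 0" if "z \<in> carrier B" for z
  unfolding gns_norm_def using that f nonempty by (simp add: orb_adj_mult act)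
 then have "orbit.PP f \<le> 0" using f by (intro orbit.PP_le) auto
 then show ?thesis using orbit.PP_nonneg[OF f] by (simp add: orbit_seminorm_def)
qed

text \<open>Wherever \<open>a\<close> is nonzero the point is fixed by \<open>g\<close>, so
  \<open>single g a\<close> and \<open>single \<one> a\<close> have equal matrix coefficients and
  their difference acts as 0.\<close>

lemma orbit_seminorm_fixed:
 assumes g: "g \<in> carrier G" and a: "a \<in> C0_on X (U \<one>)"
  and fixed: "!!x. a x \<noteq> 0 ==> x \<in> U (inv g) \<and> \<theta> g x = x"
 shows "a \<in> C0_on X (U g)" "orbit_seminorm (single g a \<minus> single \<one> a) = 0"
proof -
 have fixU: "x \<in> U g" "tau g x = x" if "a x \<noteq> 0" for x
  using fixed[OF that] act_range[OF g, of x] tau_act[OF g, of x] by auto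
 then show ag: "a \<in> C0_on X (U g)" using C0_onD[OF a] by (intro C0_onI) auto
 note s = single_carrier[OF g ag] single_carrier[OF one_closed a]
 show "orbit_seminorm (single g a \<minus> single \<one> a) = 0"
 proof (rule orbit_seminorm_eq_0)
  fix x y z assume z: "z \<in> carrier B"
  have "(single g a \<minus> single \<one> a) \<star> z = single g a \<star> z \<uplus> cscale B (-1) (single \<one> a \<star> z)"
   using s z by (subst B.diff_mult_right) (simp_all add: B.cscale_m1 a_minus_def)
  then have "orb x ((single g a \<minus> single \<one> a) \<star> z) y = orb x (single g a \<star> z) y - orb x (single \<one> a \<star> z) y"
   using s z by (simp add: orb_add orb_cscale)
  also have "\<dots> = 0"
   using fixU[of y] C0_onD(3)[OF a, of y] U_topspace[OF g]
   by (cases "a y = 0") (auto simp: orb_single_mult[OF g ag z] orb_single_mult[OF one_closed a z] U_one tau_one)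
  finally show "orb x ((single g a \<minus> single \<one> a) \<star> z) y = 0" .
 qed (use s in auto)
qed

end


section \<open>The free *-algebra\<close>

definition star_word :: "('g \<times> bool) list => ('g \<times> bool) list" where
 "star_word u = rev (map (\<lambda>(p, b). (p, \<not> b)) u)"

lemma star_word_star_word [simp]: "star_word (star_word u) = u"
 by (simp add: star_word_def rev_map comp_def case_prod_unfold)

lemma star_word_Nil [simp]: "star_word [] = []"
 by (simp add: star_word_def)

lemma star_word_lists: "star_word (u :: ('g \<times> bool) list) \<in> lists (P \<times> UNIV) \<longleftrightarrow> u \<in> lists (P \<times> UNIV)"
proof -
 have "star_word u \<in> lists (P \<times> UNIV)" if "u \<in> lists (P \<times> UNIV)" for u :: "('g \<times> bool) list"
  using that by (auto simp: star_word_def in_lists_conv_set)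
 from this[of u] this[of "star_word u"] show ?thesis by auto
qed

abbreviation lmono :: "('g \<times> bool) list => ('g \<times> bool) list => complex" where
 "lmono u \<equiv> indicator {u}"

abbreviation lsupp :: "(('g \<times> bool) list => complex) => ('g \<times> bool) list set" where
 "lsupp f \<equiv> {u. f u \<noteq> 0}"

lemma free_simps:
 "carrier (free_star_alg P) = {f. finite (lsupp f) \<and> lsupp f \<subseteq> lists (P \<times> UNIV)}"
 "f \<otimes>\<^bsub>free_star_alg P\<^esub> h = (\<lambda>u. \<Sum>i\<le>length u. f (take i u) * h (drop i u))"
 "\<one>\<^bsub>free_star_alg P\<^esub> = lmono []" "\<zero>\<^bsub>free_star_alg P\<^esub> = (\<lambda>_. 0)"
 "f \<oplus>\<^bsub>free_star_alg P\<^esub> h = (\<lambda>u. f u + h u)" "cscale (free_star_alg P) c f = (\<lambda>u. c * f u)"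
 "adj (free_star_alg P) f = (\<lambda>u. cnj (f (star_word u)))"
 by (simp_all add: free_star_alg_def star_word_def)

lemma free_carrierI: "[|finite F; F \<subseteq> lists (P \<times> UNIV); !!u. u \<notin> F ==> f u = 0|] ==> f \<in> carrier (free_star_alg P)"
 by (auto simp: free_simps intro: finite_subset)

lemma free_carrierD:
 assumes "f \<in> carrier (free_star_alg P)" shows "finite (lsupp f)" "lsupp f \<subseteq> lists (P \<times> UNIV)"
 using assms by (auto simp: free_simps)

lemma mono_carrier [simp]: "u \<in> lists (P \<times> UNIV) ==> lmono u \<in> carrier (free_star_alg P)"
 by (rule free_carrierI[of "{u}"]) auto

lemma free_mult_closed:
 assumes f: "f \<in> carrier (free_star_alg P)" and h: "h \<in> carrier (free_star_alg P)"
 shows "f \<otimes>\<^bsub>free_star_alg P\<^esub> h \<in> carrier (free_star_alg P)"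
proof (rule free_carrierI)
 let ?F = "(\<lambda>(u, v). u @ v) ` (lsupp f \<times> lsupp h)"
 show "finite ?F" using free_carrierD(1)[OF f] free_carrierD(1)[OF h] by auto
 show "?F \<subseteq> lists (P \<times> UNIV)" using free_carrierD(2)[OF f] free_carrierD(2)[OF h] by force
 fix u assume u: "u \<notin> ?F"
 have "f (take i u) * h (drop i u) = 0" for i
 proof (rule ccontr)
  assume "f (take i u) * h (drop i u) \<noteq> 0"
  then have "(take i u, drop i u) \<in> lsupp f \<times> lsupp h" by simp
  then have "take i u @ drop i u \<in> ?F" by (metis (no_types, lifting) case_prod_conv image_eqI)
  then show False using u by simp
 qed
 then show "(f \<otimes>\<^bsub>free_star_alg P\<^esub> h) u = 0" unfolding free_simps by (intro sum.neutral) blast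
qed

lemma free_mult_assoc:
 "(f \<otimes>\<^bsub>free_star_alg P\<^esub> h) \<otimes>\<^bsub>free_star_alg P\<^esub> l = f \<otimes>\<^bsub>free_star_alg P\<^esub> (h \<otimes>\<^bsub>free_star_alg P\<^esub> l)"
proof
 fix u :: "('a \<times> bool) list"
 let ?n = "length u"
 define F where "F i m = f (take i u) * (h (take m (drop i u)) * l (drop m (drop i u)))" for i m
 have "((f \<otimes>\<^bsub>free_star_alg P\<^esub> h) \<otimes>\<^bsub>free_star_alg P\<^esub> l) u = (\<Sum>j\<le>?n. \<Sum>i\<le>j. F i (j - i))"
  unfolding free_simps sum_distrib_right
 proof (rule sum.cong[OF refl], rule sum.cong)
  fix j i assume "j \<in> {..?n}" and "i \<in> {..j}"
  then show "f (take i (take j u)) * h (drop i (take j u)) * l (drop j u) = F i (j - i)"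
   by (simp add: F_def take_drop min_def mult.assoc)
 qed auto
 \<comment> \<open>A word is cut into three pieces: \<open>j\<close> is the position of the second
   cut, and \<open>m = j - i\<close> is the length of the middle piece.\<close>
 also have "\<dots> = (\<Sum>(i, m)\<in>{(i, m). i + m \<le> ?n}. F i m)" by (rule sum.triangle_reindex_eq[symmetric])
 also have "{(i, m). i + m \<le> ?n} = (SIGMA i:{..?n}. {..?n - i})" by auto
 also have "(\<Sum>(i, m)\<in>(SIGMA i:{..?n}. {..?n - i}). F i m) = (\<Sum>i\<le>?n. \<Sum>m\<le>?n - i. F i m)"
  by (rule sum.Sigma[symmetric]) auto
 also have "\<dots> = (f \<otimes>\<^bsub>free_star_alg P\<^esub> (h \<otimes>\<^bsub>free_star_alg P\<^esub> l)) u"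
  by (simp add: free_simps F_def sum_distrib_left)
 finally show "((f \<otimes>\<^bsub>free_star_alg P\<^esub> h) \<otimes>\<^bsub>free_star_alg P\<^esub> l) u = (f \<otimes>\<^bsub>free_star_alg P\<^esub> (h \<otimes>\<^bsub>free_star_alg P\<^esub> l)) u" .
qed

lemma free_one_left: "lmono [] \<otimes>\<^bsub>free_star_alg P\<^esub> f = f"
proof
 fix u :: "('a \<times> bool) list"
 have "(lmono [] \<otimes>\<^bsub>free_star_alg P\<^esub> f) u = (\<Sum>i\<in>{0}. lmono [] (take i u) * f (drop i u))"
  unfolding free_simps by (rule sum.mono_neutral_right) (auto simp: indicator_def)
 then show "(lmono [] \<otimes>\<^bsub>free_star_alg P\<^esub> f) u = f u" by simp
qed

lemma free_one_right: "f \<otimes>\<^bsub>free_star_alg P\<^esub> lmono [] = f"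
proof
 fix u :: "('a \<times> bool) list"
 have "(f \<otimes>\<^bsub>free_star_alg P\<^esub> lmono []) u = (\<Sum>i\<in>{length u}. f (take i u) * lmono [] (drop i u))"
  unfolding free_simps by (rule sum.mono_neutral_right) (auto simp: indicator_def)
 then show "(f \<otimes>\<^bsub>free_star_alg P\<^esub> lmono []) u = f u" by simp
qed

lemma free_adj_mult:
 "adj (free_star_alg P) (f \<otimes>\<^bsub>free_star_alg P\<^esub> h) = adj (free_star_alg P) h \<otimes>\<^bsub>free_star_alg P\<^esub> adj (free_star_alg P) f"
proof
 fix u :: "('a \<times> bool) list"
 let ?n = "length u"
 have t: "take i (star_word u) = star_word (drop (?n - i) u)" "drop i (star_word u) = star_word (take (?n - i) u)" for i
  by (simp_all add: star_word_def take_rev drop_rev take_map drop_map)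
 have "adj (free_star_alg P) (f \<otimes>\<^bsub>free_star_alg P\<^esub> h) u = (\<Sum>i\<le>?n. cnj (f (take i (star_word u))) * cnj (h (drop i (star_word u))))"
  by (simp add: free_simps star_word_def)
 also have "\<dots> = (\<Sum>i\<le>?n. cnj (h (star_word (take i u))) * cnj (f (star_word (drop i u))))"
  by (rule sum.reindex_bij_witness[of _ "\<lambda>i. ?n - i" "\<lambda>i. ?n - i"]) (auto simp: t)
 finally show "adj (free_star_alg P) (f \<otimes>\<^bsub>free_star_alg P\<^esub> h) u
   = (adj (free_star_alg P) h \<otimes>\<^bsub>free_star_alg P\<^esub> adj (free_star_alg P) f) u"
  by (simp add: free_simps)
qed

lemma free_is_star_alg: "star_alg (free_star_alg P)"
proof (rule star_algI)
 let ?A = "free_star_alg P"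
 have add: "(\<lambda>u. f u + h u) \<in> carrier ?A" if "f \<in> carrier ?A" "h \<in> carrier ?A" for f h
  by (rule free_carrierI[of "lsupp f \<union> lsupp h"])
    (use free_carrierD[OF that(1)] free_carrierD[OF that(2)] in auto)
 have cs: "(\<lambda>u. c * f u) \<in> carrier ?A" if "f \<in> carrier ?A" for c f
  by (rule free_carrierI[of "lsupp f"]) (use free_carrierD[OF that] in auto)
 show "ring ?A"
 proof (rule ring_axiomsI)
  show "\<exists>y\<in>carrier ?A. y \<oplus>\<^bsub>?A\<^esub> x = \<zero>\<^bsub>?A\<^esub>" if "x \<in> carrier ?A" for x
   using cs[OF that, of "-1"] by (intro bexI[of _ "\<lambda>u. -1 * x u"]) (auto simp: free_simps(3-))
  show "\<zero>\<^bsub>?A\<^esub> \<in> carrier ?A" by (simp add: free_simps)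
  show "\<one>\<^bsub>?A\<^esub> \<in> carrier ?A" by (simp add: free_simps(3))
  show "(x \<oplus>\<^bsub>?A\<^esub> y) \<otimes>\<^bsub>?A\<^esub> z = x \<otimes>\<^bsub>?A\<^esub> z \<oplus>\<^bsub>?A\<^esub> y \<otimes>\<^bsub>?A\<^esub> z" for x y z
   by (simp add: free_simps distrib_right sum.distrib)
  show "z \<otimes>\<^bsub>?A\<^esub> (x \<oplus>\<^bsub>?A\<^esub> y) = z \<otimes>\<^bsub>?A\<^esub> x \<oplus>\<^bsub>?A\<^esub> z \<otimes>\<^bsub>?A\<^esub> y" for x y z
   by (simp add: free_simps distrib_left sum.distrib)
 qed (auto simp: free_mult_closed free_mult_assoc free_simps(3) free_one_left free_one_right simp del: free_simps(2), auto simp: free_simps(4,5) add add_ac)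
 show "cscale ?A c a \<in> carrier ?A" if "a \<in> carrier ?A" for a c
  using cs[OF that] by (simp add: free_simps(6))
 show "adj ?A a \<in> carrier ?A" if "a \<in> carrier ?A" for a
 proof (rule free_carrierI)
  show "finite (star_word ` lsupp a)" using free_carrierD(1)[OF that] by simp
  show "star_word ` lsupp a \<subseteq> lists (P \<times> UNIV)" using free_carrierD(2)[OF that] star_word_lists by blast
  show "adj ?A a u = 0" if "u \<notin> star_word ` lsupp a" for u
   using that image_eqI[of u star_word "star_word u" "lsupp a"] by (auto simp: free_simps(7))
 qed
 show "cscale ?A c a \<otimes>\<^bsub>?A\<^esub> b = cscale ?A c (a \<otimes>\<^bsub>?A\<^esub> b)" for a b c
  by (simp add: free_simps sum_distrib_left mult.assoc)
 show "a \<otimes>\<^bsub>?A\<^esub> cscale ?A c b = cscale ?A c (a \<otimes>\<^bsub>?A\<^esub> b)" for a b c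
  by (simp add: free_simps sum_distrib_left mult_ac)
 show "adj ?A (a \<otimes>\<^bsub>?A\<^esub> b) = adj ?A b \<otimes>\<^bsub>?A\<^esub> adj ?A a" for a b by (rule free_adj_mult)
qed (auto simp: free_simps(4-7) algebra_simps)

lemma mono_mult: "lmono u \<otimes>\<^bsub>free_star_alg P\<^esub> lmono v = lmono (u @ v)"
proof
 fix w :: "('a \<times> bool) list"
 show "(lmono u \<otimes>\<^bsub>free_star_alg P\<^esub> lmono v) w = lmono (u @ v) w"
 proof (cases "w = u @ v")
  case True
  have "(lmono u \<otimes>\<^bsub>free_star_alg P\<^esub> lmono v) w = (\<Sum>i\<in>{length u}. lmono u (take i w) * lmono v (drop i w))"
   unfolding free_simps
  proof (rule sum.mono_neutral_right)
   show "\<forall>i\<in>{..length w} - {length u}. lmono u (take i w) * lmono v (drop i w) = (0::complex)"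
   proof
    fix i assume i: "i \<in> {..length w} - {length u}"
    then have "length (take i w) \<noteq> length u" by simp
    then have "take i w \<noteq> u" by metis
    then show "lmono u (take i w) * lmono v (drop i w) = (0::complex)" by simp
   qed
  qed (use True in auto)
  then show ?thesis using True by simp
 next
  case False
  have "lmono u (take i w) * lmono v (drop i w) = (0::complex)" for i
   using False append_take_drop_id[of i w] by (auto simp: indicator_def)
  then have "(lmono u \<otimes>\<^bsub>free_star_alg P\<^esub> lmono v) w = 0"
   unfolding free_simps by (intro sum.neutral) blast
  then show ?thesis using False by simp
 qed
qed

lemma mono_adj: "adj (free_star_alg P) (lmono u) = lmono (star_word u)"
 by (auto simp: free_simps fun_eq_iff indicator_def)

lemma free_gen_eq: "free_gen p = lmono [(p, False)]"
 by (simp add: free_gen_def)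

text \<open>Only words in the support of \<open>f\<close> are ever added. An induction over an
  element of given degree therefore sees only words of that degree, as
  \<open>covariant_degree_one\<close> requires.\<close>

lemma free_induct_supp:
 assumes f: "f \<in> carrier (free_star_alg P)"
  and zero: "Q \<zero>\<^bsub>free_star_alg P\<^esub>"
  and add: "!!h c u. [|h \<in> carrier (free_star_alg P); Q h; u \<in> lists (P \<times> UNIV); f u \<noteq> 0|]
   ==> Q (h \<oplus>\<^bsub>free_star_alg P\<^esub> cscale (free_star_alg P) c (lmono u))"
 shows "Q f"
proof -
 have "(\<lambda>u. if u \<in> F then f u else 0) \<in> carrier (free_star_alg P) \<and> Q (\<lambda>u. if u \<in> F then f u else 0)"
  if "finite F" "F \<subseteq> lsupp f" for F
  using that
 proof (induction F rule: finite_induct)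
  case empty
  then show ?case using zero ring.ring_simprules(2)[OF star_alg.axioms(1)[OF free_is_star_alg[of P]]] by (simp add: free_simps(4))
 next
  case (insert u F)
  have u: "u \<in> lists (P \<times> UNIV)" "f u \<noteq> 0" using insert free_carrierD(2)[OF f] by blast+
  let ?r = "\<lambda>v. if v \<in> F then f v else 0"
  have r: "?r \<in> carrier (free_star_alg P)" "Q ?r" using insert by auto
  have eq: "(\<lambda>v. if v \<in> Set.insert u F then f v else 0) = ?r \<oplus>\<^bsub>free_star_alg P\<^esub> cscale (free_star_alg P) (f u) (lmono u)"
   using insert(2) by (auto simp: free_simps(5,6) fun_eq_iff indicator_def)
  interpret star_alg "free_star_alg P" by (rule free_is_star_alg)
  show ?case unfolding eq using add[OF r u] r(1) u by simp
 qed
 from this[OF free_carrierD(1)[OF f] subset_refl]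
 have "Q (\<lambda>u. if u \<in> lsupp f then f u else 0)" by blast
 moreover have "(\<lambda>u. if u \<in> lsupp f then f u else 0) = f" by auto
 ultimately show ?thesis by simp
qed

lemma free_induct [consumes 1, case_names zero add]:
 assumes "f \<in> carrier (free_star_alg P)" "Q \<zero>\<^bsub>free_star_alg P\<^esub>"
  and "!!f c u. [|f \<in> carrier (free_star_alg P); Q f; u \<in> lists (P \<times> UNIV)|]
   ==> Q (f \<oplus>\<^bsub>free_star_alg P\<^esub> cscale (free_star_alg P) c (lmono u))"
 shows "Q f"
 using assms(1,2) by (rule free_induct_supp) (rule assms(3))

context partial_system
begin

definition lin_ext :: "(('b \<times> bool) list => 'g => 'x => complex) => (('b \<times> bool) list => complex) => 'g => 'x => complex" where
 "lin_ext m f = (\<lambda>g x. \<Sum>u\<in>lsupp f. f u * m u g x)"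

lemma lin_ext_eq:
 assumes "finite F" "lsupp f \<subseteq> F" shows "lin_ext m f = (\<lambda>g x. \<Sum>u\<in>F. f u * m u g x)"
 unfolding lin_ext_def by (intro ext sum.mono_neutral_left[OF assms]) auto

text \<open>Multiplicativity is first proved for a monomial on the left, by induction over the right
  factor, and then by induction over the left factor.\<close>

lemma lin_ext_star_hom:
 assumes m: "!!u. u \<in> lists (P \<times> UNIV) ==> m u \<in> carrier B"
  and append: "!!u v. [|u \<in> lists (P \<times> UNIV); v \<in> lists (P \<times> UNIV)|] ==> m (u @ v) = m u \<star> m v"
  and Nil: "m [] = \<one>\<^bsub>B\<^esub>"
  and star: "!!u. u \<in> lists (P \<times> UNIV) ==> m (star_word u) = adj B (m u)"
 shows "lin_ext m \<in> star_hom (free_star_alg P) B" and "lin_ext m (lmono u) = m u"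
proof -
 let ?A = "free_star_alg P"
 interpret A: star_alg ?A by (rule free_is_star_alg)
 have mono: "lin_ext m (lmono u) = m u" for u
  using lin_ext_eq[of "{u}" "lmono u" m] by (auto simp: fun_eq_iff indicator_def)
 then show "lin_ext m (lmono u) = m u" .
 have zero: "lin_ext m \<zero>\<^bsub>?A\<^esub> = \<zero>\<^bsub>B\<^esub>" by (simp add: lin_ext_def free_simps(4) B_simps)
 have add: "lin_ext m (f \<oplus>\<^bsub>?A\<^esub> h) = lin_ext m f \<uplus> lin_ext m h" if f: "f \<in> carrier ?A" and h: "h \<in> carrier ?A" for f h
 proof -
  let ?F = "lsupp f \<union> lsupp h"
  have F: "finite ?F" using free_carrierD(1)[OF f] free_carrierD(1)[OF h] by simp
  have s: "lsupp (\<lambda>u. f u + h u) \<subseteq> ?F" by auto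
  show ?thesis
   unfolding free_simps(5) lin_ext_eq[OF F s] lin_ext_eq[OF F Un_upper1] lin_ext_eq[OF F Un_upper2]
   by (simp add: B_simps sum.distrib distrib_right)
 qed
 have cs: "lin_ext m (cscale ?A c f) = cscale B c (lin_ext m f)" if f: "f \<in> carrier ?A" for c f
 proof -
  have s: "lsupp (\<lambda>u. c * f u) \<subseteq> lsupp f" by auto
  show ?thesis
   unfolding free_simps(6) lin_ext_eq[OF free_carrierD(1)[OF f] s]
   by (simp add: B_simps sum_distrib_left lin_ext_def mult.assoc)
 qed
 have closed: "lin_ext m f \<in> carrier B" if "f \<in> carrier ?A" for f
  using that by (induction rule: free_induct) (auto simp: zero add cs mono m)
 have mm: "lmono u \<otimes>\<^bsub>?A\<^esub> lmono v = lmono (u @ v)" for u v by (rule mono_mult)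
 have mult1: "lin_ext m (lmono u \<otimes>\<^bsub>?A\<^esub> h) = m u \<star> lin_ext m h" if u: "u \<in> lists (P \<times> UNIV)" and "h \<in> carrier ?A" for u h
  using that(2)
 proof (induction rule: free_induct)
  case (add h c v)
  then show ?case
   using u by (simp add: A.r_distr A.mult_cscale_right mm \<open>!!f h. _ ==> _ ==> lin_ext m (f \<oplus>\<^bsub>?A\<^esub> h) = _\<close>
     cs mono append m closed B.r_distr B.mult_cscale_right)
 qed (use u m in \<open>simp add: zero\<close>)
 have mult: "lin_ext m (f \<otimes>\<^bsub>?A\<^esub> h) = lin_ext m f \<star> lin_ext m h" if "f \<in> carrier ?A" and h: "h \<in> carrier ?A" for f h
  using that(1)
 proof (induction rule: free_induct)
  case (add f c v)
  then show ?case
   using h by (simp add: A.l_distr A.mult_cscale_left \<open>!!f h. _ ==> _ ==> lin_ext m (f \<oplus>\<^bsub>?A\<^esub> h) = _\<close>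
     cs mono mult1 m closed B.l_distr B.mult_cscale_left)
 qed (use h closed in \<open>simp add: zero\<close>)
 have adj: "lin_ext m (adj ?A f) = adj B (lin_ext m f)" if "f \<in> carrier ?A" for f
  using that
 proof (induction rule: free_induct)
  case (add f c v)
  then show ?case
   by (simp add: A.adj_add A.adj_cscale mono_adj star_word_lists \<open>!!f h. _ ==> _ ==> lin_ext m (f \<oplus>\<^bsub>?A\<^esub> h) = _\<close>
     cs mono m closed star B.adj_add B.adj_cscale)
 qed (simp add: zero)
 show "lin_ext m \<in> star_hom ?A B"
  by (rule star_homI) (use closed add mult cs adj mono[of "[]"] in \<open>auto simp: free_simps(3) Nil\<close>)
qed

end


section \<open>Constructible right ideals\<close>

lemma list_two_step_induct [case_names Nil one step]:
 assumes "Q []" "!!x. Q [x]" "!!x y zs. Q zs ==> Q (x # y # zs)" shows "Q xs"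
 by (induction xs rule: induct_list012) (use assms in auto)

locale submonoid_pair = group G for G :: "('g, 'm) monoid_scheme" (structure) +
 fixes P :: "'g set"
 assumes submonoid: "submonoid P G"
begin

abbreviation "J \<equiv> cideals G P"
abbreviation "K \<equiv> cideal G P"
abbreviation "val \<equiv> word_val G"
abbreviation "W \<equiv> pwords P"

lemma P_carrier: "p \<in> P ==> p \<in> carrier G"
 using submonoid by (auto simp: submonoid_def)

lemma P_one [simp]: "\<one> \<in> P"
 using submonoid by (auto simp: submonoid_def)

lemma P_mult: "[|p \<in> P; q \<in> P|] ==> p \<otimes> q \<in> P"
 using submonoid by (auto simp: submonoid_def)

lemma W_Nil [simp]: "[] \<in> W"
 by (simp add: pwords_def)

lemma W_step [simp]: "p # q # a \<in> W \<longleftrightarrow> p \<in> P \<and> q \<in> P \<and> a \<in> W"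
 by (auto simp: pwords_def)

lemma W_one [simp]: "[p] \<notin> W"
 by (simp add: pwords_def)

lemma W_append [simp]: "[|a \<in> W; \<beta> \<in> W|] ==> a @ \<beta> \<in> W"
 by (auto simp: pwords_def)

lemma W_rev [simp]: "a \<in> W ==> rev a \<in> W"
 by (auto simp: pwords_def)

lemma val_closed [simp]: "a \<in> W ==> val a \<in> carrier G"
 by (induction a rule: list_two_step_induct) (auto simp: P_carrier)

lemma val_append: "[|a \<in> W; \<beta> \<in> W|] ==> val (a @ \<beta>) = val a \<otimes> val \<beta>"
 by (induction a rule: list_two_step_induct) (auto simp: P_carrier m_assoc)

lemma val_rev: "a \<in> W ==> val (rev a) = inv (val a)"
proof (induction a rule: list_two_step_induct)
 case (step p q a)
 then have "val (rev (p # q # a)) = val (rev a @ [q, p])" by simp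
 also have "\<dots> = val (rev a) \<otimes> val [q, p]" using step by (intro val_append) auto
 finally show ?case using step by (simp add: P_carrier inv_mult_group m_assoc)
qed auto

lemma mem_l_coset:
 assumes g: "g \<in> carrier G" shows "x \<in> g <# P \<longleftrightarrow> x \<in> carrier G \<and> inv g \<otimes> x \<in> P"
proof
 assume "x \<in> g <# P"
 then obtain p where "p \<in> P" "x = g \<otimes> p" by (auto simp: l_coset_def)
 then show "x \<in> carrier G \<and> inv g \<otimes> x \<in> P" using g P_carrier[of p] by (simp flip: m_assoc)
next
 assume x: "x \<in> carrier G \<and> inv g \<otimes> x \<in> P"
 then have "x = g \<otimes> (inv g \<otimes> x)" using g by (simp flip: m_assoc)
 then show "x \<in> g <# P" using x by (auto simp: l_coset_def)
qed

lemma l_coset_subset: "p \<in> P ==> p <# P \<subseteq> P"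
 by (auto simp: l_coset_def P_mult)

lemma l_coset_self: "g \<in> carrier G ==> g \<in> g <# P"
 by (simp add: mem_l_coset)

lemma K_Nil: "K [] = P"
 by (simp add: cideal_def)

text \<open>The translate with index 0 belongs to the inverse of the value of the whole word, so
  membership says that the value moves \<open>x\<close> into \<open>P\<close>. The remaining
  translates are those of the shorter word.\<close>

lemma K_step:
 assumes "p # q # \<alpha> \<in> W" shows "K (p # q # \<alpha>) = {x \<in> K \<alpha>. val (p # q # \<alpha>) \<otimes> x \<in> P}"
proof -
 let ?a = "p # q # \<alpha>"
 let ?C = "\<lambda>\<alpha> i. val (rev (drop (2 * i) \<alpha>)) <# P"
 have 1: "(\<Inter>i<length ?a div 2. ?C ?a i) = ?C ?a 0 \<inter> (\<Inter>i<length \<alpha> div 2. ?C ?a (Suc i))"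
  by (auto simp: lessThan_Suc_eq_insert_0)
 have 2: "?C ?a (Suc i) = ?C \<alpha> i" for i by simp
 have 3: "?C ?a 0 = {x \<in> carrier G. val ?a \<otimes> x \<in> P}"
 proof -
  have "val (rev ?a) = inv (val ?a)" by (rule val_rev[OF assms])
  then have "x \<in> ?C ?a 0 \<longleftrightarrow> x \<in> carrier G \<and> val ?a \<otimes> x \<in> P" for x
   using mem_l_coset[of "inv (val ?a)" x] val_closed[OF assms] by simp
  then show ?thesis by blast
 qed
 show ?thesis unfolding cideal_def 1 2 3 using P_carrier by blast
qed

lemma K_subset: "a \<in> W ==> K a \<subseteq> P"
 by (auto simp: cideal_def)

text \<open>The set \<open>K a\<close> is the domain of the partial bijection
  \<open>x -> val a \<otimes> x\<close> composed of the steps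
  \<open>x -> inv p \<otimes> q \<otimes> x\<close> within \<open>P\<close>, read from the right.
  Concatenation of words is composition of partial bijections, and reversal is inversion.\<close>

lemma K_append: "[|a \<in> W; \<beta> \<in> W|] ==> K (a @ \<beta>) = {x \<in> K \<beta>. val \<beta> \<otimes> x \<in> K a}"
proof (induction a rule: list_two_step_induct)
 case Nil
 have "val \<beta> \<otimes> x \<in> P" if "x \<in> K \<beta>" for x
 proof (cases \<beta>)
  case Nil
  then show ?thesis using that by (simp add: K_Nil P_carrier)
 next
  case (Cons p \<beta>')
  then obtain q \<beta>'' where "\<beta> = p # q # \<beta>''" using \<open>\<beta> \<in> W\<close> by (cases \<beta>') auto
  then show ?thesis using that K_step[of p q \<beta>''] \<open>\<beta> \<in> W\<close> by blast
 qed
 then show ?case by (auto simp: K_Nil)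
next
 case (step p q a)
 have w: "p # q # (a @ \<beta>) \<in> W" using step by simp
 have "K ((p # q # a) @ \<beta>) = {x \<in> K (a @ \<beta>). val ((p # q # a) @ \<beta>) \<otimes> x \<in> P}"
  using K_step[OF w] by simp
 also have "\<dots> = {x \<in> K \<beta>. val \<beta> \<otimes> x \<in> K a \<and> val (p # q # a) \<otimes> (val \<beta> \<otimes> x) \<in> P}"
  using step K_subset[OF \<open>\<beta> \<in> W\<close>] val_append[OF step(2,3)] val_closed[OF step(2)] val_closed[OF step(3)]
  by (auto simp: m_assoc P_carrier subset_iff)
 also have "\<dots> = {x \<in> K \<beta>. val \<beta> \<otimes> x \<in> K (p # q # a)}" using K_step[OF step(2)] by blast
 finally show ?case .
qed simp

lemma K_val: "[|a \<in> W; x \<in> K a|] ==> val a \<otimes> x \<in> P"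
 using K_append[of "[]" a] by (auto simp: K_Nil)

lemma K_rev_mem: "[|a \<in> W; x \<in> K a|] ==> val a \<otimes> x \<in> K (rev a)"
proof (induction a arbitrary: x rule: list_two_step_induct)
 case (step p q a)
 have pq: "p \<in> carrier G" "q \<in> carrier G" "a \<in> W" using step by (auto simp: P_carrier)
 have x: "x \<in> K a" "val (p # q # a) \<otimes> x \<in> P" using K_step[OF step(2)] step(3) by auto
 then have xc: "x \<in> carrier G" using K_subset[OF pq(3)] P_carrier by blast
 have y: "val a \<otimes> x \<in> K (rev a)" using step x by simp
 then have yP: "val a \<otimes> x \<in> P" using K_subset pq(3) W_rev by blast
 let ?z = "val (p # q # a) \<otimes> x"
 have z: "val [q, p] \<otimes> ?z = val a \<otimes> x"
 proof -
  have "inv q \<otimes> p \<otimes> (inv p \<otimes> q \<otimes> (val a \<otimes> x)) = inv q \<otimes> (p \<otimes> inv p) \<otimes> q \<otimes> (val a \<otimes> x)"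
   using pq xc val_closed[OF pq(3)] by (simp only: m_assoc m_closed inv_closed)
  then show ?thesis using pq xc val_closed[OF pq(3)] by (simp add: m_assoc)
 qed
 have "?z \<in> K [q, p]" using K_step[of q p "[]"] step x(2) z yP by (simp add: K_Nil)
 then have "?z \<in> K (rev a @ [q, p])" using K_append[of "rev a" "[q, p]"] step y z by simp
 then show ?case by simp
qed (auto simp: K_Nil P_carrier)

lemma K_rev_iff:
 assumes "a \<in> W" "x \<in> carrier G" shows "val a \<otimes> x \<in> K (rev a) \<longleftrightarrow> x \<in> K a"
proof
 assume "val a \<otimes> x \<in> K (rev a)"
 from K_rev_mem[OF W_rev[OF assms(1)] this] show "x \<in> K a"
  using assms by (simp add: val_rev flip: m_assoc)
qed (use K_rev_mem assms in blast)

lemma J_I: "a \<in> W ==> K a \<in> J"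
 by (simp add: cideals_def)

lemma P_in_J [simp]: "P \<in> J"
 using J_I[of "[]"] by (simp add: K_Nil)

lemma J_subset: "S \<in> J ==> S \<subseteq> P"
 using K_subset by (auto simp: cideals_def)

text \<open>The word \<open>rev a @ a\<close> runs through \<open>a\<close> and back: same domain,
  trivial value.\<close>

lemma J_neutral:
 assumes "S \<in> J" obtains a where "a \<in> W" "val a = \<one>" "S = K a"
proof -
 obtain a where a: "a \<in> W" "S = K a" using assms by (auto simp: cideals_def)
 have "K (rev a @ a) = K a" using K_append[of "rev a" a] a K_rev_mem by auto
 moreover have "val (rev a @ a) = \<one>" using a by (simp add: val_append val_rev)
 ultimately show thesis using that[of "rev a @ a"] a by simp
qed

text \<open>Precomposing with a neutral word of domain \<open>S\<close> restricts the domain and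
  keeps the value.\<close>

lemma J_restrict:
 assumes "S \<in> J" "a \<in> W" obtains \<beta> where "\<beta> \<in> W" "val \<beta> = val a" "K \<beta> = K a \<inter> S"
proof -
 obtain \<sigma> where \<sigma>: "\<sigma> \<in> W" "val \<sigma> = \<one>" "S = K \<sigma>" using J_neutral[OF assms(1)] by blast
 have "K (a @ \<sigma>) = {x \<in> S. x \<in> K a}"
  using K_append[of a \<sigma>] \<sigma> assms(2) J_subset[OF assms(1)] P_carrier by auto
 then show thesis using that[of "a @ \<sigma>"] \<sigma> assms(2) by (auto simp: val_append)
qed

lemma J_inter [simp]: "[|R \<in> J; S \<in> J|] ==> R \<inter> S \<in> J"
proof -
 assume a: "R \<in> J" "S \<in> J"
 then obtain \<rho> where "\<rho> \<in> W" "R = K \<rho>" by (auto simp: cideals_def)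
 moreover then obtain \<beta> where "\<beta> \<in> W" "K \<beta> = K \<rho> \<inter> S" using J_restrict[OF a(2)] by blast
 ultimately show ?thesis using J_I by metis
qed

lemma J_pull: "[|S \<in> J; \<alpha> \<in> W|] ==> {x \<in> K \<alpha>. val \<alpha> \<otimes> x \<in> S} \<in> J"
proof -
 assume a: "S \<in> J" "\<alpha> \<in> W"
 then obtain \<sigma> where \<sigma>: "\<sigma> \<in> W" "S = K \<sigma>" by (auto simp: cideals_def)
 show ?thesis using K_append[OF \<sigma>(1) a(2)] J_I[OF W_append[OF \<sigma>(1) a(2)]] \<sigma>(2) by simp
qed

lemma K_right_ideal: "[|a \<in> W; x \<in> K a; p \<in> P|] ==> x \<otimes> p \<in> K a"
proof (induction a rule: list_two_step_induct)
 case (step s t a)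
 have "x \<in> K a" "val (s # t # a) \<otimes> x \<in> P" using K_step[OF step(2)] step(3) by auto
 moreover have "x \<in> carrier G" using calculation(1) K_subset[of a] step(2) P_carrier by auto
 ultimately show ?case
  using K_step[OF step(2)] step P_mult[of "val (s # t # a) \<otimes> x" p] val_closed[OF step(2)] P_carrier[of p]
  by (auto simp: m_assoc simp del: word_val.simps)
qed (auto simp: K_Nil P_mult)

lemma J_right_ideal: "[|S \<in> J; x \<in> S|] ==> x <# P \<subseteq> S"
 using K_right_ideal by (auto simp: cideals_def l_coset_def)

lemma K_pair: "[|p \<in> P; q \<in> P|] ==> K [p, q] = {x \<in> P. inv p \<otimes> q \<otimes> x \<in> P}"
 using K_step[of p q "[]"] by (simp add: K_Nil P_carrier)

lemma K_principal: "p \<in> P ==> K [p, \<one>] = p <# P"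
 using K_pair[of p \<one>] l_coset_subset[of p] mem_l_coset[of p] P_carrier by auto

lemma principal_J [simp]: "p \<in> P ==> p <# P \<in> J"
 using J_I[of "[p, \<one>]"] K_principal by simp

lemma exists_word:
 assumes g: "g \<in> carrier G" and r: "r \<in> P" "g \<otimes> r \<in> P"
 obtains \<alpha> where "\<alpha> \<in> W" "val \<alpha> = g" "r \<in> K \<alpha>"
proof -
 \<comment> \<open>Read from the right: divide by \<open>r\<close>, then multiply by
   \<open>g \<otimes> r\<close>. Both stages stay in \<open>P\<close> when started at
   \<open>r\<close>.\<close>
 let ?a = "[\<one>, g \<otimes> r, r, \<one>]"
 have W: "?a \<in> W" using r by simp
 have v: "val ?a = g" using g P_carrier[OF r(1)] by (simp add: m_assoc)
 have "K ?a = {x \<in> r <# P. g \<otimes> x \<in> P}" using K_step[of \<one> "g \<otimes> r" "[r, \<one>]"] r K_principal[OF r(1)] v by simp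
 then show thesis using that[OF W v] r l_coset_self P_carrier by blast
qed

section \<open>Characters\<close>

lemma J_hatD:
 assumes "w \<in> J_hat G P"
 shows "S \<in> J ==> w S = 0 \<or> w S = 1" "[|R \<in> J; S \<in> J|] ==> w (R \<inter> S) = w R * w S" "{} \<in> J ==> w {} = 0"
  "w P = 1" "S \<notin> J ==> w S = undefined"
proof -
 show 1: "S \<in> J ==> w S = 0 \<or> w S = 1" for S using assms by (auto simp: J_hat_def PiE_def Pi_def)
 show 2: "[|R \<in> J; S \<in> J|] ==> w (R \<inter> S) = w R * w S" for R S using assms by (auto simp: J_hat_def)
 show "{} \<in> J ==> w {} = 0" using assms by (auto simp: J_hat_def)
 show "S \<notin> J ==> w S = undefined" using assms by (auto simp: J_hat_def PiE_def extensional_def)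
 obtain S where S: "S \<in> J" "w S \<noteq> 0" using assms by (auto simp: J_hat_def)
 have "w (P \<inter> S) = w P * w S" using 2[OF P_in_J S(1)] .
 then show "w P = 1" using S J_subset[OF S(1)] 1[OF P_in_J] by (simp add: Int_absorb1)
qed

lemma char_mono: "[|w \<in> J_hat G P; R \<in> J; S \<in> J; w R = 1; R \<subseteq> S|] ==> w S = 1"
 using J_hatD(2)[of w R S] by (simp add: Int_absorb2)

lemma char_inter: "[|w \<in> J_hat G P; R \<in> J; S \<in> J|] ==> w (R \<inter> S) = 1 \<longleftrightarrow> w R = 1 \<and> w S = 1"
 using J_hatD(2)[of w R S] by simp

lemma char_nonempty: "[|w \<in> J_hat G P; S \<in> J; w S = 1|] ==> S \<noteq> {}"
 using J_hatD(3)[of w] by (cases "S = {}") simp_all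

lemma char_eqI:
 assumes "w \<in> J_hat G P" "v \<in> J_hat G P" "!!S. S \<in> J ==> w S = 1 \<longleftrightarrow> v S = 1" shows "w = v"
proof
 fix S show "w S = v S"
  using J_hatD(1)[OF assms(1), of S] J_hatD(1)[OF assms(2), of S] J_hatD(5)[OF assms(1), of S] J_hatD(5)[OF assms(2), of S] assms(3)[of S]
  by (cases "S \<in> J") auto
qed

text \<open>Supports of characters are exactly these proper filters, so maximality and Zorn's lemma
  are handled with sets of ideals.\<close>

definition filt :: "'g set set => bool" where
 "filt F \<longleftrightarrow> F \<subseteq> J \<and> P \<in> F \<and> {} \<notin> F \<and> (\<forall>R\<in>F. \<forall>S\<in>F. R \<inter> S \<in> F) \<and> (\<forall>R\<in>F. \<forall>S\<in>J. R \<subseteq> S --> S \<in> F)"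

lemma filtD:
 assumes "filt F"
 shows "R \<in> F ==> R \<in> J" "P \<in> F" "{} \<notin> F" "[|R \<in> F; S \<in> F|] ==> R \<inter> S \<in> F" "[|R \<in> F; S \<in> J; R \<subseteq> S|] ==> S \<in> F"
 using assms by (auto simp: filt_def)

definition char_of :: "'g set set => 'g set => nat" where
 "char_of F = (\<lambda>S\<in>J. if S \<in> F then 1 else 0)"

lemma char_of_J_hat: assumes "filt F" shows "char_of F \<in> J_hat G P"
proof -
 have F: "P \<in> F" "{} \<notin> F" "!!R S. [|R \<in> F; S \<in> F|] ==> R \<inter> S \<in> F" "!!R S. [|R \<in> F; S \<in> J; R \<subseteq> S|] ==> S \<in> F"
  using assms by (auto simp: filt_def)
 have "char_of F (R \<inter> S) = char_of F R * char_of F S" if RS: "R \<in> J" "S \<in> J" for R S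
 proof -
  have "R \<inter> S \<in> F \<longleftrightarrow> R \<in> F \<and> S \<in> F"
   using F(3)[of R S] F(4)[of "R \<inter> S" R] F(4)[of "R \<inter> S" S] RS by blast
  then show ?thesis using RS by (simp add: char_of_def)
 qed
 moreover have "char_of F \<in> J \<rightarrow>\<^sub>E {0, 1}" by (auto simp: char_of_def)
 moreover have "char_of F P \<noteq> 0" using F(1) by (simp add: char_of_def)
 moreover have "{} \<in> J --> char_of F {} = 0" using F(2) by (simp add: char_of_def)
 ultimately show ?thesis unfolding J_hat_def using P_in_J by blast
qed

lemma char_of_support: "filt F ==> char_support G P (char_of F) = F"
 by (auto simp: char_support_def char_of_def filt_def)

lemma support_filt: assumes w: "w \<in> J_hat G P" shows "filt (char_support G P w)"
 unfolding filt_def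
proof (intro conjI ballI impI)
 show "char_support G P w \<subseteq> J" "P \<in> char_support G P w"
  using J_hatD(4)[OF w] by (auto simp: char_support_def)
 show "{} \<notin> char_support G P w" using char_nonempty[OF w] by (auto simp: char_support_def)
 fix R assume R: "R \<in> char_support G P w"
 show "S \<in> char_support G P w" if "S \<in> J" "R \<subseteq> S" for S
  using R that char_mono[OF w, of R S] by (simp add: char_support_def)
 show "R \<inter> S \<in> char_support G P w" if "S \<in> char_support G P w" for S
  using R that char_inter[OF w, of R S] by (simp add: char_support_def)
qed

text \<open>If \<open>S\<close> met every ideal of the filter, the ideals containing some
  \<open>T \<inter> S\<close> would form a larger proper filter, one that contains
  \<open>S\<close>.\<close>

lemma maximal_charsD:
 assumes "w \<in> maximal_chars G P"
 shows "w \<in> J_hat G P" "[|S \<in> J; w S = 0|] ==> \<exists>T\<in>J. w T = 1 \<and> T \<inter> S = {}"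
proof -
 show w: "w \<in> J_hat G P" using assms by (simp add: maximal_chars_def)
 show "\<exists>T\<in>J. w T = 1 \<and> T \<inter> S = {}" if S: "S \<in> J" "w S = 0"
 proof (rule ccontr)
  assume neg: "\<not> ?thesis"
  define F where "F = {R \<in> J. \<exists>T\<in>J. w T = 1 \<and> T \<inter> S \<subseteq> R}"
  have fF: "filt F" unfolding filt_def
  proof (intro conjI ballI impI)
   show "F \<subseteq> J" "P \<in> F" using J_hatD(4)[OF w] J_subset by (auto simp: F_def intro!: bexI[of _ P])
   show "{} \<notin> F" using neg by (auto simp: F_def)
   fix R assume R: "R \<in> F"
   then obtain T where T: "T \<in> J" "w T = 1" "T \<inter> S \<subseteq> R" "R \<in> J" by (auto simp: F_def)
   show "R' \<in> F" if "R' \<in> J" "R \<subseteq> R'" for R' using T that by (auto simp: F_def)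
   fix R' assume "R' \<in> F"
   then obtain T' where T': "T' \<in> J" "w T' = 1" "T' \<inter> S \<subseteq> R'" "R' \<in> J" by (auto simp: F_def)
   show "R \<inter> R' \<in> F" unfolding F_def
    using T T' char_inter[OF w T(1) T'(1)] by (auto intro!: bexI[of _ "T \<inter> T'"])
  qed
  have "char_support G P w \<subseteq> char_support G P (char_of F)"
   unfolding char_of_support[OF fF] by (auto simp: F_def char_support_def)
  then have "char_support G P (char_of F) = char_support G P w"
   using assms char_of_J_hat[OF fF] unfolding maximal_chars_def by blast
  then have "F = char_support G P w" unfolding char_of_support[OF fF] .
  moreover have "S \<in> F" using S(1) J_hatD(4)[OF w] by (auto simp: F_def intro!: bexI[of _ P])
  ultimately show False using S by (simp add: char_support_def)
 qed
qed

lemma maximal_charsI: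
 assumes w: "w \<in> J_hat G P" and ultra: "!!S. [|S \<in> J; w S = 0|] ==> \<exists>T\<in>J. w T = 1 \<and> T \<inter> S = {}"
 shows "w \<in> maximal_chars G P"
 unfolding maximal_chars_def
proof (intro CollectI conjI ballI impI)
 fix v assume v: "v \<in> J_hat G P" and sub: "char_support G P w \<subseteq> char_support G P v"
 show "char_support G P v = char_support G P w"
 proof (rule ccontr)
  assume "\<not> ?thesis"
  then obtain S where S: "S \<in> J" "v S = 1" "w S \<noteq> 1" using sub by (auto simp: char_support_def)
  then have "w S = 0" using J_hatD(1)[OF w S(1)] by simp
  then obtain T where T: "T \<in> J" "w T = 1" "T \<inter> S = {}" using ultra S(1) by blast
  then have "v T = 1" using sub by (auto simp: char_support_def)
  then have "v (T \<inter> S) = 1" using char_inter[OF v T(1) S(1)] S by simp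
  then show False using char_nonempty[OF v J_inter[OF T(1) S(1)]] T by simp
 qed
qed (fact w)

text \<open>Zorn's lemma among the filters containing \<open>S\<close>. A maximal one is maximal
  among all filters, since a larger filter still contains \<open>S\<close>.\<close>

lemma exists_maximal:
 assumes S: "S \<in> J" "S \<noteq> {}" obtains w where "w \<in> maximal_chars G P" "w S = 1"
proof -
 let ?A = "{F. filt F \<and> S \<in> F}"
 have "{R \<in> J. S \<subseteq> R} \<in> ?A" using S J_subset[OF S(1)] by (auto simp: filt_def)
 then have ne: "?A \<noteq> {}" by blast
 have chain: "\<Union>C \<in> ?A" if C: "C \<noteq> {}" "subset.chain ?A C" for C
 proof -
  have sub: "!!F. F \<in> C ==> filt F \<and> S \<in> F" using C(2) by (auto simp: subset.chain_def)
  have lin: "F \<subseteq> F' \<or> F' \<subseteq> F" if "F \<in> C" "F' \<in> C" for F F' using C(2) that by (auto simp: subset.chain_def)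
  have filt: "filt F" if "F \<in> C" for F using sub[OF that] by blast
  have "filt (\<Union>C)" unfolding filt_def
  proof (intro conjI ballI impI)
   show "\<Union>C \<subseteq> J" using filtD(1)[OF filt] by blast
   show "P \<in> \<Union>C" using C(1) filtD(2)[OF filt] by blast
   show "{} \<notin> \<Union>C" using filtD(3)[OF filt] by blast
   fix R assume "R \<in> \<Union>C"
   then obtain F where F: "F \<in> C" "R \<in> F" by blast
   show "T \<in> \<Union>C" if "T \<in> J" "R \<subseteq> T" for T using F filtD(5)[OF filt[OF F(1)] F(2) that] by blast
   fix T assume "T \<in> \<Union>C"
   then obtain F' where F': "F' \<in> C" "T \<in> F'" by blast
   consider "R \<in> F'" | "T \<in> F" using lin[OF F(1) F'(1)] F F' by blast
   then show "R \<inter> T \<in> \<Union>C"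
    using F F' filtD(4)[OF filt[OF F(1)] F(2)] filtD(4)[OF filt[OF F'(1)] _ F'(2)] by cases blast+
  qed
  then show ?thesis using sub C(1) by blast
 qed
 obtain M where M: "M \<in> ?A" "\<forall>X\<in>?A. M \<subseteq> X --> X = M" using subset_Zorn_nonempty[OF ne chain] by blast
 have "char_of M \<in> maximal_chars G P"
  unfolding maximal_chars_def
 proof (intro CollectI conjI ballI impI)
  show "char_of M \<in> J_hat G P" using M(1) char_of_J_hat by blast
  fix v assume v: "v \<in> J_hat G P" "char_support G P (char_of M) \<subseteq> char_support G P v"
  then show "char_support G P v = char_support G P (char_of M)"
  proof -
   have fM: "filt M" and SM: "S \<in> M" using M(1) by auto
   have "M \<subseteq> char_support G P v" using v(2) unfolding char_of_support[OF fM] .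
   then show ?thesis using M(2) support_filt[OF v(1)] SM unfolding char_of_support[OF fM] by blast
  qed
 qed
 moreover have "char_of M S = 1" using M(1) S(1) by (simp add: char_of_def)
 ultimately show thesis using that by blast
qed

text \<open>Each ideal of the finite family is decided by one ideal of value 1, and the intersection
  of these decides all of them. This converts agreement of characters on a finite family into
  containment and disjointness.\<close>

lemma maximal_separate:
 assumes w: "w \<in> maximal_chars G P" and F: "finite \<S>" "\<S> \<subseteq> J"
 obtains R where "R \<in> J" "w R = 1" "!!S. [|S \<in> \<S>; w S = 1|] ==> R \<subseteq> S" "!!S. [|S \<in> \<S>; w S \<noteq> 1|] ==> R \<inter> S = {}"
proof -
 note \<omega>J = maximal_charsD(1)[OF w]
 have "\<exists>R\<in>J. w R = 1 \<and> (\<forall>S\<in>\<S>. (w S = 1 --> R \<subseteq> S) \<and> (w S \<noteq> 1 --> R \<inter> S = {}))"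
  using F
 proof (induction \<S> rule: finite_induct)
  case empty
  then show ?case using J_hatD(4)[OF \<omega>J] P_in_J by blast
 next
  case (insert S \<S>)
  then obtain R where R: "R \<in> J" "w R = 1" "\<forall>S\<in>\<S>. (w S = 1 --> R \<subseteq> S) \<and> (w S \<noteq> 1 --> R \<inter> S = {})" by auto
  have S: "S \<in> J" using insert by simp
  obtain T where T: "T \<in> J" "w T = 1" "w S = 1 --> T \<subseteq> S" "w S \<noteq> 1 --> T \<inter> S = {}"
  proof (cases "w S = 1")
   case False
   then have "w S = 0" using J_hatD(1)[OF \<omega>J S] by simp
   then show thesis using that maximal_charsD(2)[OF w S] False by auto
  qed (use S that in auto)
  have "(w S' = 1 --> R \<inter> T \<subseteq> S') \<and> (w S' \<noteq> 1 --> R \<inter> T \<inter> S' = {})" if "S' \<in> Set.insert S \<S>" for S'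
  proof (cases "S' = S")
   case True
   then show ?thesis using T(3,4) by blast
  next
   case False
   then show ?thesis using that R(3)[rule_format, of S'] by blast
  qed
  moreover have "w (R \<inter> T) = 1" using R(2) T(2) char_inter[OF \<omega>J R(1) T(1)] by simp
  ultimately show ?case using J_inter[OF R(1) T(1)] by blast
 qed
 then obtain R where "R \<in> J" "w R = 1" "\<forall>S\<in>\<S>. (w S = 1 --> R \<subseteq> S) \<and> (w S \<noteq> 1 --> R \<inter> S = {})" by blast
 then show thesis by (intro that[of R]) simp_all
qed

subsection \<open>Topology of the boundary\<close>

abbreviation "Bd \<equiv> bd_Omega G P"
abbreviation "T \<equiv> bd_top G P"
abbreviation "JT \<equiv> product_topology (\<lambda>_. discrete_topology {0, 1 :: nat}) J"

lemma topspace_J_hat_top: "topspace (J_hat_top G P) = J_hat G P"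
 by (auto simp: J_hat_top_def J_hat_def)

lemma openin_eval: "S \<in> J ==> openin JT {w \<in> topspace JT. w S \<in> A}"
proof -
 assume S: "S \<in> J"
 have "continuous_map JT (discrete_topology {0, 1}) (\<lambda>w. w S)"
  using continuous_map_product_projection[OF S, of "\<lambda>_. discrete_topology {0, 1 :: nat}"] .
 from openin_continuous_map_preimage[OF this, of "A \<inter> {0, 1}"]
 have "openin JT {w \<in> topspace JT. w S \<in> A \<inter> {0, 1}}" by simp
 moreover have "{w \<in> topspace JT. w S \<in> A \<inter> {0, 1}} = {w \<in> topspace JT. w S \<in> A}"
  by (rule Collect_cong) (use S in \<open>auto simp: PiE_def Pi_def\<close>)
 ultimately show ?thesis by simp
qed

lemma closedin_eval: "S \<in> J ==> closedin JT {w \<in> topspace JT. w S \<in> A}"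
proof -
 assume S: "S \<in> J"
 have "topspace JT - {w \<in> topspace JT. w S \<in> A} = {w \<in> topspace JT. w S \<in> -A}" by auto
 then show ?thesis using openin_eval[OF S, of "-A"] by (auto simp: closedin_def)
qed

lemma closedin_J_hat: "closedin JT (J_hat G P)"
proof -
 let ?C = "\<lambda>R S. {w \<in> topspace JT. w (R \<inter> S) = w R * w S}"
 have C: "closedin JT (?C R S)" if RS: "R \<in> J" "S \<in> J" for R S
 proof -
  \<comment> \<open>Multiplicativity involves only four combinations of values, each of which is a
    closed condition.\<close>
  define D where "D a b = {w \<in> topspace JT. w R \<in> {a}} \<inter> {w \<in> topspace JT. w S \<in> {b}} \<inter> {w \<in> topspace JT. w (R \<inter> S) \<in> {a * b}}" for a b
  have eq: "?C R S = (\<Union>a\<in>{0, 1}. \<Union>b\<in>{0, 1}. D a b)"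
  proof (intro subset_antisym subsetI)
   fix w assume a: "w \<in> ?C R S"
   then have "w R \<in> {0, 1}" "w S \<in> {0, 1}" using RS by (auto simp: PiE_def Pi_def)
   moreover have "w \<in> D (w R) (w S)" using a by (simp add: D_def)
   ultimately show "w \<in> (\<Union>a\<in>{0, 1}. \<Union>b\<in>{0, 1}. D a b)" by blast
  qed (auto simp: D_def)
  have "closedin JT (D a b)" for a b
   unfolding D_def using RS by (intro closedin_Int closedin_eval J_inter)
  then show ?thesis unfolding eq by (simp add: closedin_Un)
 qed
 \<comment> \<open>Being nonzero is not visibly a closed condition; for multiplicative functions it
   amounts to the value 1 at \<open>P\<close>, which is.\<close>
 have eq: "J_hat G P = {w \<in> topspace JT. w P \<in> {1}} \<inter> (\<Inter>R\<in>J. \<Inter>S\<in>J. ?C R S) \<inter>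
   (if {} \<in> J then {w \<in> topspace JT. w {} \<in> {0}} else topspace JT)" (is "_ = ?E")
 proof (intro subset_antisym subsetI)
  fix w assume w: "w \<in> J_hat G P"
  have "w \<in> topspace JT" using w by (simp add: J_hat_def)
  then show "w \<in> ?E" using J_hatD(2-4)[OF w] by simp
 next
  fix w assume w: "w \<in> ?E"
  then have "w \<in> J \<rightarrow>\<^sub>E {0, 1}" "w P \<noteq> 0" by simp_all
  moreover have "\<forall>R\<in>J. \<forall>S\<in>J. w (R \<inter> S) = w R * w S" using w by simp
  moreover have "{} \<in> J --> w {} = 0" using w by (cases "{} \<in> J") simp_all
  ultimately show "w \<in> J_hat G P" unfolding J_hat_def using P_in_J by blast
 qed
 have c2: "closedin JT (\<Inter>R\<in>J. \<Inter>S\<in>J. ?C R S)"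
 proof (rule closedin_INT)
  show "J \<noteq> {}" using P_in_J by blast
  show "closedin JT (\<Inter>S\<in>J. ?C R S)" if "R \<in> J" for R
   by (rule closedin_INT) (use P_in_J C that in blast)+
 qed
 have c3: "closedin JT (if {} \<in> J then {w \<in> topspace JT. w {} \<in> {0}} else topspace JT)"
  using closedin_eval[of "{}" "{0}"] closedin_topspace[of JT] by presburger
 show ?thesis unfolding eq by (intro closedin_Int closedin_eval P_in_J c2 c3)
qed

lemma compact_J_hat_top: "compact_space (J_hat_top G P)"
proof -
 have "compact_space JT"
  by (simp add: compact_space_product_topology compact_space_discrete_topology)
 then show ?thesis
  unfolding J_hat_top_def using closedin_J_hat closedin_compact_space compact_space_subtopology by blast
qed

lemma Hausdorff_J_hat_top: "Hausdorff_space (J_hat_top G P)"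
 unfolding J_hat_top_def
 by (intro Hausdorff_space_subtopology) (simp add: Hausdorff_space_product_topology)

lemma J_hat_nbhd:
 assumes V: "openin (J_hat_top G P) V" and w: "w \<in> V"
 obtains \<S> where "finite \<S>" "\<S> \<subseteq> J" "!!v. [|v \<in> J_hat G P; !!S. S \<in> \<S> ==> v S = w S|] ==> v \<in> V"
proof -
 obtain V' where V': "openin JT V'" "V = V' \<inter> J_hat G P"
  using V by (auto simp: J_hat_top_def openin_subtopology)
 obtain X where X: "w \<in> (\<Pi>\<^sub>E i\<in>J. X i)" "!!i. openin (discrete_topology {0, 1 :: nat}) (X i)"
   "finite {i. X i \<noteq> {0, 1}}" "(\<Pi>\<^sub>E i\<in>J. X i) \<subseteq> V'"
  using product_topology_open_contains_basis[OF V'(1), of w] w V'(2) by auto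
 show thesis
 proof (rule that[of "{i. X i \<noteq> {0, 1}} \<inter> J"])
  fix v assume v: "v \<in> J_hat G P" and eq: "!!S. S \<in> {i. X i \<noteq> {0, 1}} \<inter> J ==> v S = w S"
  have "v S \<in> X S" if "S \<in> J" for S
   using eq[of S] X(1) that J_hatD(1)[OF v that] by (cases "X S = {0, 1}") (auto simp: PiE_def Pi_def)
  moreover have "v \<in> extensional J" using v by (auto simp: J_hat_def PiE_def)
  ultimately have "v \<in> (\<Pi>\<^sub>E i\<in>J. X i)" by (auto simp: PiE_def)
  then show "v \<in> V" using X(4) V'(2) v by blast
 qed (use X(3) in auto)
qed

lemma openin_J_hat_eval: "S \<in> J ==> openin (J_hat_top G P) {w \<in> J_hat G P. w S \<in> A}"
proof -
 assume S: "S \<in> J"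
 have "{w \<in> J_hat G P. w S \<in> A} = {w \<in> topspace JT. w S \<in> A} \<inter> J_hat G P" by (auto simp: J_hat_def)
 then show ?thesis unfolding J_hat_top_def openin_subtopology using openin_eval[OF S] by blast
qed

lemma openin_J_hat_agree:
 assumes "finite \<S>" "\<S> \<subseteq> J" shows "openin (J_hat_top G P) {v \<in> J_hat G P. \<forall>S\<in>\<S>. v S = w S}"
 using assms
proof (induction \<S> rule: finite_induct)
 case empty
 then show ?case using openin_topspace[of "J_hat_top G P"] by (simp add: topspace_J_hat_top)
next
 case (insert S \<S>)
 have eq: "{v \<in> J_hat G P. \<forall>S'\<in>Set.insert S \<S>. v S' = w S'} = {v \<in> J_hat G P. v S \<in> {w S}} \<inter> {v \<in> J_hat G P. \<forall>S\<in>\<S>. v S = w S}"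
  by auto
 have S: "S \<in> J" and IH: "openin (J_hat_top G P) {v \<in> J_hat G P. \<forall>S\<in>\<S>. v S = w S}" using insert by auto
 show ?case unfolding eq by (rule openin_Int[OF openin_J_hat_eval[OF S] IH])
qed

text \<open>The finitary form of the closure. Statements about boundary characters that involve only
  finitely many ideals can be transferred from maximal characters by it.\<close>

lemma bd_iff:
 "w \<in> Bd \<longleftrightarrow> w \<in> J_hat G P \<and> (\<forall>\<S>. finite \<S> \<and> \<S> \<subseteq> J --> (\<exists>v\<in>maximal_chars G P. \<forall>S\<in>\<S>. v S = w S))"
proof
 assume w: "w \<in> Bd"
 then have J: "w \<in> J_hat G P" by (simp add: bd_Omega_def in_closure_of topspace_J_hat_top)
 have "\<exists>v\<in>maximal_chars G P. \<forall>S\<in>\<S>. v S = w S" if "finite \<S>" "\<S> \<subseteq> J" for \<S>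
 proof -
  have "\<forall>V. w \<in> V \<and> openin (J_hat_top G P) V --> (\<exists>v. v \<in> maximal_chars G P \<and> v \<in> V)"
   using w unfolding bd_Omega_def in_closure_of by (rule conjunct2)
  from this[THEN spec, of "{v \<in> J_hat G P. \<forall>S\<in>\<S>. v S = w S}"]
  show ?thesis using openin_J_hat_agree[OF that, of w] J by auto
 qed
 then show "w \<in> J_hat G P \<and> (\<forall>\<S>. finite \<S> \<and> \<S> \<subseteq> J --> (\<exists>v\<in>maximal_chars G P. \<forall>S\<in>\<S>. v S = w S))"
  using J by blast
next
 assume R: "w \<in> J_hat G P \<and> (\<forall>\<S>. finite \<S> \<and> \<S> \<subseteq> J --> (\<exists>v\<in>maximal_chars G P. \<forall>S\<in>\<S>. v S = w S))"
 have "\<exists>v. v \<in> maximal_chars G P \<and> v \<in> V" if V: "w \<in> V" "openin (J_hat_top G P) V" for V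
 proof -
  obtain \<S> where \<S>: "finite \<S>" "\<S> \<subseteq> J" "!!v. [|v \<in> J_hat G P; !!S. S \<in> \<S> ==> v S = w S|] ==> v \<in> V"
   using J_hat_nbhd[OF V(2,1)] by blast
  then obtain v where "v \<in> maximal_chars G P" "\<forall>S\<in>\<S>. v S = w S" using R by blast
  then show ?thesis using \<S>(3) maximal_charsD(1) by blast
 qed
 then show "w \<in> Bd" using R unfolding bd_Omega_def in_closure_of topspace_J_hat_top by blast
qed

lemma bd_J_hat: "w \<in> Bd ==> w \<in> J_hat G P"
 by (simp add: bd_iff)

lemma maximal_bd: "w \<in> maximal_chars G P ==> w \<in> Bd"
 using maximal_charsD(1) by (auto simp: bd_iff)

lemma topspace_T: "topspace T = Bd"
 using bd_J_hat by (auto simp: bd_top_def topspace_J_hat_top)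

lemma compact_T: "compact_space T"
 unfolding bd_top_def bd_Omega_def
 using compact_J_hat_top closedin_closure_of closedin_compact_space compact_space_subtopology by blast

lemma Hausdorff_T: "Hausdorff_space T"
 unfolding bd_top_def by (rule Hausdorff_space_subtopology[OF Hausdorff_J_hat_top])

lemma T_nbhd:
 assumes V: "openin T V" and w: "w \<in> V"
 obtains \<S> where "finite \<S>" "\<S> \<subseteq> J" "!!v. [|v \<in> Bd; !!S. S \<in> \<S> ==> v S = w S|] ==> v \<in> V"
proof -
 obtain V' where V': "openin (J_hat_top G P) V'" "V = V' \<inter> Bd"
  using V by (auto simp: bd_top_def openin_subtopology)
 obtain \<S> where "finite \<S>" "\<S> \<subseteq> J" "!!v. [|v \<in> J_hat G P; !!S. S \<in> \<S> ==> v S = w S|] ==> v \<in> V'"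
  using J_hat_nbhd[OF V'(1), of w] w V'(2) by blast
 then show thesis using that[of \<S>] V'(2) bd_J_hat by blast
qed

lemma openin_T_agree:
 assumes "finite \<S>" "\<S> \<subseteq> J" shows "openin T {v \<in> Bd. \<forall>S\<in>\<S>. v S = w S}"
proof -
 have "{v \<in> Bd. \<forall>S\<in>\<S>. v S = w S} = {v \<in> J_hat G P. \<forall>S\<in>\<S>. v S = w S} \<inter> Bd" using bd_J_hat by auto
 then show ?thesis unfolding bd_top_def openin_subtopology using openin_J_hat_agree[OF assms] by blast
qed

lemma openin_T_eval: "S \<in> J ==> openin T {v \<in> Bd. v S = c}"
 using openin_T_agree[of "{S}" "\<lambda>_. c"] by simp

lemma openin_TI:
 assumes "V \<subseteq> Bd" "!!w. w \<in> V ==> \<exists>\<S>. finite \<S> \<and> \<S> \<subseteq> J \<and> {v \<in> Bd. \<forall>S\<in>\<S>. v S = w S} \<subseteq> V"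
 shows "openin T V"
proof -
 have "\<exists>V'. openin T V' \<and> w \<in> V' \<and> V' \<subseteq> V" if w: "w \<in> V" for w
 proof -
  from assms(2)[OF w] obtain \<S> where "finite \<S> \<and> \<S> \<subseteq> J \<and> {v \<in> Bd. \<forall>S\<in>\<S>. v S = w S} \<subseteq> V" ..
  then have "finite \<S>" "\<S> \<subseteq> J" and sub: "{v \<in> Bd. \<forall>S\<in>\<S>. v S = w S} \<subseteq> V" by simp_all
  then have op: "openin T {v \<in> Bd. \<forall>S\<in>\<S>. v S = w S}" by (intro openin_T_agree)
  have mem: "w \<in> {v \<in> Bd. \<forall>S\<in>\<S>. v S = w S}" using subsetD[OF assms(1) w] by simp
  show ?thesis by (rule exI[of _ "{v \<in> Bd. \<forall>S\<in>\<S>. v S = w S}"]) (intro conjI op mem sub)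
 qed
 then show ?thesis by (subst openin_subopen) (rule ballI)
qed

definition Wset :: "'g => ('g set => nat) set" where
 "Wset p = {w \<in> Bd. w (p <# P) = 1}"

lemma Wset_nonempty: assumes "p \<in> P" obtains w where "w \<in> maximal_chars G P" "w \<in> Wset p"
proof -
 have "p <# P \<noteq> {}" using l_coset_self P_carrier assms by blast
 then obtain w where "w \<in> maximal_chars G P" "w (p <# P) = 1" using exists_maximal[OF principal_J[OF assms]] by blast
 then show thesis using that maximal_bd by (auto simp: Wset_def)
qed

lemma openin_Wset: "p \<in> P ==> openin T (Wset p)"
 using openin_T_eval[of "p <# P" 1] by (simp add: Wset_def)

lemma Wset_mono: assumes "p \<in> P" "q \<in> p <# P" shows "Wset q \<subseteq> Wset p"
proof
 fix w assume w: "w \<in> Wset q"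
 have q: "q \<in> P" using assms l_coset_subset by blast
 have "q <# P \<subseteq> p <# P" using J_right_ideal[OF principal_J[OF assms(1)] assms(2)] .
 then show "w \<in> Wset p"
  using w char_mono[OF bd_J_hat principal_J[OF q] principal_J[OF assms(1)]] by (auto simp: Wset_def)
qed

text \<open>Evaluation at an ideal with a principal subideal \<open>p P\<close> is constant on \<open>Wset p\<close>, so these sets form a \<open>\<pi>\<close>-base.\<close>

lemma open_contains_Wset:
 assumes V: "openin T V" "V \<noteq> {}" obtains p where "p \<in> P" "Wset p \<subseteq> V"
proof -
 obtain w0 where w0: "w0 \<in> V" using V(2) by blast
 then have "w0 \<in> Bd" using openin_subset[OF V(1)] topspace_T by blast
 obtain \<S> where \<S>: "finite \<S>" "\<S> \<subseteq> J" "!!v. [|v \<in> Bd; !!S. S \<in> \<S> ==> v S = w0 S|] ==> v \<in> V"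
  using T_nbhd[OF V(1) w0] by blast
 obtain w where w: "w \<in> maximal_chars G P" "\<forall>S\<in>\<S>. w S = w0 S"
  using \<open>w0 \<in> Bd\<close> \<S>(1,2) by (auto simp: bd_iff)
 note \<omega>J = maximal_charsD(1)[OF w(1)]
 obtain R where R: "R \<in> J" "w R = 1" "!!S. [|S \<in> \<S>; w S = 1|] ==> R \<subseteq> S" "!!S. [|S \<in> \<S>; w S \<noteq> 1|] ==> R \<inter> S = {}"
  using maximal_separate[OF w(1) \<S>(1,2)] by blast
 obtain p where p: "p \<in> R" using char_nonempty[OF \<omega>J R(1,2)] by blast
 then have pP: "p \<in> P" using J_subset[OF R(1)] by blast
 have pR: "p <# P \<subseteq> R" using J_right_ideal[OF R(1) p] .
 have "v \<in> V" if v: "v \<in> Wset p" for v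
 proof (rule \<S>(3))
  show "v \<in> Bd" using v by (simp add: Wset_def)
  then have \<eta>J: "v \<in> J_hat G P" by (rule bd_J_hat)
  have \<eta>p: "v (p <# P) = 1" using v by (simp add: Wset_def)
  fix S assume S: "S \<in> \<S>"
  then have SJ: "S \<in> J" using \<S>(2) by blast
  show "v S = w0 S"
  proof (cases "w S = 1")
   case True
   then have "v S = 1" using char_mono[OF \<eta>J principal_J[OF pP] SJ \<eta>p] pR R(3)[OF S] by blast
   then show ?thesis using True w(2) S by auto
  next
   case False
   have "v S \<noteq> 1"
   proof
    assume "v S = 1"
    then have "v ((p <# P) \<inter> S) = 1" using char_inter[OF \<eta>J principal_J[OF pP] SJ] \<eta>p by simp
    then have "(p <# P) \<inter> S \<noteq> {}" using char_nonempty[OF \<eta>J J_inter[OF principal_J[OF pP] SJ]] by simp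
    then show False using pR R(4)[OF S False] by blast
   qed
   then have "v S = 0" "w S = 0" using J_hatD(1)[OF \<eta>J SJ] J_hatD(1)[OF \<omega>J SJ] False by auto
   then show ?thesis using w(2) S by auto
  qed
 qed
 then show thesis using that pP by blast
qed

text \<open>The ideal \<open>R\<close> that decides \<open>S\<close> and its cover is nonempty and
  contained in the union, so it meets a member of the cover; not being disjoint from it, it gives
  that member the value 1.\<close>

lemma bd_Omega_subset: "Bd \<subseteq> Omega G P"
proof
 fix w assume w: "w \<in> Bd"
 note \<omega>J = bd_J_hat[OF w]
 have "\<exists>R\<in>\<S>. w R = 1" if S: "S \<in> J" "\<S> \<subseteq> J" "finite \<S>" "S = \<Union>\<S>" "w S = 1" for S \<S>
 proof -
  obtain v where v: "v \<in> maximal_chars G P" "\<forall>R\<in>Set.insert S \<S>. v R = w R"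
   using w S unfolding bd_iff by (metis finite.insertI insert_subset)
  obtain R where R: "R \<in> J" "v R = 1" "!!S'. [|S' \<in> Set.insert S \<S>; v S' = 1|] ==> R \<subseteq> S'" "!!S'. [|S' \<in> Set.insert S \<S>; v S' \<noteq> 1|] ==> R \<inter> S' = {}"
   using maximal_separate[OF v(1), of "Set.insert S \<S>"] S by auto
  have "R \<subseteq> \<Union>\<S>" using R(3)[of S] v(2) S by auto
  moreover have "R \<noteq> {}" using char_nonempty[OF maximal_charsD(1)[OF v(1)] R(1,2)] .
  ultimately obtain S' where "S' \<in> \<S>" "R \<inter> S' \<noteq> {}" by blast
  then have "v S' = 1" using R(4)[of S'] by blast
  then show ?thesis using v(2) \<open>S' \<in> \<S>\<close> by auto
 qed
 then show "w \<in> Omega G P" using \<omega>J unfolding Omega_def by blast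
qed

end


section \<open>The partial action on the boundary\<close>

context submonoid_pair
begin

text \<open>An explicit form of \<open>pact_hom\<close>: pull \<open>S\<close> back along
  \<open>x -> g \<otimes> x\<close> on the domain of some word for \<open>g\<close> at which
  \<open>w\<close> is 1. By \<open>act_eq\<close> the chosen word is irrelevant.\<close>

definition act :: "'g => ('g set => nat) => 'g set => nat" where
 "act g w = (\<lambda>S\<in>J. w {x \<in> K (SOME a. a \<in> W \<and> val a = g \<and> w (K a) = 1). g \<otimes> x \<in> S})"

lemma char_restrict:
 assumes "w \<in> J_hat G P" "R \<in> J" "S \<in> J" "w S = 1" shows "w (R \<inter> S) = w R"
 using J_hatD(2)[OF assms(1-3)] assms(4) by simp

text \<open>Both pullbacks may be cut down to the intersection of the two domains without changing
  their value, as \<open>w\<close> is 1 on each domain; there they coincide.\<close>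

lemma act_eq:
 assumes w: "w \<in> J_hat G P" and a: "a \<in> W" "w (K a) = 1" and S: "S \<in> J"
 shows "act (val a) w S = w {x \<in> K a. val a \<otimes> x \<in> S}"
proof -
 define \<beta> where "\<beta> = (SOME \<beta>. \<beta> \<in> W \<and> val \<beta> = val a \<and> w (K \<beta>) = 1)"
 have "\<beta> \<in> W \<and> val \<beta> = val a \<and> w (K \<beta>) = 1"
  unfolding \<beta>_def by (rule someI[of _ a]) (use a in simp)
 then have \<beta>: "\<beta> \<in> W" "val \<beta> = val a" "w (K \<beta>) = 1" by simp_all
 have A: "{x \<in> K a. val a \<otimes> x \<in> S} \<in> J" "{x \<in> K \<beta>. val a \<otimes> x \<in> S} \<in> J"
  using J_pull[OF S a(1)] J_pull[OF S \<beta>(1)] \<beta>(2) by simp_all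
 have eq: "{x \<in> K \<beta>. val a \<otimes> x \<in> S} \<inter> K a = {x \<in> K a. val a \<otimes> x \<in> S} \<inter> K \<beta>" by blast
 have "w {x \<in> K \<beta>. val a \<otimes> x \<in> S} = w ({x \<in> K \<beta>. val a \<otimes> x \<in> S} \<inter> K a)"
  by (rule char_restrict[OF w A(2) J_I[OF a(1)] a(2), symmetric])
 also have "\<dots> = w {x \<in> K a. val a \<otimes> x \<in> S}"
  unfolding eq by (rule char_restrict[OF w A(1) J_I[OF \<beta>(1)] \<beta>(3)])
 finally show ?thesis using S by (simp add: act_def \<beta>_def)
qed

lemma act_extensional: "S \<notin> J ==> act g w S = undefined"
 by (simp add: act_def)

definition adom :: "'g => ('g set => nat) set" where
 "adom g = {w \<in> Bd. \<exists>a\<in>W. val a = g \<and> w (K a) = 1}"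

lemma adomE:
 assumes "w \<in> adom g" obtains a where "a \<in> W" "val a = g" "w (K a) = 1"
 using assms by (auto simp: adom_def)

lemma act_J_hat:
 assumes w: "w \<in> J_hat G P" and a: "a \<in> W" "w (K a) = 1" shows "act (val a) w \<in> J_hat G P"
proof -
 note eq = act_eq[OF w a]
 have "act (val a) w \<in> J \<rightarrow>\<^sub>E {0, 1}"
  using J_hatD(1)[OF w J_pull[OF _ a(1)]] eq act_extensional by (intro PiE_I) auto
 moreover have "act (val a) w P \<noteq> 0"
 proof -
  have "{x \<in> K a. val a \<otimes> x \<in> P} = K a" using K_val[OF a(1)] by blast
  then show ?thesis using eq[OF P_in_J] a(2) by simp
 qed
 moreover have "act (val a) w (R \<inter> S) = act (val a) w R * act (val a) w S" if RS: "R \<in> J" "S \<in> J" for R S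
 proof -
  have "{x \<in> K a. val a \<otimes> x \<in> R \<inter> S} = {x \<in> K a. val a \<otimes> x \<in> R} \<inter> {x \<in> K a. val a \<otimes> x \<in> S}" by blast
  then show ?thesis
   using eq[OF J_inter[OF RS]] eq[OF RS(1)] eq[OF RS(2)] J_hatD(2)[OF w J_pull[OF RS(1) a(1)] J_pull[OF RS(2) a(1)]] by simp
 qed
 moreover have "{} \<in> J --> act (val a) w {} = 0"
  using eq[of "{}"] J_hatD(3)[OF w] by simp
 ultimately show ?thesis unfolding J_hat_def using P_in_J by blast
qed

lemma act_image:
 assumes w: "w \<in> J_hat G P" and a: "a \<in> W" "w (K a) = 1" and S: "S \<in> J"
 shows "{y \<in> K (rev a). inv (val a) \<otimes> y \<in> S} \<in> J" (is "?S' \<in> J")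
  and "act (val a) w {y \<in> K (rev a). inv (val a) \<otimes> y \<in> S} = w S"
proof -
 show S': "?S' \<in> J" using J_pull[OF S W_rev[OF a(1)]] a(1) by (simp add: val_rev)
 have "{x \<in> K a. val a \<otimes> x \<in> ?S'} = S \<inter> K a"
 proof -
  have "val a \<otimes> x \<in> ?S' \<longleftrightarrow> x \<in> S" if "x \<in> K a" for x
   using K_rev_mem[OF a(1) that] K_subset[OF a(1)] that P_carrier val_closed[OF a(1)]
   by (auto simp: subset_iff simp flip: m_assoc)
  then show ?thesis by blast
 qed
 then show "act (val a) w ?S' = w S"
  using act_eq[OF w a S'] char_restrict[OF w S J_I[OF a(1)] a(2)] by simp
qed

lemma act_K_rev:
 assumes w: "w \<in> J_hat G P" and a: "a \<in> W" "w (K a) = 1" and \<beta>: "\<beta> \<in> W" "val \<beta> = val a"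
 shows "act (val a) w (K (rev \<beta>)) = w (K \<beta>)"
proof -
 have "{x \<in> K a. val a \<otimes> x \<in> K (rev \<beta>)} = K \<beta> \<inter> K a"
  using K_rev_iff[OF \<beta>(1)] \<beta>(2) K_subset[OF a(1)] P_carrier by auto
 then show ?thesis
  using act_eq[OF w a J_I[OF W_rev[OF \<beta>(1)]]] char_restrict[OF w J_I[OF \<beta>(1)] J_I[OF a(1)] a(2)] by simp
qed

lemma act_maximal:
 assumes w: "w \<in> maximal_chars G P" and a: "a \<in> W" "w (K a) = 1" shows "act (val a) w \<in> maximal_chars G P"
proof (rule maximal_charsI)
 note \<omega>J = maximal_charsD(1)[OF w]
 show "act (val a) w \<in> J_hat G P" by (rule act_J_hat[OF \<omega>J a])
 fix S assume S: "S \<in> J" "act (val a) w S = 0"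
 then have "w {x \<in> K a. val a \<otimes> x \<in> S} = 0" using act_eq[OF \<omega>J a S(1)] by simp
 then obtain R where R: "R \<in> J" "w R = 1" "R \<inter> {x \<in> K a. val a \<otimes> x \<in> S} = {}"
  using maximal_charsD(2)[OF w J_pull[OF S(1) a(1)]] by blast
 \<comment> \<open>The translate by \<open>val a\<close> of the part of \<open>R\<close> in
   \<open>K a\<close>, written as a pullback along the reversed word so that it is visibly
   constructible.\<close>
 let ?R' = "{y \<in> K (rev a). inv (val a) \<otimes> y \<in> R}"
 have False if y: "y \<in> ?R'" "y \<in> S" for y
 proof -
  have yc: "y \<in> carrier G" using y J_subset[OF S(1)] P_carrier by blast
  have eq: "val a \<otimes> (inv (val a) \<otimes> y) = y" using yc val_closed[OF a(1)] by (simp flip: m_assoc)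
  have "inv (val a) \<otimes> y \<in> K a"
   using K_rev_iff[OF a(1), of "inv (val a) \<otimes> y"] y(1) yc val_closed[OF a(1)] eq by simp
  then show False using R(3) y eq by auto
 qed
 then have "?R' \<inter> S = {}" by blast
 then show "\<exists>R\<in>J. act (val a) w R = 1 \<and> R \<inter> S = {}"
  using act_image[OF \<omega>J a R(1)] R(2) by (intro bexI[of _ ?R']) auto
qed

lemma act_bd:
 assumes w: "w \<in> Bd" and a: "a \<in> W" "w (K a) = 1" shows "act (val a) w \<in> Bd"
 unfolding bd_iff
proof (intro conjI allI impI)
 note \<omega>J = bd_J_hat[OF w]
 show "act (val a) w \<in> J_hat G P" by (rule act_J_hat[OF \<omega>J a])
 fix \<S> assume \<S>: "finite \<S> \<and> \<S> \<subseteq> J"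
 \<comment> \<open>The pullbacks transfer the values, while \<open>K a\<close> forces the
   approximating maximal character into the domain of the partial homeomorphism.\<close>
 let ?\<S>' = "Set.insert (K a) ((\<lambda>S. {x \<in> K a. val a \<otimes> x \<in> S}) ` \<S>)"
 have "finite ?\<S>'" "?\<S>' \<subseteq> J" using \<S> J_I[OF a(1)] J_pull[OF _ a(1)] by blast+
 then obtain v where v: "v \<in> maximal_chars G P" "\<forall>S\<in>?\<S>'. v S = w S" using w unfolding bd_iff by meson
 then have va: "v (K a) = 1" using a(2) by simp
 have "act (val a) v S = act (val a) w S" if "S \<in> \<S>" for S
  using act_eq[OF maximal_charsD(1)[OF v(1)] a(1) va, of S] act_eq[OF \<omega>J a, of S] \<S> that v(2) by auto
 then show "\<exists>v\<in>maximal_chars G P. \<forall>S\<in>\<S>. v S = act (val a) w S"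
  using act_maximal[OF v(1) a(1) va] by blast
qed

lemma bd_dom_eq: "g \<in> carrier G ==> bd_dom G P (inv g) = adom g"
 using bd_Omega_subset by (auto simp: bd_dom_def pact_dom_def adom_def)

lemma adom_range:
 assumes "w \<in> adom g" shows "act g w \<in> adom (inv g)"
proof -
 obtain a where a: "a \<in> W" "val a = g" "w (K a) = 1" using assms by (rule adomE)
 have w: "w \<in> Bd" using assms by (simp add: adom_def)
 have "act g w (K (rev a)) = 1" using act_K_rev[OF bd_J_hat[OF w] a(1,3) a(1)] a by simp
 then show ?thesis using act_bd[OF w a(1,3)] a by (auto simp: adom_def val_rev intro!: bexI[of _ "rev a"])
qed

lemma pact_hom_eq:
 assumes g: "g \<in> carrier G" and w: "w \<in> adom g"
 shows "pact_hom G P g w = act g w"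
 unfolding pact_hom_def
proof (rule the_equality)
 obtain a where a: "a \<in> W" "val a = g" "w (K a) = 1" using w by (rule adomE)
 have \<omega>J: "w \<in> J_hat G P" using w bd_J_hat by (simp add: adom_def)
 have dom: "act g w \<in> pact_dom G P g"
  using adom_range[OF w] bd_dom_eq[of "inv g"] g by (auto simp: bd_dom_def)
 have val: "act g w (K \<beta>) = w (K (rev \<beta>))" if "\<beta> \<in> W" "val \<beta> = inv g" for \<beta>
  using act_K_rev[OF \<omega>J a(1,3) W_rev[OF that(1)]] that a g by (simp add: val_rev)
 then show "act g w \<in> pact_dom G P g \<and> (\<forall>\<beta>\<in>W. val \<beta> = inv g --> act g w (K \<beta>) = w (K (rev \<beta>)))"
  using dom by blast
 fix v assume v: "v \<in> pact_dom G P g \<and> (\<forall>\<beta>\<in>W. val \<beta> = inv g --> v (K \<beta>) = w (K (rev \<beta>)))"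
 have \<eta>J: "v \<in> J_hat G P" using v by (simp add: pact_dom_def Omega_def)
 obtain \<beta>0 where \<beta>0: "\<beta>0 \<in> W" "val \<beta>0 = inv g" "v (K \<beta>0) = 1" using v by (auto simp: pact_dom_def)
 have aJ: "act g w \<in> J_hat G P" using act_J_hat[OF \<omega>J a(1,3)] a(2) by simp
 have a1: "act g w (K \<beta>0) = 1" using val[OF \<beta>0(1,2)] v \<beta>0 by simp
 show "v = act g w"
 proof (rule char_eqI[OF \<eta>J aJ])
  \<comment> \<open>Intersecting \<open>S\<close> with one ideal of value 1 belonging to a word for
    \<open>inv g\<close> yields an ideal of a word for \<open>inv g\<close>; so the values
    prescribed by \<open>pact_hom\<close> determine all others.\<close>
  fix S assume S: "S \<in> J"
  obtain \<beta> where \<beta>: "\<beta> \<in> W" "val \<beta> = inv g" "K \<beta> = S \<inter> K \<beta>0"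
   using J_restrict[OF S \<beta>0(1)] \<beta>0(2) by (metis inf_commute)
  have "v S = v (K \<beta>)" using char_restrict[OF \<eta>J S J_I[OF \<beta>0(1)] \<beta>0(3)] \<beta>(3) by simp
  also have "v (K \<beta>) = w (K (rev \<beta>))" using conjunct2[OF v] \<beta>(1,2) by blast
  also have "\<dots> = act g w (K \<beta>)" by (rule val[OF \<beta>(1,2), symmetric])
  also have "\<dots> = act g w S" using char_restrict[OF aJ S J_I[OF \<beta>0(1)] a1] \<beta>(3) by simp
  finally show "v S = 1 \<longleftrightarrow> act g w S = 1" by simp
 qed
qed

lemma act_comp:
 assumes w: "w \<in> adom h" and a: "act h w \<in> adom g"
 shows "w \<in> adom (g \<otimes> h)" "act (g \<otimes> h) w = act g (act h w)"
proof -
 obtain \<beta> where \<beta>: "\<beta> \<in> W" "val \<beta> = h" "w (K \<beta>) = 1" using w by (rule adomE)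
 obtain \<alpha> where \<alpha>: "\<alpha> \<in> W" "val \<alpha> = g" "act h w (K \<alpha>) = 1" using a by (rule adomE)
 have \<omega>B: "w \<in> Bd" using w by (simp add: adom_def)
 note \<omega>J = bd_J_hat[OF \<omega>B]
 have hJ: "act h w \<in> J_hat G P" using act_J_hat[OF \<omega>J \<beta>(1,3)] \<beta>(2) by simp
 have gh: "g \<in> carrier G" "h \<in> carrier G" using \<alpha> \<beta> val_closed by auto
 have eqh: "act h w S = w {x \<in> K \<beta>. h \<otimes> x \<in> S}" if "S \<in> J" for S
  using act_eq[OF \<omega>J \<beta>(1,3) that] \<beta>(2) by simp
 have K: "K (\<alpha> @ \<beta>) = {x \<in> K \<beta>. h \<otimes> x \<in> K \<alpha>}" using K_append[OF \<alpha>(1) \<beta>(1)] \<beta>(2) by simp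
 have W: "\<alpha> @ \<beta> \<in> W" and v: "val (\<alpha> @ \<beta>) = g \<otimes> h" using \<alpha> \<beta> by (auto simp: val_append)
 have 1: "w (K (\<alpha> @ \<beta>)) = 1" using eqh[OF J_I[OF \<alpha>(1)]] \<alpha>(3) K by simp
 show "w \<in> adom (g \<otimes> h)" using \<omega>B W v 1 by (auto simp: adom_def)
 show "act (g \<otimes> h) w = act g (act h w)"
 proof
  fix S show "act (g \<otimes> h) w S = act g (act h w) S"
  proof (cases "S \<in> J")
   case S: True
   have "act (g \<otimes> h) w S = w {x \<in> K (\<alpha> @ \<beta>). g \<otimes> h \<otimes> x \<in> S}" using act_eq[OF \<omega>J W 1 S] v by simp
   also have "{x \<in> K (\<alpha> @ \<beta>). g \<otimes> h \<otimes> x \<in> S} = {x \<in> K \<beta>. h \<otimes> x \<in> {y \<in> K \<alpha>. g \<otimes> y \<in> S}}"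
    unfolding K using K_subset[OF \<beta>(1)] P_carrier gh by (auto simp: m_assoc subset_iff)
   also have "w \<dots> = act h w {y \<in> K \<alpha>. g \<otimes> y \<in> S}" using eqh J_pull[OF S \<alpha>(1)] \<alpha>(2) by simp
   also have "\<dots> = act g (act h w) S" using act_eq[OF hJ \<alpha>(1,3) S] \<alpha>(2) by simp
   finally show ?thesis .
  qed (simp add: act_extensional)
 qed
qed

lemma act_one: assumes "w \<in> Bd" shows "act \<one> w = w"
proof
 note \<omega>J = bd_J_hat[OF assms]
 fix S show "act \<one> w S = w S"
 proof (cases "S \<in> J")
  case True
  have "{x \<in> P. \<one> \<otimes> x \<in> S} = S" using J_subset[OF True] P_carrier by auto
  then show ?thesis using act_eq[OF \<omega>J W_Nil _ True] J_hatD(4)[OF \<omega>J] by (simp add: K_Nil)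
 qed (simp add: act_extensional J_hatD(5)[OF \<omega>J])
qed

lemma openin_adom: "openin T (adom g)"
proof (rule openin_TI)
 fix w assume "w \<in> adom g"
 then obtain a where "a \<in> W" "val a = g" "w (K a) = 1" by (rule adomE)
 then show "\<exists>\<S>. finite \<S> \<and> \<S> \<subseteq> J \<and> {v \<in> Bd. \<forall>S\<in>\<S>. v S = w S} \<subseteq> adom g"
  using J_I by (intro exI[of _ "{K a}"]) (auto simp: adom_def)
qed (auto simp: adom_def)

lemma act_continuous: "continuous_map (subtopology T (adom g)) T (act g)"
 unfolding continuous_map_def
proof (intro conjI allI impI)
 have top: "topspace (subtopology T (adom g)) = adom g" by (auto simp: topspace_T adom_def)
 show "act g \<in> topspace (subtopology T (adom g)) \<rightarrow> topspace T"
  unfolding top topspace_T using adom_range by (auto simp: adom_def)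
 fix V assume V: "openin T V"
 have "openin T {w \<in> adom g. act g w \<in> V}"
 proof (rule openin_TI)
  fix w assume w: "w \<in> {w \<in> adom g. act g w \<in> V}"
  then obtain a where a: "a \<in> W" "val a = g" "w (K a) = 1" by (auto elim: adomE)
  have \<omega>J: "w \<in> J_hat G P" using w bd_J_hat by (simp add: adom_def)
  have aV: "act g w \<in> V" using w by simp
  obtain \<S> where \<S>: "finite \<S>" "\<S> \<subseteq> J" "!!v. [|v \<in> Bd; !!S. S \<in> \<S> ==> v S = act g w S|] ==> v \<in> V"
   using T_nbhd[OF V aV] by blast
  let ?\<S>' = "Set.insert (K a) ((\<lambda>S. {x \<in> K a. g \<otimes> x \<in> S}) ` \<S>)"
  have "v \<in> {w \<in> adom g. act g w \<in> V}" if v: "v \<in> Bd" "\<forall>S\<in>?\<S>'. v S = w S" for v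
  proof -
   have va: "v (K a) = 1" using v(2) a(3) by simp
   have "act g v S = act g w S" if "S \<in> \<S>" for S
    using act_eq[OF bd_J_hat[OF v(1)] a(1) va, of S] act_eq[OF \<omega>J a(1,3), of S] \<S>(2) that v(2) a(2) by auto
   then have "act g v \<in> V" using \<S>(3)[of "act g v"] act_bd[OF v(1) a(1) va] a(2) by simp
   then show ?thesis using v(1) a va by (auto simp: adom_def)
  qed
  moreover have "finite ?\<S>'" using \<S>(1) by simp
  moreover have "?\<S>' \<subseteq> J" using \<S>(2) J_I[OF a(1)] J_pull[OF _ a(1)] a(2) by auto
  ultimately show "\<exists>\<S>. finite \<S> \<and> \<S> \<subseteq> J \<and> {v \<in> Bd. \<forall>S\<in>\<S>. v S = w S} \<subseteq> {w \<in> adom g. act g w \<in> V}"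
   by (intro exI[of _ ?\<S>'] conjI subsetI) auto
 qed (auto simp: adom_def)
 then show "openin (subtopology T (adom g)) {w \<in> topspace (subtopology T (adom g)). act g w \<in> V}"
  unfolding top openin_subtopology by (intro exI[of _ "{w \<in> adom g. act g w \<in> V}"]) auto
qed

abbreviation "bU \<equiv> bd_dom G P"
abbreviation "b\<theta> \<equiv> pact_hom G P"

lemma bU_eq: "g \<in> carrier G ==> bU g = adom (inv g)"
 using bd_dom_eq[of "inv g"] by simp

sublocale ps: partial_system G T bU b\<theta>
proof
 show "compact_space T" "Hausdorff_space T" by (rule compact_T, rule Hausdorff_T)
 show "topspace T \<noteq> {}" using Wset_nonempty[OF P_one] unfolding topspace_T Wset_def by blast
 show "openin T (bU g)" if "g \<in> carrier G" for g using openin_adom by (simp add: bU_eq that)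
 have d1: "adom \<one> = Bd"
  using J_hatD(4)[OF bd_J_hat] by (auto simp: adom_def K_Nil intro!: bexI[of _ "[]"])
 then show "bU \<one> = topspace T" by (simp add: bU_eq topspace_T)
 show "b\<theta> \<one> x = x" if "x \<in> topspace T" for x
  using that pact_hom_eq[OF one_closed, of x] act_one d1 by (simp add: topspace_T)
 show "b\<theta> g x \<in> bU g" if "g \<in> carrier G" "x \<in> bU (inv g)" for g x
  using that adom_range[of x g] by (simp add: bU_eq bd_dom_eq pact_hom_eq)
 show "x \<in> bU (inv (g \<otimes> h)) \<and> b\<theta> (g \<otimes> h) x = b\<theta> g (b\<theta> h x)"
  if "g \<in> carrier G" "h \<in> carrier G" "x \<in> bU (inv h)" "b\<theta> h x \<in> bU (inv g)" for g h x
  using that act_comp[of x h g] by (simp add: bd_dom_eq pact_hom_eq)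
 show "continuous_map (subtopology T (bU (inv g))) T (b\<theta> g)" if "g \<in> carrier G" for g
  unfolding bd_dom_eq[OF that]
  by (rule continuous_map_eq[OF act_continuous]) (simp add: pact_hom_eq that topspace_T)
qed

section \<open>Topological freeness\<close>

lemma G0_D:
 assumes "g \<in> G0 G P"
 shows "g \<in> carrier G" "[|S \<in> J; S \<noteq> {}|] ==> \<exists>x\<in>S. inv g \<otimes> x \<in> P" "[|S \<in> J; S \<noteq> {}|] ==> \<exists>x\<in>S. g \<otimes> x \<in> P"
proof -
 show g: "g \<in> carrier G" using assms by (simp add: G0_def)
 have *: "S \<in> J ==> S \<noteq> {} ==> (g <# P) \<inter> S \<noteq> {} \<and> (inv g <# P) \<inter> S \<noteq> {}" for S
  using assms by (simp add: G0_def)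
 show "[|S \<in> J; S \<noteq> {}|] ==> \<exists>x\<in>S. inv g \<otimes> x \<in> P" "[|S \<in> J; S \<noteq> {}|] ==> \<exists>x\<in>S. g \<otimes> x \<in> P"
  using *[of S] mem_l_coset[OF g] mem_l_coset[of "inv g"] g by auto
qed

lemma G0_I:
 assumes g: "g \<in> carrier G"
  and "!!S. [|S \<in> J; S \<noteq> {}|] ==> \<exists>x\<in>S. inv g \<otimes> x \<in> P" "!!S. [|S \<in> J; S \<noteq> {}|] ==> \<exists>x\<in>S. g \<otimes> x \<in> P"
 shows "g \<in> G0 G P"
proof -
 have "(g <# P) \<inter> S \<noteq> {} \<and> (inv g <# P) \<inter> S \<noteq> {}" if S: "S \<in> J" "S \<noteq> {}" for S
 proof -
  obtain x y where "x \<in> S" "inv g \<otimes> x \<in> P" "y \<in> S" "g \<otimes> y \<in> P" using assms(2,3)[OF S] by blast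
  moreover then have "x \<in> carrier G" "y \<in> carrier G" using J_subset[OF S(1)] P_carrier by blast+
  ultimately have "x \<in> g <# P" "y \<in> inv g <# P" using mem_l_coset[OF g, of x] mem_l_coset[of "inv g" y] g by simp_all
  then show ?thesis using \<open>x \<in> S\<close> \<open>y \<in> S\<close> by blast
 qed
 then show ?thesis using g by (simp add: G0_def)
qed

text \<open>Translate by \<open>g\<close> the part of \<open>S\<close> that lies in the domain of a
  suitable word. The result is a nonempty constructible ideal, to which the condition on
  \<open>h\<close> applies; a witness \<open>y\<close> there gives \<open>inv g \<otimes> y\<close>
  in \<open>S\<close>.\<close>

lemma G0_translate:
 assumes g: "g \<in> carrier G" and h: "h \<in> carrier G" and S: "S \<in> J" "S \<noteq> {}"
  and g': "!!S. [|S \<in> J; S \<noteq> {}|] ==> \<exists>x\<in>S. g \<otimes> x \<in> P" and h': "!!S. [|S \<in> J; S \<noteq> {}|] ==> \<exists>x\<in>S. h \<otimes> x \<in> P"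
 shows "\<exists>x\<in>S. h \<otimes> g \<otimes> x \<in> P"
proof -
 obtain x where x: "x \<in> S" "g \<otimes> x \<in> P" using g'[OF S] by blast
 have xP: "x \<in> P" using x J_subset[OF S(1)] by blast
 obtain a where a: "a \<in> W" "val a = inv g" "g \<otimes> x \<in> K a"
  using exists_word[of "inv g" "g \<otimes> x"] g x xP P_carrier by (auto simp flip: m_assoc)
 let ?R = "{y \<in> K a. inv g \<otimes> y \<in> S}"
 have "inv g \<otimes> (g \<otimes> x) = x" using g xP P_carrier by (simp flip: m_assoc)
 then have "g \<otimes> x \<in> ?R" using a x by simp
 moreover have "?R \<in> J" using J_pull[OF S(1) a(1)] a(2) by simp
 ultimately obtain y where y: "y \<in> ?R" "h \<otimes> y \<in> P" using h'[of ?R] by blast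
 have "y \<in> carrier G" using y K_subset[OF a(1)] P_carrier by blast
 then have "h \<otimes> g \<otimes> (inv g \<otimes> y) = h \<otimes> y" using g h by (simp add: m_assoc) (simp flip: m_assoc)
 then show ?thesis using y by (intro bexI[of _ "inv g \<otimes> y"]) auto
qed

lemma subgroup_G0: "subgroup (G0 G P) G"
proof
 show "G0 G P \<subseteq> carrier G" using G0_D(1) by blast
 show "\<one> \<in> G0 G P"
 proof (rule G0_I)
  have "\<exists>x\<in>S. \<one> \<otimes> x \<in> P" if "S \<in> J" "S \<noteq> {}" for S
   using J_subset[OF that(1)] that(2) P_carrier by fastforce
  then show "\<exists>x\<in>S. \<one> \<otimes> x \<in> P" "\<exists>x\<in>S. inv \<one> \<otimes> x \<in> P" if "S \<in> J" "S \<noteq> {}" for S using that by auto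
 qed simp
 show "inv g \<in> G0 G P" if "g \<in> G0 G P" for g
  by (rule G0_I) (use G0_D[OF that] in auto)
 show "g \<otimes> h \<in> G0 G P" if "g \<in> G0 G P" "h \<in> G0 G P" for g h
 proof (rule G0_I)
  note g = G0_D[OF that(1)] and h = G0_D[OF that(2)]
  show "g \<otimes> h \<in> carrier G" using g h by simp
  fix S assume S: "S \<in> J" "S \<noteq> {}"
  show "\<exists>x\<in>S. g \<otimes> h \<otimes> x \<in> P" by (rule G0_translate[OF h(1) g(1) S h(3) g(3)])
  have "\<exists>x\<in>S. inv h \<otimes> inv g \<otimes> x \<in> P"
   by (rule G0_translate[OF _ _ S g(2) h(2)]) (use g h in auto)
  then show "\<exists>x\<in>S. inv (g \<otimes> h) \<otimes> x \<in> P" using g h by (simp add: inv_mult_group)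
 qed
qed

abbreviation "tfree H \<equiv> topologically_free G H T bU b\<theta>"

lemma not_tfreeE:
 assumes "\<not> tfree H" "H \<subseteq> carrier G"
 obtains g p where "g \<in> H" "g \<noteq> \<one>" "p \<in> P" "!!w. w \<in> Wset p ==> w \<in> adom g \<and> act g w = w"
proof -
 obtain g where g: "g \<in> H" "g \<noteq> \<one>" "T interior_of {x \<in> bU (inv g). b\<theta> g x = x} \<noteq> {}"
  using assms(1) by (auto simp: topologically_free_def)
 have gc: "g \<in> carrier G" using g assms(2) by blast
 obtain p where p: "p \<in> P" "Wset p \<subseteq> T interior_of {x \<in> bU (inv g). b\<theta> g x = x}"
  by (rule open_contains_Wset[OF openin_interior_of g(3)])
 have "w \<in> adom g \<and> act g w = w" if "w \<in> Wset p" for w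
 proof -
  have "w \<in> {x \<in> bU (inv g). b\<theta> g x = x}"
   using subsetD[OF subset_trans[OF p(2) interior_of_subset] that] .
  then show ?thesis using pact_hom_eq[OF gc, of w] by (simp add: bd_dom_eq gc)
 qed
 then show thesis using that[OF g(1,2) p(1)] by blast
qed

lemma not_tfreeI:
 assumes "g \<in> H" "g \<noteq> \<one>" "g \<in> carrier G" "p \<in> P" "!!w. w \<in> Wset p ==> w \<in> adom g \<and> act g w = w"
 shows "\<not> tfree H"
proof -
 have "Wset p \<subseteq> {x \<in> bU (inv g). b\<theta> g x = x}"
 proof
  fix w assume "w \<in> Wset p"
  from assms(5)[OF this] show "w \<in> {x \<in> bU (inv g). b\<theta> g x = x}"
   using pact_hom_eq[OF assms(3), of w] by (simp add: bd_dom_eq assms(3))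
 qed
 then have "Wset p \<subseteq> T interior_of {x \<in> bU (inv g). b\<theta> g x = x}"
  by (rule interior_of_maximal[OF _ openin_Wset[OF assms(4)]])
 moreover have "Wset p \<noteq> {}" using Wset_nonempty[OF assms(4)] by blast
 ultimately show ?thesis using assms(1,2) by (auto simp: topologically_free_def)
qed

section \<open>Conditions (1) to (4) for principal right ideals\<close>

definition "cond3 \<longleftrightarrow> (\<forall>g\<in>G0 G P. g \<noteq> \<one> --> (\<forall>p\<in>P. \<exists>q\<in>p <# P. (q <# P) \<inter> ((g \<otimes> q) <# P) = {}))"
definition "cond4 \<longleftrightarrow> (\<forall>p\<in>P. \<forall>t\<in>P. p \<noteq> t --> (\<exists>s\<in>P. ((p \<otimes> s) <# P) \<inter> ((t \<otimes> s) <# P) = {}))"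

lemma l_coset_mult: "[|g \<in> carrier G; q \<in> carrier G|] ==> (g \<otimes> q) <# P = (\<lambda>x. g \<otimes> x) ` (q <# P)"
 using P_carrier by (auto simp: l_coset_def m_assoc image_iff)

lemma l_coset_disjoint_shift:
 assumes "g \<in> carrier G" "q \<in> carrier G" "r \<in> carrier G" "(q <# P) \<inter> (r <# P) = {}"
 shows "((g \<otimes> q) <# P) \<inter> ((g \<otimes> r) <# P) = {}"
proof -
 have "False" if "x \<in> q <# P" "y \<in> r <# P" "g \<otimes> x = g \<otimes> y" for x y
 proof -
  have "x \<in> carrier G" "y \<in> carrier G" using that mem_l_coset assms by blast+
  then show False using that assms by auto
 qed
 then show ?thesis unfolding l_coset_mult[OF assms(1,2)] l_coset_mult[OF assms(1,3)] by blast
qed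

text \<open>Put \<open>g = inv p \<otimes> t\<close> and seek \<open>s\<close> with
  \<open>s P\<close> and \<open>g s P\<close> disjoint; left translation by \<open>p\<close> then
  gives the claim. If \<open>g\<close> lies outside \<open>G0 G P\<close>, take \<open>s\<close> in
  a nonempty ideal \<open>S\<close> that no \<open>g \<otimes> y\<close> with \<open>y\<close> in
  \<open>P\<close> meets, or no element of which is moved into \<open>P\<close> by \<open>g\<close>:
  a common point of the two cosets would contradict this.\<close>

lemma cond3_imp_cond4: assumes cond3 shows cond4
 unfolding cond4_def
proof (intro ballI impI)
 fix p t assume pt: "p \<in> P" "t \<in> P" "p \<noteq> t"
 define g where "g = inv p \<otimes> t"
 have c: "p \<in> carrier G" "t \<in> carrier G" "g \<in> carrier G" using pt P_carrier by (auto simp: g_def)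
 have pg: "p \<otimes> g = t" using c by (simp add: g_def flip: m_assoc)
 have g1: "g \<noteq> \<one>" using pg pt(3) c by auto
 obtain s where s: "s \<in> P" "(s <# P) \<inter> ((g \<otimes> s) <# P) = {}"
 proof (cases "g \<in> G0 G P")
  case True
  then obtain q where "q \<in> \<one> <# P" "(q <# P) \<inter> ((g \<otimes> q) <# P) = {}"
   using assms g1 P_one unfolding cond3_def by blast
  then show thesis using that l_coset_subset[OF P_one] by blast
 next
  case False
  then have "(\<exists>S\<in>J. S \<noteq> {} \<and> (\<forall>x\<in>S. inv g \<otimes> x \<notin> P)) \<or> (\<exists>S\<in>J. S \<noteq> {} \<and> (\<forall>x\<in>S. g \<otimes> x \<notin> P))"
   using G0_I[OF c(3)] by blast
  then show thesis
  proof (elim disjE bexE conjE)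
   fix S assume S: "S \<in> J" "S \<noteq> {}" "\<forall>x\<in>S. inv g \<otimes> x \<notin> P"
   obtain s where s: "s \<in> S" using S by blast
   have sP: "s \<in> P" using s J_subset[OF S(1)] by blast
   have "(s <# P) \<inter> ((g \<otimes> s) <# P) = {}"
   proof -
    have False if x1: "x \<in> s <# P" and x2: "x \<in> (g \<otimes> s) <# P" for x
    proof -
     have "x \<in> S" using x1 J_right_ideal[OF S(1) s] by blast
     obtain y where y: "y \<in> P" "x = g \<otimes> s \<otimes> y" using x2 by (auto simp: l_coset_def)
     have "inv g \<otimes> x = s \<otimes> y" using y c sP P_carrier by (simp add: m_assoc) (simp flip: m_assoc)
     then show False using S(3) \<open>x \<in> S\<close> P_mult[OF sP y(1)] by auto
    qed
    then show ?thesis by blast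
   qed
   then show thesis using that sP by blast
  next
   fix S assume S: "S \<in> J" "S \<noteq> {}" "\<forall>x\<in>S. g \<otimes> x \<notin> P"
   obtain s where s: "s \<in> S" using S by blast
   have sP: "s \<in> P" using s J_subset[OF S(1)] by blast
   have "(s <# P) \<inter> ((g \<otimes> s) <# P) = {}"
   proof -
    have False if x1: "x \<in> s <# P" and x2: "x \<in> (g \<otimes> s) <# P" for x
    proof -
     have xP: "x \<in> P" using x1 l_coset_subset[OF sP] by blast
     obtain y where y: "y \<in> P" "x = g \<otimes> s \<otimes> y" using x2 by (auto simp: l_coset_def)
     have "s \<otimes> y \<in> S" using J_right_ideal[OF S(1) s] y(1) by (auto simp: l_coset_def)
     moreover have "g \<otimes> (s \<otimes> y) = x" using y c sP P_carrier by (simp add: m_assoc)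
     ultimately show False using S(3) xP by auto
    qed
    then show ?thesis by blast
   qed
   then show thesis using that sP by blast
  qed
 qed
 have "((p \<otimes> s) <# P) \<inter> ((p \<otimes> (g \<otimes> s)) <# P) = {}"
  by (rule l_coset_disjoint_shift) (use s c P_carrier in auto)
 moreover have "p \<otimes> (g \<otimes> s) = t \<otimes> s" using s c P_carrier by (simp add: pg flip: m_assoc)
 ultimately show "\<exists>s\<in>P. ((p \<otimes> s) <# P) \<inter> ((t \<otimes> s) <# P) = {}" using s(1) by auto
qed

lemma act_translate:
 assumes w: "w \<in> adom g" and q: "q \<in> P" "g \<otimes> q \<in> P" "w (q <# P) = 1"
 shows "act g w ((g \<otimes> q) <# P) = 1"
proof -
 obtain a where a: "a \<in> W" "val a = g" "w (K a) = 1" using w by (rule adomE)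
 have \<omega>J: "w \<in> J_hat G P" using w bd_J_hat by (simp add: adom_def)
 have g: "g \<in> carrier G" using a val_closed by blast
 have qc: "q \<in> carrier G" using q P_carrier by blast
 have "{x \<in> K a. g \<otimes> x \<in> (g \<otimes> q) <# P} = (q <# P) \<inter> K a"
 proof -
  have "g \<otimes> x \<in> (g \<otimes> q) <# P \<longleftrightarrow> x \<in> q <# P" if "x \<in> K a" for x
  proof -
   have xc: "x \<in> carrier G" using that K_subset[OF a(1)] P_carrier by blast
   have "inv (g \<otimes> q) \<otimes> (g \<otimes> x) = inv q \<otimes> x"
    using xc g qc by (simp add: inv_mult_group m_assoc) (simp flip: m_assoc)
   then show ?thesis using mem_l_coset[OF qc, of x] mem_l_coset[of "g \<otimes> q" "g \<otimes> x"] xc g qc by simp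
  qed
  then show ?thesis by blast
 qed
 then show ?thesis
  using act_eq[OF \<omega>J a(1,3) principal_J[OF q(2)]] char_restrict[OF \<omega>J principal_J[OF q(1)] J_I[OF a(1)] a(3)] q(3) a(2) by simp
qed

text \<open>Suppose \<open>g\<close> fixes all of \<open>Wset p\<close>. Choose \<open>r\<close> in
  \<open>p P\<close> in the domain of a word for \<open>g\<close>, so that
  \<open>g \<otimes> r\<close> is in \<open>P\<close>, and apply the condition to the pair
  \<open>r\<close>, \<open>g \<otimes> r\<close>. A character in \<open>Wset (r \<otimes> s)\<close>
  is fixed, so it takes the value 1 at two disjoint ideals.\<close>

lemma cond4_imp_tfree: assumes cond4 shows "tfree (carrier G)"
proof (rule ccontr)
 assume "\<not> tfree (carrier G)"
 then obtain g p where g: "g \<in> carrier G" "g \<noteq> \<one>" and p: "p \<in> P" and fix_act: "!!w. w \<in> Wset p ==> w \<in> adom g \<and> act g w = w"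
  using not_tfreeE by blast
 obtain w where w: "w \<in> maximal_chars G P" "w \<in> Wset p" using Wset_nonempty[OF p] by blast
 have \<omega>J: "w \<in> J_hat G P" using w(1) by (rule maximal_charsD)
 obtain \<alpha> where \<alpha>: "\<alpha> \<in> W" "val \<alpha> = g" "w (K \<alpha>) = 1" using fix_act[OF w(2)] by (auto elim: adomE)
 have "w ((p <# P) \<inter> K \<alpha>) = 1" using char_inter[OF \<omega>J principal_J[OF p] J_I[OF \<alpha>(1)]] w(2) \<alpha>(3) by (simp add: Wset_def)
 then obtain r where r: "r \<in> p <# P" "r \<in> K \<alpha>"
  using char_nonempty[OF \<omega>J J_inter[OF principal_J[OF p] J_I[OF \<alpha>(1)]]] by blast
 have rP: "r \<in> P" using r(1) l_coset_subset[OF p] by blast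
 have gr: "g \<otimes> r \<in> P" using K_val[OF \<alpha>(1) r(2)] \<alpha>(2) by simp
 have "r \<noteq> g \<otimes> r" using g rP P_carrier by simp
 then obtain s where s: "s \<in> P" "((r \<otimes> s) <# P) \<inter> ((g \<otimes> r \<otimes> s) <# P) = {}"
  using assms rP gr unfolding cond4_def by blast
 have rs: "r \<otimes> s \<in> P" using P_mult[OF rP s(1)] .
 obtain v where v: "v \<in> maximal_chars G P" "v \<in> Wset (r \<otimes> s)" using Wset_nonempty[OF rs] by blast
 have \<eta>J: "v \<in> J_hat G P" using v(1) by (rule maximal_charsD)
 have "r \<otimes> s \<in> p <# P" using J_right_ideal[OF principal_J[OF p] r(1)] s(1) by (auto simp: l_coset_def)
 then have "v \<in> Wset p" using Wset_mono[OF p] v(2) by blast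
 then have a: "v \<in> adom g" "act g v = v" using fix_act by auto
 have grs: "g \<otimes> (r \<otimes> s) = g \<otimes> r \<otimes> s" using g rP s P_carrier by (simp add: m_assoc)
 have grsP: "g \<otimes> (r \<otimes> s) \<in> P" using P_mult[OF gr s(1)] grs by simp
 have "v ((r \<otimes> s) <# P) = 1" using v(2) by (simp add: Wset_def)
 moreover have "v ((g \<otimes> (r \<otimes> s)) <# P) = 1" using act_translate[OF a(1) rs grsP] calculation a(2) by simp
 ultimately have "v (((r \<otimes> s) <# P) \<inter> ((g \<otimes> (r \<otimes> s)) <# P)) = 1"
  using char_inter[OF \<eta>J principal_J[OF rs] principal_J[OF grsP]] by simp
 then show False using char_nonempty[OF \<eta>J J_inter[OF principal_J[OF rs] principal_J[OF grsP]]] s(2) grs by simp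
qed

text \<open>Comparing a boundary character with its image at one ideal involves only finitely many
  ideals, so it suffices that maximal characters are fixed.\<close>

lemma fixed_closed:
 assumes p: "p \<in> P" and a: "a \<in> W" "p \<in> K a"
  and fixed: "!!w. [|w \<in> maximal_chars G P; w \<in> Wset p|] ==> act (val a) w = w" and w: "w \<in> Wset p"
 shows "w \<in> adom (val a) \<and> act (val a) w = w"
proof -
 have sub: "p <# P \<subseteq> K a" using J_right_ideal[OF J_I[OF a(1)] a(2)] .
 have a1: "v (K a) = 1" if "v \<in> J_hat G P" "v (p <# P) = 1" for v
  using char_mono[OF that(1) principal_J[OF p] J_I[OF a(1)] that(2) sub] .
 have \<omega>B: "w \<in> Bd" "w (p <# P) = 1" using w by (auto simp: Wset_def)
 note \<omega>J = bd_J_hat[OF \<omega>B(1)]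
 have wa: "w (K a) = 1" by (rule a1[OF \<omega>J \<omega>B(2)])
 have "act (val a) w = w"
 proof
  fix S show "act (val a) w S = w S"
  proof (cases "S \<in> J")
   case S: True
   let ?S' = "{x \<in> K a. val a \<otimes> x \<in> S}"
   \<comment> \<open>The first ideal keeps the approximating character in \<open>Wset p\<close>; the
     other two carry the values to be compared.\<close>
   have "finite {p <# P, S, ?S'}" "{p <# P, S, ?S'} \<subseteq> J" using S J_pull[OF S a(1)] principal_J[OF p] by auto
   then obtain v where v: "v \<in> maximal_chars G P" "\<forall>S\<in>{p <# P, S, ?S'}. v S = w S"
    using \<omega>B(1) unfolding bd_iff by meson
   have \<eta>J: "v \<in> J_hat G P" using v(1) by (rule maximal_charsD)
   have \<eta>p: "v (p <# P) = 1" using v(2) \<omega>B(2) by simp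
   then have "v \<in> Wset p" using maximal_bd[OF v(1)] by (simp add: Wset_def)
   then have "act (val a) v = v" by (rule fixed[OF v(1)])
   then have "v ?S' = v S" using act_eq[OF \<eta>J a(1) a1[OF \<eta>J \<eta>p] S] by simp
   then show ?thesis using act_eq[OF \<omega>J a(1) wa S] v(2) by simp
  qed (simp add: act_extensional J_hatD(5)[OF \<omega>J])
 qed
 then show ?thesis using \<omega>B(1) a(1) wa by (auto simp: adom_def)
qed

text \<open>Membership of \<open>g\<close> in \<open>G0 G P\<close> supplies \<open>r\<close> in
  \<open>p P\<close> with \<open>g \<otimes> r\<close> in \<open>P\<close>. If a maximal character
  in \<open>Wset r\<close> were moved, it would be 1 at some \<open>S\<close> and its image 1 at
  some \<open>R\<close> disjoint from \<open>S\<close>; a point \<open>q\<close> of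
  \<open>r P\<close> and \<open>S\<close> with \<open>g \<otimes> q\<close> in \<open>R\<close>
  would have disjoint \<open>q P\<close> and \<open>g q P\<close>. Hence all of
  \<open>Wset r\<close> is fixed and freeness fails.\<close>

lemma tfree_G0_imp_cond3: assumes "tfree (G0 G P)" shows cond3
proof (rule ccontr)
 assume "\<not> cond3"
 then obtain g where "g \<in> G0 G P \<and> g \<noteq> \<one> \<and>
   \<not> (\<forall>p\<in>P. \<exists>q\<in>p <# P. (q <# P) \<inter> ((g \<otimes> q) <# P) = {})"
  unfolding cond3_def by blast
 then obtain p where g: "g \<in> G0 G P" "g \<noteq> \<one>" and p: "p \<in> P"
  and meet: "\<not> (\<exists>q\<in>p <# P. (q <# P) \<inter> ((g \<otimes> q) <# P) = {})" by blast
 have gc: "g \<in> carrier G" using G0_D(1)[OF g(1)] .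
 have "p <# P \<noteq> {}" using l_coset_self P_carrier p by blast
 then obtain r where r: "r \<in> p <# P" "g \<otimes> r \<in> P" using G0_D(3)[OF g(1) principal_J[OF p]] by blast
 have rP: "r \<in> P" using r(1) l_coset_subset[OF p] by blast
 obtain a where a: "a \<in> W" "val a = g" "r \<in> K a" by (rule exists_word[OF gc rP r(2)])
 have rp: "r <# P \<subseteq> p <# P" using J_right_ideal[OF principal_J[OF p] r(1)] .
 have fixed: "act (val a) w = w" if w: "w \<in> maximal_chars G P" "w \<in> Wset r" for w
 proof -
  have \<omega>J: "w \<in> J_hat G P" using w(1) by (rule maximal_charsD)
  have \<omega>r: "w (r <# P) = 1" using w(2) by (simp add: Wset_def)
  have wa: "w (K a) = 1"
   using char_mono[OF \<omega>J principal_J[OF rP] J_I[OF a(1)] \<omega>r J_right_ideal[OF J_I[OF a(1)] a(3)]] .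
  have aM: "act (val a) w \<in> maximal_chars G P" by (rule act_maximal[OF w(1) a(1) wa])
  have aJ: "act (val a) w \<in> J_hat G P" using aM by (rule maximal_charsD)
  have sub: "w S = 1 ==> act (val a) w S = 1" if S: "S \<in> J" for S
  proof (rule ccontr)
   assume 1: "w S = 1" and "act (val a) w S \<noteq> 1"
   then have "act (val a) w S = 0" using J_hatD(1)[OF aJ S] by simp
   then obtain R where R: "R \<in> J" "act (val a) w R = 1" "R \<inter> S = {}" using maximal_charsD(2)[OF aM S] by blast
   let ?R' = "{x \<in> K a. val a \<otimes> x \<in> R}"
   have R': "?R' \<in> J" "w ?R' = 1" using J_pull[OF R(1) a(1)] act_eq[OF \<omega>J a(1) wa R(1)] R(2) by auto
   have "w ((r <# P) \<inter> S \<inter> ?R') = 1"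
    using char_inter[OF \<omega>J J_inter[OF principal_J[OF rP] S] R'(1)] char_inter[OF \<omega>J principal_J[OF rP] S] \<omega>r 1 R'(2) by simp
   then obtain q where q: "q \<in> r <# P" "q \<in> S" "q \<in> ?R'"
    using char_nonempty[OF \<omega>J J_inter[OF J_inter[OF principal_J[OF rP] S] R'(1)]] by blast
   have "(q <# P) \<inter> ((g \<otimes> q) <# P) \<noteq> {}" using meet q(1) rp by blast
   moreover have "q <# P \<subseteq> S" using J_right_ideal[OF S q(2)] .
   moreover have "(g \<otimes> q) <# P \<subseteq> R" using J_right_ideal[OF R(1), of "g \<otimes> q"] q(3) a(2) by simp
   ultimately show False using R(3) by blast
  qed
  \<comment> \<open>One inclusion of supports is enough, because \<open>w\<close> is
    maximal.\<close>
  have "char_support G P w \<subseteq> char_support G P (act (val a) w)" using sub by (auto simp: char_support_def)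
  then have "char_support G P (act (val a) w) = char_support G P w"
   using w(1) aJ by (auto simp: maximal_chars_def)
  then show ?thesis using char_eqI[OF aJ \<omega>J] by (auto simp: char_support_def)
 qed
 have "\<not> tfree (G0 G P)"
 proof (rule not_tfreeI[OF g(1,2) gc rP])
  fix w assume w: "w \<in> Wset r"
  show "w \<in> adom g \<and> act g w = w" using fixed_closed[OF rP a(1,3) fixed w] a(2) by blast
 qed
 then show False using assms by simp
qed

lemma tfree_mono: "[|tfree H; H' \<subseteq> H|] ==> tfree H'"
 by (auto simp: topologically_free_def)

end


section \<open>Generators of the boundary crossed product\<close>

context submonoid_pair
begin

abbreviation "B0 \<equiv> alg_crossed G T bU b\<theta>"
abbreviation "A0 \<equiv> free_star_alg P"

abbreviation mult_B0 (infixl "\<star>" 70) where "f \<star> h \<equiv> f \<otimes>\<^bsub>B0\<^esub> h"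
abbreviation add_B0 (infixl "\<uplus>" 65) where "f \<uplus> h \<equiv> f \<oplus>\<^bsub>B0\<^esub> h"
abbreviation diff_B0 (infixl "\<minus>" 65) where "f \<minus> h \<equiv> f \<ominus>\<^bsub>B0\<^esub> h"

sublocale A0: star_alg A0 by (rule free_is_star_alg)

text \<open>Cut off outside the boundary, as \<open>C0_on\<close> requires.\<close>

definition ev :: "'g set => ('g set => nat) => complex" where
 "ev S w = (if w \<in> Bd then of_nat (w S) else 0)"

lemma ev_out: "w \<notin> Bd ==> ev S w = 0"
 by (simp add: ev_def)

lemma ev_cases: "S \<in> J ==> ev S w = 0 \<or> ev S w = 1"
 using J_hatD(1)[OF bd_J_hat, of w S] by (auto simp: ev_def)

lemma continuous_ev: assumes "S \<in> J" shows "continuous_map T euclidean (ev S)"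
proof (rule continuous_map_complexI)
 fix x and e :: real assume x: "x \<in> topspace T" and e: "e > 0"
 have "\<forall>y\<in>{v \<in> Bd. v S = x S}. cmod (ev S y - ev S x) < e"
  using x e by (auto simp: ev_def topspace_T)
 then show "\<exists>V. openin T V \<and> x \<in> V \<and> (\<forall>y\<in>V. cmod (ev S y - ev S x) < e)"
  using x openin_T_eval[OF assms] by (intro exI[of _ "{v \<in> Bd. v S = x S}"]) (simp add: topspace_T)
qed

lemma ev_C0: assumes "a \<in> W" shows "ev (K (rev a)) \<in> C0_on T (bU (val a))"
proof (rule C0_onI[OF continuous_ev])
 show "K (rev a) \<in> J" using J_I assms by simp
 show "ev (K (rev a)) w = 0" if "w \<notin> bU (val a)" for w
 proof -
  have "\<not> (w \<in> Bd \<and> w (K (rev a)) = 1)"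
   using that assms W_rev[OF assms] val_rev[OF assms] by (auto simp: bU_eq adom_def)
  then show ?thesis using ev_cases[OF \<open>K (rev a) \<in> J\<close>, of w] by (auto simp: ev_def)
 qed
qed (simp add: ev_out topspace_T)

text \<open>The support \<open>K (rev a)\<close> is the translate of \<open>K a\<close> by \<open>val a\<close>.\<close>

definition gen :: "'g list => 'g => ('g set => nat) => complex" where
 "gen a = single (val a) (ev (K (rev a)))"

lemma gen_carrier [simp]: "a \<in> W ==> gen a \<in> carrier B0"
 unfolding gen_def by (rule ps.single_carrier) (auto intro: ev_C0)

lemma K_neutral_rev: assumes "a \<in> W" "val a = \<one>" shows "K (rev a) = K a"
proof -
 have "x \<in> K (rev a) \<longleftrightarrow> x \<in> K a" if "x \<in> carrier G" for x
  using K_rev_iff[OF assms(1) that] assms(2) that by simp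
 moreover have "K a \<subseteq> carrier G" "K (rev a) \<subseteq> carrier G"
  using K_subset assms(1) W_rev P_carrier by blast+
 ultimately show ?thesis by blast
qed

lemma gen_neutral: "[|a \<in> W; val a = \<one>|] ==> gen a = single \<one> (ev (K a))"
 by (simp add: gen_def K_neutral_rev)

lemma ev_P: "ev P = indicator (topspace T)"
 using J_hatD(4)[OF bd_J_hat] by (auto simp: ev_def topspace_T indicator_def)

lemma gen_Nil: "gen [] = \<one>\<^bsub>B0\<^esub>"
 by (simp add: gen_neutral K_Nil ps.B_one ev_P)

text \<open>Composition of the partial bijections of the two words: by \<open>K_append\<close> the
  range of the composite is the part of the range of \<open>a\<close> that \<open>inv val a\<close>
  carries into the range of \<open>\<beta>\<close>. Off that range both sides vanish.\<close>

lemma gen_append: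
 assumes a: "a \<in> W" and \<beta>: "\<beta> \<in> W" shows "gen (a @ \<beta>) = gen a \<star> gen \<beta>"
proof (intro ext)
 fix k w
 note g = val_closed[OF a] and h = val_closed[OF \<beta>]
 show "gen (a @ \<beta>) k w = (gen a \<star> gen \<beta>) k w"
 proof (cases "k \<in> carrier G")
  case k: True
  have prod: "(gen a \<star> gen \<beta>) k w = ev (K (rev a)) w * gen \<beta> (inv val a \<otimes> k) (ps.tau (val a) w)"
   unfolding gen_def[of a] by (rule ps.single_mult_left[OF g ev_C0[OF a] k])
  have "inv val a \<otimes> k = val \<beta> \<longleftrightarrow> k = val a \<otimes> val \<beta>" using g h k by (metis inv_solve_left)
  then consider "k \<noteq> val a \<otimes> val \<beta>" "inv val a \<otimes> k \<noteq> val \<beta>" | "k = val a \<otimes> val \<beta>" "inv val a \<otimes> k = val \<beta>" by blast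
  then show ?thesis
  proof cases
   case 1
   then show ?thesis using prod by (simp add: gen_def single_def val_append[OF a \<beta>])
  next
   case 2
   have L: "gen (a @ \<beta>) k w = ev (K (rev (a @ \<beta>))) w"
    using 2 by (simp add: gen_def val_append[OF a \<beta>])
   have R: "(gen a \<star> gen \<beta>) k w = ev (K (rev a)) w * ev (K (rev \<beta>)) (ps.tau (val a) w)"
    unfolding prod 2(2) by (simp add: gen_def)
   have vr: "val (rev a) = inv val a" by (rule val_rev[OF a])
   note ra = W_rev[OF a] and rb = W_rev[OF \<beta>]
   have K: "K (rev (a @ \<beta>)) = {x \<in> K (rev a). inv val a \<otimes> x \<in> K (rev \<beta>)}"
    using K_append[OF rb ra] by (simp add: vr)
   have J': "K (rev (a @ \<beta>)) \<in> J" using J_I[OF W_rev[OF W_append[OF a \<beta>]]] .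
   show ?thesis
   proof (cases "w \<in> Bd \<and> w (K (rev a)) = 1")
    case True
    then have ad: "w \<in> adom (inv val a)" using ra vr by (auto simp: adom_def)
    have t: "ps.tau (val a) w = act (inv val a) w"
     unfolding ps.tau_def by (rule pact_hom_eq) (use g ad in auto)
    have "act (inv val a) w \<in> Bd" using act_bd[OF _ ra] True vr by simp
    moreover have "act (inv val a) w (K (rev \<beta>)) = w (K (rev (a @ \<beta>)))"
     using act_eq[OF bd_J_hat ra _ J_I[OF rb], of w] True vr unfolding K by simp
    ultimately show ?thesis unfolding L R t using True by (simp add: ev_def)
   next
    case False
    have "\<not> (w \<in> Bd \<and> w (K (rev (a @ \<beta>))) = 1)"
     using False char_mono[OF bd_J_hat J' J_I[OF ra], of w] unfolding K by blast
    then show ?thesis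
     unfolding L R using False ev_cases[OF J', of w] ev_cases[OF J_I[OF ra], of w] by (auto simp: ev_def split: if_splits)
   qed
  qed
 qed (use a \<beta> g h in \<open>auto simp: ps.B_mult_out gen_def single_def val_append\<close>)
qed

lemma gen_adj: assumes a: "a \<in> W" shows "adj B0 (gen a) = gen (rev a)"
proof -
 have "(if w \<in> bU (inv val a) then cnj (ev (K (rev a)) (b\<theta> (val a) w)) else 0) = ev (K a) w" for w
 proof (cases "w \<in> adom (val a)")
  case True
  then obtain \<gamma> where c: "\<gamma> \<in> W" "val \<gamma> = val a" "w (K \<gamma>) = 1" by (rule adomE)
  have B: "w \<in> Bd" using True by (simp add: adom_def)
  have "act (val a) w (K (rev a)) = w (K a)" using act_K_rev[OF bd_J_hat[OF B] c(1,3) a] c(2) by simp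
  moreover have "act (val a) w \<in> Bd" using act_bd[OF B c(1,3)] c(2) by simp
  ultimately show ?thesis
   using True B by (simp add: bd_dom_eq[OF val_closed[OF a]] pact_hom_eq[OF val_closed[OF a]] ev_def)
 next
  case False
  then have "\<not> (w \<in> Bd \<and> w (K a) = 1)" using a by (auto simp: adom_def)
  then show ?thesis
   using False ev_cases[OF J_I[OF a], of w] by (auto simp: bd_dom_eq[OF val_closed[OF a]] ev_def)
 qed
 then show ?thesis
  unfolding gen_def ps.adj_single[OF val_closed[OF a]] by (simp add: val_rev[OF a])
qed

lemma crossed_gen_eq: assumes "p \<in> P" shows "crossed_gen G P p = gen [\<one>, p]"
 using assms P_carrier[OF assms] by (auto simp: crossed_gen_def gen_def single_def ev_def K_principal fun_eq_iff)

section \<open>The homomorphism from the free *-algebra and its range\<close>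

definition code :: "('g \<times> bool) list => 'g list" where
 "code u = concat (map (\<lambda>(p, b). if b then [p, \<one>] else [\<one>, p]) u)"

lemma code_simps [simp]: "code [] = []" "code ((p, True) # u) = p # \<one> # code u" "code ((p, False) # u) = \<one> # p # code u"
 by (simp_all add: code_def)

lemma code_append: "code (u @ v) = code u @ code v"
 by (simp add: code_def)

lemma code_W: "u \<in> lists (P \<times> UNIV) ==> code u \<in> W"
proof (induction u)
 case (Cons x u)
 then show ?case by (cases x; cases "snd x") auto
qed simp

lemma code_star_word: "code (star_word u) = rev (code u)"
proof (induction u)
 case (Cons x u)
 then show ?case
  by (cases x; cases "snd x") (simp_all add: star_word_def code_append)
qed simp

definition psi :: "(('g \<times> bool) list => complex) => 'g => ('g set => nat) => complex" where
 "psi = ps.lin_ext (gen \<circ> code)"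

lemma psi_star_hom: "psi \<in> star_hom A0 B0"
 and psi_lmono: "psi (lmono u) = gen (code u)"
proof -
 have "psi \<in> star_hom A0 B0 \<and> psi (lmono u) = gen (code u)"
  unfolding psi_def
  using ps.lin_ext_star_hom[of P "gen \<circ> code"]
  by (simp add: code_W gen_append code_append gen_Nil code_star_word gen_adj)
 then show "psi \<in> star_hom A0 B0" "psi (lmono u) = gen (code u)" by blast+
qed

lemma psi_free_gen: "p \<in> P ==> psi (free_gen p) = crossed_gen G P p"
 by (simp add: free_gen_eq psi_lmono crossed_gen_eq)

fun wl :: "'g list => ('g \<times> bool) list" where
 "wl (p # q # a) = (p, True) # (q, False) # wl a"
| "wl _ = []"

lemma wl_lists: "a \<in> W ==> wl a \<in> lists (P \<times> UNIV)"
 by (induction a rule: wl.induct) auto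

text \<open>A pair \<open>p, q\<close> is encoded as \<open>p, \<one>, \<one>, q\<close>. The
  passage through the trivial step changes neither the value nor the range, since multiplication by
  \<open>p\<close> maps all of \<open>P\<close> into \<open>P\<close>.\<close>

lemma gen_code_wl: "a \<in> W ==> gen (code (wl a)) = gen a"
proof (induction a rule: wl.induct)
 case (1 p q a)
 then have W: "p \<in> P" "q \<in> P" "a \<in> W" by auto
 note c = P_carrier[OF W(1)] P_carrier[OF W(2)]
 have "K [q, \<one>, \<one>, p] = {x \<in> K [\<one>, p]. p \<otimes> x \<in> K [q, \<one>]}"
  using K_append[of "[q, \<one>]" "[\<one>, p]"] W c by simp
 also have "K [\<one>, p] = P" using W c P_mult by (auto simp: K_pair)
 also have "{x \<in> P. p \<otimes> x \<in> K [q, \<one>]} = K [q, p]"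
  using W c P_mult P_carrier by (auto simp: K_pair m_assoc)
 finally have "gen [p, \<one>, \<one>, q] = gen [p, q]" using c by (simp add: gen_def)
 moreover have "gen (p # q # a) = gen [p, q] \<star> gen a" using gen_append[of "[p, q]" a] W by simp
 moreover have "gen (code (wl (p # q # a))) = gen [p, \<one>, \<one>, q] \<star> gen (code (wl a))"
  using gen_append[of "[p, \<one>, \<one>, q]" "code (wl a)"] W wl_lists[OF W(3)] by (simp add: code_W)
 ultimately show ?case using 1 by simp
qed (simp_all)

subsection \<open>Density\<close>

text \<open>The coefficients of the homogeneous elements of degree \<open>g\<close> in the range of
  \<open>psi\<close>; density is proved in each degree separately.\<close>

definition pspan :: "'g => (('g set => nat) => complex) set" where
 "pspan g = {c. single g c \<in> psi ` carrier A0}"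

lemma pspan_gen: assumes "a \<in> W" shows "ev (K (rev a)) \<in> pspan (val a)"
 unfolding pspan_def mem_Collect_eq gen_def[symmetric]
 by (rule image_eqI[of _ _ "lmono (wl a)"]) (simp_all add: psi_lmono gen_code_wl assms wl_lists)

lemma pspan_add: assumes "c \<in> pspan g" "d \<in> pspan g" shows "(\<lambda>x. c x + d x) \<in> pspan g"
proof -
 obtain f h where f: "f \<in> carrier A0" "single g c = psi f" and h: "h \<in> carrier A0" "single g d = psi h"
  using assms by (auto simp: pspan_def)
 have "single g (\<lambda>x. c x + d x) = single g c \<uplus> single g d" by (auto simp: single_def ps.B_simps fun_eq_iff)
 also have "\<dots> = psi (f \<oplus>\<^bsub>A0\<^esub> h)" using star_hom_add[OF psi_star_hom f(1) h(1)] f h by simp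
 finally show ?thesis using f h by (simp add: pspan_def)
qed

lemma pspan_cmult: assumes "c \<in> pspan g" shows "(\<lambda>x. k * c x) \<in> pspan g"
proof -
 obtain f where f: "f \<in> carrier A0" "single g c = psi f" using assms by (auto simp: pspan_def)
 have "single g (\<lambda>x. k * c x) = cscale B0 k (single g c)" by (simp add: ps.single_cscale)
 also have "\<dots> = psi (cscale A0 k f)" using star_hom_cscale[OF psi_star_hom f(1)] f by simp
 finally show ?thesis using f by (simp add: pspan_def)
qed

lemma pspan_mult_ev: assumes c: "c \<in> pspan g" and g: "g \<in> carrier G" and S: "S \<in> J" shows "(\<lambda>x. ev S x * c x) \<in> pspan g"
proof -
 obtain f where f: "f \<in> carrier A0" "single g c = psi f" using c by (auto simp: pspan_def)
 obtain a where a: "a \<in> W" "val a = \<one>" "S = K a" using S by (rule J_neutral)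
 have e: "ev S \<in> C0_on T (bU \<one>)" using ev_C0[OF a(1)] a by (simp add: K_neutral_rev)
 have pf: "psi f \<in> carrier B0" using star_hom_closed[OF psi_star_hom f(1)] .
 have "single g (\<lambda>x. ev S x * c x) = single \<one> (ev S) \<star> single g c"
 proof (intro ext)
  fix k x
  show "single g (\<lambda>x. ev S x * c x) k x = (single \<one> (ev S) \<star> single g c) k x"
  proof (cases "k \<in> carrier G")
   case True
   show ?thesis
    unfolding ps.single_mult_left[OF one_closed e True]
    using True ps.tau_one[of x] by (cases "x \<in> Bd") (auto simp: single_def topspace_T ev_out)
  qed (use g in \<open>auto simp: ps.B_mult_out single_def\<close>)
 qed
 also have "\<dots> = psi (lmono (wl a) \<otimes>\<^bsub>A0\<^esub> f)"
  using star_hom_mult[OF psi_star_hom _ f(1), of "lmono (wl a)"] a f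
  by (simp add: wl_lists psi_lmono gen_code_wl gen_neutral)
 finally show ?thesis using f a wl_lists by (simp add: pspan_def)
qed

text \<open>The indicator of a basic open set is a product of factors \<open>ev S\<close> and
  \<open>1 - ev S\<close>, and multiplication by each of them preserves
  \<open>pspan g\<close>.\<close>

lemma pspan_mult_pattern:
 assumes "finite \<S>" "\<S> \<subseteq> J" and c: "c \<in> pspan g" and g: "g \<in> carrier G"
 shows "(\<lambda>\<eta>. if \<forall>S\<in>\<S>. \<eta> S = w S \<or> \<eta> \<notin> Bd then c \<eta> else 0) \<in> pspan g"
 using assms(1,2)
proof (induction \<S>)
 case (insert S \<S>)
 let ?c = "\<lambda>\<eta>. if \<forall>S\<in>\<S>. \<eta> S = w S \<or> \<eta> \<notin> Bd then c \<eta> else 0"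
 have c': "?c \<in> pspan g" using insert by simp
 have out: "c \<eta> = 0" if "\<eta> \<notin> Bd" for \<eta>
 proof -
  obtain f where "f \<in> carrier A0" "single g c = psi f" using c by (auto simp: pspan_def)
  then have "single g c \<in> carrier B0" using star_hom_closed[OF psi_star_hom] by simp
  from ps.carrier_BD(5)[OF this, of \<eta> g] show ?thesis using that by (simp add: topspace_T)
 qed
 have S: "S \<in> J" using insert by simp
 have e: "(\<lambda>\<eta>. ev S \<eta> * ?c \<eta>) \<in> pspan g" by (rule pspan_mult_ev[OF c' g S])
 have n: "(\<lambda>\<eta>. ?c \<eta> + (-1) * (ev S \<eta> * ?c \<eta>)) \<in> pspan g"
  by (rule pspan_add[OF c' pspan_cmult[OF e]])
 have z: "(\<lambda>\<eta>. 0 * ?c \<eta>) \<in> pspan g" by (rule pspan_cmult[OF c'])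
 let ?d = "\<lambda>\<eta>. if \<forall>S\<in>Set.insert S \<S>. \<eta> S = w S \<or> \<eta> \<notin> Bd then c \<eta> else 0"
 have v: "\<eta> \<in> Bd ==> \<eta> S = 0 \<or> \<eta> S = 1" for \<eta> using J_hatD(1)[OF bd_J_hat S] by blast
 \<comment> \<open>The function \<open>w\<close> is arbitrary here; a value other than 0 and 1 makes
   the pattern empty on the boundary and the product 0.\<close>
 consider "w S = 1" | "w S = 0" | "w S \<noteq> 0" "w S \<noteq> 1" by blast
 then show ?case
 proof cases
  case 1
  have "?d = (\<lambda>\<eta>. ev S \<eta> * ?c \<eta>)"
  proof
   fix \<eta> show "?d \<eta> = ev S \<eta> * ?c \<eta>" using 1 out v[of \<eta>] by (cases "\<eta> \<in> Bd") (auto simp: ev_def)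
  qed
  then show ?thesis using e by simp
 next
  case 2
  have "?d = (\<lambda>\<eta>. ?c \<eta> + (-1) * (ev S \<eta> * ?c \<eta>))"
  proof
   fix \<eta> show "?d \<eta> = ?c \<eta> + (-1) * (ev S \<eta> * ?c \<eta>)" using 2 out v[of \<eta>] by (cases "\<eta> \<in> Bd") (auto simp: ev_def)
  qed
  then show ?thesis using n by simp
 next
  case 3
  have "?d = (\<lambda>\<eta>. 0 * ?c \<eta>)"
  proof
   fix \<eta> show "?d \<eta> = 0 * ?c \<eta>" using 3 out v[of \<eta>] by (cases "\<eta> \<in> Bd") auto
  qed
  then show ?thesis using z by simp
 qed
qed (use c in simp)

text \<open>The set where the modulus of \<open>b\<close> is at least \<open>e\<close> is compact.
  It is covered by finitely many basic open sets on which \<open>b\<close> varies by less than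
  \<open>e\<close> and whose indicators lie in \<open>pspan g\<close>. The locally constant
  approximations are pasted together, and 0 approximates \<open>b\<close> elsewhere.\<close>

lemma pspan_dense:
 assumes g: "g \<in> carrier G" and b: "b \<in> C0_on T (bU g)" and e: "e > 0"
 obtains c where "c \<in> pspan g" "!!v. v \<in> Bd ==> cmod (b v - c v) < e"
proof -
 let ?C = "{x \<in> topspace T. b x \<in> {z. e \<le> cmod z}}"
 have cl: "closedin T ?C"
  by (rule closedin_continuous_map_preimage[OF C0_onD(1)[OF b]]) (simp add: closed_Collect_le continuous_intros)
 have C: "compactin T ?C" using closedin_compact_space[OF compact_T cl] .
 define good where "good V \<longleftrightarrow> openin T V \<and> (\<exists>w. (\<forall>v\<in>V. cmod (b v - b w) < e) \<and>
   (\<forall>c\<in>pspan g. (\<lambda>v. if v \<in> V then c v else 0) \<in> pspan g) \<and> (indicator V \<in> pspan g))" for V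
 have cover: "\<exists>V. good V \<and> w \<in> V" if w: "w \<in> ?C" for w
 proof -
  have B: "w \<in> Bd" using w by (simp add: topspace_T)
  have "b w \<noteq> 0" using w e by auto
  then have "w \<in> bU g" using C0_onD(2)[OF b] by blast
  then obtain a where a: "a \<in> W" "val a = inv g" "w (K a) = 1" unfolding bU_eq[OF g] by (rule adomE)
  obtain V0 where V0: "openin T V0" "w \<in> V0" "\<forall>y\<in>V0. cmod (b y - b w) < e"
   using continuous_map_complexD[OF C0_onD(1)[OF b] _ e, of w] w by blast
  obtain \<S> where \<S>: "finite \<S>" "\<S> \<subseteq> J" "!!v. [|v \<in> Bd; !!S. S \<in> \<S> ==> v S = w S|] ==> v \<in> V0"
   using T_nbhd[OF V0(1,2)] by blast
  \<comment> \<open>Including \<open>K a\<close> keeps the neighbourhood inside the support of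
    \<open>ev (K a)\<close>, so that cutting this element of \<open>pspan g\<close> down to
    \<open>V\<close> gives exactly the indicator of \<open>V\<close>.\<close>
  define \<S>' where "\<S>' = Set.insert (K a) \<S>"
  have \<S>': "finite \<S>'" "\<S>' \<subseteq> J" using \<S> J_I[OF a(1)] by (auto simp: \<S>'_def)
  define V where "V = {v \<in> Bd. \<forall>S\<in>\<S>'. v S = w S}"
  have cut: "(\<lambda>v. if v \<in> V then c v else 0) \<in> pspan g" if c: "c \<in> pspan g" for c
  proof -
   have out: "c v = 0" if "v \<notin> Bd" for v
   proof -
    obtain f where "f \<in> carrier A0" "single g c = psi f" using c by (auto simp: pspan_def)
    then have "single g c \<in> carrier B0" using star_hom_closed[OF psi_star_hom] by simp
    from ps.carrier_BD(5)[OF this, of v g] show ?thesis using that by (simp add: topspace_T)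
   qed
   have "(\<lambda>v. if v \<in> V then c v else 0) = (\<lambda>v. if \<forall>S\<in>\<S>'. v S = w S \<or> v \<notin> Bd then c v else 0)"
   proof
    fix v show "(if v \<in> V then c v else 0) = (if \<forall>S\<in>\<S>'. v S = w S \<or> v \<notin> Bd then c v else 0)"
     using out by (cases "v \<in> Bd") (auto simp: V_def)
   qed
   then show ?thesis using pspan_mult_pattern[OF \<S>' c g, of w] by simp
  qed
  have "val (rev a) = g" using val_rev[OF a(1)] a(2) g by simp
  then have "ev (K a) \<in> pspan g" using pspan_gen[OF W_rev[OF a(1)]] by simp
  have "(\<lambda>v. if v \<in> V then ev (K a) v else 0) = indicator V"
  proof
   fix v
   have "ev (K a) v = 1" if "v \<in> V"
    using that a(3) by (simp add: V_def ev_def \<S>'_def)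
   then show "(if v \<in> V then ev (K a) v else 0) = indicator V v" by simp
  qed
  then have i: "indicator V \<in> pspan g" using cut[OF \<open>ev (K a) \<in> pspan g\<close>] by simp
  have "V \<subseteq> V0" using \<S>(3) by (auto simp: V_def \<S>'_def)
  then have "good V"
   unfolding good_def
   using openin_T_agree[OF \<S>', of w, folded V_def] V0(3) cut i by (intro conjI exI[of _ w] ballI) blast+
  moreover have "w \<in> V" using B by (simp add: V_def)
  ultimately show ?thesis by blast
 qed
 have "\<exists>\<F>. finite \<F> \<and> \<F> \<subseteq> Collect good \<and> ?C \<subseteq> \<Union>\<F>"
 proof -
  have "\<forall>V\<in>Collect good. openin T V" by (auto simp: good_def)
  moreover have "?C \<subseteq> \<Union>(Collect good)"
  proof
   fix w assume "w \<in> ?C"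
   from cover[OF this] show "w \<in> \<Union>(Collect good)" by blast
  qed
  ultimately show ?thesis using C unfolding compactin_def by meson
 qed
 then obtain \<F> where \<F>: "finite \<F>" "\<F> \<subseteq> Collect good" "?C \<subseteq> \<Union>\<F>" by blast
 have zero: "(\<lambda>_. 0) \<in> pspan g"
 proof -
  have "single g (\<lambda>_. 0) = psi \<zero>\<^bsub>A0\<^esub>"
   unfolding star_hom_zero[OF psi_star_hom A0.star_alg_axioms ps.B_star_alg] by (auto simp: single_def ps.B_simps)
  then show ?thesis by (simp add: pspan_def)
 qed
 have "\<exists>c\<in>pspan g. (\<forall>v\<in>\<Union>\<F>. cmod (b v - c v) < e) \<and> (\<forall>v. v \<notin> \<Union>\<F> --> c v = 0)"
  using \<F>(1,2)
 proof (induction \<F>)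
  case empty
  then show ?case using zero by (intro bexI[of _ "\<lambda>_. 0"]) auto
 next
  case (insert V \<F>)
  then obtain c where c: "c \<in> pspan g" "\<forall>v\<in>\<Union>\<F>. cmod (b v - c v) < e" "\<forall>v. v \<notin> \<Union>\<F> --> c v = 0" by auto
  have "good V" using insert by simp
  then obtain w where V: "\<forall>v\<in>V. cmod (b v - b w) < e"
   "\<forall>c\<in>pspan g. (\<lambda>v. if v \<in> V then c v else 0) \<in> pspan g" "indicator V \<in> pspan g"
   unfolding good_def by blast
  \<comment> \<open>The new value overwrites the old one on \<open>V\<close>, so the sets of the
    cover need not be disjoint.\<close>
  let ?d = "\<lambda>v. (c v + (-1) * (if v \<in> V then c v else 0)) + b w * indicator V v"
  have "?d \<in> pspan g"
   by (rule pspan_add[OF pspan_add[OF c(1) pspan_cmult[OF bspec[OF V(2) c(1)]]] pspan_cmult[OF V(3)]])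
  moreover have "?d v = (if v \<in> V then b w else c v)" for v by simp
  ultimately show ?case
   using V(1) c(2,3) by (intro bexI[of _ ?d]) auto
 qed
 then obtain c where c: "c \<in> pspan g" "\<forall>v\<in>\<Union>\<F>. cmod (b v - c v) < e" "\<forall>v. v \<notin> \<Union>\<F> --> c v = 0" by blast
 have "cmod (b v - c v) < e" if "v \<in> Bd" for v
 proof (cases "v \<in> \<Union>\<F>")
  case True
  then show ?thesis using c(2) by blast
 next
  case False
  then have "v \<notin> ?C" using \<F>(3) by blast
  then have "cmod (b v) < e" using that by (auto simp: topspace_T)
  moreover have "c v = 0" using c(3) False by blast
  ultimately show ?thesis by simp
 qed
 then show thesis using that c(1) by blast
qed

lemma psi_dense:
 assumes b: "b \<in> carrier B0" and e: "e > 0"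
 obtains f where "f \<in> carrier A0" "ps.l1 (b \<minus> psi f) < e"
proof -
 have "\<exists>f\<in>carrier A0. ps.l1 (b \<minus> psi f) \<le> card (supp b) * d" if d: "d > 0" for d :: real
 proof -
  define c where "c g = (SOME c. c \<in> pspan g \<and> (\<forall>v\<in>Bd. cmod (b g v - c v) < d))" for g
  have cg: "c g \<in> pspan g \<and> (\<forall>v\<in>Bd. cmod (b g v - c g v) < d)" if g: "g \<in> carrier G" for g
  proof -
   obtain c' where "c' \<in> pspan g" "!!v. v \<in> Bd ==> cmod (b g v - c' v) < d"
    using pspan_dense[OF g ps.carrier_BD(3)[OF b g] d] by metis
   then have "c' \<in> pspan g \<and> (\<forall>v\<in>Bd. cmod (b g v - c' v) < d)" by simp
   then show ?thesis unfolding c_def by (rule someI[of "\<lambda>c. c \<in> pspan g \<and> (\<forall>v\<in>Bd. cmod (b g v - c v) < d)"])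
  qed
  have c: "g \<in> carrier G ==> c g \<in> pspan g" "[|g \<in> carrier G; v \<in> Bd|] ==> cmod (b g v - c g v) < d" for g v
   using cg[of g] by simp_all
  have "\<exists>f\<in>carrier A0. psi f = (\<lambda>g x. if g \<in> F then c g x else 0)" if "finite F" "F \<subseteq> carrier G" for F
   using that
  proof (induction F)
   case empty
   show ?case using star_hom_zero[OF psi_star_hom A0.star_alg_axioms ps.B_star_alg]
    by (intro bexI[of _ "\<zero>\<^bsub>A0\<^esub>"]) (auto simp: ps.B_simps)
  next
   case (insert h F)
   then obtain f where f: "f \<in> carrier A0" "psi f = (\<lambda>g x. if g \<in> F then c g x else 0)" by auto
   have "h \<in> carrier G" using insert by simp
   from c(1)[OF this] obtain f' where f': "f' \<in> carrier A0" "single h (c h) = psi f'" by (auto simp: pspan_def)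
   have "psi (f \<oplus>\<^bsub>A0\<^esub> f') = (\<lambda>g x. if g \<in> Set.insert h F then c g x else 0)"
    unfolding star_hom_add[OF psi_star_hom f(1) f'(1)] f(2) f'(2)[symmetric]
    using insert(2) by (auto simp: ps.B_simps single_def fun_eq_iff)
   then show ?case using f f' by blast
  qed
  then obtain f where f: "f \<in> carrier A0" "psi f = (\<lambda>g x. if g \<in> supp b then c g x else 0)"
   using ps.carrier_BD(1,2)[OF b] by blast
  have pf: "psi f \<in> carrier B0" using star_hom_closed[OF psi_star_hom f(1)] .
  have diff: "(b \<minus> psi f) g x = b g x - psi f g x" for g x
   using b pf by (simp add: a_minus_def ps.B.cscale_m1[symmetric] ps.B_simps)
  have s: "supp (b \<minus> psi f) \<subseteq> supp b"
  proof -
   have "b \<minus> psi f = (\<lambda>g x. b g x - psi f g x)" by (intro ext) (rule diff)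
   then show ?thesis unfolding f(2) by (auto simp: fun_eq_iff)
  qed
  have "ps.l1 (b \<minus> psi f) = (\<Sum>g\<in>supp b. sup_norm T ((b \<minus> psi f) g))"
   by (rule ps.l1_eq[OF ps.carrier_BD(1)[OF b] s])
  also have "\<dots> \<le> (\<Sum>g\<in>supp b. d)"
  proof (rule sum_mono)
   fix g assume g: "g \<in> supp b"
   then have gc: "g \<in> carrier G" using ps.carrier_BD(2)[OF b] by blast
   show "sup_norm T ((b \<minus> psi f) g) \<le> d"
   proof (rule ps.sup_norm_least)
    fix x assume "x \<in> topspace T"
    then have "cmod (b g x - c g x) < d" using c(2)[OF gc] by (simp add: topspace_T)
    then show "cmod ((b \<minus> psi f) g x) \<le> d" unfolding diff unfolding f(2) using g by simp
   qed
  qed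
  finally show ?thesis using f(1) by auto
 qed
 note * = this
 let ?n = "real (card (supp b))"
 \<comment> \<open>Dividing by one more than the number of coefficients gives a strict bound, and it
   also covers \<open>b = 0\<close>.\<close>
 have "e / (?n + 1) > 0" using e by (simp add: add_nonneg_pos)
 from *[OF this] obtain f where f: "f \<in> carrier A0" "ps.l1 (b \<minus> psi f) \<le> ?n * (e / (?n + 1))" by blast
 have "?n * e < e * (?n + 1)" using e by (simp add: algebra_simps)
 then have "?n * (e / (?n + 1)) < e" by (simp add: pos_divide_less_eq add_nonneg_pos)
 then show thesis using that[OF f(1)] f(2) by linarith
qed

end


section \<open>The diagonal algebra and its values on the boundary\<close>

text \<open>Tested on the unit vector at \<open>p\<close>. The hypothesis on \<open>M\<close> makes
  the supremum defining \<open>mult_opnorm\<close> bounded.\<close>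

lemma cmod_le_mult_opnorm:
 assumes p: "p \<in> A" and M: "!!x. x \<in> A ==> cmod (b x) \<le> M"
 shows "cmod (b p) \<le> mult_opnorm A b"
proof -
 let ?\<Xi> = "{z :: 'a => complex. (\<lambda>p. (cmod (z p))\<^sup>2) summable_on A \<and> (\<Sum>\<^sub>\<infinity>p\<in>A. (cmod (z p))\<^sup>2) \<le> 1}"
 let ?\<delta> = "indicator {p} :: 'a => complex"
 have M0: "0 \<le> M" using M[OF p] norm_ge_zero[of "b p"] by linarith
 have d: "(\<Sum>\<^sub>\<infinity>q\<in>A. (cmod (c q * ?\<delta> q))\<^sup>2) = (cmod (c p))\<^sup>2"
  "(\<lambda>q. (cmod (c q * ?\<delta> q))\<^sup>2) summable_on A" for c :: "'a => complex"
 proof -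
  have "((\<lambda>q. (cmod (c q * ?\<delta> q))\<^sup>2) has_sum (cmod (c p))\<^sup>2) A"
   by (rule has_sum_finite_neutralI[of "{p}"]) (use p in auto)
  then show "(\<Sum>\<^sub>\<infinity>q\<in>A. (cmod (c q * ?\<delta> q))\<^sup>2) = (cmod (c p))\<^sup>2"
   "(\<lambda>q. (cmod (c q * ?\<delta> q))\<^sup>2) summable_on A" by (auto simp: infsumI summable_on_def)
 qed
 have mem: "?\<delta> \<in> ?\<Xi>" using d[of "\<lambda>_. 1"] by simp
 have bdd: "sqrt (\<Sum>\<^sub>\<infinity>q\<in>A. (cmod (b q * z q))\<^sup>2) \<le> M" if "z \<in> ?\<Xi>" for z
 proof -
  have s: "(\<lambda>q. M\<^sup>2 * (cmod (z q))\<^sup>2) summable_on A" using that by (intro summable_on_cmult_right) simp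
  have le: "(cmod (b q * z q))\<^sup>2 \<le> M\<^sup>2 * (cmod (z q))\<^sup>2" if "q \<in> A" for q
   using M[OF that] by (simp add: norm_mult power_mult_distrib mult_right_mono power_mono)
  have s': "(\<lambda>q. (cmod (b q * z q))\<^sup>2) summable_on A"
   by (rule summable_on_comparison_test[OF s]) (use le in auto)
  have "(\<Sum>\<^sub>\<infinity>q\<in>A. (cmod (b q * z q))\<^sup>2) \<le> (\<Sum>\<^sub>\<infinity>q\<in>A. M\<^sup>2 * (cmod (z q))\<^sup>2)"
   by (rule infsum_mono[OF s' s le])
  also have "\<dots> = M\<^sup>2 * (\<Sum>\<^sub>\<infinity>q\<in>A. (cmod (z q))\<^sup>2)" by (rule infsum_cmult_right) (use that in simp)
  also have "\<dots> \<le> M\<^sup>2 * 1" by (rule mult_left_mono) (use that in simp_all)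
  finally show ?thesis using M0 real_le_lsqrt by simp
 qed
 have "sqrt (\<Sum>\<^sub>\<infinity>q\<in>A. (cmod (b q * ?\<delta> q))\<^sup>2) \<le> mult_opnorm A b"
  unfolding mult_opnorm_def by (rule cSUP_upper[OF mem bdd_aboveI2]) (rule bdd)
 then show ?thesis by (simp only: d) simp
qed

lemma cSUP_eqI_zero: "[|X \<noteq> {}; !!x. f x = (0 :: real)|] ==> (SUP x\<in>X. f x) = 0"
 by simp

lemma mult_opnorm_zero:
 assumes "!!p. p \<in> A ==> b p = 0" shows "mult_opnorm A b = 0"
proof -
 let ?\<Xi> = "{z :: 'a => complex. (\<lambda>p. (cmod (z p))\<^sup>2) summable_on A \<and> (\<Sum>\<^sub>\<infinity>p\<in>A. (cmod (z p))\<^sup>2) \<le> 1}"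
 have "(\<lambda>_. 0) \<in> ?\<Xi>" by simp
 then have "?\<Xi> \<noteq> {}" by (rule ex_in_conv[THEN iffD1, OF exI])
 moreover have "sqrt (\<Sum>\<^sub>\<infinity>p\<in>A. (cmod (b p * z p))\<^sup>2) = 0" for z
 proof -
  have "(\<Sum>\<^sub>\<infinity>p\<in>A. (cmod (b p * z p))\<^sup>2) = 0" by (rule infsum_0) (simp add: assms)
  then show ?thesis by (simp only: real_sqrt_zero)
 qed
 ultimately show ?thesis unfolding mult_opnorm_def by (rule cSUP_eqI_zero)
qed

context submonoid_pair
begin

abbreviation "Dr \<equiv> D_r G P"

definition span_J :: "('g => complex) set" where
 "span_J = {f. \<exists>\<S> c. finite \<S> \<and> \<S> \<subseteq> J \<and> f = (\<lambda>x. \<Sum>S\<in>\<S>. c S * indicator S x)}"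

lemma span_J_indicator: "S \<in> J ==> indicator S \<in> span_J"
 unfolding span_J_def by (intro CollectI exI[of _ "{S}"] exI[of _ "\<lambda>_. 1"]) auto

lemma span_J_add:
 assumes "f \<in> span_J" "h \<in> span_J" shows "(\<lambda>x. f x + h x) \<in> span_J"
proof -
 obtain \<S> c where f: "finite \<S>" "\<S> \<subseteq> J" "f = (\<lambda>x. \<Sum>S\<in>\<S>. c S * indicator S x)" using assms(1) by (auto simp: span_J_def)
 obtain \<T> d where h: "finite \<T>" "\<T> \<subseteq> J" "h = (\<lambda>x. \<Sum>S\<in>\<T>. d S * indicator S x)" using assms(2) by (auto simp: span_J_def)
 let ?c = "\<lambda>S. (if S \<in> \<S> then c S else 0) + (if S \<in> \<T> then d S else 0)"
 have "f x + h x = (\<Sum>S\<in>\<S> \<union> \<T>. ?c S * indicator S x)" for x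
 proof -
  have "f x = (\<Sum>S\<in>\<S> \<union> \<T>. (if S \<in> \<S> then c S else 0) * indicator S x)"
   unfolding f(3) by (rule sum.mono_neutral_cong_left) (use f h in auto)
  moreover have "h x = (\<Sum>S\<in>\<S> \<union> \<T>. (if S \<in> \<T> then d S else 0) * indicator S x)"
   unfolding h(3) by (rule sum.mono_neutral_cong_left) (use f h in auto)
  ultimately show ?thesis by (simp add: distrib_right sum.distrib)
 qed
 then show ?thesis unfolding span_J_def using f h by (intro CollectI exI[of _ "\<S> \<union> \<T>"] exI[of _ ?c]) auto
qed

lemma span_J_cmult: assumes "f \<in> span_J" shows "(\<lambda>x. k * f x) \<in> span_J"
proof -
 obtain \<S> c where f: "finite \<S>" "\<S> \<subseteq> J" "f = (\<lambda>x. \<Sum>S\<in>\<S>. c S * indicator S x)" using assms by (auto simp: span_J_def)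
 have "(\<lambda>x. k * f x) = (\<lambda>x. \<Sum>S\<in>\<S>. (k * c S) * indicator S x)"
  unfolding f(3) sum_distrib_left mult.assoc ..
 then show ?thesis
  unfolding span_J_def by (intro CollectI exI[of _ \<S>] exI[of _ "\<lambda>S. k * c S"] conjI f(1,2))
qed

lemma span_J_sum:
 "[|finite I; !!i. i \<in> I ==> f i \<in> span_J|] ==> (\<lambda>x. \<Sum>i\<in>I. f i x) \<in> span_J"
proof (induction rule: finite_induct)
 case empty
 show ?case using span_J_cmult[OF span_J_indicator[OF P_in_J], of 0] by simp
next
 case (insert i I)
 then show ?case using span_J_add[of "f i" "\<lambda>x. \<Sum>i\<in>I. f i x"] by simp
qed

lemma span_J_mult_indicator: assumes f: "f \<in> span_J" and S: "S \<in> J" shows "(\<lambda>x. indicator S x * f x) \<in> span_J"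
proof -
 obtain \<S> c where f: "finite \<S>" "\<S> \<subseteq> J" "f = (\<lambda>x. \<Sum>S\<in>\<S>. c S * indicator S x)" using f by (auto simp: span_J_def)
 have "(\<lambda>x. \<Sum>R\<in>\<S>. c R * indicator (S \<inter> R) x) \<in> span_J"
  by (rule span_J_sum[OF f(1)]) (use f(2) S in \<open>auto intro!: span_J_cmult span_J_indicator\<close>)
 moreover have "indicator S x * f x = (\<Sum>R\<in>\<S>. c R * indicator (S \<inter> R) x)" for x
  unfolding f(3) sum_distrib_left by (simp add: indicator_inter_arith mult.left_commute)
 ultimately show ?thesis by simp
qed

text \<open>A function of the pattern \<open>{S \<in> \<S>. x \<in> S}\<close>, \<open>\<S>\<close> finite; unlike \<open>span_J\<close>, the set of these functions
 is visibly closed under pointwise operations.\<close>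

definition pattern_fun :: "'g set set => ('g set set => complex) => 'g => complex" where
 "pattern_fun \<S> h x = (if x \<in> P then h {S \<in> \<S>. x \<in> S} else 0)"

lemma pattern_fun_span:
 assumes "finite \<S>" "\<S> \<subseteq> J" shows "pattern_fun \<S> h \<in> span_J"
 using assms
proof (induction \<S> arbitrary: h)
 case empty
 have "pattern_fun {} h = (\<lambda>x. h {} * indicator P x)" by (auto simp: pattern_fun_def)
 then show ?case using span_J_cmult[OF span_J_indicator[OF P_in_J]] by simp
next
 case (insert S \<S>)
 define f1 where "f1 = pattern_fun \<S> (\<lambda>Q. h (Set.insert S Q))"
 define f2 where "f2 = pattern_fun \<S> h"
 have SJ: "S \<in> J" and f: "f1 \<in> span_J" "f2 \<in> span_J" using insert by (auto simp: f1_def f2_def)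
 have "(\<lambda>x. indicator S x * f1 x + (f2 x + (-1) * (indicator S x * f2 x))) \<in> span_J"
  by (rule span_J_add[OF span_J_mult_indicator[OF f(1) SJ] span_J_add[OF f(2) span_J_cmult[OF span_J_mult_indicator[OF f(2) SJ]]]])
 moreover have "pattern_fun (Set.insert S \<S>) h x = indicator S x * f1 x + (f2 x + (-1) * (indicator S x * f2 x))" for x
 proof -
  have "{R \<in> Set.insert S \<S>. x \<in> R} = (if x \<in> S then Set.insert S {R \<in> \<S>. x \<in> R} else {R \<in> \<S>. x \<in> R})" by auto
  then show ?thesis using J_subset[OF SJ] by (auto simp: f1_def f2_def pattern_fun_def)
 qed
 ultimately show ?case by presburger
qed

lemma span_pattern_fun:
 assumes "finite \<S>" "\<S> \<subseteq> J"
 shows "(\<lambda>x. \<Sum>S\<in>\<S>. c S * indicator S x) = pattern_fun \<S> (\<lambda>Q. \<Sum>S\<in>Q. c S)"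
proof
 fix x
 show "(\<Sum>S\<in>\<S>. c S * indicator S x) = pattern_fun \<S> (\<lambda>Q. \<Sum>S\<in>Q. c S) x"
 proof (cases "x \<in> P")
  case True
  have "(\<Sum>S\<in>\<S>. c S * indicator S x) = (\<Sum>S\<in>{S \<in> \<S>. x \<in> S}. c S)"
   by (rule sum.mono_neutral_cong_right) (use assms in auto)
  then show ?thesis using True by (simp add: pattern_fun_def)
 next
  case False
  then have "\<forall>S\<in>\<S>. x \<notin> S" using assms(2) J_subset by blast
  then show ?thesis using False by (simp add: pattern_fun_def)
 qed
qed

lemma span_JE:
 assumes "f \<in> span_J" obtains \<S> h where "finite \<S>" "\<S> \<subseteq> J" "f = pattern_fun \<S> h"
 using assms span_pattern_fun by (auto simp: span_J_def)

text \<open>Functions in \<open>span_J\<close> have finitely many values, so \<open>k\<close> may be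
  arbitrary; later a discontinuous truncation is used.\<close>

lemma span_J_map:
 assumes "f \<in> span_J" shows "(\<lambda>x. if x \<in> P then k (f x) else 0) \<in> span_J"
proof -
 obtain \<S> h where f: "finite \<S>" "\<S> \<subseteq> J" "f = pattern_fun \<S> h" using assms by (rule span_JE)
 have "(\<lambda>x. if x \<in> P then k (f x) else 0) = pattern_fun \<S> (\<lambda>Q. k (h Q))" by (auto simp: f(3) pattern_fun_def)
 then show ?thesis using pattern_fun_span[OF f(1,2)] by simp
qed

lemma span_J_carrier: assumes "f \<in> span_J" shows "f \<in> carrier Dr"
proof -
 obtain \<S> c where f: "finite \<S>" "\<S> \<subseteq> J" "f = (\<lambda>x. \<Sum>S\<in>\<S>. c S * indicator S x)" using assms by (auto simp: span_J_def)
 then have "\<forall>e>0. finite \<S> \<and> \<S> \<subseteq> J \<and> (\<forall>x. cmod (f x - (\<Sum>S\<in>\<S>. c S * indicator S x)) < e)" by simp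
 then show ?thesis unfolding D_r_def by (simp only: partial_object.simps mem_Collect_eq) blast
qed

lemma Dr_approx:
 assumes "f \<in> carrier Dr" "e > 0" obtains s where "s \<in> span_J" "!!x. cmod (f x - s x) < e"
proof -
 obtain \<S> c where "finite \<S>" "\<S> \<subseteq> J" "\<forall>x. cmod (f x - (\<Sum>S\<in>\<S>. c S * indicator S x)) < e"
  using assms unfolding D_r_def by (auto simp only: partial_object.simps mem_Collect_eq)
 note c = this
 have "(\<lambda>x. \<Sum>S\<in>\<S>. c S * indicator S x) \<in> span_J"
  unfolding span_J_def by (intro CollectI exI[of _ \<S>] exI[of _ c] conjI c(1,2) refl)
 then show thesis by (rule that) (use c(3) in blast)
qed

lemma Dr_bounded:
 assumes "f \<in> carrier Dr" obtains M where "!!x. cmod (f x) \<le> M"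
proof -
 obtain s where s: "s \<in> span_J" "!!x. cmod (f x - s x) < 1" using Dr_approx[OF assms, of 1] by auto
 obtain \<S> c where c: "finite \<S>" "s = (\<lambda>x. \<Sum>S\<in>\<S>. c S * indicator S x)" using s(1) by (auto simp: span_J_def)
 have "cmod (f x) \<le> (\<Sum>S\<in>\<S>. cmod (c S)) + 1" for x
 proof -
  have "cmod (s x) \<le> (\<Sum>S\<in>\<S>. cmod (c S))"
   unfolding c(2) by (rule sum_norm_le) (auto simp: norm_mult indicator_def)
  then show ?thesis using s(2)[of x] norm_triangle_ineq2[of "f x" "s x"] by linarith
 qed
 then show thesis using that by blast
qed

subsection \<open>Limits at boundary points\<close>

text \<open>Points of \<open>P\<close> are identified with characters of \<open>J\<close>; \<open>hat\<close> extends functions in \<open>D_r G P\<close> to the boundary.\<close>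

definition approach :: "('g set => nat) => 'g filter" where
 "approach w = (INF S\<in>J. principal {p. p \<in> S \<longleftrightarrow> w S = 1})"

lemma eventually_approach:
 "eventually Q (approach w) \<longleftrightarrow> (\<exists>\<S>. finite \<S> \<and> \<S> \<subseteq> J \<and> (\<forall>p. (\<forall>S\<in>\<S>. p \<in> S \<longleftrightarrow> w S = 1) --> Q p))"
proof -
 have "eventually Q (INF S\<in>\<S>. principal {p. p \<in> S \<longleftrightarrow> w S = 1}) \<longleftrightarrow> (\<forall>p. (\<forall>S\<in>\<S>. p \<in> S \<longleftrightarrow> w S = 1) --> Q p)"
  if "finite \<S>" for \<S>
  unfolding INF_principal_finite[OF that] eventually_principal by auto
 then show ?thesis unfolding approach_def eventually_INF[of _ _ J] by (metis (no_types, lifting))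
qed

text \<open>Start with a point of an ideal \<open>R\<close> that decides \<open>\<S>\<close> for a
  maximal character. Whenever \<open>p P\<close> meets \<open>g P\<close>, replace \<open>p\<close>
  by a point of the intersection: its right ideal lies in both, it stays in \<open>R\<close>, and
  the alternatives already settled persist under shrinking. The final point lies in
  \<open>Delta G P F\<close>.\<close>

lemma bd_point:
 assumes w: "w \<in> Bd" and \<S>: "finite \<S>" "\<S> \<subseteq> J" and F: "finite F" "F \<subseteq> carrier G"
 obtains p where "p \<in> Delta G P F" "!!S. S \<in> \<S> ==> p \<in> S \<longleftrightarrow> w S = 1"
proof -
 obtain v where v: "v \<in> maximal_chars G P" "\<forall>S\<in>\<S>. v S = w S" using w \<S> unfolding bd_iff by meson
 obtain R where R: "R \<in> J" "v R = 1" "!!S. [|S \<in> \<S>; v S = 1|] ==> R \<subseteq> S" "!!S. [|S \<in> \<S>; v S \<noteq> 1|] ==> R \<inter> S = {}"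
  using maximal_separate[OF v(1) \<S>] by metis
 have "\<exists>p\<in>R. \<forall>g\<in>F. (p <# P) \<inter> (g <# P) = {} \<or> p <# P \<subseteq> g <# P"
  using F
 proof (induction F)
  case empty
  show ?case using char_nonempty[OF maximal_charsD(1)[OF v(1)] R(1,2)] by auto
 next
  case (insert g F)
  then obtain p where p: "p \<in> R" "\<forall>g\<in>F. (p <# P) \<inter> (g <# P) = {} \<or> p <# P \<subseteq> g <# P" by auto
  have pP: "p \<in> P" using p(1) J_subset[OF R(1)] by blast
  show ?case
  proof (cases "(p <# P) \<inter> (g <# P) = {}")
   case True
   then show ?thesis using p by auto
  next
   case False
   then obtain r where r: "r \<in> p <# P" "r \<in> g <# P" by blast
   have rp: "r <# P \<subseteq> p <# P" using J_right_ideal[OF principal_J[OF pP] r(1)] .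
   have "r <# P \<subseteq> g <# P"
   proof
    fix x assume "x \<in> r <# P"
    then obtain y where y: "y \<in> P" "x = r \<otimes> y" by (auto simp: l_coset_def)
    obtain z where z: "z \<in> P" "r = g \<otimes> z" using r(2) by (auto simp: l_coset_def)
    have "g \<in> carrier G" using insert by simp
    then have "x = g \<otimes> (z \<otimes> y)" using y z P_carrier by (simp add: m_assoc)
    then show "x \<in> g <# P" using P_mult[OF z(1) y(1)] by (auto simp: l_coset_def)
   qed
   moreover have "r \<in> R" using r(1) J_right_ideal[OF R(1) p(1)] by blast
   moreover have "\<forall>g\<in>F. (r <# P) \<inter> (g <# P) = {} \<or> r <# P \<subseteq> g <# P"
   proof
    fix g' assume "g' \<in> F"
    then have "(p <# P) \<inter> (g' <# P) = {} \<or> p <# P \<subseteq> g' <# P" using p(2) by blast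
    then show "(r <# P) \<inter> (g' <# P) = {} \<or> r <# P \<subseteq> g' <# P" using rp by blast
   qed
   ultimately show ?thesis by (intro bexI[of _ r]) auto
  qed
 qed
 then obtain p where p: "p \<in> R" "\<forall>g\<in>F. (p <# P) \<inter> (g <# P) = {} \<or> p <# P \<subseteq> g <# P" by blast
 have "p \<in> Delta G P F" unfolding Delta_def using p J_subset[OF R(1)] by auto
 moreover have "p \<in> S \<longleftrightarrow> w S = 1" if S: "S \<in> \<S>" for S
 proof (cases "v S = 1")
  case True
  then show ?thesis using R(3)[OF S] p(1) v(2) S by auto
 next
  case False
  then show ?thesis using R(4)[OF S] p(1) v(2) S by auto
 qed
 ultimately show thesis using that by blast
qed

lemma approach_neq_bot: assumes "w \<in> Bd" shows "approach w \<noteq> bot"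
proof
 assume "approach w = bot"
 then have "eventually (\<lambda>_. False) (approach w)" by simp
 then obtain \<S> where \<S>: "finite \<S>" "\<S> \<subseteq> J" "\<forall>p. \<not> (\<forall>S\<in>\<S>. p \<in> S \<longleftrightarrow> w S = 1)"
  unfolding eventually_approach by auto
 obtain p where "!!S. S \<in> \<S> ==> p \<in> S \<longleftrightarrow> w S = 1" using bd_point[OF assms \<S>(1,2), of "{}"] by auto
 then show False using \<S>(3) by blast
qed

lemma pattern_fun_tendsto:
 assumes "finite \<S>" "\<S> \<subseteq> J" "w \<in> Bd"
 shows "(pattern_fun \<S> h \<longlongrightarrow> h {S \<in> \<S>. w S = 1}) (approach w)"
proof (rule tendsto_eventually)
 \<comment> \<open>Adding \<open>P\<close> to the family forces \<open>p\<close> into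
   \<open>P\<close>, where \<open>pattern_fun\<close> takes its pattern value.\<close>
 have "pattern_fun \<S> h p = h {S \<in> \<S>. w S = 1}" if "\<forall>S\<in>Set.insert P \<S>. p \<in> S \<longleftrightarrow> w S = 1" for p
 proof -
  have "p \<in> P" using that J_hatD(4)[OF bd_J_hat[OF assms(3)]] by simp
  moreover have "{S \<in> \<S>. p \<in> S} = {S \<in> \<S>. w S = 1}" using that by auto
  ultimately show ?thesis by (simp add: pattern_fun_def)
 qed
 moreover have "finite (Set.insert P \<S>)" "Set.insert P \<S> \<subseteq> J" using assms by auto
 ultimately show "eventually (\<lambda>p. pattern_fun \<S> h p = h {S \<in> \<S>. w S = 1}) (approach w)"
  unfolding eventually_approach by blast
qed

definition hat :: "('g => complex) => ('g set => nat) => complex" where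
 "hat f w = (if w \<in> Bd then Lim (approach w) f else 0)"

lemma hat_eqI: "[|w \<in> Bd; (f \<longlongrightarrow> z) (approach w)|] ==> hat f w = z"
 by (simp add: hat_def tendsto_Lim approach_neq_bot)

lemma hat_pattern_fun:
 "[|finite \<S>; \<S> \<subseteq> J; w \<in> Bd|] ==> hat (pattern_fun \<S> h) w = h {S \<in> \<S>. w S = 1}"
 by (intro hat_eqI pattern_fun_tendsto)

lemma tendsto_dist_le:
 assumes w: "w \<in> Bd" and f: "(f \<longlongrightarrow> a) (approach w)" and h: "(h \<longlongrightarrow> b) (approach w)" and le: "!!x. cmod (f x - h x) \<le> e"
 shows "cmod (a - b) \<le> e"
 by (rule tendsto_upperbound[OF tendsto_norm[OF tendsto_diff[OF f h]] _ approach_neq_bot[OF w]]) (simp add: le)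

text \<open>Functions in \<open>span_J\<close> are eventually constant along
  \<open>approach w\<close>. For general \<open>f\<close> the limits of uniformly approximating
  functions from \<open>span_J\<close> form a Cauchy sequence, whose limit is that of
  \<open>f\<close>.\<close>

lemma hat_tendsto:
 assumes f: "f \<in> carrier Dr" and w: "w \<in> Bd"
 shows "(f \<longlongrightarrow> hat f w) (approach w)"
proof -
 define s where "s n = (SOME s. s \<in> span_J \<and> (\<forall>x. cmod (f x - s x) < inverse (real (Suc n))))" for n
 have s: "s n \<in> span_J \<and> (\<forall>x. cmod (f x - s n x) < inverse (real (Suc n)))" for n
 proof -
  obtain s' where "s' \<in> span_J" "!!x. cmod (f x - s' x) < inverse (real (Suc n))"
   using Dr_approx[OF f, of "inverse (real (Suc n))"] by auto
  then have "s' \<in> span_J \<and> (\<forall>x. cmod (f x - s' x) < inverse (real (Suc n)))" by simp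
  then show ?thesis unfolding s_def by (rule someI[of "\<lambda>s. s \<in> span_J \<and> (\<forall>x. cmod (f x - s x) < inverse (real (Suc n)))"])
 qed
 have "\<exists>L. (s n \<longlongrightarrow> L) (approach w)" for n
 proof -
  have "s n \<in> span_J" by (rule conjunct1[OF s])
  then obtain \<S> h where p: "finite \<S>" "\<S> \<subseteq> J" "s n = pattern_fun \<S> h" by (rule span_JE)
  show ?thesis unfolding p(3) by (rule exI, rule pattern_fun_tendsto[OF p(1,2) w])
 qed
 then obtain L where L: "!!n. (s n \<longlongrightarrow> L n) (approach w)" by metis
 have d: "cmod (L m - L n) \<le> inverse (real (Suc m)) + inverse (real (Suc n))" for m n
 proof (rule tendsto_dist_le[OF w L L])
  fix x
  have "cmod (f x - s m x) < inverse (real (Suc m))" "cmod (f x - s n x) < inverse (real (Suc n))" by (simp_all only: conjunct2[OF s, rule_format])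
  then show "cmod (s m x - s n x) \<le> inverse (real (Suc m)) + inverse (real (Suc n))"
   using norm_triangle_ineq4[of "f x - s n x" "f x - s m x"] by simp
 qed
 have "Cauchy L"
 proof (rule metric_CauchyI)
  fix e :: real assume "e > 0"
  then obtain N where N: "inverse (real (Suc N)) < e / 2" using reals_Archimedean[of "e / 2"] by auto
  have "dist (L m) (L n) < e" if "m \<ge> N" "n \<ge> N" for m n
  proof -
   have "inverse (real (Suc m)) \<le> inverse (real (Suc N))" "inverse (real (Suc n)) \<le> inverse (real (Suc N))"
    using that by (auto intro!: le_imp_inverse_le)
   then show ?thesis unfolding dist_norm using d[of m n] N by linarith
  qed
  then show "\<exists>M. \<forall>m\<ge>M. \<forall>n\<ge>M. dist (L m) (L n) < e" by blast
 qed
 then obtain z where z: "L \<longlonglongrightarrow> z" using Cauchy_convergent convergent_def by blast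
 have "(f \<longlongrightarrow> z) (approach w)"
 proof (rule tendstoI)
  fix e :: real assume e: "e > 0"
  have "eventually (\<lambda>n. inverse (real (Suc n)) < e / 3) sequentially"
   using LIMSEQ_inverse_real_of_nat e by (intro order_tendstoD(2)) auto
  moreover have "eventually (\<lambda>n. dist (L n) z < e / 3) sequentially" using e by (intro tendstoD[OF z]) simp
  ultimately have "eventually (\<lambda>n. inverse (real (Suc n)) < e / 3 \<and> dist (L n) z < e / 3) sequentially"
   by (rule eventually_conj)
  from eventually_happens'[OF sequentially_bot this]
  obtain n where n: "inverse (real (Suc n)) < e / 3" "dist (L n) z < e / 3" by auto
  have "eventually (\<lambda>x. dist (s n x) (L n) < e / 3) (approach w)" using e by (intro tendstoD[OF L]) simp
  then show "eventually (\<lambda>x. dist (f x) z < e) (approach w)"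
  proof (rule eventually_mono)
   fix x assume 1: "dist (s n x) (L n) < e / 3"
   have "cmod (f x - s n x) < inverse (real (Suc n))" by (rule conjunct2[OF s, rule_format])
   then have 2: "dist (f x) (s n x) < e / 3" using n(1) by (simp add: dist_norm)
   show "dist (f x) z < e"
    using dist_triangle[of "f x" z "s n x"] dist_triangle[of "s n x" z "L n"] 1 2 n(2) by linarith
  qed
 qed
 then show ?thesis using hat_eqI[OF w] by metis
qed

lemma hat_diff_le:
 assumes "f \<in> carrier Dr" "h \<in> carrier Dr" "!!x. cmod (f x - h x) \<le> e" "w \<in> Bd"
 shows "cmod (hat f w - hat h w) \<le> e"
 by (rule tendsto_dist_le[OF assms(4) hat_tendsto[OF assms(1,4)] hat_tendsto[OF assms(2,4)] assms(3)])

lemma hat_indicator: assumes S: "S \<in> J" shows "hat (indicator S) = ev S"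
proof
 fix w show "hat (indicator S) w = ev S w"
 proof (cases "w \<in> Bd")
  case True
  have "indicator S = pattern_fun {S} (\<lambda>Q. if Q = {} then 0 else 1)"
   using J_subset[OF S] by (auto simp: pattern_fun_def indicator_def fun_eq_iff)
  then have "hat (indicator S) w = (if {R \<in> {S}. w R = 1} = {} then 0 else 1)"
   using hat_pattern_fun[of "{S}" w] S True by simp
  then show ?thesis using J_hatD(1)[OF bd_J_hat[OF True] S] True by (auto simp: ev_def)
 qed (simp add: hat_def ev_def)
qed

lemma hat_C0: assumes f: "f \<in> carrier Dr" shows "hat f \<in> C0_on T (bU \<one>)"
proof (rule C0_onI)
 show "continuous_map T euclidean (hat f)"
 proof (rule continuous_map_complexI)
  fix w and e :: real assume w: "w \<in> topspace T" and e: "e > 0"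
  have B: "w \<in> Bd" using w by (simp add: topspace_T)
  obtain s where s: "s \<in> span_J" "!!x. cmod (f x - s x) < e / 3" using Dr_approx[OF f, of "e / 3"] e by auto
  obtain \<S> h where \<S>: "finite \<S>" "\<S> \<subseteq> J" "s = pattern_fun \<S> h" using s(1) by (rule span_JE)
  have near: "cmod (hat f v - hat s v) \<le> e / 3" if "v \<in> Bd" for v
   by (rule hat_diff_le[OF f span_J_carrier[OF s(1)] _ that]) (use s(2) in \<open>simp add: less_imp_le\<close>)
  let ?V = "{v \<in> Bd. \<forall>S\<in>\<S>. v S = w S}"
  have "cmod (hat f v - hat f w) < e" if v: "v \<in> ?V" for v
  proof -
   have B': "v \<in> Bd" using v by simp
   have "{S \<in> \<S>. v S = 1} = {S \<in> \<S>. w S = 1}" using v by auto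
   then have "hat s v = hat s w" using hat_pattern_fun[OF \<S>(1,2)] B B' \<S>(3) by simp
   then have eq: "hat f v - hat f w = (hat f v - hat s v) - (hat f w - hat s w)" by simp
   show ?thesis
    unfolding eq using norm_triangle_ineq4[of "hat f v - hat s v" "hat f w - hat s w"] near[OF B] near[OF B'] e by linarith
  qed
  then show "\<exists>V. openin T V \<and> w \<in> V \<and> (\<forall>v\<in>V. cmod (hat f v - hat f w) < e)"
   using openin_T_agree[OF \<S>(1,2), of w] B by (intro exI[of _ ?V]) simp
 qed
qed (auto simp: hat_def topspace_T ps.U_one)

lemma Dr_simps: "f \<oplus>\<^bsub>Dr\<^esub> h = (\<lambda>x. f x + h x)" "f \<otimes>\<^bsub>Dr\<^esub> h = (\<lambda>x. f x * h x)" "\<one>\<^bsub>Dr\<^esub> = indicator P"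
  "cscale Dr c f = (\<lambda>x. c * f x)" "adj Dr f = (\<lambda>x. cnj (f x))"
 by (simp_all add: D_r_def)

lemma hat_star_hom: "(\<lambda>f. single \<one> (hat f)) \<in> star_hom Dr B0"
proof (rule star_homI)
 fix f assume f: "f \<in> carrier Dr"
 note tf = hat_tendsto[OF f]
 show "single \<one> (hat f) \<in> carrier B0" by (rule ps.single_carrier[OF one_closed hat_C0[OF f]])
 show "single \<one> (hat (cscale Dr c f)) = cscale B0 c (single \<one> (hat f))" for c
 proof -
  have "hat (cscale Dr c f) w = c * hat f w" for w
   by (cases "w \<in> Bd") (simp add: Dr_simps hat_eqI tendsto_mult_left[OF tf], simp add: hat_def)
  then have "hat (cscale Dr c f) = (\<lambda>w. c * hat f w)" by (rule ext)
  then show ?thesis by (simp add: ps.single_cscale)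
 qed
 show "single \<one> (hat (adj Dr f)) = adj B0 (single \<one> (hat f))"
 proof -
  have "hat (adj Dr f) w = cnj (hat f w)" for w
   by (cases "w \<in> Bd") (simp add: Dr_simps hat_eqI tendsto_cnj[OF tf], simp add: hat_def)
  then have "hat (adj Dr f) = (\<lambda>w. cnj (hat f w))" by (rule ext)
  then show ?thesis by (simp add: ps.adj_single_one[OF hat_C0[OF f]])
 qed
 fix h assume h: "h \<in> carrier Dr"
 note th = hat_tendsto[OF h]
 show "single \<one> (hat (f \<oplus>\<^bsub>Dr\<^esub> h)) = single \<one> (hat f) \<uplus> single \<one> (hat h)"
 proof -
  have "hat (f \<oplus>\<^bsub>Dr\<^esub> h) w = hat f w + hat h w" for w
   by (cases "w \<in> Bd") (simp add: Dr_simps hat_eqI tendsto_add[OF tf th], simp add: hat_def)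
  then have "hat (f \<oplus>\<^bsub>Dr\<^esub> h) = (\<lambda>w. hat f w + hat h w)" by (rule ext)
  then show ?thesis by (simp add: ps.single_one_add)
 qed
 show "single \<one> (hat (f \<otimes>\<^bsub>Dr\<^esub> h)) = single \<one> (hat f) \<star> single \<one> (hat h)"
 proof -
  have "hat (f \<otimes>\<^bsub>Dr\<^esub> h) w = hat f w * hat h w" for w
   by (cases "w \<in> Bd") (simp add: Dr_simps hat_eqI tendsto_mult[OF tf th], simp add: hat_def)
  then have "hat (f \<otimes>\<^bsub>Dr\<^esub> h) = (\<lambda>w. hat f w * hat h w)" by (rule ext)
  then show ?thesis by (simp add: ps.single_one_mult[OF hat_C0[OF f]])
 qed
next
 show "single \<one> (hat \<one>\<^bsub>Dr\<^esub>) = \<one>\<^bsub>B0\<^esub>"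
  by (simp add: Dr_simps hat_indicator ev_P ps.B_one)
qed

text \<open>By \<open>bd_point\<close> there are points arbitrarily close to \<open>w\<close> inside
  \<open>Delta G P F\<close>, where \<open>b\<close> is bounded by the small number
  \<open>mult_opnorm (Delta G P F) b\<close>.\<close>

lemma hat_D_r_o: assumes b: "b \<in> D_r_o G P" shows "hat b = (\<lambda>_. 0)"
proof
 have bD: "b \<in> carrier Dr" and lim: "((\<lambda>F. mult_opnorm (Delta G P F) b) \<longlongrightarrow> 0) (finite_subsets_at_top (carrier G))"
  using b by (auto simp: D_r_o_def)
 obtain M where M: "!!x. cmod (b x) \<le> M" using Dr_bounded[OF bD] by blast
 fix w
 show "hat b w = 0"
 proof (cases "w \<in> Bd")
  case True
  have "cmod (hat b w) \<le> 0 + e" if e: "e > 0" for e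
  proof -
   have e2: "0 < e / 2" using e by simp
   have "eventually (\<lambda>F. mult_opnorm (Delta G P F) b < e / 2) (finite_subsets_at_top (carrier G))"
    using order_tendstoD(2)[OF lim e2] .
   then obtain F where F: "finite F" "F \<subseteq> carrier G" "mult_opnorm (Delta G P F) b < e / 2"
    unfolding eventually_finite_subsets_at_top by blast
   have "eventually (\<lambda>x. dist (b x) (hat b w) < e / 2) (approach w)" using tendstoD[OF hat_tendsto[OF bD True] e2] .
   from this[unfolded eventually_approach]
   obtain \<S> where \<S>: "finite \<S>" "\<S> \<subseteq> J" "\<forall>p. (\<forall>S\<in>\<S>. p \<in> S \<longleftrightarrow> w S = 1) --> dist (b p) (hat b w) < e / 2"
    by (elim exE conjE)
   obtain p where p: "p \<in> Delta G P F" "!!S. S \<in> \<S> ==> p \<in> S \<longleftrightarrow> w S = 1"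
    using bd_point[OF True \<S>(1,2) F(1,2)] by metis
   have "\<forall>S\<in>\<S>. p \<in> S \<longleftrightarrow> w S = 1" using p(2) by simp
   then have "dist (b p) (hat b w) < e / 2" by (rule mp[OF spec[OF \<S>(3)]])
   moreover have "cmod (b p) \<le> mult_opnorm (Delta G P F) b" by (rule cmod_le_mult_opnorm[OF p(1) M])
   ultimately show ?thesis
    using F(3) norm_triangle_ineq3[of "b p" "hat b w"] by (simp add: dist_norm)
  qed
  then have "cmod (hat b w) \<le> 0" by (rule field_le_epsilon)
  then show ?thesis by simp
 qed (simp add: hat_def)
qed

text \<open>A converse to \<open>bd_point\<close>. Each ideal is \<open>P\<close> intersected with
  finitely many cosets, and \<open>F\<close> collects their translating elements. For
  \<open>p\<close> in \<open>Delta G P F\<close> the ideal \<open>p P\<close> lies in each coset or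
  misses it, so any maximal character in \<open>Wset p\<close> sees the same members of
  \<open>\<S>\<close> as \<open>p\<close>.\<close>

lemma Delta_pattern:
 assumes \<S>: "finite \<S>" "\<S> \<subseteq> J"
 obtains F where "finite F" "F \<subseteq> carrier G"
  "!!F' p. [|F \<subseteq> F'; p \<in> Delta G P F'|] ==> \<exists>w\<in>Bd. \<forall>S\<in>\<S>. p \<in> S \<longleftrightarrow> w S = 1"
proof -
 have "\<exists>F. finite F \<and> F \<subseteq> carrier G \<and> S = P \<inter> (\<Inter>g\<in>F. g <# P)" if S: "S \<in> J" for S
 proof -
  obtain a where a: "a \<in> W" "S = K a" using S by (auto simp: cideals_def)
  let ?F = "(\<lambda>i. val (rev (drop (2 * i) a))) ` {..<length a div 2}"
  have "rev (drop (2 * i) a) \<in> W" for i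
  proof (rule W_rev)
   show "drop (2 * i) a \<in> W" using a(1) by (auto simp: pwords_def in_set_dropD)
  qed
  then have "?F \<subseteq> carrier G" by auto
  then show ?thesis using a(2) by (intro exI[of _ ?F]) (simp add: cideal_def)
 qed
 then obtain F where F: "!!S. S \<in> J ==> finite (F S) \<and> F S \<subseteq> carrier G \<and> S = P \<inter> (\<Inter>g\<in>F S. g <# P)" by metis
 let ?F = "\<Union>S\<in>\<S>. F S"
 have "\<exists>w\<in>Bd. \<forall>S\<in>\<S>. p \<in> S \<longleftrightarrow> w S = 1" if F': "?F \<subseteq> F'" and p: "p \<in> Delta G P F'" for F' p
 proof -
  have pP: "p \<in> P" using p by (simp add: Delta_def)
  obtain w where w: "w \<in> maximal_chars G P" "w \<in> Wset p" using Wset_nonempty[OF pP] by blast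
  have \<omega>J: "w \<in> J_hat G P" using w(1) by (rule maximal_charsD)
  have \<omega>p: "w (p <# P) = 1" using w(2) by (simp add: Wset_def)
  have "p \<in> S \<longleftrightarrow> w S = 1" if S: "S \<in> \<S>" for S
  proof
   have SJ: "S \<in> J" using S \<S>(2) by blast
   show "w S = 1" if "p \<in> S"
    by (rule char_mono[OF \<omega>J principal_J[OF pP] SJ \<omega>p J_right_ideal[OF SJ that]])
   show "p \<in> S" if 1: "w S = 1"
   proof (rule ccontr)
    assume "p \<notin> S"
    then obtain g where g: "g \<in> F S" "p \<notin> g <# P" using conjunct2[OF conjunct2[OF F[OF SJ]]] pP by blast
    have "g \<in> F'" using g(1) S F' by blast
    then have "(p <# P) \<inter> (g <# P) = {} \<or> (p <# P) \<inter> (g <# P) = p <# P" using p by (auto simp: Delta_def)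
    moreover have "p \<in> p <# P" using l_coset_self[OF P_carrier[OF pP]] .
    ultimately have "(p <# P) \<inter> (g <# P) = {}" using g(2) by blast
    then have "(p <# P) \<inter> S = {}" using conjunct2[OF conjunct2[OF F[OF SJ]]] g(1) by blast
    moreover have "w ((p <# P) \<inter> S) = 1" using char_inter[OF \<omega>J principal_J[OF pP] SJ] \<omega>p 1 by simp
    ultimately show False using char_nonempty[OF \<omega>J J_inter[OF principal_J[OF pP] SJ]] by simp
   qed
  qed
  then show ?thesis using maximal_bd[OF w(1)] by blast
 qed
 moreover have "finite ?F" "?F \<subseteq> carrier G" using F \<S> by blast+
 ultimately show thesis using that by blast
qed

lemma D_r_oI:
 assumes b: "b \<in> carrier Dr" and F: "finite F" "F \<subseteq> carrier G"
  and zero: "!!F' p. [|F \<subseteq> F'; p \<in> Delta G P F'|] ==> b p = 0"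
 shows "b \<in> D_r_o G P"
proof -
 have "eventually (\<lambda>F'. mult_opnorm (Delta G P F') b = 0) (finite_subsets_at_top (carrier G))"
  unfolding eventually_finite_subsets_at_top
 proof (intro exI[of _ F] conjI allI impI)
  fix F' assume "finite F' \<and> F \<subseteq> F' \<and> F' \<subseteq> carrier G"
  then show "mult_opnorm (Delta G P F') b = 0" using zero[of F'] by (intro mult_opnorm_zero) simp
 qed (use F in auto)
 then show ?thesis using b by (simp add: D_r_o_def tendsto_eventually)
qed

text \<open>Hence, modulo \<open>D_r_o G P\<close>, a function in \<open>span_J\<close> takes only its boundary values.\<close>

lemma span_J_truncate:
 assumes f: "f \<in> span_J" and k: "!!w. w \<in> Bd ==> k (hat f w) = hat f w"
 shows "(\<lambda>x. f x - (if x \<in> P then k (f x) else 0)) \<in> D_r_o G P"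
proof -
 obtain \<S> h where \<S>: "finite \<S>" "\<S> \<subseteq> J" "f = pattern_fun \<S> h" using f by (rule span_JE)
 let ?d = "\<lambda>x. f x + (-1) * (if x \<in> P then k (f x) else 0)"
 have d: "?d \<in> carrier Dr" by (rule span_J_carrier[OF span_J_add[OF f span_J_cmult[OF span_J_map[OF f]]]])
 obtain F where F: "finite F" "F \<subseteq> carrier G"
  "!!F' p. [|F \<subseteq> F'; p \<in> Delta G P F'|] ==> \<exists>w\<in>Bd. \<forall>S\<in>\<S>. p \<in> S \<longleftrightarrow> w S = 1"
  using Delta_pattern[OF \<S>(1,2)] by blast
 have "?d \<in> D_r_o G P"
 proof (rule D_r_oI[OF d F(1,2)])
  fix F' p assume F': "F \<subseteq> F'" "p \<in> Delta G P F'"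
  then obtain w where w: "w \<in> Bd" "\<forall>S\<in>\<S>. p \<in> S \<longleftrightarrow> w S = 1" using F(3) by blast
  have "{S \<in> \<S>. p \<in> S} = {S \<in> \<S>. w S = 1}" using w(2) by auto
  moreover have "p \<in> P" using F'(2) by (simp add: Delta_def)
  ultimately have "f p = hat f w" using hat_pattern_fun[OF \<S>(1,2) w(1)] by (simp add: \<S>(3) pattern_fun_def)
  then show "?d p = 0" using k[OF w(1)] \<open>p \<in> P\<close> by simp
 qed
 then show ?thesis by simp
qed

end


section \<open>The covariance norm\<close>

lemma word_op_hom:
 assumes h: "h \<in> star_hom A B" and A: "star_alg A" and w: "!!p. p \<in> P ==> w p \<in> carrier A" and a: "a \<in> pwords P"
 shows "word_op A w a \<in> carrier A \<and> h (word_op A w a) = word_op B (\<lambda>p. h (w p)) a"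
proof -
 interpret A: star_alg A by (rule A)
 show ?thesis using a
 proof (induction a rule: list_two_step_induct)
  case (step p q a)
  then have pq: "p \<in> P" "q \<in> P" "a \<in> pwords P" by (auto simp: pwords_def)
  note IH = step(1)[OF pq(3)]
  show ?case
   using IH w[OF pq(1)] w[OF pq(2)] by (simp add: star_hom_mult[OF h] star_hom_adj[OF h])
 qed (auto simp: star_hom_one[OF h] pwords_def)
qed

context submonoid_pair
begin

lemma word_op_free: "a \<in> W ==> word_op A0 free_gen a = lmono (wl a)"
proof (induction a rule: list_two_step_induct)
 case (step p q a)
 then show ?case by (simp add: free_gen_eq mono_adj mono_mult star_word_def)
qed (auto simp: free_simps(3))

section \<open>Seminorms of the crossed product are strongly covariant\<close>

context
 fixes q assumes q: "cstar_seminorm B0 q"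
begin

interpretation qh: seminormed_hom A0 "\<lambda>f. q (psi f)" B0 q psi
proof (rule seminormed_hom.intro)
 show "cstar_seminormed A0 (\<lambda>f. q (psi f))"
  by (intro cstar_seminormed.intro cstar_seminormed_axioms.intro A0.star_alg_axioms
    cstar_seminorm_pullback[OF A0.star_alg_axioms psi_star_hom q])
 show "cstar_seminormed B0 q"
  by (intro cstar_seminormed.intro cstar_seminormed_axioms.intro ps.B_star_alg q)
 show "seminormed_hom_axioms A0 (\<lambda>f. q (psi f)) B0 q psi"
  by (rule seminormed_hom_axioms.intro[OF psi_star_hom order_refl])
qed

text \<open>The relations of an isometric representation need to be checked only after applying
  \<open>psi\<close>, that is, among the elements \<open>gen\<close>.\<close>

lemma pullback_incl_eq:
 assumes "f \<in> carrier A0" "h \<in> carrier A0" "psi f = psi h"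
 shows "completion_incl A0 (\<lambda>f. q (psi f)) f = completion_incl A0 (\<lambda>f. q (psi f)) h"
proof -
 have "psi (f \<ominus>\<^bsub>A0\<^esub> h) = \<zero>\<^bsub>B0\<^esub>" using qh.h_diff[OF assms(1,2)] assms qh.h_closed by simp
 then have "q (psi (f \<ominus>\<^bsub>A0\<^esub> h)) = 0" by simp
 then show ?thesis
  using qh.A.nrm_incl_diff[OF assms(1,2)] qh.A.nrm_diff_zero_iff assms(1,2) qh.A.incl_carrier by metis
qed

lemma gen_unitary_pair: "p \<in> P ==> gen [p, p] = \<one>\<^bsub>B0\<^esub>"
proof -
 assume p: "p \<in> P"
 have "K [p, p] = P" using p P_carrier by (auto simp: K_pair)
 moreover have "val [p, p] = \<one>" using p P_carrier by simp
 ultimately show ?thesis using p by (simp add: gen_neutral ev_P ps.B_one)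
qed

lemma gen_mult_pair: assumes p: "p \<in> P" and t: "t \<in> P" shows "gen [\<one>, p \<otimes> t] = gen [\<one>, p, \<one>, t]"
proof -
 note c = P_carrier[OF p] P_carrier[OF t]
 have "K [t, \<one>, p, \<one>] = {x \<in> K [p, \<one>]. inv p \<otimes> x \<in> K [t, \<one>]}"
  using K_append[of "[t, \<one>]" "[p, \<one>]"] p t c by simp
 also have "\<dots> = K [p \<otimes> t, \<one>]"
 proof (rule Set.set_eqI)
  fix x
  show "x \<in> {x \<in> K [p, \<one>]. inv p \<otimes> x \<in> K [t, \<one>]} \<longleftrightarrow> x \<in> K [p \<otimes> t, \<one>]"
  proof (cases "x \<in> carrier G")
   case True
   have "inv (p \<otimes> t) \<otimes> x = inv t \<otimes> (inv p \<otimes> x)" using c True by (simp add: inv_mult_group m_assoc)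
   moreover have "inv p \<otimes> x \<in> P" if "inv t \<otimes> (inv p \<otimes> x) \<in> P"
   proof -
    have "t \<otimes> (inv t \<otimes> (inv p \<otimes> x)) = inv p \<otimes> x" using c True by (simp flip: m_assoc)
    then show ?thesis using P_mult[OF t that] by simp
   qed
   ultimately show ?thesis
    using True c p t by (auto simp: K_principal P_mult mem_l_coset)
  next
   case False
   then show ?thesis using K_subset[of "[p, \<one>]"] K_subset[of "[p \<otimes> t, \<one>]"] P_carrier p t P_mult by auto
  qed
 qed
 finally show ?thesis using c by (simp add: gen_def)
qed

text \<open>Density of the range of \<open>psi\<close> makes the completion of the free algebra for
  the pulled back seminorm isomorphic to the completion of \<open>B0\<close>. The required
  homomorphism is \<open>hat\<close>, followed by the inclusion of functions in degree
  \<open>\<one>\<close> and the inverse of this isomorphism.\<close>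

lemma pullback_strongly_covariant:
 "strongly_covariant G P (completion A0 (\<lambda>f. q (psi f))) (\<lambda>p. completion_incl A0 (\<lambda>f. q (psi f)) (free_gen p))"
proof -
 let ?C = "completion A0 (\<lambda>f. q (psi f))"
 let ?i = "completion_incl A0 (\<lambda>f. q (psi f))"
 let ?\<Phi> = "induced_map B0 q psi"
 note i = qh.A.incl_star_hom
 have gc: "free_gen p \<in> carrier A0" if "p \<in> P" for p using that by (simp add: free_gen_eq)
 have rep: "isometric_rep G P ?C (\<lambda>p. ?i (free_gen p))"
  unfolding isometric_rep_def
 proof (intro conjI ballI)
  fix p assume p: "p \<in> P"
  show "?i (free_gen p) \<in> carrier ?C" using gc[OF p] by simp
  have "adj ?C (?i (free_gen p)) \<otimes>\<^bsub>?C\<^esub> ?i (free_gen p) = ?i (adj A0 (free_gen p) \<otimes>\<^bsub>A0\<^esub> free_gen p)"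
   using gc[OF p] by (simp add: star_hom_mult[OF i] star_hom_adj[OF i])
  also have "adj A0 (free_gen p) \<otimes>\<^bsub>A0\<^esub> free_gen p = lmono (wl [p, p])"
   by (simp add: free_gen_eq mono_adj mono_mult star_word_def)
  also have "?i (lmono (wl [p, p])) = ?i \<one>\<^bsub>A0\<^esub>"
  proof (rule pullback_incl_eq)
   have "psi (lmono (wl [p, p])) = gen [p, p]" unfolding psi_lmono by (rule gen_code_wl) (use p in simp)
   also have "\<dots> = \<one>\<^bsub>B0\<^esub>" by (rule gen_unitary_pair[OF p])
   also have "\<dots> = psi \<one>\<^bsub>A0\<^esub>" by (rule star_hom_one[OF psi_star_hom, symmetric])
   finally show "psi (lmono (wl [p, p])) = psi \<one>\<^bsub>A0\<^esub>" .
  qed (use p in \<open>auto simp: wl_lists\<close>)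
  also have "\<dots> = \<one>\<^bsub>?C\<^esub>" by (rule star_hom_one[OF i])
  finally show "adj ?C (?i (free_gen p)) \<otimes>\<^bsub>?C\<^esub> ?i (free_gen p) = \<one>\<^bsub>?C\<^esub>" .
  fix t assume t: "t \<in> P"
  have "?i (free_gen (p \<otimes> t)) = ?i (free_gen p \<otimes>\<^bsub>A0\<^esub> free_gen t)"
  proof (rule pullback_incl_eq)
   show "psi (free_gen (p \<otimes> t)) = psi (free_gen p \<otimes>\<^bsub>A0\<^esub> free_gen t)"
    using gen_mult_pair[OF p t] by (simp add: free_gen_eq mono_mult psi_lmono)
  qed (use p t gc P_mult in auto)
  then show "?i (free_gen (p \<otimes> t)) = ?i (free_gen p) \<otimes>\<^bsub>?C\<^esub> ?i (free_gen t)"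
   using star_hom_mult[OF i gc[OF p] gc[OF t]] by simp
 next
  have "?i (free_gen \<one>) = ?i \<one>\<^bsub>A0\<^esub>"
   by (rule pullback_incl_eq) (use gen_unitary_pair[OF P_one] star_hom_one[OF psi_star_hom] gc in \<open>auto simp: free_gen_eq psi_lmono\<close>)
  then show "?i (free_gen \<one>) = \<one>\<^bsub>?C\<^esub>" using star_hom_one[OF i] by simp
 qed
 have iso: "?\<Phi> \<in> star_iso ?C qh.B.Co"
 proof (rule qh.induced_star_iso)
  fix b and e :: real assume b: "b \<in> carrier B0" and e: "e > 0"
  obtain f where f: "f \<in> carrier A0" "ps.l1 (b \<minus> psi f) < e" using psi_dense[OF b e] by blast
  have "q (b \<minus> psi f) \<le> ps.l1 (b \<minus> psi f)"
   using ps.cstar_seminorm_le_l1[OF q] b qh.h_closed[OF f(1)] by simp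
  then show "\<exists>a\<in>carrier A0. q (b \<minus> psi a) < e" using f by (intro bexI[of _ f]) auto
 qed simp
 let ?\<Psi> = "inv_into (carrier ?C) ?\<Phi>"
 have isoB: "?\<Psi> \<in> star_hom qh.B.Co ?C"
  using star_iso_inv[OF iso qh.A.Co_star_alg] by (simp add: star_iso_def)
 have inv: "?\<Psi> (?\<Phi> X) = X" if "X \<in> carrier ?C" for X
  by (rule inv_into_f_f[OF _ that]) (use iso in \<open>simp add: star_iso_def bij_betw_def\<close>)
 let ?\<phi> = "?\<Psi> \<circ> (completion_incl B0 q \<circ> (\<lambda>f. single \<one> (hat f)))"
 have \<phi>: "?\<phi> \<in> star_hom Dr ?C"
  by (intro star_hom_comp[OF _ isoB] star_hom_comp[OF _ qh.B.incl_star_hom] hat_star_hom)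
 have "?\<phi> (indicator (K \<alpha>)) = word_op ?C (\<lambda>p. ?i (free_gen p)) \<alpha>" if \<alpha>: "\<alpha> \<in> W" "neutral G \<alpha>" for \<alpha>
 proof -
  have n: "val \<alpha> = \<one>" using \<alpha>(2) by (simp add: neutral_def)
  have m: "lmono (wl \<alpha>) \<in> carrier A0" using wl_lists[OF \<alpha>(1)] by simp
  have "psi (lmono (wl \<alpha>)) = single \<one> (hat (indicator (K \<alpha>)))"
   using \<alpha>(1) by (simp add: psi_lmono gen_code_wl gen_neutral n hat_indicator J_I)
  then have "?\<phi> (indicator (K \<alpha>)) = ?\<Psi> (?\<Phi> (?i (lmono (wl \<alpha>))))"
   using qh.induced_incl[OF m] by simp
  also have "\<dots> = ?i (lmono (wl \<alpha>))" using inv m by simp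
  also have "\<dots> = word_op ?C (\<lambda>p. ?i (free_gen p)) \<alpha>"
   using word_op_hom[where w = free_gen, OF i A0.star_alg_axioms gc \<alpha>(1)] word_op_free[OF \<alpha>(1)] by simp
  finally show ?thesis .
 qed
 moreover have "?\<phi> b = \<zero>\<^bsub>?C\<^esub>" if b: "b \<in> D_r_o G P" for b
 proof -
  have "single \<one> (hat b) = \<zero>\<^bsub>B0\<^esub>" unfolding hat_D_r_o[OF b] by (auto simp: single_def ps.B_simps)
  then show ?thesis
   using star_hom_zero[OF qh.B.incl_star_hom ps.B_star_alg qh.B.Co_star_alg]
    star_hom_zero[OF isoB qh.B.Co_star_alg qh.A.Co_star_alg] by simp
 qed
 ultimately show ?thesis unfolding strongly_covariant_def using rep \<phi> by blast
qed

end

section \<open>Strongly covariant seminorms are bounded by the l1-norm\<close>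

lemma psi_homogeneous:
 assumes f: "f \<in> carrier A0" and g: "!!u. f u \<noteq> 0 ==> val (code u) = g"
 shows "psi f = single g (psi f g)"
proof (intro ext)
 fix h x
 show "psi f h x = single g (psi f g) h x"
 proof (cases "h = g")
  case False
  have "f u * gen (code u) h x = 0" if "u \<in> lsupp f" for u
   using g[of u] that False by (simp add: gen_def single_def)
  then have "psi f h x = 0" by (simp add: psi_def ps.lin_ext_def)
  then show ?thesis using False by (simp add: single_def)
 qed simp
qed

context
 fixes q
 assumes q: "cstar_seminorm A0 q"
  and cov: "strongly_covariant G P (completion A0 q) (\<lambda>p. completion_incl A0 q (free_gen p))"
begin

interpretation qc: cstar_seminormed A0 q
 by (rule cstar_seminormed.intro[OF A0.star_alg_axioms]) (simp add: cstar_seminormed_axioms_def q)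

text \<open>The encoding inserts units into words; they disappear because an isometric
  representation sends \<open>\<one>\<close> to the unit.\<close>

lemma covariant_word:
 assumes "u \<in> lists (P \<times> UNIV)"
 shows "completion_incl A0 q (lmono u) = word_op qc.Co (\<lambda>p. completion_incl A0 q (free_gen p)) (code u)"
 using assms
proof (induction u)
 case Nil
 then show ?case using star_hom_one[OF qc.incl_star_hom] by (simp add: free_simps(3))
next
 case (Cons x u)
 interpret Co: star_alg qc.Co by (rule qc.Co_star_alg)
 obtain p b where x: "x = (p, b)" by (cases x)
 have p: "p \<in> P" and u: "u \<in> lists (P \<times> UNIV)" using Cons x by auto
 have w1: "completion_incl A0 q (free_gen \<one>) = \<one>\<^bsub>qc.Co\<^esub>"
  using cov by (simp add: strongly_covariant_def isometric_rep_def)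
 have gc: "free_gen p \<in> carrier A0" "lmono u \<in> carrier A0" using p u by (simp_all add: free_gen_eq)
 note IH = Cons.IH[symmetric]
 show ?case
 proof (cases b)
  case True
  have "lmono (x # u) = adj A0 (free_gen p) \<otimes>\<^bsub>A0\<^esub> lmono u"
   using True x by (simp add: free_gen_eq mono_adj mono_mult star_word_def)
  then show ?thesis
   using True x gc by (simp add: star_hom_mult[OF qc.incl_star_hom] star_hom_adj[OF qc.incl_star_hom] IH w1)
 next
  case False
  have "lmono (x # u) = free_gen p \<otimes>\<^bsub>A0\<^esub> lmono u"
   using False x by (simp add: free_gen_eq mono_mult)
  then show ?thesis
   using False x gc by (simp add: star_hom_mult[OF qc.incl_star_hom] IH w1)
 qed
qed

text \<open>All words of \<open>f\<close> are neutral, so strong covariance expresses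
  \<open>f\<close> as the image of a function \<open>F\<close> in \<open>span_J\<close> whose
  boundary values are the coefficient of \<open>psi f\<close>. The seminorm is bounded by the sup
  norm of \<open>F\<close>, and truncation modulo \<open>D_r_o G P\<close> leaves only the boundary
  values to be bounded.\<close>

lemma covariant_degree_one:
 assumes f: "f \<in> carrier A0" and n: "!!u. f u \<noteq> 0 ==> val (code u) = \<one>"
 shows "q f \<le> sup_norm T (psi f \<one>)"
proof -
 interpret Co: star_alg qc.Co by (rule qc.Co_star_alg)
 interpret C: cstar_algebra qc.Co by (rule qc.Co_cstar_algebra)
 obtain \<phi> where \<phi>: "\<phi> \<in> star_hom Dr qc.Co"
  and word: "!!a. [|a \<in> W; neutral G a|] ==> \<phi> (indicator (K a)) = word_op qc.Co (\<lambda>p. completion_incl A0 q (free_gen p)) a"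
  and kill: "!!b. b \<in> D_r_o G P ==> \<phi> b = \<zero>\<^bsub>qc.Co\<^esub>"
  using cov unfolding strongly_covariant_def by blast
 note iH = qc.incl_star_hom
 \<comment> \<open>Both conditions must be carried through one induction: \<open>F\<close> need not
   be determined by \<open>psi f\<close>, and the two equations have to concern the same
   \<open>F\<close>.\<close>
 have "\<exists>F\<in>span_J. completion_incl A0 q f = \<phi> F \<and> psi f = single \<one> (hat F)"
  using f
 proof (rule free_induct_supp)
  have z: "(\<lambda>x. 0 * indicator P x) \<in> span_J" by (rule span_J_cmult[OF span_J_indicator[OF P_in_J]])
  have "\<phi> (cscale Dr 0 (indicator P)) = \<zero>\<^bsub>qc.Co\<^esub>"
   using star_hom_cscale[OF \<phi> span_J_carrier[OF span_J_indicator[OF P_in_J]]]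
    star_hom_closed[OF \<phi> span_J_carrier[OF span_J_indicator[OF P_in_J]]] by simp
  moreover have "single \<one> (hat (cscale Dr 0 (indicator P))) = \<zero>\<^bsub>B0\<^esub>"
   using star_hom_cscale[OF hat_star_hom span_J_carrier[OF span_J_indicator[OF P_in_J]]] by (simp add: ps.B_simps)
  ultimately show "\<exists>F\<in>span_J. completion_incl A0 q \<zero>\<^bsub>A0\<^esub> = \<phi> F \<and> psi \<zero>\<^bsub>A0\<^esub> = single \<one> (hat F)"
   using z star_hom_zero[OF iH A0.star_alg_axioms qc.Co_star_alg] star_hom_zero[OF psi_star_hom A0.star_alg_axioms ps.B_star_alg]
   by (intro bexI[OF _ z]) (simp add: Dr_simps)
 next
  fix h c u assume h: "h \<in> carrier A0" and IH: "\<exists>F\<in>span_J. completion_incl A0 q h = \<phi> F \<and> psi h = single \<one> (hat F)"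
   and u: "u \<in> lists (P \<times> UNIV)" "f u \<noteq> 0"
  obtain F where F: "F \<in> span_J" "completion_incl A0 q h = \<phi> F" "psi h = single \<one> (hat F)" using IH by blast
  have cu: "code u \<in> W" "val (code u) = \<one>" using code_W[OF u(1)] n[OF u(2)] by auto
  let ?I = "indicator (K (code u)) :: 'g => complex"
  have I: "?I \<in> span_J" by (rule span_J_indicator[OF J_I[OF cu(1)]])
  have cI: "cscale Dr c ?I \<in> span_J" using span_J_cmult[OF I, of c] by (simp add: Dr_simps)
  have s: "F \<oplus>\<^bsub>Dr\<^esub> cscale Dr c ?I \<in> span_J" using span_J_add[OF F(1) cI] by (simp add: Dr_simps)
  have m: "lmono u \<in> carrier A0" using u by simp
  have il: "completion_incl A0 q (lmono u) = \<phi> ?I"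
   using covariant_word[OF u(1)] word[OF cu(1)] cu(2) by (simp add: neutral_def)
  have pl: "psi (lmono u) = single \<one> (hat ?I)"
   using cu by (simp add: psi_lmono gen_neutral hat_indicator J_I)
  have "completion_incl A0 q (h \<oplus>\<^bsub>A0\<^esub> cscale A0 c (lmono u)) = \<phi> (F \<oplus>\<^bsub>Dr\<^esub> cscale Dr c ?I)"
   unfolding star_hom_add[OF \<phi> span_J_carrier[OF F(1)] span_J_carrier[OF cI]] star_hom_cscale[OF \<phi> span_J_carrier[OF I]]
    star_hom_add[OF iH h A0.cscale_closed[OF m]] star_hom_cscale[OF iH m] F(2) il ..
  moreover have "psi (h \<oplus>\<^bsub>A0\<^esub> cscale A0 c (lmono u)) = single \<one> (hat (F \<oplus>\<^bsub>Dr\<^esub> cscale Dr c ?I))"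
   unfolding star_hom_add[OF hat_star_hom span_J_carrier[OF F(1)] span_J_carrier[OF cI]] star_hom_cscale[OF hat_star_hom span_J_carrier[OF I]]
    star_hom_add[OF psi_star_hom h A0.cscale_closed[OF m]] star_hom_cscale[OF psi_star_hom m] F(3) pl ..
  ultimately show "\<exists>F\<in>span_J. completion_incl A0 q (h \<oplus>\<^bsub>A0\<^esub> cscale A0 c (lmono u)) = \<phi> F \<and>
    psi (h \<oplus>\<^bsub>A0\<^esub> cscale A0 c (lmono u)) = single \<one> (hat F)"
   using s by blast
 qed
 then obtain F where F: "F \<in> span_J" "completion_incl A0 q f = \<phi> F" "psi f = single \<one> (hat F)" by blast
 define N where "N F = nrm qc.Co (\<phi> F)" for F
 have qN: "q f = N F" using qc.nrm_incl[OF f] F(2) by (simp add: N_def)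
 note \<phi>c = star_hom_closed[OF \<phi> span_J_carrier]
 have Nc: "N (\<lambda>x. c * F x) = cmod c * N F" if "F \<in> span_J" for c F
  using star_hom_cscale[OF \<phi> span_J_carrier[OF that], of c] C.q_cscale[OF \<phi>c[OF that]] by (simp add: N_def Dr_simps)
 have N1: "N F \<le> 1" if F: "F \<in> span_J" and le: "!!x. cmod (F x) \<le> 1" for F
 proof (rule function_cstar_seminorm_le[where S = span_J and Y = P and N = N])
  show "N (\<lambda>y. cnj (f y) * f y) = (N f)\<^sup>2" if f: "f \<in> span_J" for f
  proof -
   have af: "adj Dr f \<in> span_J"
   proof -
    have "adj Dr f = (\<lambda>x. if x \<in> P then cnj (f x) else 0)"
    proof
     obtain \<S> h where "f = pattern_fun \<S> h" using f by (rule span_JE)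
     then show "adj Dr f x = (if x \<in> P then cnj (f x) else 0)" for x by (simp add: Dr_simps pattern_fun_def)
    qed
    then show ?thesis using span_J_map[OF f, of cnj] by simp
   qed
   have "\<phi> (adj Dr f \<otimes>\<^bsub>Dr\<^esub> f) = adj qc.Co (\<phi> f) \<otimes>\<^bsub>qc.Co\<^esub> \<phi> f"
    by (simp add: star_hom_mult[OF \<phi> span_J_carrier[OF af] span_J_carrier[OF f]] star_hom_adj[OF \<phi> span_J_carrier[OF f]])
   then show ?thesis using C.q_cstar[OF \<phi>c[OF f]] by (simp add: N_def Dr_simps)
  qed
  show "0 \<le> N f" if "f \<in> span_J" for f using C.q_nonneg[OF \<phi>c[OF that]] by (simp add: N_def)
  show "N (\<lambda>y. (f y + g y) / 2) \<le> (N f + N g) / 2" if fg: "f \<in> span_J" "g \<in> span_J" for f g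
  proof -
   have s: "(\<lambda>x. f x + g x) \<in> span_J" by (rule span_J_add[OF fg])
   have "N (\<lambda>x. f x + g x) \<le> N f + N g"
    using star_hom_add[OF \<phi> span_J_carrier[OF fg(1)] span_J_carrier[OF fg(2)]] C.q_add[OF \<phi>c[OF fg(1)] \<phi>c[OF fg(2)]]
    by (simp add: N_def Dr_simps)
   moreover have "N (\<lambda>y. (1 / 2) * (f y + g y)) = 1 / 2 * N (\<lambda>x. f x + g x)" using Nc[OF s, of "1 / 2"] by simp
   ultimately show ?thesis by simp
  qed
  show "(\<lambda>y. if y \<in> P then k (f y) else 0) \<in> span_J" if "f \<in> span_J" for f k by (rule span_J_map[OF that])
  show "N (indicator P) \<le> 1"
   using star_hom_one[OF \<phi>] C.q_one_le by (simp add: N_def Dr_simps)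
  show "F \<in> span_J" by (rule F)
  show "F y = 0" if "y \<notin> P" for y
  proof -
   obtain \<S> h where "F = pattern_fun \<S> h" using F by (rule span_JE)
   then show ?thesis using that by (simp add: pattern_fun_def)
  qed
 qed (rule le)
 have N2: "N F \<le> 1" if F: "F \<in> span_J" and le: "!!w. cmod (hat F w) \<le> 1" for F
 proof -
  \<comment> \<open>Sends values of modulus above 1 to 0 and fixes the others, hence all boundary
    values of \<open>F\<close>. The truncated function is bounded by 1 everywhere, and the
    difference lies in \<open>D_r_o G P\<close>.\<close>
  define k where "k z = (if cmod z \<le> 1 then z else 0)" for z :: complex
  let ?F = "\<lambda>x. if x \<in> P then k (F x) else 0"
  have F': "?F \<in> span_J" by (rule span_J_map[OF F])
  have o: "(\<lambda>x. F x - ?F x) \<in> D_r_o G P" by (rule span_J_truncate[OF F]) (simp add: k_def le)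
  have oc: "(\<lambda>x. F x - ?F x) \<in> carrier Dr" using o by (simp add: D_r_o_def)
  have "F = ?F \<oplus>\<^bsub>Dr\<^esub> (\<lambda>x. F x - ?F x)" by (simp add: Dr_simps)
  then have "\<phi> F = \<phi> ?F \<oplus>\<^bsub>qc.Co\<^esub> \<phi> (\<lambda>x. F x - ?F x)"
   using star_hom_add[OF \<phi> span_J_carrier[OF F'] oc] by simp
  then have "\<phi> F = \<phi> ?F" unfolding kill[OF o] using \<phi>c[OF F'] by simp
  then have "N F = N ?F" by (simp add: N_def)
  moreover have "N ?F \<le> 1" by (rule N1[OF F']) (simp add: k_def)
  ultimately show ?thesis by simp
 qed
 have hc: "hat F \<in> C0_on T (bU \<one>)" by (rule hat_C0[OF span_J_carrier[OF F(1)]])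
 have "N F \<le> sup_norm T (hat F) + e" if e: "e > 0" for e
 proof -
  define m where "m = sup_norm T (hat F) + e"
  have m: "m > 0" using ps.sup_norm_nonneg[OF C0_onD(1)[OF hc]] e by (simp add: m_def)
  let ?c = "complex_of_real (1 / m)"
  have s: "(\<lambda>x. ?c * F x) \<in> span_J" by (rule span_J_cmult[OF F(1)])
  have "cmod (hat (\<lambda>x. ?c * F x) w) \<le> 1" for w
  proof -
   have "single \<one> (hat (cscale Dr ?c F)) = single \<one> (\<lambda>x. ?c * hat F x)"
    using star_hom_cscale[OF hat_star_hom span_J_carrier[OF F(1)]] by (simp add: ps.single_cscale)
   then have "hat (\<lambda>x. ?c * F x) = (\<lambda>x. ?c * hat F x)" unfolding Dr_simps by (metis single_same)
   then have "cmod (hat (\<lambda>x. ?c * F x) w) = cmod (hat F w) / m" using m by (simp add: norm_mult norm_divide)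
   also have "\<dots> \<le> 1" using ps.C0_upper[OF hc, of w] m e by (simp add: divide_le_eq m_def)
   finally show ?thesis .
  qed
  then have "N (\<lambda>x. ?c * F x) \<le> 1" by (rule N2[OF s])
  then have "cmod ?c * N F \<le> 1" unfolding Nc[OF F(1)] .
  moreover have "cmod ?c = 1 / m" using m by (simp only: norm_of_real) simp
  ultimately show ?thesis using m by (simp add: divide_le_eq flip: m_def)
 qed
 then have "N F \<le> sup_norm T (hat F)" by (rule field_le_epsilon)
 then show ?thesis using qN F(3) by simp
qed

text \<open>The C*-identity reduces to degree \<open>\<one>\<close>: in \<open>f* f\<close> the
  degrees \<open>inv g\<close> and \<open>g\<close> of the factors cancel.\<close>

lemma covariant_homogeneous:
 assumes f: "f \<in> carrier A0" and n: "!!u. f u \<noteq> 0 ==> val (code u) = g" and g: "g \<in> carrier G"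
 shows "q f \<le> sup_norm T (psi f g)"
proof -
 let ?a = "psi f g"
 have pf: "psi f \<in> carrier B0" by (rule star_hom_closed[OF psi_star_hom f])
 have a: "?a \<in> C0_on T (bU g)" using ps.carrier_BD(3)[OF pf g] .
 have ff: "adj A0 f \<otimes>\<^bsub>A0\<^esub> f \<in> carrier A0" using f by simp
 have psi_ff: "psi (adj A0 f \<otimes>\<^bsub>A0\<^esub> f) = single \<one> (ps.sqf g ?a)"
 proof -
  have "psi (adj A0 f \<otimes>\<^bsub>A0\<^esub> f) = adj B0 (psi f) \<star> psi f"
   using f by (simp add: star_hom_mult[OF psi_star_hom] star_hom_adj[OF psi_star_hom])
  also have "\<dots> = adj B0 (single g ?a) \<star> single g ?a"
   using psi_homogeneous[OF f n] by simp
  also have "\<dots> = single \<one> (ps.sqf g ?a)" by (rule ps.adj_single_mult_single[OF g a])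
  finally show ?thesis .
 qed
 have "val (code u) = \<one>" if u: "(adj A0 f \<otimes>\<^bsub>A0\<^esub> f) u \<noteq> 0" for u
 proof -
  have "(\<Sum>i\<le>length u. adj A0 f (take i u) * f (drop i u)) \<noteq> 0" using u by (simp add: free_simps(2))
  then obtain i where i: "adj A0 f (take i u) * f (drop i u) \<noteq> 0" by (meson sum.not_neutral_contains_not_neutral)
  then have 1: "f (star_word (take i u)) \<noteq> 0" "f (drop i u) \<noteq> 0" by (auto simp: free_star_alg_def star_word_def)
  note L = free_carrierD(2)[OF f]
  have l: "star_word (take i u) \<in> lists (P \<times> UNIV)" "drop i u \<in> lists (P \<times> UNIV)" using 1 L by blast+
  have t: "take i u \<in> lists (P \<times> UNIV)" using l(1) star_word_lists by blast
  have "inv (val (code (take i u))) = g"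
   using n[OF 1(1)] val_rev[OF code_W[OF t]] code_star_word[of "take i u"] by simp
  then have "val (code (take i u)) = inv g" using inv_inv[OF val_closed[OF code_W[OF t]]] by simp
  moreover have "code u = code (take i u) @ code (drop i u)" by (simp flip: code_append)
  ultimately show ?thesis
   using val_append[OF code_W[OF t] code_W[OF l(2)]] n[OF 1(2)] g by simp
 qed
 from covariant_degree_one[OF ff this] have "q (adj A0 f \<otimes>\<^bsub>A0\<^esub> f) \<le> sup_norm T (ps.sqf g ?a)" by (simp add: psi_ff)
 also have "\<dots> \<le> (sup_norm T ?a)\<^sup>2" by (rule ps.sup_norm_least) (rule ps.sqf_le[OF g a])
 finally have "(q f)\<^sup>2 \<le> (sup_norm T ?a)\<^sup>2" using qc.q_cstar[OF f] by simp
 then show ?thesis by (rule power2_le_imp_le) (rule ps.sup_norm_nonneg[OF C0_onD(1)[OF a]])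
qed

lemma covariant_le_l1:
 assumes f: "f \<in> carrier A0" shows "q f \<le> ps.l1 (psi f)"
proof -
 \<comment> \<open>The part of \<open>f\<close> with degree in \<open>D\<close>. Splitting happens
   in the free algebra, by the values of the encoded words, before a seminorm is applied.\<close>
 define part where "part D = (\<lambda>u. if val (code u) \<in> D then f u else 0)" for D
 have pc: "part D \<in> carrier A0" for D
  by (rule free_carrierI[OF free_carrierD[OF f]]) (auto simp: part_def)
 have psi_part: "psi (part {g}) g = psi f g" for g
 proof -
  have sub: "lsupp (part {g}) \<subseteq> lsupp f" by (auto simp: part_def split: if_splits)
  have "psi (part {g}) g x = psi f g x" for x
  proof -
   have "psi (part {g}) g x = (\<Sum>u\<in>lsupp f. part {g} u * gen (code u) g x)"
    using ps.lin_ext_eq[OF free_carrierD(1)[OF f] sub, of "gen \<circ> code"] by (simp add: psi_def)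
   also have "\<dots> = psi f g x"
    unfolding psi_def ps.lin_ext_def by (intro sum.cong refl) (auto simp: part_def gen_def single_def)
   finally show ?thesis .
  qed
  then show ?thesis by (rule ext)
 qed
 let ?F = "(\<lambda>u. val (code u)) ` lsupp f"
 have F: "finite ?F" "?F \<subseteq> carrier G"
  using free_carrierD(1)[OF f] by simp (use subsetD[OF free_carrierD(2)[OF f]] val_closed[OF code_W] in blast)
 have "q (part D) \<le> (\<Sum>g\<in>D. sup_norm T (psi f g))" if "finite D" "D \<subseteq> carrier G" for D
  using that
 proof (induction D)
  case empty
  have "part {} = \<zero>\<^bsub>A0\<^esub>" by (simp add: part_def free_simps(4))
  then show ?case using qc.q_zero by simp
 next
  case (insert g D)
  have gc: "g \<in> carrier G" using insert by simp
  have "part (Set.insert g D) = part {g} \<oplus>\<^bsub>A0\<^esub> part D" 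
   by (rule ext) (use insert(2) in \<open>simp add: part_def free_simps(5)\<close>)
  then have "q (part (Set.insert g D)) \<le> q (part {g}) + q (part D)" using qc.q_add[OF pc pc] by simp
  moreover have "q (part {g}) \<le> sup_norm T (psi f g)"
  proof -
   have "val (code u) = g" if "part {g} u \<noteq> 0" for u using that by (simp add: part_def split: if_splits)
   from covariant_homogeneous[OF pc[of "{g}"] this gc] show ?thesis by (simp add: psi_part)
  qed
  moreover have "q (part D) \<le> (\<Sum>g\<in>D. sup_norm T (psi f g))" using insert by simp
  ultimately show ?case using insert(1,2) by simp
 qed
 from this[OF F] have "q (part ?F) \<le> (\<Sum>g\<in>?F. sup_norm T (psi f g))" .
 moreover have "part ?F = f"
 proof
  show "part ?F u = f u" for u by (cases "f u = 0") (auto simp: part_def)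
 qed
 moreover have "supp (psi f) \<subseteq> ?F"
 proof
  fix g assume "g \<in> supp (psi f)"
  then obtain x where "psi f g x \<noteq> 0" by (auto simp: fun_eq_iff)
  then have "(\<Sum>u\<in>lsupp f. f u * gen (code u) g x) \<noteq> 0" by (simp add: psi_def ps.lin_ext_def)
  then obtain u where "u \<in> lsupp f" "f u * gen (code u) g x \<noteq> 0" by (meson sum.not_neutral_contains_not_neutral)
  then show "g \<in> ?F" by (auto simp: gen_def single_def split: if_splits)
 qed
 ultimately show ?thesis using ps.l1_eq[OF F(1)] by simp
qed

end

end


section \<open>From the l1 bound to the isomorphism of the covariance algebra\<close>

context partial_system
begin

lemma l1_diff_swap: assumes "a \<in> carrier B" "b \<in> carrier B" shows "l1 (a \<minus> b) \<le> l1 (b \<minus> a)"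
proof -
 have "a \<minus> b = cscale B (-1) (b \<minus> a)" using assms by (simp add: B.cscale_m1 B.diff_swap)
 then show ?thesis using l1_cscale[of "b \<minus> a" "-1"] assms by simp
qed

lemma l1_triangle:
 assumes "a \<in> carrier B" "b \<in> carrier B" "c \<in> carrier B"
 shows "l1 (a \<minus> c) \<le> l1 (a \<minus> b) + l1 (b \<minus> c)"
 using l1_add[of "a \<minus> b" "b \<minus> c"] B.diff_telescope[OF assms] assms by simp

lemma l1_tendsto_0:
 assumes "!!n. s n \<in> carrier B" "!!n. l1 (s n) \<le> g n" "g \<longlonglongrightarrow> 0"
 shows "(\<lambda>n. l1 (s n)) \<longlonglongrightarrow> 0"
 by (rule Lim_null_comparison[OF _ assms(3)]) (use assms(1,2) l1_nonneg in simp)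

end

context submonoid_pair
begin

text \<open>Preimages are not unique and need not exist, so an element of \<open>B0\<close> is
  represented by sequences in the free algebra whose images converge to it in the l1-norm, in which
  the algebraic operations are continuous.\<close>

definition appr :: "('g => ('g set => nat) => complex) => (nat => ('g \<times> bool) list => complex) => bool" where
 "appr b t \<longleftrightarrow> (\<forall>n. t n \<in> carrier A0) \<and> (\<lambda>n. ps.l1 (b \<minus> psi (t n))) \<longlonglongrightarrow> 0"

lemma apprD: "appr b t ==> t n \<in> carrier A0" "appr b t ==> (\<lambda>n. ps.l1 (b \<minus> psi (t n))) \<longlonglongrightarrow> 0"
 by (simp_all add: appr_def)

lemma psi_closed [simp]: "f \<in> carrier A0 ==> psi f \<in> carrier B0"
 by (rule star_hom_closed[OF psi_star_hom])

lemma appr_exists: assumes b: "b \<in> carrier B0" shows "\<exists>t. appr b t"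
proof -
 define t where "t n = (SOME f. f \<in> carrier A0 \<and> ps.l1 (b \<minus> psi f) < inverse (real (Suc n)))" for n
 have t: "t n \<in> carrier A0 \<and> ps.l1 (b \<minus> psi (t n)) < inverse (real (Suc n))" for n
 proof -
  have "inverse (real (Suc n)) > 0" by simp
  from psi_dense[OF b this] obtain f where "f \<in> carrier A0 \<and> ps.l1 (b \<minus> psi f) < inverse (real (Suc n))" by metis
  then show ?thesis unfolding t_def by (rule someI[of "\<lambda>f. f \<in> carrier A0 \<and> ps.l1 (b \<minus> psi f) < inverse (real (Suc n))"])
 qed
 note tc = conjunct1[OF t]
 have "(\<lambda>n. ps.l1 (b \<minus> psi (t n))) \<longlonglongrightarrow> 0"
 proof (rule ps.l1_tendsto_0[OF _ _ LIMSEQ_inverse_real_of_nat])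
  show "b \<minus> psi (t n) \<in> carrier B0" for n using b tc by simp
  show "ps.l1 (b \<minus> psi (t n)) \<le> inverse (real (Suc n))" for n by (rule less_imp_le[OF conjunct2[OF t]])
 qed
 then show ?thesis using tc by (intro exI[of _ t]) (simp add: appr_def)
qed

lemma appr_const: assumes f: "f \<in> carrier A0" shows "appr (psi f) (\<lambda>_. f)"
 using f by (simp add: appr_def ps.B.diff_self del: ps.B_simps)

lemma appr_add:
 assumes b: "b \<in> carrier B0" "appr b s" and c: "c \<in> carrier B0" "appr c t"
 shows "appr (b \<uplus> c) (\<lambda>n. s n \<oplus>\<^bsub>A0\<^esub> t n)"
proof -
 note s = apprD(1)[OF b(2)] and t = apprD(1)[OF c(2)]
 have "(\<lambda>n. ps.l1 ((b \<uplus> c) \<minus> psi (s n \<oplus>\<^bsub>A0\<^esub> t n))) \<longlonglongrightarrow> 0"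
 proof (rule ps.l1_tendsto_0)
  show "(b \<uplus> c) \<minus> psi (s n \<oplus>\<^bsub>A0\<^esub> t n) \<in> carrier B0" for n using b c s[of n] t[of n] by simp
  show "ps.l1 ((b \<uplus> c) \<minus> psi (s n \<oplus>\<^bsub>A0\<^esub> t n)) \<le> ps.l1 (b \<minus> psi (s n)) + ps.l1 (c \<minus> psi (t n))" for n
   unfolding star_hom_add[OF psi_star_hom s t] ps.B.add_diff_add[OF b(1) c(1) psi_closed[OF s] psi_closed[OF t]]
   by (rule ps.l1_add) (use b c s t in simp_all)
  show "(\<lambda>n. ps.l1 (b \<minus> psi (s n)) + ps.l1 (c \<minus> psi (t n))) \<longlonglongrightarrow> 0"
   using tendsto_add[OF apprD(2)[OF b(2)] apprD(2)[OF c(2)]] by simp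
 qed
 then show ?thesis using s t by (simp add: appr_def)
qed

lemma appr_cscale:
 assumes b: "b \<in> carrier B0" "appr b s" shows "appr (cscale B0 c b) (\<lambda>n. cscale A0 c (s n))"
proof -
 note s = apprD(1)[OF b(2)]
 have "(\<lambda>n. ps.l1 (cscale B0 c b \<minus> psi (cscale A0 c (s n)))) \<longlonglongrightarrow> 0"
 proof (rule ps.l1_tendsto_0)
  show "cscale B0 c b \<minus> psi (cscale A0 c (s n)) \<in> carrier B0" for n using b s[of n] by simp
  show "ps.l1 (cscale B0 c b \<minus> psi (cscale A0 c (s n))) \<le> cmod c * ps.l1 (b \<minus> psi (s n))" for n
   unfolding star_hom_cscale[OF psi_star_hom s] ps.B.cscale_diff_right[OF b(1) psi_closed[OF s], symmetric]
   by (rule ps.l1_cscale) (use b s in simp)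
  show "(\<lambda>n. cmod c * ps.l1 (b \<minus> psi (s n))) \<longlonglongrightarrow> 0"
   using tendsto_mult_left[OF apprD(2)[OF b(2)], of "cmod c"] by simp
 qed
 then show ?thesis using s by (simp add: appr_def)
qed

lemma appr_adj:
 assumes b: "b \<in> carrier B0" "appr b s" shows "appr (adj B0 b) (\<lambda>n. adj A0 (s n))"
proof -
 note s = apprD(1)[OF b(2)]
 have "(\<lambda>n. ps.l1 (adj B0 b \<minus> psi (adj A0 (s n)))) \<longlonglongrightarrow> 0"
 proof (rule ps.l1_tendsto_0[OF _ _ apprD(2)[OF b(2)]])
  show "adj B0 b \<minus> psi (adj A0 (s n)) \<in> carrier B0" for n using b s[of n] by simp
  show "ps.l1 (adj B0 b \<minus> psi (adj A0 (s n))) \<le> ps.l1 (b \<minus> psi (s n))" for n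
   unfolding star_hom_adj[OF psi_star_hom s] ps.B.adj_diff[OF b(1) psi_closed[OF s], symmetric]
   by (rule ps.l1_adj) (use b s in simp)
 qed
 then show ?thesis using s by (simp add: appr_def)
qed

lemma appr_mult:
 assumes b: "b \<in> carrier B0" "appr b s" and c: "c \<in> carrier B0" "appr c t"
 shows "appr (b \<star> c) (\<lambda>n. s n \<otimes>\<^bsub>A0\<^esub> t n)"
proof -
 note s = apprD(1)[OF b(2)] and t = apprD(1)[OF c(2)]
 let ?u = "\<lambda>n. ps.l1 (b \<minus> psi (s n))" and ?v = "\<lambda>n. ps.l1 (c \<minus> psi (t n))"
 have "(\<lambda>n. ps.l1 ((b \<star> c) \<minus> psi (s n \<otimes>\<^bsub>A0\<^esub> t n))) \<longlonglongrightarrow> 0"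
 proof (rule ps.l1_tendsto_0)
  fix n
  note x = psi_closed[OF s[of n]] and y = psi_closed[OF t[of n]]
  show "(b \<star> c) \<minus> psi (s n \<otimes>\<^bsub>A0\<^esub> t n) \<in> carrier B0" using b c s[of n] t[of n] by simp
  have d: "b \<minus> psi (s n) \<in> carrier B0" "c \<minus> psi (t n) \<in> carrier B0" using b c x y by simp_all
  have "ps.l1 (psi (s n)) \<le> ps.l1 b + ?u n"
  proof -
   have "ps.l1 (psi (s n) \<minus> \<zero>\<^bsub>B0\<^esub>) \<le> ps.l1 (psi (s n) \<minus> b) + ps.l1 (b \<minus> \<zero>\<^bsub>B0\<^esub>)"
    by (rule ps.l1_triangle[OF x b(1) ps.B.zero_closed])
   then have "ps.l1 (psi (s n)) \<le> ps.l1 b + ps.l1 (psi (s n) \<minus> b)"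
    unfolding ps.B.diff_zero[OF x] ps.B.diff_zero[OF b(1)] by simp
   then show ?thesis using ps.l1_diff_swap[OF x b(1)] by simp
  qed
  then have "ps.l1 (psi (s n)) * ?v n \<le> (ps.l1 b + ?u n) * ?v n"
   by (rule mult_right_mono) (rule ps.l1_nonneg[OF d(2)])
  moreover have "ps.l1 ((b \<star> c) \<minus> psi (s n \<otimes>\<^bsub>A0\<^esub> t n))
    \<le> ps.l1 ((b \<minus> psi (s n)) \<star> c) + ps.l1 (psi (s n) \<star> (c \<minus> psi (t n)))"
   unfolding star_hom_mult[OF psi_star_hom s t] ps.B.mult_diff_mult[OF b(1) c(1) x y]
   by (rule ps.l1_add) (use c x d in simp_all)
  moreover have "ps.l1 ((b \<minus> psi (s n)) \<star> c) \<le> ?u n * ps.l1 c" by (rule ps.l1_mult[OF d(1) c(1)])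
  moreover have "ps.l1 (psi (s n) \<star> (c \<minus> psi (t n))) \<le> ps.l1 (psi (s n)) * ?v n" by (rule ps.l1_mult[OF x d(2)])
  ultimately show "ps.l1 ((b \<star> c) \<minus> psi (s n \<otimes>\<^bsub>A0\<^esub> t n)) \<le> ?u n * ps.l1 c + (ps.l1 b + ?u n) * ?v n"
   by linarith
 next
  have "(\<lambda>n. ?u n * ps.l1 c + (ps.l1 b + ?u n) * ?v n) \<longlonglongrightarrow> 0 * ps.l1 c + (ps.l1 b + 0) * 0"
   by (intro tendsto_intros apprD(2)[OF b(2)] apprD(2)[OF c(2)])
  then show "(\<lambda>n. ?u n * ps.l1 c + (ps.l1 b + ?u n) * ?v n) \<longlonglongrightarrow> 0" by simp
 qed
 then show ?thesis using s t by (simp add: appr_def)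
qed

text \<open>A \<open>C\<^sup>*\<close>-seminorm on \<open>A0\<close> that is \<open>l1\<close>-bounded along \<open>psi\<close> extends from the dense image of \<open>psi\<close>
 to \<open>B0\<close>.\<close>

lemma le_full_norm:
 assumes q: "cstar_seminorm A0 q" and le: "!!f. f \<in> carrier A0 ==> q f \<le> ps.l1 (psi f)" and f: "f \<in> carrier A0"
 shows "q f \<le> full_norm G T bU b\<theta> (psi f)"
proof -
 interpret qc: cstar_seminormed A0 q
  by (rule cstar_seminormed.intro[OF A0.star_alg_axioms]) (simp add: cstar_seminormed_axioms_def q)
 have le2: "q (x \<ominus>\<^bsub>A0\<^esub> y) \<le> ps.l1 (b \<minus> psi x) + ps.l1 (b \<minus> psi y)"
  if "b \<in> carrier B0" "x \<in> carrier A0" "y \<in> carrier A0" for b x y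
 proof -
  have "q (x \<ominus>\<^bsub>A0\<^esub> y) \<le> ps.l1 (psi x \<minus> psi y)"
   using le[of "x \<ominus>\<^bsub>A0\<^esub> y"] star_hom_diff[OF psi_star_hom A0.star_alg_axioms ps.B_star_alg that(2,3)] that by simp
  then show ?thesis
   using ps.l1_triangle[OF psi_closed[OF that(2)] that(1) psi_closed[OF that(3)]]
    ps.l1_diff_swap[OF psi_closed[OF that(2)] that(1)] by linarith
 qed
 have CS: "t \<in> qc.CS" if b: "b \<in> carrier B0" and t: "appr b t" for b t
 proof (rule qc.CS_I)
  show "t n \<in> carrier A0" for n by (rule apprD(1)[OF t])
  fix e :: real assume "e > 0"
  then have "0 < e / 2" by simp
  from order_tendstoD(2)[OF apprD(2)[OF t] this] obtain N where N: "\<forall>n\<ge>N. ps.l1 (b \<minus> psi (t n)) < e / 2"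
   unfolding eventually_sequentially by blast
  have "q (t m \<ominus>\<^bsub>A0\<^esub> t n) < e" if "m \<ge> N" "n \<ge> N" for m n
  proof -
   have "ps.l1 (b \<minus> psi (t m)) < e / 2" "ps.l1 (b \<minus> psi (t n)) < e / 2" using N that by simp_all
   then show ?thesis using le2[OF b apprD(1)[OF t] apprD(1)[OF t], of m n] by linarith
  qed
  then show "\<exists>N. \<forall>m\<ge>N. \<forall>n\<ge>N. q (t m \<ominus>\<^bsub>A0\<^esub> t n) < e" by blast
 qed
 \<comment> \<open>Independence of the approximating sequence makes the extension
   \<open>\<Theta>\<close> well defined and compatible with sums, products and adjoints.\<close>
 have unique: "qc.cls s = qc.cls t" if b: "b \<in> carrier B0" and s: "appr b s" and t: "appr b t" for b s t
 proof -
  have "(\<lambda>n. q (s n \<ominus>\<^bsub>A0\<^esub> t n)) \<longlonglongrightarrow> 0"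
  proof (rule qc.q_tendsto_0_le)
   show "s n \<ominus>\<^bsub>A0\<^esub> t n \<in> carrier A0" for n using apprD(1)[OF s] apprD(1)[OF t] by simp
   show "q (s n \<ominus>\<^bsub>A0\<^esub> t n) \<le> ps.l1 (b \<minus> psi (s n)) + ps.l1 (b \<minus> psi (t n))" for n
    by (rule le2[OF b apprD(1)[OF s] apprD(1)[OF t]])
   show "(\<lambda>n. ps.l1 (b \<minus> psi (s n)) + ps.l1 (b \<minus> psi (t n))) \<longlonglongrightarrow> 0"
    using tendsto_add[OF apprD(2)[OF s] apprD(2)[OF t]] by simp
  qed
  then show ?thesis using qc.cls_eq_iff[OF CS[OF b s] CS[OF b t]] by simp
 qed
 define \<Theta> where "\<Theta> b = qc.cls (SOME t. appr b t)" for b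
 have some: "appr b (SOME t. appr b t)" if "b \<in> carrier B0" for b by (rule someI_ex[OF appr_exists[OF that]])
 have \<Theta>: "\<Theta> b = qc.cls t" if "b \<in> carrier B0" "appr b t" for b t
  unfolding \<Theta>_def by (rule unique[OF that(1) some[OF that(1)] that(2)])
 have \<Theta>_psi: "\<Theta> (psi h) = completion_incl A0 q h" if "h \<in> carrier A0" for h
  using \<Theta>[OF psi_closed[OF that] appr_const[OF that]] by (simp add: qc.incl_eq)
 have "\<Theta> \<in> star_hom B0 qc.Co"
 proof (rule star_homI)
  fix b assume b: "b \<in> carrier B0"
  note sb = some[OF b]
  show "\<Theta> b \<in> carrier qc.Co" unfolding \<Theta>_def by (rule qc.cls_carrier[OF CS[OF b sb]])
  show "\<Theta> (cscale B0 c b) = cscale qc.Co c (\<Theta> b)" for c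
   using \<Theta>[OF _ appr_cscale[OF b sb]] \<Theta>[OF b sb] b by (simp add: qc.Co_cscale[OF CS[OF b sb]])
  show "\<Theta> (adj B0 b) = adj qc.Co (\<Theta> b)"
   using \<Theta>[OF _ appr_adj[OF b sb]] \<Theta>[OF b sb] b by (simp add: qc.Co_adj[OF CS[OF b sb]])
  fix c assume c: "c \<in> carrier B0"
  note sc = some[OF c]
  show "\<Theta> (b \<uplus> c) = \<Theta> b \<oplus>\<^bsub>qc.Co\<^esub> \<Theta> c"
   using \<Theta>[OF _ appr_add[OF b sb c sc]] \<Theta>[OF b sb] \<Theta>[OF c sc] b c by (simp add: qc.Co_add[OF CS[OF b sb] CS[OF c sc]])
  show "\<Theta> (b \<star> c) = \<Theta> b \<otimes>\<^bsub>qc.Co\<^esub> \<Theta> c"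
   using \<Theta>[OF _ appr_mult[OF b sb c sc]] \<Theta>[OF b sb] \<Theta>[OF c sc] b c by (simp add: qc.Co_mult[OF CS[OF b sb] CS[OF c sc]])
 next
  show "\<Theta> \<one>\<^bsub>B0\<^esub> = \<one>\<^bsub>qc.Co\<^esub>"
   using \<Theta>_psi[OF A0.one_closed] star_hom_one[OF psi_star_hom] star_hom_one[OF qc.incl_star_hom] by simp
 qed
 \<comment> \<open>The norm of the completion, pulled back along \<open>\<Theta>\<close>, is one of
   the seminorms over which \<open>fnorm\<close> is the supremum.\<close>
 then have "cstar_seminorm B0 (\<lambda>b. nrm qc.Co (\<Theta> b))"
  by (rule cstar_seminorm_pullback[OF ps.B_star_alg _ qc.Co_cstar_seminorm])
 from ps.full_norm_upper[OF this psi_closed[OF f]] show ?thesis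
  unfolding \<Theta>_psi[OF f] qc.nrm_incl[OF f] .
qed

abbreviation "fnorm \<equiv> full_norm G T bU b\<theta>"

text \<open>Each strongly covariant seminorm is bounded by \<open>fnorm\<close> along
  \<open>psi\<close>, and each C*-seminorm of \<open>B0\<close> pulls back to a strongly covariant
  one; so the two suprema agree.\<close>

lemma covariance_norm_eq:
 assumes f: "f \<in> carrier A0" shows "covariance_norm G P f = fnorm (psi f)"
proof -
 define CV where "CV = {q. cstar_seminorm A0 q \<and>
   strongly_covariant G P (completion A0 q) (\<lambda>p. completion_incl A0 q (free_gen p))}"
 have le: "q f \<le> fnorm (psi f)" if "q \<in> CV" for q
  by (rule le_full_norm[OF _ _ f]) (use that covariant_le_l1 in \<open>auto simp: CV_def\<close>)
 have mem: "(\<lambda>f. q (psi f)) \<in> CV" if "cstar_seminorm B0 q" for q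
  using cstar_seminorm_pullback[OF A0.star_alg_axioms psi_star_hom that] pullback_strongly_covariant[OF that] by (simp add: CV_def)
 have ne: "CV \<noteq> {}" using mem[OF ps.cstar_seminorm_zero] by blast
 have eq: "covariance_norm G P f = (SUP q\<in>CV. q f)" by (simp add: covariance_norm_def CV_def)
 have "(SUP q\<in>CV. q f) \<le> fnorm (psi f)" by (rule cSUP_least[OF ne le])
 moreover have "fnorm (psi f) \<le> (SUP q\<in>CV. q f)"
  unfolding full_norm_def
 proof (rule cSUP_least)
  show "{q. cstar_seminorm B0 q} \<noteq> {}" using ps.cstar_seminorm_zero by blast
  fix q assume "q \<in> {q. cstar_seminorm B0 q}"
  then have m: "(\<lambda>f. q (psi f)) \<in> CV" using mem by simp
  have "bdd_above ((\<lambda>q. q f) ` CV)" using le by (rule bdd_aboveI2)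
  from cSUP_upper[OF m this] show "q (psi f) \<le> (SUP q\<in>CV. q f)" .
 qed
 ultimately show ?thesis using eq by simp
qed

text \<open>Needed because \<open>covariance_norm\<close> is identified only on the carrier of the
  free algebra.\<close>

lemma cstar_seminorm_cong:
 assumes "star_alg A" "!!a. a \<in> carrier A ==> q a = q' a" "cstar_seminorm A q'"
 shows "cstar_seminorm A q"
proof -
 interpret A: cstar_seminormed A q' using assms by (simp add: cstar_seminormed_def cstar_seminormed_axioms_def)
 show ?thesis
  by (rule cstar_seminormI) (use assms(2) A.q_nonneg A.q_cscale A.q_add A.q_mult A.q_cstar in simp_all)
qed

lemma covariance_seminorm: "cstar_seminorm A0 (covariance_norm G P)"
 by (rule cstar_seminorm_cong[OF A0.star_alg_axioms covariance_norm_eq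
   cstar_seminorm_pullback[OF A0.star_alg_axioms psi_star_hom ps.full_norm_cstar_seminorm]])

sublocale cv: seminormed_hom A0 "covariance_norm G P" B0 fnorm psi
proof (rule seminormed_hom.intro)
 show "cstar_seminormed A0 (covariance_norm G P)"
  by (intro cstar_seminormed.intro cstar_seminormed_axioms.intro A0.star_alg_axioms covariance_seminorm)
 show "cstar_seminormed B0 fnorm"
  by (intro cstar_seminormed.intro cstar_seminormed_axioms.intro ps.B_star_alg ps.full_norm_cstar_seminorm)
 show "seminormed_hom_axioms A0 (covariance_norm G P) B0 fnorm psi"
  by (rule seminormed_hom_axioms.intro[OF psi_star_hom]) (simp add: covariance_norm_eq)
qed

text \<open>The isomorphism induced by \<open>psi\<close> witnesses that the choice in the
  definition is possible. Only the isomorphism property of the chosen map is recorded.\<close>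

lemma covariance_iso:
 "covariance_iso G P \<in> star_iso (covariance_algebra G P) (bd_full_crossed G P)"
proof -
 let ?\<Phi> = "induced_map B0 fnorm psi"
 have "?\<Phi> \<in> star_iso cv.A.Co cv.B.Co"
 proof (rule cv.induced_star_iso)
  show "fnorm (psi a) = covariance_norm G P a" if "a \<in> carrier A0" for a using covariance_norm_eq[OF that] by simp
  fix b and e :: real assume b: "b \<in> carrier B0" and e: "e > 0"
  obtain f where f: "f \<in> carrier A0" "ps.l1 (b \<minus> psi f) < e" using psi_dense[OF b e] by metis
  have "fnorm (b \<minus> psi f) \<le> ps.l1 (b \<minus> psi f)"
   by (rule ps.full_norm_le_l1) (use b f(1) in simp)
  then show "\<exists>a\<in>carrier A0. fnorm (b \<minus> psi a) < e" using f by (intro bexI[of _ f]) auto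
 qed
 moreover have "?\<Phi> (covariance_gen G P p) = completion_incl B0 fnorm (crossed_gen G P p)" if "p \<in> P" for p
  unfolding covariance_gen_def using cv.induced_incl[of "free_gen p"] that psi_free_gen[OF that] by (simp add: free_gen_eq)
 ultimately have "\<exists>\<Phi>. \<Phi> \<in> star_iso (covariance_algebra G P) (bd_full_crossed G P) \<and>
   (\<forall>p\<in>P. \<Phi> (covariance_gen G P p) = completion_incl B0 fnorm (crossed_gen G P p))"
  unfolding covariance_algebra_def full_crossed_def by (intro exI[of _ ?\<Phi>]) simp
 from someI_ex[OF this] show ?thesis unfolding covariance_iso_def by (rule conjunct1)
qed

end


section \<open>Ideals of the covariance algebra\<close>

context submonoid_pair
begin

abbreviation "CA \<equiv> covariance_algebra G P"
abbreviation "CX \<equiv> bd_full_crossed G P"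
abbreviation "rnorm \<equiv> reduced_norm G T bU b\<theta>"
abbreviation "ciso \<equiv> covariance_iso G P"
abbreviation "osi \<equiv> inv_into (carrier CA) ciso"

lemma CA_eq: "CA = cv.A.Co" and CX_eq: "CX = cv.B.Co"
 by (simp_all add: covariance_algebra_def full_crossed_def)

lemma CA_cstar: "cstar_algebra CA" and CX_cstar: "cstar_algebra CX"
 unfolding CA_eq CX_eq by (rule cv.A.Co_cstar_algebra, rule cv.B.Co_cstar_algebra)

lemma CA_star: "star_alg CA" and CX_star: "star_alg CX"
 unfolding CA_eq CX_eq by (rule cv.A.Co_star_alg, rule cv.B.Co_star_alg)

lemma iso_hom: "ciso \<in> star_hom CA CX" and osi_hom: "osi \<in> star_hom CX CA"
 using covariance_iso star_iso_inv[OF covariance_iso CA_star] by (simp_all add: star_iso_def)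

lemma osi_iso: "a \<in> carrier CA ==> osi (ciso a) = a" and iso_osi: "X \<in> carrier CX ==> ciso (osi X) = X"
 using covariance_iso by (auto simp: star_iso_def bij_betw_def inv_into_f_f f_inv_into_f)

lemma incl_CX: "completion_incl B0 fnorm \<in> star_hom B0 CX"
 unfolding CX_eq by (rule cv.B.incl_star_hom)

text \<open>The identity of \<open>B0\<close> extends from the full crossed product to the
  completion for any C*-seminorm; the cases used are the reduced norm and the orbit
  seminorm.\<close>

lemma below_full:
 assumes q: "cstar_seminorm B0 q" shows "seminormed_hom B0 fnorm B0 q id"
proof (rule seminormed_hom.intro)
 show "cstar_seminormed B0 fnorm" by (rule cv.B.cstar_seminormed_axioms)
 show "cstar_seminormed B0 q"
  by (intro cstar_seminormed.intro cstar_seminormed_axioms.intro ps.B_star_alg q)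
 have "id \<in> star_hom B0 B0" by (rule star_homI) auto
 then show "seminormed_hom_axioms B0 fnorm B0 q id"
  by (rule seminormed_hom_axioms.intro) (use ps.full_norm_upper[OF q] in simp)
qed

lemma Lambda_bd_eq: "Lambda_bd G P a = induced_map B0 rnorm id (ciso a)"
 by (simp add: Lambda_bd_def full_to_reduced_def completion_map_eq)

lemma gen_range: assumes p: "p \<in> P" shows "gen [\<one>, p] \<star> adj B0 (gen [\<one>, p]) = single \<one> (ev (p <# P))"
 and "adj B0 (gen [\<one>, p]) \<star> gen [\<one>, p] = \<one>\<^bsub>B0\<^esub>"
proof -
 note c = P_carrier[OF p]
 have W: "[\<one>, p] \<in> W" "[p, \<one>] \<in> W" using p by simp_all
 have K1: "K [\<one>, p] = P" using p c P_mult by (auto simp: K_pair)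
 have adj: "adj B0 (gen [\<one>, p]) = gen [p, \<one>]" using gen_adj[OF W(1)] by simp
 have "K [\<one>, p, p, \<one>] = {x \<in> K [p, \<one>]. inv p \<otimes> x \<in> K [\<one>, p]}" using K_append[OF W] c by simp
 also have "\<dots> = p <# P" unfolding K1 using p by (auto simp: K_principal mem_l_coset c)
 finally show "gen [\<one>, p] \<star> adj B0 (gen [\<one>, p]) = single \<one> (ev (p <# P))"
  unfolding adj using gen_append[OF W] gen_neutral[of "[\<one>, p, p, \<one>]"] p c by simp
 have "K [p, \<one>, \<one>, p] = {x \<in> K [\<one>, p]. p \<otimes> x \<in> K [p, \<one>]}" using K_append[OF W(2,1)] c by simp
 also have "\<dots> = P" unfolding K1 using p c P_mult P_carrier by (auto simp: K_principal mem_l_coset simp flip: m_assoc)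
 finally have "gen [p, \<one>, \<one>, p] = \<one>\<^bsub>B0\<^esub>" using p c by (simp add: gen_neutral ev_P ps.B_one)
 then show "adj B0 (gen [\<one>, p]) \<star> gen [\<one>, p] = \<one>\<^bsub>B0\<^esub>" unfolding adj using gen_append[OF W(2,1)] by simp
qed

text \<open>One group element at a time. If \<open>g\<close> moves some point of the current set,
  separate the point from its image by open sets and shrink; conditions on earlier elements survive
  shrinking. Otherwise the open set \<open>Wset r1 \<inter> bU g\<close> consists of fixed points,
  so it is empty by topological freeness.\<close>

lemma avoid_fixed_points:
 assumes tf: "tfree (carrier G)" and r: "r \<in> P" and F: "finite F" "F \<subseteq> carrier G - {\<one>}"
 shows "\<exists>r'\<in>P. Wset r' \<subseteq> Wset r \<and> (\<forall>g\<in>F. \<forall>w\<in>Wset r'. w \<in> bU g --> ps.tau g w \<notin> Wset r')"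
 using F
proof (induction F)
 case empty
 then show ?case using r by auto
next
 case (insert g F)
 then obtain r1 where r1: "r1 \<in> P" "Wset r1 \<subseteq> Wset r" "\<forall>g\<in>F. \<forall>w\<in>Wset r1. w \<in> bU g --> ps.tau g w \<notin> Wset r1"
  by auto
 have g: "g \<in> carrier G" "g \<noteq> \<one>" using insert by auto
 show ?case
 proof (cases "\<exists>w\<in>Wset r1. w \<in> bU g \<and> ps.tau g w \<noteq> w")
  case True
  then obtain w where w: "w \<in> Wset r1" "w \<in> bU g" "ps.tau g w \<noteq> w" by blast
  have "w \<in> topspace T" "ps.tau g w \<in> topspace T"
   by (rule subsetD[OF ps.U_topspace[OF g(1)] w(2)], rule ps.tau_topspace[OF g(1) w(2)])
  then have "w \<in> topspace T \<and> ps.tau g w \<in> topspace T \<and> w \<noteq> ps.tau g w" using w(3) by simp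
  from Hausdorff_T[unfolded Hausdorff_space_def, rule_format, OF this]
  obtain O1 O2 where O: "openin T O1" "openin T O2" "w \<in> O1" "ps.tau g w \<in> O2" "disjnt O1 O2"
   by (elim exE conjE)
  have bo: "openin T (bU g)" by (rule ps.U_open[OF g(1)])
  have top: "topspace (subtopology T (bU g)) = bU g"
   using ps.U_topspace[OF g(1)] by (simp add: Int_absorb1)
  have "openin (subtopology T (bU g)) {x \<in> bU g. ps.tau g x \<in> O2}"
   using openin_continuous_map_preimage[OF ps.tau_cont[OF g(1)] O(2)] by (simp only: top)
  then have "openin T {x \<in> bU g. ps.tau g x \<in> O2}" by (simp add: openin_open_subtopology[OF bo])
  then have V: "openin T (Wset r1 \<inter> O1 \<inter> {x \<in> bU g. ps.tau g x \<in> O2})"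
   by (intro openin_Int openin_Wset[OF r1(1)] O(1))
  have "w \<in> Wset r1 \<inter> O1 \<inter> {x \<in> bU g. ps.tau g x \<in> O2}" using w O by simp
  then have "Wset r1 \<inter> O1 \<inter> {x \<in> bU g. ps.tau g x \<in> O2} \<noteq> {}" by (rule ex_in_conv[THEN iffD1, OF exI])
  then obtain r2 where r2: "r2 \<in> P" "Wset r2 \<subseteq> Wset r1 \<inter> O1 \<inter> {x \<in> bU g. ps.tau g x \<in> O2}"
   by (rule open_contains_Wset[OF V])
  have "ps.tau g x \<notin> Wset r2" if "x \<in> Wset r2" for x
  proof
   assume "ps.tau g x \<in> Wset r2"
   then have "ps.tau g x \<in> O1" using r2(2) by blast
   moreover have "ps.tau g x \<in> O2" using that r2(2) by blast
   ultimately show False using O(5) by (auto simp: disjnt_iff)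
  qed
  moreover have "\<forall>h\<in>F. \<forall>x\<in>Wset r2. x \<in> bU h --> ps.tau h x \<notin> Wset r2"
  proof (intro ballI impI notI)
   fix h x assume "h \<in> F" "x \<in> Wset r2" "x \<in> bU h" "ps.tau h x \<in> Wset r2"
   moreover have "Wset r2 \<subseteq> Wset r1" by (rule subset_trans[OF r2(2)]) blast
   ultimately have "x \<in> Wset r1" "ps.tau h x \<in> Wset r1" by (auto simp only: subset_iff)
   then show False using r1(3)[rule_format, OF \<open>h \<in> F\<close> _ \<open>x \<in> bU h\<close>] by simp
  qed
  moreover have "Wset r2 \<subseteq> Wset r" by (rule subset_trans[OF subset_trans[OF r2(2)] r1(2)]) blast
  ultimately show ?thesis using r2(1) by (intro bexI[of _ r2]) simp_all
 next
  case False
  \<comment> \<open>Since \<open>ps.tau g\<close> is the partial homeomorphism of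
    \<open>inv g\<close>, freeness is applied to \<open>inv g\<close>.\<close>
  have "Wset r1 \<inter> bU g \<subseteq> {x \<in> bU (inv (inv g)). b\<theta> (inv g) x = x}"
   using False g by (auto simp: ps.tau_def)
  then have "Wset r1 \<inter> bU g \<subseteq> T interior_of {x \<in> bU (inv (inv g)). b\<theta> (inv g) x = x}"
   by (rule interior_of_maximal) (intro openin_Int openin_Wset[OF r1(1)] ps.U_open[OF g(1)])
  moreover have "T interior_of {x \<in> bU (inv (inv g)). b\<theta> (inv g) x = x} = {}"
   by (rule tf[unfolded topologically_free_def, rule_format]) (use g in simp_all)
  ultimately have e: "Wset r1 \<inter> bU g = {}" by simp
  have "\<forall>h\<in>Set.insert g F. \<forall>w\<in>Wset r1. w \<in> bU h --> ps.tau h w \<notin> Wset r1"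
   using r1(3) disjoint_iff[THEN iffD1, OF e] by simp
  then show ?thesis using r1(1,2) by (intro bexI[of _ r1] conjI)
 qed
qed

text \<open>Otherwise cut \<open>Y\<close> and \<open>b\<close> down by \<open>1\<^sub>r\<^sub>P\<close>, with \<open>r P\<close> so small that \<open>b\<close> becomes a function bounded
 below by \<open>c\<close> on \<open>Wset r\<close>. Dividing by it and conjugating with the isometry \<open>1\<^sub>r\<^sub>P \<delta>\<^sub>r\<close> takes \<open>Y\<close> to an
 element of \<open>I\<close> at distance less than 1 from the unit. Only absorption of products is needed of \<open>I\<close>.\<close>

lemma ideal_expectation_le:
 assumes I: "I \<subseteq> carrier CX" "\<one>\<^bsub>CX\<^esub> \<notin> I"
  and absorb: "!!X Y. [|X \<in> carrier CX; Y \<in> I|] ==> X \<otimes>\<^bsub>CX\<^esub> Y \<in> I" "!!X Y. [|X \<in> carrier CX; Y \<in> I|] ==> Y \<otimes>\<^bsub>CX\<^esub> X \<in> I"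
  and tf: "tfree (carrier G)" and Y: "Y \<in> I" and b: "b \<in> carrier B0"
 shows "sup_norm T (b \<one>) \<le> nrm CX (Y \<ominus>\<^bsub>CX\<^esub> completion_incl B0 fnorm b)"
proof (rule ps.sup_norm_least, rule ccontr)
 interpret CX: cstar_algebra CX by (rule CX_cstar)
 let ?i = "completion_incl B0 fnorm" and ?N = "nrm CX"
 note ic = star_hom_closed[OF incl_CX]
 have Yc: "Y \<in> carrier CX" using Y I(1) by blast
 define D where "D = Y \<ominus>\<^bsub>CX\<^esub> ?i b"
 have D: "D \<in> carrier CX" using Yc ic[OF b] by (simp add: D_def)
 fix w0 assume w0: "w0 \<in> topspace T" "\<not> cmod (b \<one> w0) \<le> ?N (Y \<ominus>\<^bsub>CX\<^esub> ?i b)"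
 \<comment> \<open>The strict gap serves on both sides: \<open>b\<close> exceeds \<open>c\<close> in
   modulus on a nonempty open set, and the norm of \<open>D\<close> divided by \<open>c\<close> is
   less than 1.\<close>
 then obtain c where c: "?N D < c" "c < cmod (b \<one> w0)" using dense unfolding D_def by (metis not_le)
 have c0: "c > 0" using c(1) CX.q_nonneg[OF D] by linarith
 have b1: "b \<one> \<in> C0_on T (bU \<one>)" using ps.carrier_BD(3)[OF b] by simp
 have V: "openin T {x \<in> topspace T. b \<one> x \<in> {z. c < cmod z}}"
  by (rule openin_continuous_map_preimage[OF C0_onD(1)[OF b1]]) (simp add: open_Collect_less continuous_intros)
 have "w0 \<in> {x \<in> topspace T. b \<one> x \<in> {z. c < cmod z}}" using w0(1) c(2) by simp
 then have "{x \<in> topspace T. b \<one> x \<in> {z. c < cmod z}} \<noteq> {}" by (rule ex_in_conv[THEN iffD1, OF exI])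
 then obtain r0 where r0: "r0 \<in> P" "Wset r0 \<subseteq> {x \<in> topspace T. b \<one> x \<in> {z. c < cmod z}}"
  by (rule open_contains_Wset[OF V])
 have "finite (supp b - {\<one>})" "supp b - {\<one>} \<subseteq> carrier G - {\<one>}" using ps.carrier_BD(1,2)[OF b] by auto
 from avoid_fixed_points[OF tf r0(1) this] obtain r where r: "r \<in> P" "Wset r \<subseteq> Wset r0"
  "\<forall>g\<in>supp b - {\<one>}. \<forall>w\<in>Wset r. w \<in> bU g --> ps.tau g w \<notin> Wset r" by (elim bexE conjE)
 let ?e = "ev (r <# P)"
 have eJ: "r <# P \<in> J" using r(1) by simp
 have e: "?e \<in> C0_on T (bU \<one>)"
  by (rule C0_onI[OF continuous_ev[OF eJ]]) (auto simp: ev_def ps.U_one topspace_T)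
 have e_iff: "?e w = (if w \<in> Wset r then 1 else 0)" for w
  using ev_cases[OF eJ, of w] by (auto simp: ev_def Wset_def)
 let ?u = "single \<one> ?e"
 have u: "?u \<in> carrier B0" by (rule ps.single_carrier[OF one_closed e])
 have big: "c < cmod (b \<one> w)" if "w \<in> Wset r" for w using r(2) r0(2) that by blast
 \<comment> \<open>A nonzero coefficient at some \<open>k\<close> other than the identity would
   require a point of \<open>Wset r\<close> whose translate is again in \<open>Wset r\<close>, which
   the choice of \<open>r\<close> excludes for the support of \<open>b\<close>.\<close>
 have comp: "(?u \<star> b) \<star> ?u = single \<one> (\<lambda>w. ?e w * b \<one> w)"
 proof (intro ext)
  fix k w
  show "((?u \<star> b) \<star> ?u) k w = single \<one> (\<lambda>w. ?e w * b \<one> w) k w"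
  proof (cases "k \<in> carrier G \<and> w \<in> Bd")
   case True
   then have k: "k \<in> carrier G" and B: "w \<in> Bd" by auto
   have "((?u \<star> b) \<star> ?u) k w = (?u \<star> b) k w * ?e (ps.tau k w)"
    using ps.single_mult_right[OF ps.B.m_closed[OF u b] one_closed k] k by simp
   also have "(?u \<star> b) k w = ?e w * b k w"
    using ps.single_mult_left[OF one_closed e k] k ps.tau_one[of w] B by (simp add: topspace_T)
   finally have eq: "((?u \<star> b) \<star> ?u) k w = ?e w * b k w * ?e (ps.tau k w)" .
   show ?thesis
   proof (cases "k = \<one>")
    case True
    then show ?thesis unfolding eq using ps.tau_one[of w] B by (simp add: topspace_T e_iff)
   next
    case False
    have "?e w * b k w * ?e (ps.tau k w) = 0"
    proof (rule ccontr)
     assume nz: "\<not> ?thesis"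
     then have "k \<in> supp b" "w \<in> bU k" using ps.carrier_BD(6)[OF b, of w k] by auto
     moreover have "w \<in> Wset r" "ps.tau k w \<in> Wset r" using nz by (auto simp: e_iff split: if_splits)
     ultimately show False using r(3) False by blast
    qed
    then show ?thesis unfolding eq using False by (simp add: single_def)
   qed
  next
   case False
   have "(?u \<star> b) \<star> ?u \<in> carrier B0" using u b by simp
   then have "((?u \<star> b) \<star> ?u) k w = 0"
    using False ps.carrier_BD(4)[of _ k] ps.carrier_BD(5)[of _ w k] by (metis topspace_T)
   then show ?thesis using False by (auto simp: single_def e_iff Wset_def)
  qed
 qed
 \<comment> \<open>A continuous substitute for \<open>1 / z\<close>: exact where the modulus of
   \<open>z\<close> exceeds \<open>c\<close>, and bounded by \<open>1 / c\<close> everywhere because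
   of the maximum in the denominator.\<close>
 define k where "k z = cnj z / of_real (max (c\<^sup>2) ((cmod z)\<^sup>2))" for z :: complex
 have kpos: "0 < max (c\<^sup>2) ((cmod z)\<^sup>2)" for z using c0 by (simp add: less_max_iff_disj)
 have kc: "continuous_on UNIV k"
  unfolding k_def by (intro continuous_intros) (use kpos in \<open>metis less_irrefl of_real_eq_0_iff\<close>)
 let ?k = "\<lambda>y. if y \<in> topspace T then k (b \<one> y) else 0"
 have kC: "?k \<in> C0_on T (bU \<one>)" by (rule ps.C0_funct[OF b1 kc])
 have kle: "cmod (k z) \<le> 1 / c" for z
 proof -
  have "cmod (k z) = cmod z / max (c\<^sup>2) ((cmod z)\<^sup>2)" using kpos[of z] by (simp add: k_def norm_divide)
  also have "\<dots> \<le> 1 / c"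
  proof -
   have "c * cmod z \<le> max (c\<^sup>2) ((cmod z)\<^sup>2)"
   proof (cases "cmod z \<le> c")
    case True
    then have "c * cmod z \<le> c\<^sup>2" using c0 by (simp add: power2_eq_square)
    then show ?thesis by simp
   next
    case False
    then have "c * cmod z \<le> (cmod z)\<^sup>2" by (simp add: power2_eq_square mult_right_mono)
    then show ?thesis by simp
   qed
   then show ?thesis using kpos[of z] c0 by (simp add: divide_simps mult.commute)
  qed
  finally show ?thesis .
 qed
 have kinv: "k z * z = 1" if "c < cmod z" for z
 proof -
  have "c\<^sup>2 \<le> (cmod z)\<^sup>2" using that c0 by (simp add: power_mono)
  then have "k z * z = cnj z * z / of_real ((cmod z)\<^sup>2)" by (simp add: k_def max_absorb2)
  also have "cnj z * z = of_real ((cmod z)\<^sup>2)" by (simp only: complex_norm_square mult.commute)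
  also have "complex_of_real ((cmod z)\<^sup>2) / of_real ((cmod z)\<^sup>2) = 1"
  proof (rule divide_self)
   have "(cmod z)\<^sup>2 \<noteq> 0" using that c0 by (intro power_not_zero) linarith
   then show "complex_of_real ((cmod z)\<^sup>2) \<noteq> 0" by (simp only: of_real_eq_0_iff not_False_eq_True)
  qed
  finally show ?thesis .
 qed
 have ks: "single \<one> ?k \<in> carrier B0" by (rule ps.single_carrier[OF one_closed kC])
 have prod: "single \<one> ?k \<star> ((?u \<star> b) \<star> ?u) = ?u"
 proof -
  have "(\<lambda>x. ?k x * (?e x * b \<one> x)) = ?e"
  proof
   fix x show "?k x * (?e x * b \<one> x) = ?e x"
   proof (cases "x \<in> Wset r")
    case True
    then have "x \<in> topspace T" by (simp add: Wset_def topspace_T)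
    then show ?thesis using kinv[OF big[OF True]] True by (simp add: e_iff)
   qed (simp add: e_iff)
  qed
  then show ?thesis unfolding comp ps.single_one_mult[OF kC] by simp
 qed
 have N_incl: "?N (?i x) = fnorm x" if "x \<in> carrier B0" for x
  using cv.B.nrm_incl[OF that] by (simp add: CX_eq)
 note sup = ps.cstar_seminorm_function_le[OF ps.full_norm_cstar_seminorm]
 have Nk: "?N (?i (single \<one> ?k)) \<le> 1 / c"
  unfolding N_incl[OF ks] by (rule order_trans[OF sup[OF kC] ps.sup_norm_least]) (simp add: kle)
 have Nu: "?N (?i ?u) \<le> 1"
  unfolding N_incl[OF u] by (rule order_trans[OF sup[OF e] ps.sup_norm_least]) (simp add: e_iff)
 let ?g = "gen [\<one>, r]"
 have g: "?g \<in> carrier B0" using r(1) by simp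
 note i = ic[OF ks] ic[OF u] ic[OF b] ic[OF g]
 let ?U = "?i ?u" and ?E = "?i ?g"
 have EE: "adj CX ?E \<otimes>\<^bsub>CX\<^esub> ?E = \<one>\<^bsub>CX\<^esub>"
  using gen_range(2)[OF r(1)] g by (simp flip: star_hom_adj[OF incl_CX] star_hom_mult[OF incl_CX] star_hom_one[OF incl_CX])
 have EU: "adj CX ?E \<otimes>\<^bsub>CX\<^esub> (?U \<otimes>\<^bsub>CX\<^esub> ?E) = \<one>\<^bsub>CX\<^esub>"
 proof -
  have "?U = ?E \<otimes>\<^bsub>CX\<^esub> adj CX ?E"
   unfolding gen_range(1)[OF r(1), symmetric] using g by (simp add: star_hom_adj[OF incl_CX] star_hom_mult[OF incl_CX])
  then have "?U \<otimes>\<^bsub>CX\<^esub> ?E = ?E" using i EE by (simp add: CX.m_assoc)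
  then show ?thesis using EE by simp
 qed
 have NE: "?N ?E \<le> 1" by (rule CX.q_isometry_le[OF i(4) EE])
 \<comment> \<open>The map \<open>Z\<close> cuts down and divides, and \<open>V\<close> conjugates
   by the isometry. They increase norms at most by the factor \<open>1 / c\<close>, and together
   they send the image of \<open>b\<close> to the unit.\<close>
 define Z where "Z X = ?i (single \<one> ?k) \<otimes>\<^bsub>CX\<^esub> ((?U \<otimes>\<^bsub>CX\<^esub> X) \<otimes>\<^bsub>CX\<^esub> ?U)" for X
 define V where "V X = adj CX ?E \<otimes>\<^bsub>CX\<^esub> (X \<otimes>\<^bsub>CX\<^esub> ?E)" for X
 have Zb: "Z (?i b) = ?U"
  using prod u b ks by (simp add: Z_def flip: star_hom_mult[OF incl_CX])
 have ZD: "Z D = Z Y \<ominus>\<^bsub>CX\<^esub> ?U" and Zc: "Z Y \<in> carrier CX"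
  unfolding Zb[symmetric] using i Yc by (simp_all add: Z_def D_def CX.diff_mult_left CX.diff_mult_right)
 have VD: "V (Z D) = V (Z Y) \<ominus>\<^bsub>CX\<^esub> \<one>\<^bsub>CX\<^esub>" and Vc: "V (Z Y) \<in> carrier CX"
  unfolding ZD EU[symmetric] using i Zc by (simp_all add: V_def CX.diff_mult_left CX.diff_mult_right)
 have le1: "?N (X \<otimes>\<^bsub>CX\<^esub> X') \<le> ?N X'" "?N (X' \<otimes>\<^bsub>CX\<^esub> X) \<le> ?N X'"
  if "X \<in> carrier CX" "X' \<in> carrier CX" "?N X \<le> 1" for X X'
  using CX.q_mult[OF that(1,2)] CX.q_mult[OF that(2,1)] mult_right_mono[OF that(3) CX.q_nonneg[OF that(2)]]
  by (simp_all add: mult.commute)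
 have "?N (V (Z D)) \<le> ?N (Z D)"
  unfolding V_def using le1(1)[of "adj CX ?E" "Z D \<otimes>\<^bsub>CX\<^esub> ?E"] le1(2)[of ?E "Z D"] i NE Zc ZD by simp
 also have "\<dots> \<le> 1 / c * ?N ((?U \<otimes>\<^bsub>CX\<^esub> D) \<otimes>\<^bsub>CX\<^esub> ?U)"
  unfolding Z_def using i D Nk by (intro order_trans[OF CX.q_mult] mult_right_mono) simp_all
 also have "\<dots> \<le> 1 / c * ?N D"
  using le1(1)[of ?U D] le1(2)[of ?U "?U \<otimes>\<^bsub>CX\<^esub> D"] i D Nu c0 by (intro mult_left_mono) simp_all
 also have "\<dots> < 1" using c(1) c0 by simp
 finally have "?N (\<one>\<^bsub>CX\<^esub> \<ominus>\<^bsub>CX\<^esub> V (Z Y)) < 1"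
  unfolding VD CX.q_diff_swap[OF Vc CX.one_closed] .
 then obtain z where z: "z \<in> carrier CX" "z \<otimes>\<^bsub>CX\<^esub> (\<one>\<^bsub>CX\<^esub> \<ominus>\<^bsub>CX\<^esub> (\<one>\<^bsub>CX\<^esub> \<ominus>\<^bsub>CX\<^esub> V (Z Y))) = \<one>\<^bsub>CX\<^esub>"
  using CX.neumann_inverse[of "\<one>\<^bsub>CX\<^esub> \<ominus>\<^bsub>CX\<^esub> V (Z Y)"] Vc by auto
 have "\<one>\<^bsub>CX\<^esub> \<ominus>\<^bsub>CX\<^esub> (\<one>\<^bsub>CX\<^esub> \<ominus>\<^bsub>CX\<^esub> V (Z Y)) = V (Z Y)"
  using Vc by (simp add: a_minus_def CX.minus_add CX.minus_minus CX.r_neg CX.r_neg1 flip: CX.a_assoc)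
 moreover have "V (Z Y) \<in> I" unfolding V_def Z_def using i Y by (intro absorb) simp_all
 ultimately have "\<one>\<^bsub>CX\<^esub> \<in> I" using absorb(1)[OF z(1), of "V (Z Y)"] z(2) by simp
 then show False using I(2) by blast
qed

text \<open>The estimate for expectations is applied to \<open>X* X\<close> rather than to
  \<open>X\<close>: the coefficients of \<open>s n* s n\<close> at the identity tend to 0, and their
  sup norms are the squared Hilbert module norms of \<open>s n\<close>. Faithfulness of the
  expectation then makes the reduced norms of \<open>s n\<close> tend to 0, so the image in the
  reduced crossed product is 0.\<close>

lemma proper_ideal_in_kernel:
 assumes tf: "tfree (carrier G)" and I: "closed_ideal CA I" "I \<noteq> carrier CA"
 shows "I \<subseteq> a_kernel CA (boundary_quotient G P) (Lambda_bd G P)"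
proof
 interpret CA: cstar_algebra CA by (rule CA_cstar)
 interpret CX: cstar_algebra CX by (rule CX_cstar)
 interpret I: ideal I CA using I(1) by (simp add: closed_ideal_def)
 interpret fr: seminormed_hom B0 fnorm B0 rnorm id by (rule below_full[OF ps.reduced_norm_cstar_seminorm])
 let ?I = "{X \<in> carrier CX. osi X \<in> I}"
 have "\<one>\<^bsub>CA\<^esub> \<notin> I" using I(2) I.one_imp_carrier by blast
 then have I1: "\<one>\<^bsub>CX\<^esub> \<notin> ?I" by (simp add: star_hom_one[OF osi_hom])
 note oc = star_hom_closed[OF osi_hom] and om = star_hom_mult[OF osi_hom]
 have absorb: "X \<otimes>\<^bsub>CX\<^esub> Y \<in> ?I" "Y \<otimes>\<^bsub>CX\<^esub> X \<in> ?I" if "X \<in> carrier CX" "Y \<in> ?I" for X Y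
  using that by (simp_all add: om oc I.I_l_closed I.I_r_closed)
 fix a assume aI: "a \<in> I"
 have a: "a \<in> carrier CA" using aI I.a_subset by blast
 define X where "X = ciso a"
 have X: "X \<in> carrier CX" unfolding X_def by (rule star_hom_closed[OF iso_hom a])
 have XI: "X \<in> ?I" using X aI osi_iso[OF a] by (simp add: X_def)
 obtain s where s: "s \<in> cv.B.CS" "X = cv.B.cls s" using X unfolding CX_eq by (rule cv.B.carrier_CoE)
 note sc = cv.B.CS_carrier[OF s(1)]
 let ?t = "\<lambda>n. adj B0 (s n) \<star> s n"
 have t: "?t \<in> cv.B.CS" by (rule cv.B.CS_mult[OF cv.B.CS_adj[OF s(1)] s(1)])
 have XX: "adj CX X \<otimes>\<^bsub>CX\<^esub> X = cv.B.cls ?t"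
  unfolding CX_eq s(2) by (simp add: cv.B.Co_adj[OF s(1)] cv.B.Co_mult[OF cv.B.CS_adj[OF s(1)] s(1)])
 have XXI: "adj CX X \<otimes>\<^bsub>CX\<^esub> X \<in> ?I" by (rule absorb(1)[OF CX.adj_closed[OF X] XI])
 have "(\<lambda>n. hilbmod_norm G T bU b\<theta> (s n)) \<longlonglongrightarrow> sqrt 0"
  unfolding hilbmod_norm_def
 proof (intro tendsto_real_sqrt Lim_null_comparison[OF always_eventually[OF allI] cv.B.incl_tendsto_cls[OF t]])
  fix n
  have c: "?t n \<in> carrier B0" using sc by simp
  have "sup_norm T (?t n \<one>) \<le> nrm CX (cv.B.cls ?t \<ominus>\<^bsub>CX\<^esub> completion_incl B0 fnorm (?t n))"
   by (rule ideal_expectation_le[OF _ I1 absorb tf XXI[unfolded XX] c]) simp_all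
  then show "norm (sup_norm T (?t n \<one>)) \<le> nrm cv.B.Co (cv.B.cls ?t \<ominus>\<^bsub>cv.B.Co\<^esub> completion_incl B0 fnorm (?t n))"
   using ps.carrier_sup_nonneg[OF c, of \<one>] by (simp add: CX_eq)
 qed
 then have h: "(\<lambda>n. hilbmod_norm G T bU b\<theta> (s n)) \<longlonglongrightarrow> 0" by simp
 have sr: "s \<in> fr.B.CS" using fr.map_CS[OF s(1)] by simp
 have r0: "(\<lambda>n. rnorm (s n)) \<longlonglongrightarrow> 0" by (rule ps.reduced_norm_tendsto_0[OF sr h])
 have "Lambda_bd G P a = fr.B.cls s"
  unfolding Lambda_bd_eq X_def[symmetric] s(2) using fr.induced_cls[OF s(1)] by simp
 also have "\<dots> = fr.B.cls (\<lambda>_. \<zero>\<^bsub>B0\<^esub>)"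
  using fr.B.cls_eq_iff[OF sr fr.B.CS_const[OF ps.B.zero_closed]] r0 sc by (simp add: ps.B.diff_zero)
 also have "\<dots> = \<zero>\<^bsub>boundary_quotient G P\<^esub>"
  by (simp add: boundary_quotient_def reduced_crossed_def fr.B.Co_zero)
 finally show "a \<in> a_kernel CA (boundary_quotient G P) (Lambda_bd G P)" using a by (simp add: a_kernel_def')
qed

text \<open>If freeness fails, the kernel of the orbit representation is a proper closed ideal not
  contained in the kernel of \<open>Lambda_bd\<close>. The element \<open>?x\<close>, supported on a
  set fixed by \<open>g\<close>, lies in the former only.\<close>

lemma kernel_property_imp_tfree:
 assumes max: "!!I. [|closed_ideal CA I; I \<noteq> carrier CA|] ==> I \<subseteq> a_kernel CA (boundary_quotient G P) (Lambda_bd G P)"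
 shows "tfree (carrier G)"
proof (rule ccontr)
 assume "\<not> tfree (carrier G)"
 then obtain g p where g: "g \<in> carrier G" "g \<noteq> \<one>" and p: "p \<in> P" and fix_act: "!!w. w \<in> Wset p ==> w \<in> adom g \<and> act g w = w"
  using not_tfreeE[OF _ subset_refl] by metis
 interpret CA: cstar_algebra CA by (rule CA_cstar)
 interpret fo: seminormed_hom B0 fnorm B0 ps.orbit_seminorm id by (rule below_full[OF ps.orbit_cstar_seminorm])
 interpret fr: seminormed_hom B0 fnorm B0 rnorm id by (rule below_full[OF ps.reduced_norm_cstar_seminorm])
 let ?e = "ev (p <# P)"
 have eJ: "p <# P \<in> J" using p by simp
 have e: "?e \<in> C0_on T (bU \<one>)"
  by (rule C0_onI[OF continuous_ev[OF eJ]]) (auto simp: ev_def ps.U_one topspace_T)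
 have "w \<in> bU (inv g) \<and> b\<theta> g w = w" if "?e w \<noteq> 0" for w
 proof -
  have "w \<in> Wset p" using that ev_cases[OF eJ, of w] by (auto simp: ev_def Wset_def split: if_splits)
  from fix_act[OF this] show ?thesis using pact_hom_eq[OF g(1), of w] by (simp add: bd_dom_eq[OF g(1)])
 qed
 note fixed = ps.orbit_seminorm_fixed[OF g(1) e this]
 let ?x = "single g ?e \<minus> single \<one> ?e"
 have s: "single g ?e \<in> carrier B0" "single \<one> ?e \<in> carrier B0"
  using ps.single_carrier[OF g(1) fixed(1)] ps.single_carrier[OF one_closed e] by simp_all
 have x: "?x \<in> carrier B0" using s by simp
 define q where "q a = nrm fo.B.Co (induced_map B0 ps.orbit_seminorm id (ciso a))" for a
 have q: "cstar_seminorm CA q"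
  unfolding q_def
  by (rule cstar_seminorm_pullback[OF CA_star iso_hom[unfolded CX_eq] cstar_seminorm_pullback[OF cv.B.Co_star_alg fo.induced_star_hom fo.B.Co_cstar_seminorm]])
 let ?I = "{a \<in> carrier CA. q a = 0}"
 have "q \<one>\<^bsub>CA\<^esub> = ps.orbit_seminorm \<one>\<^bsub>B0\<^esub>"
  using fo.B.nrm_incl[OF ps.B.one_closed]
  by (simp add: q_def star_hom_one[OF iso_hom] CX_eq star_hom_one[OF fo.induced_star_hom] star_hom_one[OF fo.B.incl_star_hom])
 then have "\<one>\<^bsub>CA\<^esub> \<notin> ?I" using ps.orbit_seminorm_one by simp
 then have "?I \<noteq> carrier CA" using CA.one_closed by metis
 from max[OF CA.kernel_closed_ideal[OF q] this] have ker: "?I \<subseteq> a_kernel CA (boundary_quotient G P) (Lambda_bd G P)" .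
 let ?X = "completion_incl B0 fnorm ?x"
 have X: "?X \<in> carrier CX" by (rule star_hom_closed[OF incl_CX x])
 have "q (osi ?X) = ps.orbit_seminorm ?x"
  using fo.induced_incl[OF x] fo.B.nrm_incl[OF x] by (simp add: q_def iso_osi[OF X])
 then have "osi ?X \<in> ?I" using fixed(2) star_hom_closed[OF osi_hom X] by simp
 then have "Lambda_bd G P (osi ?X) = \<zero>\<^bsub>boundary_quotient G P\<^esub>" using ker by (auto simp: a_kernel_def')
 then have "completion_incl B0 rnorm ?x = \<zero>\<^bsub>fr.B.Co\<^esub>"
  unfolding Lambda_bd_eq iso_osi[OF X] using fr.induced_incl[OF x] by (simp add: boundary_quotient_def reduced_crossed_def)
 then have "nrm fr.B.Co (completion_incl B0 rnorm ?x) = nrm fr.B.Co (completion_incl B0 rnorm \<zero>\<^bsub>B0\<^esub>)"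
  using star_hom_zero[OF fr.B.incl_star_hom ps.B_star_alg fr.B.Co_star_alg] by simp
 then have r0: "rnorm ?x = 0" using fr.B.nrm_incl[OF x] fr.B.nrm_incl[OF ps.B.zero_closed] by simp
 obtain w where w: "w \<in> Wset p" using Wset_nonempty[OF p] by metis
 have B: "w \<in> topspace T" using w by (simp add: topspace_T Wset_def)
 interpret ph: positive_functional B0 "\<lambda>b. b \<one> w" by (rule ps.expectation_positive_functional[OF B])
 \<comment> \<open>Cauchy-Schwarz against the unit bounds the coefficient at the identity by the
   reduced norm; at \<open>w\<close> this coefficient is -1, because the part of degree
   \<open>g\<close> does not contribute to it.\<close>
 have "cmod (?x \<one> w) \<le> ph.nn \<one>\<^bsub>B0\<^esub> * ph.nn ?x"
  using ph.cauchy_schwarz[OF ps.B.one_closed x] x by simp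
 also have "ph.nn \<one>\<^bsub>B0\<^esub> = 1" by (rule ps.red.ni_one[OF B])
 also have "1 * ph.nn ?x \<le> ps.red.NN ?x" using ps.red.ni_le_NN[OF B x] by simp
 also have "\<dots> \<le> rnorm ?x" using ps.hilbmod_le_reduced[OF x] unfolding ps.hilbmod_norm_eq .
 finally have "?x \<one> w = 0" using r0 by simp
 moreover have "?x \<one> w = - 1"
 proof -
  have "?x \<one> w = single g ?e \<one> w - single \<one> ?e \<one> w"
   using s by (simp add: a_minus_def ps.B.cscale_m1[symmetric] ps.B_simps)
  then show ?thesis using g(2) w by (simp add: single_def ev_def Wset_def)
 qed
 ultimately show False by simp
qed

end

theorem theorem6p18:
  fixes G :: "('g, 'm) monoid_scheme" (structure) and P :: "'g set"
  assumes "group G" and "submonoid P G"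
  defines "stmt1 \<equiv> topologically_free G (carrier G) (bd_top G P) (bd_dom G P) (pact_hom G P)"
    and "stmt2 \<equiv> topologically_free G (G0 G P) (bd_top G P) (bd_dom G P) (pact_hom G P)"
    and "stmt3 \<equiv> \<forall>g\<in>G0 G P. g \<noteq> \<one> \<longrightarrow> (\<forall>p\<in>P. \<exists>q\<in>p <# P. (q <# P) \<inter> ((g \<otimes> q) <# P) = {})"
    and "stmt4 \<equiv> \<forall>p\<in>P. \<forall>t\<in>P. p \<noteq> t \<longrightarrow> (\<exists>s\<in>P. ((p \<otimes> s) <# P) \<inter> ((t \<otimes> s) <# P) = {})"
    and "stmt5 \<equiv> \<forall>I. closed_ideal (covariance_algebra G P) I \<and> I \<noteq> carrier (covariance_algebra G P)
                   \<longrightarrow> I \<subseteq> a_kernel (covariance_algebra G P) (boundary_quotient G P) (Lambda_bd G P)"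
  shows "subgroup (G0 G P) G \<and>
    (stmt1 \<longleftrightarrow> stmt2) \<and> (stmt2 \<longleftrightarrow> stmt3) \<and> (stmt3 \<longleftrightarrow> stmt4) \<and> (stmt4 \<longleftrightarrow> stmt5)"
proof -
 interpret submonoid_pair G P by (rule submonoid_pair.intro[OF assms(1)]) (rule submonoid_pair_axioms.intro[OF assms(2)])
 \<comment> \<open>The first four statements are linked in a cycle, and the fifth is tied to the
   first.\<close>
 have "stmt1 ==> stmt2"
  unfolding stmt1_def stmt2_def by (rule tfree_mono[OF _ subgroup.subset[OF subgroup_G0]])
 moreover have "stmt2 ==> stmt3"
  unfolding stmt2_def stmt3_def cond3_def[symmetric] by (rule tfree_G0_imp_cond3)
 moreover have "stmt3 ==> stmt4"
  unfolding stmt3_def stmt4_def cond3_def[symmetric] cond4_def[symmetric] by (rule cond3_imp_cond4)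
 moreover have "stmt4 ==> stmt1"
  unfolding stmt1_def stmt4_def cond4_def[symmetric] by (rule cond4_imp_tfree)
 moreover have "stmt1 ==> stmt5"
  unfolding stmt1_def stmt5_def by (intro allI impI, elim conjE) (rule proper_ideal_in_kernel)
 moreover have "stmt5 ==> stmt1"
  unfolding stmt1_def stmt5_def by (rule kernel_property_imp_tfree) simp
 ultimately show ?thesis using subgroup_G0 by satx
qed

end
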